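(* Let $n\ge2$, $p\in(0,1)$, $\delta^{(n)}=-ne_n+\sum_{j=1}^ne_j$. Choose $\epsilon\in\{\pm1\}$ uniformly at random and let $(u_M,M)\in\widetilde{\mathfrak S}_n\times\mathbb Z/n\mathbb Z$ be the state of $\widetilde{\mathbf M}_{\epsilon\delta^{(n)}}$ at time $M$. Then (almost surely) there is $w_*\in\mathfrak S_n$ such that $\mathcal A u_M\subseteq\mathcal C w_*$ for all sufficiently large $M$, and for each $w\in\mathfrak S_n$, \[\mathbb P(w_*=w)=\frac12\left(\frac{F_{w^{-1}w_\circ}(1,\dots,1,1-p;0)}{P_{(1,2,\dots,n)}(1,\dots,1,1-p;0)}+\frac{F_{w^{-1}w_\circ}(1,\dots,1,(1-p)^{-1};0)}{P_{(1,2,\dots,n)}(1,\dots,1,(1-p)^{-1};0)}\right).\]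
   Context: Type $A_{n-1}$: $V=V^*=\{\gamma\in\mathbb R^n:\sum\gamma_i=0\}$, roots $e_i-e_j$ ($i\neq j$), positive roots $e_i-e_j$ ($i<j$), simple roots $\alpha_i=e_i-e_{i+1}$ ($1\le i\le n-1$), highest root $\theta=e_1-e_n$, coroot lattice $Q^\vee=\mathbb Z^n\cap V$. The affine symmetric group $\widetilde{\mathfrak S}_n$ has simple reflections $s_i$, $i\in\mathbb Z/n\mathbb Z$, and acts on $V$ on the right: $s_i$ ($1\le i\le n-1$) reflects through $\{\gamma_i=\gamma_{i+1}\}$ and $s_0$ through $\{\gamma_1-\gamma_n=1\}$. Hyperplanes $\mathrm H^k_{e_i-e_j}=\{\gamma_i-\gamma_j=k\}$. $\mathcal C=\{\gamma_1\ge\cdots\ge\gamma_n\}$, $\mathcal A=\{\gamma\in\mathcal C:\gamma_1-\gamma_n\le1\}$; $u\mapsto\mathcal A u$ bijects $\widetilde{\mathfrak S}_n$ onto alcoves, $w\mapsto\mathcal C w$ bijects $\mathfrak S_n$ onto chambers; $w_\circ$ is the longest element of $\mathfrak S_n$ ($w_\circ(i)=n+1-i$). $\mathrm H^{(u,s_i)}$ separates $\mathcal A u$ and $\mathcal A s_iu$. Fix $z_0$ in the interior of $\mathcal A$. For $\eta\in\{\pm\delta^{(n)}\}$, if the ray from $z_0$ in direction $\eta$ passes successively through alcoves $\mathcal A u_0=\mathcal A,\mathcal A u_1,\dots$ (crossing one hyperplane at a time), define $i_j$ by $u_{j+1}=s_{i_j}u_j$; for $\delta^{(n)}$ one has $i_j\equiv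 j\pmod n$, period $n$. $\widetilde{\mathbf M}_\eta$ is the Markov chain on $\widetilde{\mathfrak S}_n\times\mathbb Z/n\mathbb Z$ started at $(\mathbbm1,0)$: from $(u,k)$, if $\mathrm H^{(u,s_{i_k})}$ does not separate $\mathcal A u$ from $\mathcal A$, go to $(s_{i_k}u,k+1)$ with probability $p$ and $(u,k+1)$ with probability $1-p$; otherwise go to $(u,k+1)$. ASEP polynomials: for a nondecreasing tuple $\lambda$ of nonnegative integers, $S_\lambda$ is its set of rearrangements. For $w\in\mathfrak S_n$ and a tuple $y$, $wy=(y_{w^{-1}(1)},\dots,y_{w^{-1}(n)})$; for a polynomial $f$, $(wf)(\mathbf x)=f(w\mathbf x)$. Indices mod $n$; $\overline s_i$ ($i\in\mathbb Z/n\mathbb Z$) is the transposition of $i,i+1$; $c$ is the cycle $(1\,2\cdots n)$. $T_i=t-\frac{tx_i-x_{i+1}}{x_i-x_{i+1}}(1-\overline s_i)$ on $\mathbb C(t)[x_1,\dots,x_n]$ ($x_{n+1}=x_1$). The ASEP polynomials $(F_\mu(\mathbf x;t))_{\mu\in S_\lambda}$ are the unique homogeneous polynomials in $\mathbb C(t)[\mathbf x]$ such that the coefficient of $x_1^{\lambda_n-\lambda_1}\cdots x_n^{\lambda_n-\lambda_n}$ in $F_\lambda$ is $1$ and: $T_iF_\mu=F_{\overline s_i\mu}$ if $\mu_i<\mu_{i+1}$; $\overline s_iF_\mu=F_\mu$ if $\mu_i=\mu_{i+1}$; $cF_{c\mu}=F_\mu$. $P_\lambda=\sum_{\mu\in S_\lambda}F_\mu$.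 For $\lambda=(1,2,\dots,n)$ and $w\in\mathfrak S_n$, write $F_w:=F_{(w^{-1}(1),\dots,w^{-1}(n))}$. In the formula, $t=0$. *)

theory Defs
  imports "HOL-Probability.Probability" "HOL-Computational_Algebra.Polynomial"
    "HOL-Computational_Algebra.Fraction_Field" "HOL-Combinatorics.Permutations"
begin

type_synonym vec = "nat \<Rightarrow> real"

definition Vsp :: "nat \<Rightarrow> vec set" where
  "Vsp n = {\<gamma>. (\<forall>k. k \<notin> {1..n} \<longrightarrow> \<gamma> k = 0) \<and> (\<Sum>k\<in>{1..n}. \<gamma> k) = 0}"

definition chamberC :: "nat \<Rightarrow> vec set" where
  "chamberC n = {\<gamma> \<in> Vsp n. \<forall>i\<in>{1..<n}. \<gamma> (Suc i) \<le> \<gamma> i}"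

definition alcoveA :: "nat \<Rightarrow> vec set" where
  "alcoveA n = {\<gamma> \<in> chamberC n. \<gamma> 1 - \<gamma> n \<le> 1}"

definition alcoveA_int :: "nat \<Rightarrow> vec set" where
  "alcoveA_int n = {\<gamma> \<in> Vsp n. (\<forall>i\<in>{1..<n}. \<gamma> (Suc i) < \<gamma> i) \<and> \<gamma> 1 - \<gamma> n < 1}"

text \<open>Simple reflections s_i, i in Z/nZ represented by 0..n-1: s_i (1 <= i <= n-1) swaps the
  coordinates i, i+1 (reflection through gamma_i = gamma_{i+1}); s_0 is the reflection through
  gamma_1 - gamma_n = 1.\<close>

definition srefl :: "nat \<Rightarrow> nat \<Rightarrow> vec \<Rightarrow> vec" where
  "srefl n i \<gamma> =
     (if i = 0 then \<gamma>(1 := \<gamma> n + 1, n := \<gamma> 1 - 1)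
      else if i < n then \<gamma>(i := \<gamma> (Suc i), Suc i := \<gamma> i)
      else \<gamma>)"

text \<open>An element u of the affine symmetric group is represented by the map gamma |-> gamma u
  of its (faithful, right) action.  Since the action is on the right,
  gamma (s_i u) = (gamma s_i) u, i.e. the map of s_i u is (map of u) o s_i.\<close>

definition sgen :: "nat \<Rightarrow> nat \<Rightarrow> (vec \<Rightarrow> vec) \<Rightarrow> (vec \<Rightarrow> vec)" where
  "sgen n i u = u \<circ> srefl n i"

inductive_set aff_sym :: "nat \<Rightarrow> (vec \<Rightarrow> vec) set" for n where
  aff_sym_id: "id \<in> aff_sym n"
| aff_sym_step: "u \<in> aff_sym n \<Longrightarrow> i < n \<Longrightarrow> sgen n i u \<in> aff_sym n"

definition alc :: "nat \<Rightarrow> (vec \<Rightarrow> vec) \<Rightarrow> vec set" where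
  "alc n u = u ` alcoveA n"

text \<open>The chamber C w for w in S_n (a permutation of {1..n}); the right action of w on V is
  gamma w = gamma o w, i.e. (gamma w)_k = gamma_{w(k)}.\<close>

definition chamber :: "nat \<Rightarrow> (nat \<Rightarrow> nat) \<Rightarrow> vec set" where
  "chamber n w = (\<lambda>\<gamma>. \<gamma> \<circ> w) ` chamberC n"

definition separates :: "nat \<Rightarrow> nat \<Rightarrow> int \<Rightarrow> vec set \<Rightarrow> vec set \<Rightarrow> bool" where
  "separates a b k X Y \<longleftrightarrow>
     ((\<forall>x\<in>X. x a - x b \<le> of_int k) \<and> (\<forall>y\<in>Y. of_int k \<le> y a - y b)) \<or>
     ((\<forall>x\<in>X. of_int k \<le> x a - x b) \<and> (\<forall>y\<in>Y. y a - y b \<le> of_int k))"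

text \<open>H^{(u,s_i)} (the hyperplane separating A u and A s_i u) does not separate A u from A.\<close>

definition not_back :: "nat \<Rightarrow> (vec \<Rightarrow> vec) \<Rightarrow> nat \<Rightarrow> bool" where
  "not_back n u i \<longleftrightarrow>
     \<not> (\<exists>a\<in>{1..n}. \<exists>b\<in>{1..n}. \<exists>k::int. a \<noteq> b \<and>
          separates a b k (alc n u) (alc n (sgen n i u)) \<and>
          separates a b k (alc n u) (alcoveA n))"

definition delta :: "nat \<Rightarrow> vec" where
  "delta n = (\<lambda>k. (if k \<in> {1..n} then 1 else 0) - (if k = n then real n else 0))"

primrec ray_u :: "nat \<Rightarrow> (nat \<Rightarrow> nat) \<Rightarrow> nat \<Rightarrow> (vec \<Rightarrow> vec)" where
  "ray_u n i 0 = id"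
| "ray_u n i (Suc j) = sgen n (i j) (ray_u n i j)"

text \<open>The ray z_0 + s eta (s >= 0) passes successively through A u_0 = A, A u_1, ... with
  u_{j+1} = s_{i_j} u_j: there are times 0 = tau_0 < tau_1 < ... (unbounded) such that the
  segment for s in [tau_j, tau_{j+1}] lies in A u_j.\<close>

definition ray_walk :: "nat \<Rightarrow> vec \<Rightarrow> vec \<Rightarrow> (nat \<Rightarrow> nat) \<Rightarrow> bool" where
  "ray_walk n z0 \<eta> i \<longleftrightarrow>
     (\<forall>j. i j < n) \<and>
     (\<exists>\<tau>::nat \<Rightarrow> real. \<tau> 0 = 0 \<and> strict_mono \<tau> \<and> (\<forall>x. \<exists>j. x < \<tau> j) \<and>
        (\<forall>j. \<forall>s\<in>{\<tau> j..\<tau> (Suc j)}. (\<lambda>k. z0 k + s * \<eta> k) \<in> alc n (ray_u n i j)))"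

definition ray_index :: "nat \<Rightarrow> vec \<Rightarrow> vec \<Rightarrow> nat \<Rightarrow> nat" where
  "ray_index n z0 \<eta> = (THE i. ray_walk n z0 \<eta> i)"

text \<open>Realised by independent coins: omega M = True with probability p.  From (u, k) with
  k = M mod n: if H^{(u,s_{i_k})} does not separate A u from A, move to s_{i_k} u iff the coin
  shows True; otherwise stay.\<close>

definition chain_step :: "nat \<Rightarrow> vec \<Rightarrow> vec \<Rightarrow> nat \<Rightarrow> bool \<Rightarrow> (vec \<Rightarrow> vec) \<Rightarrow> (vec \<Rightarrow> vec)" where
  "chain_step n z0 \<eta> k b u =
     (let i = ray_index n z0 \<eta> k in if not_back n u i \<and> b then sgen n i u else u)"

primrec chain_path :: "nat \<Rightarrow> vec \<Rightarrow> vec \<Rightarrow> (nat \<Rightarrow> bool) \<Rightarrow> nat \<Rightarrow> (vec \<Rightarrow> vec)" where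
  "chain_path n z0 \<eta> \<omega> 0 = id"
| "chain_path n z0 \<eta> \<omega> (Suc M) = chain_step n z0 \<eta> (M mod n) (\<omega> M) (chain_path n z0 \<eta> \<omega> M)"

type_synonym ratt = "complex poly fract"

definition tvar :: ratt where "tvar = Fract [:0, 1:] 1"

text \<open>A polynomial in x_1..x_n over C(t) is given by its coefficient function on exponent
  vectors (nat => nat, zero outside {1..n}), with finite support.\<close>

definition is_hpoly :: "nat \<Rightarrow> ((nat \<Rightarrow> nat) \<Rightarrow> ratt) \<Rightarrow> bool" where
  "is_hpoly n c \<longleftrightarrow> finite {a. c a \<noteq> 0} \<and>
     (\<forall>a. c a \<noteq> 0 \<longrightarrow> (\<forall>i. i \<notin> {1..n} \<longrightarrow> a i = 0)) \<and>
     (\<exists>d. \<forall>a. c a \<noteq> 0 \<longrightarrow> (\<Sum>i\<in>{1..n}. a i) = d)"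

definition peval :: "nat \<Rightarrow> ((nat \<Rightarrow> nat) \<Rightarrow> ratt) \<Rightarrow> (nat \<Rightarrow> ratt) \<Rightarrow> ratt" where
  "peval n c x = (\<Sum>a\<in>{a. c a \<noteq> 0}. c a * (\<Prod>i\<in>{1..n}. x i ^ a i))"

definition nxt :: "nat \<Rightarrow> nat \<Rightarrow> nat" where
  "nxt n i = (if i = n then 1 else Suc i)"

definition sbar :: "nat \<Rightarrow> nat \<Rightarrow> nat \<Rightarrow> nat" where
  "sbar n i = id(i := nxt n i, nxt n i := i)"

definition cyc :: "nat \<Rightarrow> nat \<Rightarrow> nat" where
  "cyc n = (\<lambda>i. if i = n then 1 else if i \<in> {1..<n} then Suc i else i)"

definition pact :: "(nat \<Rightarrow> nat) \<Rightarrow> (nat \<Rightarrow> 'a) \<Rightarrow> (nat \<Rightarrow> 'a)" where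
  "pact w y = y \<circ> inv w"

definition rearr :: "nat \<Rightarrow> (nat \<Rightarrow> nat) \<Rightarrow> (nat \<Rightarrow> nat) set" where
  "rearr n lam = {lam \<circ> \<sigma> | \<sigma>. \<sigma> permutes {1..n}}"

definition asep_family :: "nat \<Rightarrow> (nat \<Rightarrow> nat) \<Rightarrow> ((nat \<Rightarrow> nat) \<Rightarrow> (nat \<Rightarrow> nat) \<Rightarrow> ratt) \<Rightarrow> bool" where
  "asep_family n lam F \<longleftrightarrow>
     (\<forall>\<mu>. \<mu> \<notin> rearr n lam \<longrightarrow> F \<mu> = (\<lambda>_. 0)) \<and>
     (\<forall>\<mu>\<in>rearr n lam. is_hpoly n (F \<mu>)) \<and>
     F lam (\<lambda>i. if i \<in> {1..n} then lam n - lam i else 0) = 1 \<and>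
     (\<forall>\<mu>\<in>rearr n lam. \<forall>i\<in>{1..n}. \<mu> i < \<mu> (nxt n i) \<longrightarrow>
        (\<forall>x. x i \<noteq> x (nxt n i) \<longrightarrow>
           peval n (F (pact (sbar n i) \<mu>)) x =
             tvar * peval n (F \<mu>) x
             - (tvar * x i - x (nxt n i)) / (x i - x (nxt n i))
               * (peval n (F \<mu>) x - peval n (F \<mu>) (pact (sbar n i) x)))) \<and>
     (\<forall>\<mu>\<in>rearr n lam. \<forall>i\<in>{1..n}. \<mu> i = \<mu> (nxt n i) \<longrightarrow>
        (\<forall>x. peval n (F \<mu>) (pact (sbar n i) x) = peval n (F \<mu>) x)) \<and>
     (\<forall>\<mu>\<in>rearr n lam. \<forall>x.
        peval n (F (pact (cyc n) \<mu>)) (pact (cyc n) x) = peval n (F \<mu>) x)"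

definition asep_F :: "nat \<Rightarrow> (nat \<Rightarrow> nat) \<Rightarrow> (nat \<Rightarrow> nat) \<Rightarrow> (nat \<Rightarrow> nat) \<Rightarrow> ratt" where
  "asep_F n lam = (THE F. asep_family n lam F)"

definition at_t0 :: "ratt \<Rightarrow> complex" where
  "at_t0 r = (THE v. \<exists>a b. r = Fract a b \<and> poly b 0 \<noteq> 0 \<and> v = poly a 0 / poly b 0)"

definition asep_F0 :: "nat \<Rightarrow> (nat \<Rightarrow> nat) \<Rightarrow> (nat \<Rightarrow> nat) \<Rightarrow> (nat \<Rightarrow> complex) \<Rightarrow> complex" where
  "asep_F0 n lam \<mu> y =
     (\<Sum>a\<in>{a. asep_F n lam \<mu> a \<noteq> 0}. at_t0 (asep_F n lam \<mu> a) * (\<Prod>i\<in>{1..n}. y i ^ a i))"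

definition asep_P0 :: "nat \<Rightarrow> (nat \<Rightarrow> nat) \<Rightarrow> (nat \<Rightarrow> complex) \<Rightarrow> complex" where
  "asep_P0 n lam y = (\<Sum>\<mu>\<in>rearr n lam. asep_F0 n lam \<mu> y)"

definition stair :: "nat \<Rightarrow> nat" where "stair = (\<lambda>i. i)"

definition Fw0 :: "nat \<Rightarrow> (nat \<Rightarrow> nat) \<Rightarrow> (nat \<Rightarrow> complex) \<Rightarrow> complex" where
  "Fw0 n w y = asep_F0 n stair (inv w) y"

definition wlong :: "nat \<Rightarrow> nat \<Rightarrow> nat" where
  "wlong n = (\<lambda>i. if i \<in> {1..n} then n + 1 - i else i)"

definition lastpt :: "nat \<Rightarrow> complex \<Rightarrow> nat \<Rightarrow> complex" where
  "lastpt n q = (\<lambda>i. if i = n then q else 1)"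

end

theory Submission
  imports Defs
begin

text \<open>Extend vectors to the integers by \<open>\<gamma>\<^sub>x\<^sub>+\<^sub>n = \<gamma>\<^sub>x - 1\<close>. The walk then becomes a product of 0-Hecke
  steps on affine permutations \<open>X\<close>, with indices running cyclically through \<open>0, \<dots>, n - 1\<close>
  (upwards for \<open>\<delta>\<close>, downwards for \<open>-\<delta>\<close>), and \<open>\<A> u \<subseteq> \<C> w\<close> says that \<open>w\<close> is the relative order of
  \<open>X 1, \<dots>, X n\<close>. Inversions are never undone, so this order is eventually constant, and with
  probability tending to one \<open>X\<close> is far from the walls of the chambers. The first step of the walk
  commutes past the others as a right multiplication, which far from the walls acts on the order
  as a step of the multispecies TASEP on a ring. Hence the law of \<open>w\<^sub>*\<close> is determined by any
  stationary vector of the ring process under the reversed sweep.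

  At \<open>t = 0\<close> and at a point \<open>(1, \<dots>, 1, q, 1, \<dots>, 1)\<close> with \<open>q = (1 - p)\<^sup>\<plusminus>\<^sup>1\<close> the exchange relation of
  the ASEP polynomials says that a TASEP step moves the coordinate \<open>q\<close> to the neighbouring site;
  a full sweep brings it back, so the values of the polynomials are a stationary vector.

  Over \<open>\<complex>(t)\<close> the ASEP polynomials come from a common fixed vector of Cherednik's commuting
  elements, which are unipotent on the exponents of maximal square sum. At \<open>t = 0\<close> the
  component of the longest permutation is forced to be a monomial, and all the others are
  obtained from it by ascent swaps and rotations; this gives uniqueness and excludes poles at
  \<open>t = 0\<close>.\<close>

section \<open>Demazure--Lusztig operators\<close>

text \<open>\<open>asep_F\<close> is a definite description, so existence and uniqueness over C(t)
  come before any specialisation, and \<open>at_t0\<close> has a meaning only once poles at t = 0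
  are excluded. Coefficient functions take the place of polynomials because T_i acts on them without
  division and over any commutative ring. One fact serves normalisation, uniqueness and absence of
  poles: at t = 0 a solution vanishes as soon as its coefficient at the staircase exponent does. A
  nonzero solution over C(t) can be scaled to have a nonzero reduction, so this coefficient is
  nonzero and has the largest pole order of all. The limit law needs no positivity. A fixed coin
  pattern sorts the ring from every start and so contracts oscillations; hence any complex vector
  kept by the sweep is the limit law times its total. The total is nonzero because the component at
  w = id is q^(n-1). The two values of q arise since the ratio of the coordinates at the active edge
  must be 1 - p: the reversed sweep meets q at the right end of each edge for \<delta> and at the
  left end for -\<delta>.\<close>

abbreviation swp :: "nat \<Rightarrow> nat \<Rightarrow> nat \<Rightarrow> nat" where "swp \<equiv> Transposition.transpose"

definition expset :: "nat \<Rightarrow> nat \<Rightarrow> (nat \<Rightarrow> nat) set" where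
  "expset n d = {a. (\<forall>i. i \<notin> {1..n} \<longrightarrow> a i = 0) \<and> (\<Sum>i\<in>{1..n}. a i) = d}"

definition hpoly :: "nat \<Rightarrow> nat \<Rightarrow> ((nat \<Rightarrow> nat) \<Rightarrow> 'a::zero) set" where
  "hpoly n d = {c. \<forall>a. a \<notin> expset n d \<longrightarrow> c a = 0}"

definition monval :: "nat \<Rightarrow> (nat \<Rightarrow> 'a::comm_monoid_mult) \<Rightarrow> (nat \<Rightarrow> nat) \<Rightarrow> 'a" where
  "monval n x a = (\<Prod>i\<in>{1..n}. x i ^ a i)"

text \<open>Summing over all exponents of degree d, not over the support of c as
  \<open>peval\<close> does, makes the evaluation linear in c.\<close>

definition hev :: "nat \<Rightarrow> nat \<Rightarrow> ((nat \<Rightarrow> nat) \<Rightarrow> 'a::comm_ring_1) \<Rightarrow> (nat \<Rightarrow> 'a) \<Rightarrow> 'a" where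
  "hev n d c x = (\<Sum>a\<in>expset n d. c a * monval n x a)"

text \<open>For \<open>(i, j) = (i, i + 1)\<close> these are the coefficients of \<open>x\<^sub>i \<partial>\<^sub>i f\<close> and
  \<open>x\<^sub>j \<partial>\<^sub>i f\<close>, where \<open>\<partial>\<^sub>i f = (f - s\<^sub>i f) / (x\<^sub>i - x\<^sub>j)\<close> is the divided difference.\<close>

definition demL :: "nat \<Rightarrow> nat \<Rightarrow> ((nat \<Rightarrow> nat) \<Rightarrow> 'a::comm_ring_1) \<Rightarrow> (nat \<Rightarrow> nat) \<Rightarrow> 'a" where
  "demL i j c a = (\<Sum>m | m \<le> a i + a j \<and> a i \<le> m \<and> a j < m.
      c (a(i := m, j := a i + a j - m)) - c (a(i := a i + a j - m, j := m)))"

definition demR :: "nat \<Rightarrow> nat \<Rightarrow> ((nat \<Rightarrow> nat) \<Rightarrow> 'a::comm_ring_1) \<Rightarrow> (nat \<Rightarrow> nat) \<Rightarrow> 'a" where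
  "demR i j c a = (\<Sum>m | m \<le> a i + a j \<and> a i < m \<and> a j \<le> m.
      c (a(i := m, j := a i + a j - m)) - c (a(i := a i + a j - m, j := m)))"

text \<open>T_i f = t f - (t x_i - x_j) \<partial>f, written without division. It makes sense over
  any commutative ring, in particular for t = 0.\<close>

definition heckeT :: "nat \<Rightarrow> nat \<Rightarrow> 'a \<Rightarrow> ((nat \<Rightarrow> nat) \<Rightarrow> 'a::comm_ring_1) \<Rightarrow> (nat \<Rightarrow> nat) \<Rightarrow> 'a" where
  "heckeT i j t c a = t * c a - t * demL i j c a + demR i j c a"

lemma finite_expset [simp, intro]: "finite (expset n d)"
proof -
  have "expset n d \<subseteq> {a. \<forall>i. (i \<in> {1..n} \<longrightarrow> a i \<in> {0..d}) \<and> (i \<notin> {1..n} \<longrightarrow> a i = 0)}"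
    by (auto simp: expset_def intro: member_le_sum)
  then show ?thesis by (rule finite_subset) (rule finite_set_of_finite_funs, auto)
qed

lemma comp_transpose_upd: "a \<circ> swp i j = a(i := a j, j := a i)"
  by (auto simp: Transposition.transpose_def fun_eq_iff)

lemma expset_comp_permutes:
  assumes "\<sigma> permutes {1..n}"
  shows "a \<circ> \<sigma> \<in> expset n d \<longleftrightarrow> a \<in> expset n d"
proof -
  have "(\<Sum>i\<in>{1..n}. (a \<circ> \<sigma>) i) = (\<Sum>i\<in>{1..n}. a i)"
    using sum.permute[OF assms, of a] by simp
  moreover have "(\<forall>i. i \<notin> {1..n} \<longrightarrow> (a \<circ> \<sigma>) i = 0) \<longleftrightarrow> (\<forall>i. i \<notin> {1..n} \<longrightarrow> a i = 0)"
    using permutes_not_in[OF assms] by auto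
  ultimately show ?thesis by (simp add: expset_def)
qed

lemma sum_expset_upd2:
  fixes a :: "nat \<Rightarrow> nat"
  assumes "i \<in> {1..n}" "j \<in> {1..n}" "i \<noteq> j"
  shows "(\<Sum>k\<in>{1..n}. f k ((a(i := p, j := q)) k)) = f i p + f j q + (\<Sum>k\<in>{1..n} - {i, j}. f k (a k) :: 'b::comm_monoid_add)"
proof -
  have e: "{1..n} = insert i (insert j ({1..n} - {i, j}))" using assms by auto
  have "(\<Sum>k\<in>{1..n} - {i, j}. f k ((a(i := p, j := q)) k)) = (\<Sum>k\<in>{1..n} - {i, j}. f k (a k))"
    by (rule sum.cong) auto
  then show ?thesis using assms by (subst e) (simp add: add.assoc)
qed

lemma prod_upd2:
  fixes a :: "nat \<Rightarrow> nat"
  assumes "i \<in> {1..n}" "j \<in> {1..n}" "i \<noteq> j"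
  shows "(\<Prod>k\<in>{1..n}. f k ((a(i := p, j := q)) k)) = f i p * f j q * (\<Prod>k\<in>{1..n} - {i, j}. f k (a k) :: 'b::comm_monoid_mult)"
proof -
  have e: "{1..n} = insert i (insert j ({1..n} - {i, j}))" using assms by auto
  have "(\<Prod>k\<in>{1..n} - {i, j}. f k ((a(i := p, j := q)) k)) = (\<Prod>k\<in>{1..n} - {i, j}. f k (a k))"
    by (rule prod.cong) auto
  then show ?thesis using assms by (subst e) (simp add: mult.assoc)
qed

lemma expset_upd2:
  assumes "i \<in> {1..n}" "j \<in> {1..n}" "i \<noteq> j" "p + q = a i + a j"
  shows "a(i := p, j := q) \<in> expset n d \<longleftrightarrow> a \<in> expset n d"
proof -
  have "(\<Sum>k\<in>{1..n}. (a(i := p, j := q)) k) = (\<Sum>k\<in>{1..n}. a k)"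
    using sum_expset_upd2[OF assms(1-3), of "\<lambda>_ x. x" a p q]
      sum_expset_upd2[OF assms(1-3), of "\<lambda>_ x. x" a "a i" "a j"] assms(4) by simp
  then show ?thesis using assms unfolding expset_def by auto
qed

lemma hpolyD: "c \<in> hpoly n d \<Longrightarrow> a \<notin> expset n d \<Longrightarrow> c a = 0"
  by (auto simp: hpoly_def)

lemma demL_hpoly:
  assumes "c \<in> hpoly n d" "i \<in> {1..n}" "j \<in> {1..n}" "i \<noteq> j"
  shows "demL i j c \<in> hpoly n d" "demR i j c \<in> hpoly n d"
  unfolding hpoly_def demL_def demR_def using assms
  by (auto intro!: sum.neutral simp: expset_upd2 hpolyD)

lemma heckeT_hpoly:
  assumes "c \<in> hpoly n d" "i \<in> {1..n}" "j \<in> {1..n}" "i \<noteq> j"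
  shows "heckeT i j t c \<in> hpoly n d"
  using demL_hpoly[OF assms] assms(1) by (auto simp: hpoly_def heckeT_def)

text \<open>Coefficient form of (x_i - x_j) \<partial>f = f - s f: the ranges of m in the two sums
  differ at most in the end \<open>max (a i) (a j)\<close>, and the term there gives the right
  side.\<close>

lemma demL_minus_demR:
  assumes "i \<noteq> j"
  shows "demL i j c a - demR i j c a = c a - c (a \<circ> swp i j)"
proof -
  let ?g = "\<lambda>m. c (a(i := m, j := a i + a j - m)) - c (a(i := a i + a j - m, j := m))"
  let ?L = "{m. m \<le> a i + a j \<and> a i \<le> m \<and> a j < m}" and ?R = "{m. m \<le> a i + a j \<and> a i < m \<and> a j \<le> m}"
  have fin: "finite ?L" "finite ?R" by auto
  consider "a j < a i" | "a i < a j" | "a i = a j" by linarith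
  then show ?thesis
  proof cases
    case 1
    then have e: "?L = insert (a i) ?R" by auto
    have "demL i j c a = ?g (a i) + demR i j c a"
      unfolding demL_def demR_def e by (rule sum.insert) auto
    moreover have "a(i := a i, j := a j) = a" by auto
    ultimately show ?thesis by (simp add: comp_transpose_upd)
  next
    case 2
    then have e: "?R = insert (a j) ?L" by auto
    have "demR i j c a = ?g (a j) + demL i j c a"
      unfolding demL_def demR_def e by (rule sum.insert) auto
    moreover have "a(i := a i, j := a j) = a" by auto
    ultimately show ?thesis by (simp add: comp_transpose_upd)
  next
    case 3
    then have "?L = ?R" by auto
    then have "demL i j c a = demR i j c a" unfolding demL_def demR_def by simp
    moreover have "a \<circ> swp i j = a" using 3 by (auto simp: comp_transpose_upd)
    ultimately show ?thesis by simp
  qed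
qed

lemma monval_upd2:
  assumes "i \<in> {1..n}" "j \<in> {1..n}" "i \<noteq> j"
  shows "monval n x (a(i := p, j := q)) = x i ^ p * x j ^ q * (\<Prod>k\<in>{1..n} - {i, j}. x k ^ a k)"
  unfolding monval_def using prod_upd2[OF assms, of "\<lambda>k e. x k ^ e" a p q] .

lemma monval_comp:
  assumes "\<sigma> permutes {1..n}"
  shows "monval n x (a \<circ> \<sigma>) = monval n (x \<circ> inv \<sigma>) a"
  unfolding monval_def
  using prod.permute[OF permutes_inv[OF assms], of "\<lambda>i. x i ^ (a \<circ> \<sigma>) i"]
  by (simp add: o_def permutes_inverses[OF assms])

lemma hev_comp:
  assumes "\<sigma> permutes {1..n}"
  shows "hev n d (\<lambda>a. c (a \<circ> \<sigma>)) x = hev n d c (x \<circ> \<sigma>)"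
  unfolding hev_def
proof (rule sum.reindex_bij_witness[where j = "\<lambda>a. a \<circ> \<sigma>" and i = "\<lambda>a. a \<circ> inv \<sigma>"])
  note i = permutes_inv_o[OF assms]
  fix a assume a: "a \<in> expset n d"
  show "(a \<circ> \<sigma>) \<circ> inv \<sigma> = a" "(a \<circ> inv \<sigma>) \<circ> \<sigma> = a" using i by (simp_all add: o_assoc[symmetric])
  show "a \<circ> \<sigma> \<in> expset n d" "a \<circ> inv \<sigma> \<in> expset n d"
    using a expset_comp_permutes[OF assms] expset_comp_permutes[OF permutes_inv[OF assms]] by auto
  have "monval n (x \<circ> \<sigma>) (a \<circ> \<sigma>) = monval n x a"
    using monval_comp[OF assms, of "x \<circ> \<sigma>" a] i by (simp add: o_assoc[symmetric])
  then show "c (a \<circ> \<sigma>) * monval n (x \<circ> \<sigma>) (a \<circ> \<sigma>) = c (a \<circ> \<sigma>) * monval n x a" by simp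
qed

lemma demL_shift:
  assumes "i \<noteq> j"
  shows "demL i j c (a(i := Suc p, j := q)) = demR i j c (a(i := p, j := Suc q))"
proof -
  have "{m. m \<le> Suc (p + q) \<and> Suc p \<le> m \<and> q < m} = {m. m \<le> Suc (p + q) \<and> p < m \<and> Suc q \<le> m}"
    by auto
  then show ?thesis using assms unfolding demL_def demR_def by simp
qed

lemma demL_0: "a i = 0 \<Longrightarrow> demL i j c a = 0"
  and demR_0: "a j = 0 \<Longrightarrow> demR i j c a = 0"
  unfolding demL_def demR_def by (auto intro!: sum.neutral)

text \<open>Both sides are the value of x_i x_j \<partial>f. Terms are matched by moving one unit of
  exponent from i to j, under which \<open>demL\<close> becomes \<open>demR\<close>
  (\<open>demL_shift\<close>).\<close>

lemma hev_dem:
  assumes "i \<in> {1..n}" "j \<in> {1..n}" "i \<noteq> j"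
  shows "x j * hev n d (demL i j c) x = x i * hev n d (demR i j c) x"
proof -
  have L: "x j * hev n d (demL i j c) x = (\<Sum>a\<in>{a\<in>expset n d. a i \<noteq> 0}. x j * (demL i j c a * monval n x a))"
    unfolding hev_def sum_distrib_left by (rule sum.mono_neutral_right) (auto simp: demL_0)
  have R: "x i * hev n d (demR i j c) x = (\<Sum>a\<in>{a\<in>expset n d. a j \<noteq> 0}. x i * (demR i j c a * monval n x a))"
    unfolding hev_def sum_distrib_left by (rule sum.mono_neutral_right) (auto simp: demR_0)
  show ?thesis unfolding L R
  proof (rule sum.reindex_bij_witness[where j = "\<lambda>a. a(i := a i - 1, j := Suc (a j))"
        and i = "\<lambda>a. a(i := Suc (a i), j := a j - 1)"])
    fix a assume a: "a \<in> {a \<in> expset n d. a i \<noteq> 0}"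
    then obtain p where p: "a i = Suc p" using not0_implies_Suc by auto
    define b where "b = a(i := p, j := Suc (a j))"
    have ae: "a = a(i := Suc p, j := a j)" using p by auto
    have d: "demL i j c a = demR i j c b"
      using demL_shift[OF assms(3), of c a p "a j"] ae b_def by simp
    have "x j * monval n x a = x i * monval n x b"
      using monval_upd2[OF assms, of x a "Suc p" "a j"] monval_upd2[OF assms, of x a p "Suc (a j)"] ae b_def
      by (simp add: algebra_simps)
    with d show "x i * (demR i j c (a(i := a i - 1, j := Suc (a j))) * monval n x (a(i := a i - 1, j := Suc (a j))))
        = x j * (demL i j c a * monval n x a)"
      using p by (simp add: b_def[symmetric]) (metis mult.left_commute)
  qed (use assms in \<open>auto simp: expset_upd2\<close>)
qed

lemma hev_add: "hev n d (\<lambda>a. c a + c' a) x = hev n d c x + hev n d c' x"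
  and hev_diff: "hev n d (\<lambda>a. c a - c' a) x = hev n d c x - hev n d c' x"
  and hev_scale: "hev n d (\<lambda>a. r * c a) x = r * hev n d c x"
  unfolding hev_def by (simp_all add: algebra_simps sum.distrib sum_subtractf sum_distrib_left)

text \<open>The two values solve a pair of linear equations, from \<open>demL_minus_demR\<close> and
  from \<open>hev_dem\<close>, whose determinant is \<open>x i - x j\<close> up to sign.\<close>

lemma hev_dem_field:
  fixes c :: "(nat \<Rightarrow> nat) \<Rightarrow> 'a::field"
  assumes "i \<in> {1..n}" "j \<in> {1..n}" "i \<noteq> j" "x i \<noteq> x j"
    and D_def: "D = (hev n d c x - hev n d c (x \<circ> swp i j)) / (x i - x j)"
  shows "hev n d (demL i j c) x = x i * D" "hev n d (demR i j c) x = x j * D"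
proof -
  let ?L = "hev n d (demL i j c) x" and ?R = "hev n d (demR i j c) x"
  let ?D = "hev n d c x - hev n d c (x \<circ> swp i j)"
  have "swp i j permutes {1..n}" using assms by (intro permutes_swap_id)
  note hc = hev_comp[OF this]
  have 1: "?L - ?R = ?D"
    unfolding hev_diff[symmetric] demL_minus_demR[OF assms(3)] by (simp add: hev_diff hc)
  have 2: "x j * ?L = x i * ?R" using hev_dem[OF assms(1-3)] .
  have "(x i - x j) * ?L = x i * ?D" unfolding 1[symmetric] using 2 by (simp add: algebra_simps)
  then show "?L = x i * D" using assms(4) by (simp add: field_simps D_def)
  have "(x i - x j) * ?R = x j * ?D" unfolding 1[symmetric] using 2 by (simp add: algebra_simps)
  then show "?R = x j * D" using assms(4) by (simp add: field_simps D_def)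
qed

lemma hev_heckeT:
  fixes c :: "(nat \<Rightarrow> nat) \<Rightarrow> 'a::field"
  assumes "i \<in> {1..n}" "j \<in> {1..n}" "i \<noteq> j" "x i \<noteq> x j"
  shows "hev n d (heckeT i j t c) x =
    t * hev n d c x - (t * x i - x j) / (x i - x j) * (hev n d c x - hev n d c (x \<circ> swp i j))"
proof -
  have "hev n d (heckeT i j t c) x = t * hev n d c x - t * hev n d (demL i j c) x + hev n d (demR i j c) x"
    unfolding heckeT_def[abs_def] by (simp add: hev_add hev_diff hev_scale)
  then show ?thesis using assms(4) by (simp add: hev_dem_field[OF assms refl] diff_divide_distrib algebra_simps)
qed

section \<open>Polynomial identities over C(t) from evaluation\<close>

lemma sum_base_inj:
  fixes a b :: "nat \<Rightarrow> nat"
  assumes "\<forall>i\<in>{1..n}. a i < B" "\<forall>i\<in>{1..n}. b i < B"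
    and "(\<Sum>i\<in>{1..n}. a i * B ^ i) = (\<Sum>i\<in>{1..n}. b i * B ^ i)"
  shows "\<forall>i\<in>{1..n}. a i = b i"
  using assms
proof (induction n arbitrary: a b)
  case (Suc n)
  have B: "B > 0" using Suc.prems(1) by (cases B) auto
  have *: "(\<Sum>i\<in>{1..Suc n}. f i * B ^ i) = B * (f 1 + (\<Sum>i\<in>{1..n}. f (Suc i) * B ^ i))" for f :: "nat \<Rightarrow> nat"
  proof -
    have "(\<Sum>i\<in>{1..Suc n}. f i * B ^ i) = (\<Sum>i\<in>{0..n}. f (Suc i) * B ^ (Suc i))"
      using sum.shift_bounds_cl_Suc_ivl[of "\<lambda>i. f i * B ^ i" 0 n] by simp
    also have "\<dots> = B * (\<Sum>i\<in>{0..n}. f (Suc i) * B ^ i)" by (simp add: sum_distrib_left ac_simps)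
    also have "(\<Sum>i\<in>{0..n}. f (Suc i) * B ^ i) = f 1 + (\<Sum>i\<in>{1..n}. f (Suc i) * B ^ i)"
      by (simp add: sum.atLeast_Suc_atMost)
    finally show ?thesis .
  qed
  define ra rb where "ra = (\<Sum>i\<in>{1..n}. a (Suc i) * B ^ i)" "rb = (\<Sum>i\<in>{1..n}. b (Suc i) * B ^ i)"
  have eq: "a 1 + ra = b 1 + rb" using Suc.prems(3) B unfolding * ra_rb_def by simp
  have dv: "B dvd ra" "B dvd rb" unfolding ra_rb_def by (auto intro!: dvd_sum dvd_mult simp: dvd_power)
  have "a 1 < B" "b 1 < B" using Suc.prems by auto
  moreover have "(a 1 + ra) mod B = a 1 mod B" "(b 1 + rb) mod B = b 1 mod B"
    using dv by (auto elim!: dvdE)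
  ultimately have "a 1 = b 1" using eq by simp
  moreover have "\<forall>i\<in>{1..n}. a (Suc i) = b (Suc i)"
    using eq \<open>a 1 = b 1\<close> Suc.prems by (intro Suc.IH) (auto simp: ra_rb_def)
  ultimately show ?case
  proof (intro ballI)
    fix i assume "i \<in> {1..Suc n}"
    then obtain k where "i = Suc k" "k \<le> n" by (cases i) auto
    with \<open>a 1 = b 1\<close> \<open>\<forall>i\<in>{1..n}. a (Suc i) = b (Suc i)\<close> show "a i = b i" by (cases k) auto
  qed
qed simp

definition cst :: "complex \<Rightarrow> ratt" where "cst z = Fract [:z:] 1"

lemma cst_hom: "cst (a * b) = cst a * cst b" "cst 1 = 1" "cst (a ^ k) = cst a ^ k" "cst a = cst b \<longleftrightarrow> a = b"
proof -
  show m: "cst (a * b) = cst a * cst b" for a b by (simp add: cst_def mult.commute)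
  show o: "cst 1 = 1" by (simp add: cst_def One_fract_def one_pCons)
  show "cst (a ^ k) = cst a ^ k" by (induction k) (auto simp: m o)
  show "cst a = cst b \<longleftrightarrow> a = b" by (simp add: cst_def eq_fract)
qed

text \<open>Kronecker substitution \<open>x\<^sub>i = y ^ (B ^ i)\<close> with \<open>B\<close> above all exponents makes the
  monomials of \<open>c\<close> into distinct powers of \<open>y\<close>.\<close>

lemma generic_zero:
  fixes c :: "(nat \<Rightarrow> nat) \<Rightarrow> ratt"
  assumes fin: "finite {a. c a \<noteq> 0}" and sup: "\<forall>a. c a \<noteq> 0 \<longrightarrow> (\<forall>i. i \<notin> {1..n} \<longrightarrow> a i = 0)"
    and z: "\<And>x. inj x \<Longrightarrow> peval n c x = 0"
  shows "c = (\<lambda>_. 0)"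
proof -
  let ?S = "{a. c a \<noteq> 0}"
  obtain B where B: "\<forall>a\<in>?S. \<forall>i\<in>{1..n}. a i < B" "B \<ge> 2"
  proof -
    have f: "finite ((\<lambda>(a, i). a i) ` (?S \<times> {1..n}))" using fin by auto
    define B where "B = Max (insert 1 ((\<lambda>(a, i). a i) ` (?S \<times> {1..n}))) + 1"
    have "a i < B" if "a \<in> ?S" "i \<in> {1..n}" for a i
    proof -
      have "a i \<in> insert 1 ((\<lambda>(a, i). a i) ` (?S \<times> {1..n}))" using that by force
      from Max_ge[OF _ this] f show ?thesis unfolding B_def by simp
    qed
    moreover have "B \<ge> 2" unfolding B_def using f Max_ge[of "insert 1 ((\<lambda>(a, i). a i) ` (?S \<times> {1..n}))" 1] by simp
    ultimately show ?thesis using that by blast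
  qed
  define code where "code a = (\<Sum>i\<in>{1..n}. a i * B ^ i)" for a :: "nat \<Rightarrow> nat"
  have cinj: "inj_on code ?S"
  proof (rule inj_onI)
    fix a b assume ab: "a \<in> ?S" "b \<in> ?S" "code a = code b"
    have "\<forall>i\<in>{1..n}. a i = b i" by (rule sum_base_inj[of n a B b]) (use ab B in \<open>auto simp: code_def\<close>)
    moreover have "a i = b i" if "i \<notin> {1..n}" for i
    proof -
      have "a i = 0" using ab(1) sup that by blast
      moreover have "b i = 0" using ab(2) sup that by blast
      ultimately show ?thesis by simp
    qed
    ultimately show "a = b" by blast
  qed
  define q where "q = (\<Sum>a\<in>?S. monom (c a) (code a))"
  \<comment> \<open>For k \<ge> 2 the powers \<open>k ^ (B ^ i)\<close> are distinct, so the point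
    is injective and the hypothesis on evaluations applies.\<close>
  have q0: "poly q (cst (of_nat k)) = 0" if "k \<ge> 2" for k
  proof -
    define x where "x = (\<lambda>i::nat. cst (of_nat k) ^ (B ^ i))"
    have "inj x"
    proof (rule injI)
      fix i j assume "x i = x j"
      then have "(of_nat (k ^ (B ^ i)) :: complex) = of_nat (k ^ (B ^ j))"
        unfolding x_def cst_hom(3)[symmetric] cst_hom(4) by simp
      then have "k ^ (B ^ i) = k ^ (B ^ j)" by (metis of_nat_eq_iff)
      then have "B ^ i = B ^ j" using that by simp
      then show "i = j" using B(2) by simp
    qed
    then have "0 = peval n c x" using z by simp
    also have "\<dots> = (\<Sum>a\<in>?S. c a * cst (of_nat k) ^ code a)"
      unfolding peval_def code_def x_def by (simp add: power_sum power_mult[symmetric] mult.commute)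
    also have "\<dots> = poly q (cst (of_nat k))" by (simp add: q_def poly_sum poly_monom)
    finally show ?thesis by simp
  qed
  have "infinite (range (\<lambda>k. cst (of_nat (k + 2))))"
    by (rule range_inj_infinite) (auto intro!: injI simp: cst_hom(4))
  moreover have "range (\<lambda>k. cst (of_nat (k + 2))) \<subseteq> {x. poly q x = 0}"
  proof -
    have "poly q (cst (of_nat (k + 2))) = 0" for k by (rule q0) simp
    then show ?thesis by blast
  qed
  ultimately have "q = 0" using poly_roots_finite finite_subset by blast
  show ?thesis
  proof
    fix a show "c a = 0"
    proof (rule ccontr)
      assume a: "c a \<noteq> 0"
      have "0 = coeff q (code a)" using \<open>q = 0\<close> by simp
      also have "\<dots> = (\<Sum>b\<in>?S. if b = a then c b else 0)"
        unfolding q_def coeff_sum using cinj a by (intro sum.cong) (auto simp: inj_on_def)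
      also have "\<dots> = c a" using a fin by (simp add: sum.delta)
      finally show False using a by simp
    qed
  qed
qed

lemma peval_eq_hev: "c \<in> hpoly n d \<Longrightarrow> peval n c x = hev n d c x"
  unfolding peval_def hev_def monval_def
  by (rule sum.mono_neutral_left) (auto simp: hpoly_def)

lemma hpoly_is_hpoly: "c \<in> hpoly n d \<Longrightarrow> is_hpoly n c"
  unfolding is_hpoly_def
proof (intro conjI)
  assume c: "c \<in> hpoly n d"
  then have s: "{a. c a \<noteq> 0} \<subseteq> expset n d" by (auto simp: hpoly_def)
  then show "finite {a. c a \<noteq> 0}" by (rule finite_subset) auto
  show "\<forall>a. c a \<noteq> 0 \<longrightarrow> (\<forall>i. i \<notin> {1..n} \<longrightarrow> a i = 0)" "\<exists>d. \<forall>a. c a \<noteq> 0 \<longrightarrow> (\<Sum>i\<in>{1..n}. a i) = d"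
    using s by (auto simp: expset_def intro!: exI[of _ d])
qed

text \<open>Points with distinct coordinates suffice, and nothing more is available: the exchange
  relations constrain values only where the two coordinates differ.\<close>

lemma is_hpoly_eqI:
  assumes "is_hpoly n c" "is_hpoly n c'" "\<And>x. inj x \<Longrightarrow> peval n c x = peval n c' x"
  shows "c = c'"
proof -
  let ?S = "{a. c a \<noteq> 0} \<union> {a. c' a \<noteq> 0}"
  have fin: "finite ?S" using assms by (auto simp: is_hpoly_def)
  have "peval n (\<lambda>a. c a - c' a) x = (\<Sum>a\<in>?S. (c a - c' a) * (\<Prod>i\<in>{1..n}. x i ^ a i))" for x
    unfolding peval_def by (rule sum.mono_neutral_left) (use fin in auto)
  also have "\<dots> x = (\<Sum>a\<in>?S. c a * (\<Prod>i\<in>{1..n}. x i ^ a i)) - (\<Sum>a\<in>?S. c' a * (\<Prod>i\<in>{1..n}. x i ^ a i))" for x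
    by (simp add: algebra_simps sum_subtractf)
  also have "(\<Sum>a\<in>?S. c a * (\<Prod>i\<in>{1..n}. x i ^ a i)) = peval n c x" for x
    unfolding peval_def by (rule sum.mono_neutral_right) (use fin in auto)
  also have "(\<Sum>a\<in>?S. c' a * (\<Prod>i\<in>{1..n}. x i ^ a i)) = peval n c' x" for x
    unfolding peval_def by (rule sum.mono_neutral_right) (use fin in auto)
  finally have *: "peval n (\<lambda>a. c a - c' a) x = peval n c x - peval n c' x" for x .
  have "(\<lambda>a. c a - c' a) = (\<lambda>_. 0)"
  proof (rule generic_zero)
    have "{a. c a - c' a \<noteq> 0} \<subseteq> ?S" by auto
    then show "finite {a. c a - c' a \<noteq> 0}" using fin finite_subset by blast
    show "\<forall>a. c a - c' a \<noteq> 0 \<longrightarrow> (\<forall>i. i \<notin> {1..n} \<longrightarrow> a i = 0)"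
      proof (intro allI impI)
      fix a i assume "c a - c' a \<noteq> 0" "i \<notin> {1..n}"
      then have "c a \<noteq> 0 \<or> c' a \<noteq> 0" by auto
      with assms(1,2) \<open>i \<notin> {1..n}\<close> show "a i = 0" unfolding is_hpoly_def by blast
    qed
  qed (simp add: * assms(3))
  then show ?thesis by (metis eq_iff_diff_eq_0 ext)
qed

lemma hpoly_eqI:
  fixes c :: "(nat \<Rightarrow> nat) \<Rightarrow> ratt"
  assumes "c \<in> hpoly n d" "c' \<in> hpoly n d" "\<And>x. inj x \<Longrightarrow> hev n d c x = hev n d c' x"
  shows "c = c'"
  using assms by (intro is_hpoly_eqI[of n] hpoly_is_hpoly) (auto simp: peval_eq_hev)

lemma hpoly_add: "c \<in> hpoly n d \<Longrightarrow> c' \<in> hpoly n d \<Longrightarrow> (\<lambda>a. c a + c' a :: 'a::comm_ring_1) \<in> hpoly n d"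
  and hpoly_diff: "c \<in> hpoly n d \<Longrightarrow> c' \<in> hpoly n d \<Longrightarrow> (\<lambda>a. c a - c' a :: 'a::comm_ring_1) \<in> hpoly n d"
  and hpoly_scale: "c \<in> hpoly n d \<Longrightarrow> (\<lambda>a. r * c a :: 'a::comm_ring_1) \<in> hpoly n d"
  and hpoly_0: "(\<lambda>_. 0) \<in> hpoly n d"
  by (auto simp: hpoly_def)

lemma heckeT_add: "heckeT i j t (\<lambda>a. c a + c' a) = (\<lambda>a. heckeT i j t c a + heckeT i j t c' a)"
  and heckeT_diff: "heckeT i j t (\<lambda>a. c a - c' a) = (\<lambda>a. heckeT i j t c a - heckeT i j t c' a)"
  unfolding heckeT_def demL_def demR_def
  by (simp_all add: fun_eq_iff algebra_simps sum.distrib sum_subtractf)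

lemma heckeT_scale: "heckeT i j t (\<lambda>a. r * c a) = (\<lambda>a. r * heckeT i j t c a)"
  unfolding heckeT_def demL_def demR_def
  by (simp add: fun_eq_iff sum_subtractf sum_distrib_left algebra_simps)

lemma heckeT_0: "heckeT i j t (\<lambda>_. 0) = (\<lambda>_. 0)"
  by (simp add: fun_eq_iff heckeT_def demL_def demR_def)

text \<open>The substitution f(x) -> f(cx) on coefficients. The cyclic relation becomes
  \<open>rotc n (F (\<mu> \<circ> inv (cyc n))) = F \<mu>\<close>.\<close>

definition rotc :: "nat \<Rightarrow> ((nat \<Rightarrow> nat) \<Rightarrow> 'a) \<Rightarrow> (nat \<Rightarrow> nat) \<Rightarrow> 'a" where
  "rotc n c = (\<lambda>a. c (a \<circ> inv (cyc n)))"

lemma cyc_permutes: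
  assumes n: "2 \<le> n"
  shows "cyc n permutes {1..n}"
proof (rule bij_imp_permutes)
  show "bij_betw (cyc n) {1..n} {1..n}"
    by (rule bij_betw_byWitness[where f' = "\<lambda>i. if i = 1 then n else i - 1"]) (use n in \<open>auto simp: cyc_def\<close>)
qed (use n in \<open>auto simp: cyc_def\<close>)

lemma cyc_nxt: "i \<in> {1..n} \<Longrightarrow> cyc n i = nxt n i"
  by (auto simp: cyc_def nxt_def)

lemma nxt_in: "i \<in> {1..n} \<Longrightarrow> nxt n i \<in> {1..n}"
  by (auto simp: nxt_def)

lemma inv_cyc_nxt: "2 \<le> n \<Longrightarrow> i \<in> {1..n} \<Longrightarrow> inv (cyc n) (nxt n i) = i"
  using permutes_inverses(2)[OF cyc_permutes, of n i] by (simp add: cyc_nxt)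

lemma nxt_neq: "2 \<le> n \<Longrightarrow> i \<in> {1..n} \<Longrightarrow> i \<noteq> nxt n i"
  by (auto simp: nxt_def)

lemma rotc_hpoly: "2 \<le> n \<Longrightarrow> c \<in> hpoly n d \<Longrightarrow> rotc n c \<in> hpoly n d"
  using expset_comp_permutes[OF permutes_inv[OF cyc_permutes]] by (auto simp: hpoly_def rotc_def)

lemma hev_rotc: "2 \<le> n \<Longrightarrow> hev n d (rotc n c) x = hev n d c (x \<circ> inv (cyc n))"
  unfolding rotc_def by (rule hev_comp[OF permutes_inv[OF cyc_permutes]])

lemma rotc_heckeT:
  assumes n: "2 \<le> n"
  shows "rotc n (heckeT i j t c) = heckeT (inv (cyc n) i) (inv (cyc n) j) t (rotc n c)"
proof -
  let ?r = "inv (cyc n)"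
  have inj: "?r k = ?r l \<longleftrightarrow> k = l" for k l
    using permutes_inj[OF permutes_inv[OF cyc_permutes[OF n]]] by (auto dest: injD)
  have u: "(a \<circ> ?r)(i := p, j := q) = a(?r i := p, ?r j := q) \<circ> ?r" for a :: "nat \<Rightarrow> nat" and p q
    by (auto simp: fun_eq_iff inj)
  show ?thesis unfolding rotc_def heckeT_def demL_def demR_def fun_eq_iff by (simp add: u)
qed

lemma rotc_heckeT_nxt:
  assumes n: "2 \<le> n" and "i \<in> {1..n}"
  shows "rotc n (heckeT (nxt n i) (nxt n (nxt n i)) t c) = heckeT i (nxt n i) t (rotc n c)"
  by (simp only: rotc_heckeT[OF n] inv_cyc_nxt[OF n assms(2)] inv_cyc_nxt[OF n nxt_in[OF assms(2)]])

section \<open>Hecke relations, checked at points with distinct coordinates\<close>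

lemma hecke_alg:
  fixes u v t f g :: "'a::field"
  assumes "u \<noteq> v"
  shows "t * (t * f - (t * u - v) / (u - v) * (f - g)) - (t * u - v) / (u - v) *
     ((t * f - (t * u - v) / (u - v) * (f - g)) - (t * g - (t * v - u) / (v - u) * (g - f)))
     = (t - 1) * (t * f - (t * u - v) / (u - v) * (f - g)) + t * f"
proof -
  define k where "k = (t * u - v) / (u - v)"
  \<comment> \<open>The coefficients for (u, v) and (v, u) add up to 1 + t, which is all that the
    quadratic relation needs.\<close>
  have e: "(t * v - u) / (v - u) = 1 + t - k" using assms by (simp add: k_def field_simps)
  show ?thesis unfolding k_def[symmetric] e by (simp add: algebra_simps)
qed

text \<open>Here f0, ..., f5 are the values of a polynomial at the six rearrangements of three
  coordinates u, v, w. Both sides are linear in them. The coefficients of f3, f4, f5 agree at once;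
  those of f0, f1, f2 need \<open>e0\<close>, \<open>e1\<close>, \<open>e2\<close>.\<close>

lemma braid_alg:
  fixes u v w t :: "'a::field"
  assumes "u \<noteq> v" "v \<noteq> w" "u \<noteq> w"
  defines "K \<equiv> \<lambda>p q. (t * p - q) / (p - q)"
  defines "T \<equiv> \<lambda>p q x y. t * x - K p q * (x - y)"
  shows "T u v (T v w (T u v f0 f1) (T u w f2 f3)) (T u w (T v u f1 f0) (T v w f4 f5))
       = T v w (T u v (T v w f0 f2) (T u w f1 f4)) (T u w (T w v f2 f0) (T u v f3 f5))"
proof -
  define a b c where "a = K u v" "b = K v w" "c = K u w"
  have r: "K v u = 1 + t - a" "K w v = 1 + t - b"
    using assms(1-3) by (simp_all add: a_b_c_def K_def field_simps)
  \<comment> \<open>The one relation between the coefficients of the pairs (u, v), (v, w) and (u, w)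
    on which \<open>e0\<close>, \<open>e1\<close> and \<open>e2\<close> rest; up to powers of 1 - t
    it is a partial fraction identity.\<close>
  have R: "(t - a) * (t - b) = (t - c) * (1 + t - a - b)"
  proof -
    have ne: "u - v \<noteq> 0" "v - w \<noteq> 0" "u - w \<noteq> 0" using assms(1-3) by auto
    have e: "t - a = (1 - t) * v / (u - v)" "t - b = (1 - t) * w / (v - w)" "t - c = (1 - t) * w / (u - w)"
      "1 - b = (1 - t) * v / (v - w)"
      using assms(1-3) by (simp_all add: a_b_c_def K_def field_simps)
    have "1 + t - a - b = (t - a) + (1 - b)" by simp
    also have "\<dots> = (1 - t) * v * (u - w) / ((u - v) * (v - w))"
      unfolding e using ne by (simp add: divide_simps) (simp add: algebra_simps)
    finally have "(t - c) * (1 + t - a - b) = (1 - t) * w / (u - w) * ((1 - t) * v * (u - w) / ((u - v) * (v - w)))"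
      unfolding e(3) by simp
    then show ?thesis unfolding e(1,2) using ne by (simp add: mult_ac)
  qed
  define A B C where "A = t - a" "B = t - b" "C = t - c"
  have R': "A * B = C * (1 + A - b)" "A * B = C * (1 + B - a)" using R by (simp_all add: A_B_C_def algebra_simps)
  have e0: "A * B * A + a * C * (1 + A) = B * A * B + b * C * (1 + B)"
  proof -
    have "A * B * (A - B) = A * B * (b - a)" by (simp add: A_B_C_def)
    also have "\<dots> = C * (1 + A - b) * (b - a)" using R'(1) by simp
    also have "\<dots> = b * C * (1 + B) - a * C * (1 + A)" by (simp add: A_B_C_def algebra_simps)
    finally show ?thesis by (simp add: algebra_simps)
  qed
  have e1: "A * B * a + a * C * (a - 1) = B * a * C"
    unfolding R'(2) by (simp add: algebra_simps)
  have e2: "A * b * C = B * A * b + b * C * (b - 1)"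
    unfolding mult.commute[of B A] R'(1) by (simp add: algebra_simps)
  have T: "T u v x y = A * x + a * y" "T v w x y = B * x + b * y" "T u w x y = C * x + c * y"
    "T v u x y = (a - 1) * x + (1 + A) * y" "T w v x y = (b - 1) * x + (1 + B) * y" for x y
    unfolding T_def r a_b_c_def[symmetric] A_B_C_def by (simp_all add: algebra_simps)
  have "T u v (T v w (T u v f0 f1) (T u w f2 f3)) (T u w (T v u f1 f0) (T v w f4 f5))
    = (A * B * A + a * C * (1 + A)) * f0 + (A * B * a + a * C * (a - 1)) * f1 + (A * b * C) * f2
       + A * b * c * f3 + a * c * B * f4 + a * c * b * f5"
    unfolding T by (simp add: algebra_simps)
  moreover have "T v w (T u v (T v w f0 f2) (T u w f1 f4)) (T u w (T w v f2 f0) (T u v f3 f5))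
    = (B * A * B + b * C * (1 + B)) * f0 + (B * a * C) * f1 + (B * A * b + b * C * (b - 1)) * f2
       + A * b * c * f3 + a * c * B * f4 + a * c * b * f5"
    unfolding T by (simp add: algebra_simps)
  ultimately show ?thesis unfolding e0 e1 e2 by simp
qed

context
  fixes n d :: nat and t :: ratt and c :: "(nat \<Rightarrow> nat) \<Rightarrow> ratt"
  assumes c: "c \<in> hpoly n d"
begin

lemma heckeT_quad:
  assumes "i \<in> {1..n}" "j \<in> {1..n}" "i \<noteq> j"
  shows "heckeT i j t (heckeT i j t c) = (\<lambda>a. (t - 1) * heckeT i j t c a + t * c a)"
proof (rule hpoly_eqI)
  fix x :: "nat \<Rightarrow> ratt" assume x: "inj x"
  have ne: "x i \<noteq> x j" using assms by (auto simp: inj_eq[OF x])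
  have 2: "x \<circ> swp i j \<circ> swp i j = x" by (simp add: o_assoc[symmetric])
  show "hev n d (heckeT i j t (heckeT i j t c)) x = hev n d (\<lambda>a. (t - 1) * heckeT i j t c a + t * c a) x"
    using hecke_alg[OF ne, of t "hev n d c x" "hev n d c (x \<circ> swp i j)"] ne ne[symmetric]
    by (simp add: hev_heckeT[OF assms] 2 hev_add hev_scale)
qed (use assms c in \<open>auto intro!: heckeT_hpoly hpoly_add hpoly_scale\<close>)

lemma heckeT_comm:
  assumes "i \<in> {1..n}" "j \<in> {1..n}" "k \<in> {1..n}" "l \<in> {1..n}" "distinct [i, j, k, l]"
  shows "heckeT i j t (heckeT k l t c) = heckeT k l t (heckeT i j t c)"
proof (rule hpoly_eqI)
  fix x :: "nat \<Rightarrow> ratt" assume x: "inj x"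
  have ne: "x i \<noteq> x j" "x k \<noteq> x l" using assms by (auto simp: inj_eq[OF x])
  define K where "K = (\<lambda>p q :: ratt. (t * p - q) / (p - q))"
  have K: "(t * p - q) / (p - q) = K p q" for p q by (simp add: K_def)
  have [simp]: "swp i j k = k" "swp i j l = l" "swp k l i = i" "swp k l j = j" "i \<noteq> j" "k \<noteq> l"
    using assms(5) by auto
  have 2: "x \<circ> swp k l \<circ> swp i j = x \<circ> swp i j \<circ> swp k l"
    using assms(5) by (auto simp: fun_eq_iff Transposition.transpose_def)
  show "hev n d (heckeT i j t (heckeT k l t c)) x = hev n d (heckeT k l t (heckeT i j t c)) x"
    using ne assms(1-4) by (simp add: hev_heckeT 2 K) (simp add: algebra_simps)
qed (use assms c in \<open>auto intro!: heckeT_hpoly\<close>)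

lemma heckeT_braid:
  assumes "i \<in> {1..n}" "j \<in> {1..n}" "k \<in> {1..n}" "distinct [i, j, k]"
  shows "heckeT i j t (heckeT j k t (heckeT i j t c)) = heckeT j k t (heckeT i j t (heckeT j k t c))"
proof (rule hpoly_eqI)
  fix x :: "nat \<Rightarrow> ratt" assume x: "inj x"
  have ne: "x i \<noteq> x j" "x j \<noteq> x k" "x i \<noteq> x k" using assms by (auto simp: inj_eq[OF x])
  have 2: "x \<circ> swp j k \<circ> swp i j \<circ> swp j k = x \<circ> swp i j \<circ> swp j k \<circ> swp i j"
      "x \<circ> swp i j \<circ> swp i j = x" "x \<circ> swp j k \<circ> swp j k = x"
    using assms(4) by (auto simp: fun_eq_iff Transposition.transpose_def)
  have [simp]: "swp i j k = k" "swp j k i = i" "i \<noteq> j" "j \<noteq> k" "i \<noteq> k"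
    using assms(4) by auto
  show "hev n d (heckeT i j t (heckeT j k t (heckeT i j t c))) x = hev n d (heckeT j k t (heckeT i j t (heckeT j k t c))) x"
    using braid_alg[OF ne, of t "hev n d c x" "hev n d c (x \<circ> swp i j)" "hev n d c (x \<circ> swp j k)"
       "hev n d c (x \<circ> swp j k \<circ> swp i j)" "hev n d c (x \<circ> swp i j \<circ> swp j k)"
       "hev n d c (x \<circ> swp i j \<circ> swp j k \<circ> swp i j)"] ne ne[symmetric] assms(1-3)
    by (simp add: hev_heckeT 2)
qed (use assms c in \<open>auto intro!: heckeT_hpoly\<close>)

end

section \<open>Square sums and leading exponents\<close>

definition sqs :: "nat \<Rightarrow> (nat \<Rightarrow> nat) \<Rightarrow> nat" where
  "sqs n a = (\<Sum>i\<in>{1..n}. (a i)\<^sup>2)"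

lemma sqs_upd2:
  assumes "i \<in> {1..n}" "j \<in> {1..n}" "i \<noteq> j"
  shows "sqs n (a(i := p, j := q)) + (a i)\<^sup>2 + (a j)\<^sup>2 = sqs n a + p\<^sup>2 + q\<^sup>2"
proof -
  have "sqs n (a(i := p', j := q')) = p'\<^sup>2 + q'\<^sup>2 + (\<Sum>k\<in>{1..n} - {i, j}. (a k)\<^sup>2)" for p' q'
    unfolding sqs_def using sum_expset_upd2[OF assms, of "\<lambda>_ x. x\<^sup>2" a p' q'] .
  from this[of p q] this[of "a i" "a j"] show ?thesis by simp
qed

lemma sq_spread:
  fixes p q m :: nat
  assumes "m \<le> p + q" "max p q \<le> m"
  shows "p\<^sup>2 + q\<^sup>2 \<le> m\<^sup>2 + (p + q - m)\<^sup>2" "max p q < m \<Longrightarrow> p\<^sup>2 + q\<^sup>2 < m\<^sup>2 + (p + q - m)\<^sup>2"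
proof -
  define r where "r = p + q - m"
  have r: "p + q = m + r" "r \<le> p" "r \<le> q" "p \<le> m" "q \<le> m" using assms by (auto simp: r_def)
  then obtain e where e: "p = r + e" "m = q + e" by (metis add.commute add_diff_cancel_left' le_Suc_ex nat_add_left_cancel_le add.assoc)
  obtain f where "q = r + f" using r(3) le_Suc_ex by blast
  then show "p\<^sup>2 + q\<^sup>2 \<le> m\<^sup>2 + (p + q - m)\<^sup>2"
    using e unfolding r_def[symmetric] by (simp add: power2_eq_square algebra_simps)
  assume "max p q < m"
  then have "r < q" "0 < e" using e r by auto
  then obtain g where "q = r + Suc g" using less_iff_Suc_add by auto
  then show "p\<^sup>2 + q\<^sup>2 < m\<^sup>2 + (p + q - m)\<^sup>2"
    using e \<open>0 < e\<close> unfolding r_def[symmetric] by (simp add: power2_eq_square algebra_simps)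
qed

text \<open>A divided difference brings the exponents of x_i and x_j closer together or exchanges
  them, so T_i keeps this bound (\<open>heckeT_sqle\<close>). On square sums equal to the bound it
  merely permutes exponents, with scalar factors (\<open>heckeT_top\<close>).\<close>

definition sqle :: "nat \<Rightarrow> nat \<Rightarrow> ((nat \<Rightarrow> nat) \<Rightarrow> 'a::zero) \<Rightarrow> bool" where
  "sqle n Q c \<longleftrightarrow> (\<forall>a. c a \<noteq> 0 \<longrightarrow> sqs n a \<le> Q)"

lemma sqle_upd2_0:
  assumes "sqle n Q c" "i \<in> {1..n}" "j \<in> {1..n}" "i \<noteq> j" "m \<le> a i + a j" "max (a i) (a j) \<le> m"
    "Q < sqs n a \<or> Q \<le> sqs n a \<and> max (a i) (a j) < m"
  shows "c (a(i := m, j := a i + a j - m)) = 0" "c (a(i := a i + a j - m, j := m)) = 0"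
proof -
  have "Q < sqs n (a(i := m, j := a i + a j - m))"
    using sqs_upd2[OF assms(2-4), of a m "a i + a j - m"] sq_spread[OF assms(5,6)] assms(7) by linarith
  then show "c (a(i := m, j := a i + a j - m)) = 0" using assms(1) unfolding sqle_def by fastforce
  have "Q < sqs n (a(i := a i + a j - m, j := m))"
    using sqs_upd2[OF assms(2-4), of a "a i + a j - m" m] sq_spread[OF assms(5,6)] assms(7) by linarith
  then show "c (a(i := a i + a j - m, j := m)) = 0" using assms(1) unfolding sqle_def by fastforce
qed

lemma heckeT_sqle:
  assumes "sqle n Q c" "i \<in> {1..n}" "j \<in> {1..n}" "i \<noteq> j"
  shows "sqle n Q (heckeT i j t c)"
  unfolding sqle_def
proof (intro allI impI, rule ccontr)
  fix a assume ne: "heckeT i j t c a \<noteq> 0" and "\<not> sqs n a \<le> Q"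
  then have Q: "Q < sqs n a" by simp
  have "demL i j c a = 0" "demR i j c a = 0" unfolding demL_def demR_def
    using sqle_upd2_0[OF assms, where a = a] Q by (auto intro!: sum.neutral)
  moreover have "c a = 0" using assms(1) Q unfolding sqle_def by fastforce
  ultimately show False using ne by (simp add: heckeT_def)
qed

text \<open>On exponents of maximal square sum \<open>T\<^sub>i\<close> acts as in the regular representation of the
  Hecke algebra.\<close>

lemma heckeT_top:
  assumes "sqle n Q c" "i \<in> {1..n}" "j \<in> {1..n}" "i \<noteq> j" "Q \<le> sqs n a"
  shows "heckeT i j t c a = (if a j < a i then t * c (a \<circ> swp i j) else if a i = a j then t * c a
           else (t - 1) * c a + c (a \<circ> swp i j))"
proof -
  let ?g = "\<lambda>m. c (a(i := m, j := a i + a j - m)) - c (a(i := a i + a j - m, j := m))"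
  have z: "?g m = 0" if "m \<le> a i + a j" "max (a i) (a j) < m" for m
    using sqle_upd2_0[OF assms(1-4), of m a] that assms(5) by simp
  consider "a j < a i" | "a i < a j" | "a i = a j" by linarith
  then show ?thesis
  proof cases
    case 1
    have "demL i j c a = (\<Sum>m\<in>{a i}. ?g m)" unfolding demL_def
      by (rule sum.mono_neutral_right) (use 1 z in auto)
    then have dl: "demL i j c a = c a - c (a \<circ> swp i j)" by (simp add: comp_transpose_upd)
    moreover have "demR i j c a = 0" unfolding demR_def using 1 z by (intro sum.neutral) auto
    ultimately show ?thesis using 1 unfolding heckeT_def dl by (simp add: algebra_simps)
  next
    case 2
    have "demR i j c a = (\<Sum>m\<in>{a j}. ?g m)" unfolding demR_def
      by (rule sum.mono_neutral_right) (use 2 z in auto)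
    then have "demR i j c a = c (a \<circ> swp i j) - c a" by (simp add: comp_transpose_upd)
    moreover have "demL i j c a = 0" unfolding demL_def using 2 z by (intro sum.neutral) auto
    ultimately show ?thesis using 2 by (simp add: heckeT_def algebra_simps)
  next
    case 3
    have "demL i j c a = 0" "demR i j c a = 0" unfolding demL_def demR_def using 3 z by (auto intro!: sum.neutral)
    then show ?thesis using 3 by (simp add: heckeT_def)
  qed
qed

lemma sqs_comp:
  assumes "\<sigma> permutes {1..n}"
  shows "sqs n (a \<circ> \<sigma>) = sqs n a"
  unfolding sqs_def using sum.permute[OF assms, of "\<lambda>i. (a i)\<^sup>2"] by (simp add: o_def)

lemma rotc_sqle: "2 \<le> n \<Longrightarrow> sqle n Q c \<Longrightarrow> sqle n Q (rotc n c)"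
  unfolding sqle_def rotc_def using sqs_comp[OF permutes_inv[OF cyc_permutes]] by metis

section \<open>Commuting operators\<close>

text \<open>Gaussian elimination: a pivot p with nonzero entry at e clears this entry in the other
  vectors, and the coefficient of p is chosen at the end.\<close>

lemma linear_dependence:
  fixes vs :: "'i \<Rightarrow> 'e \<Rightarrow> 'k::field"
  assumes "finite E" "finite I" "card E < card I"
  shows "\<exists>c. (\<exists>j\<in>I. c j \<noteq> 0) \<and> (\<forall>e\<in>E. (\<Sum>j\<in>I. c j * vs j e) = 0)"
  using assms
proof (induction E arbitrary: I vs rule: finite_induct)
  case empty
  then obtain j where "j \<in> I" by fastforce
  then show ?case by (intro exI[of _ "\<lambda>_. 1"]) auto
next
  case (insert e E)
  show ?case
  proof (cases "\<forall>j\<in>I. vs j e = 0")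
    case True
    obtain c where "\<exists>j\<in>I. c j \<noteq> 0" "\<forall>e\<in>E. (\<Sum>j\<in>I. c j * vs j e) = 0"
      using insert.IH[of I vs] insert.prems insert.hyps by auto
    moreover have "(\<Sum>j\<in>I. c j * vs j e) = 0" using True by (intro sum.neutral) auto
    ultimately show ?thesis by (intro exI[of _ c]) auto
  next
    case False
    then obtain p where p: "p \<in> I" "vs p e \<noteq> 0" by auto
    define w where "w j e' = vs j e' - vs j e / vs p e * vs p e'" for j e'
    have "card E < card (I - {p})" using insert.prems insert.hyps p by simp
    then obtain c where c: "\<exists>j\<in>I - {p}. c j \<noteq> 0" "\<forall>e'\<in>E. (\<Sum>j\<in>I - {p}. c j * w j e') = 0"
      using insert.IH[of "I - {p}" w] insert.prems(1) by blast
    define c' where "c' = c(p := - (\<Sum>j\<in>I - {p}. c j * (vs j e / vs p e)))"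
    have s: "(\<Sum>j\<in>I. c' j * vs j e') = (\<Sum>j\<in>I - {p}. c j * w j e')" for e'
    proof -
      have "(\<Sum>j\<in>I. c' j * vs j e') = c' p * vs p e' + (\<Sum>j\<in>I - {p}. c' j * vs j e')"
        using p insert.prems by (simp add: sum.remove)
      also have "(\<Sum>j\<in>I - {p}. c' j * vs j e') = (\<Sum>j\<in>I - {p}. c j * vs j e')"
        by (rule sum.cong) (auto simp: c'_def)
      also have "c' p * vs p e' = - (\<Sum>j\<in>I - {p}. c j * (vs j e / vs p e) * vs p e')"
        by (simp add: c'_def sum_distrib_right)
      finally show ?thesis by (simp add: w_def algebra_simps sum_subtractf)
    qed
    have "w j e = 0" for j using p by (simp add: w_def)
    then have "\<forall>e'\<in>insert e E. (\<Sum>j\<in>I. c' j * vs j e') = 0" using c(2) by (simp add: s)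
    moreover have "\<exists>j\<in>I. c' j \<noteq> 0" using c(1) by (auto simp: c'_def)
    ultimately show ?thesis by blast
  qed
qed

text \<open>Commuting operators that act trivially on the line \<open>u + W\<close> of the quotient by an invariant
  subspace \<open>W\<close> have a common fixed vector; here \<open>z k\<close> is the operator minus the identity.
  As \<open>(z k)\<^sup>m u\<close> is a combination of higher powers, subtracting these from \<open>u\<close> makes \<open>u\<close>
  nilpotent for \<open>z k\<close> without leaving its coset.\<close>

locale commuting_ops =
  fixes E :: "'e set" and z :: "'i \<Rightarrow> ('e \<Rightarrow> 'k::field) \<Rightarrow> 'e \<Rightarrow> 'k" and V W :: "('e \<Rightarrow> 'k) set" and K :: "'i set"
  assumes finE: "finite E" and V: "V = {f. \<forall>e. e \<notin> E \<longrightarrow> f e = 0}"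
    and lin: "\<And>k f g r. k \<in> K \<Longrightarrow> f \<in> V \<Longrightarrow> g \<in> V \<Longrightarrow> z k (\<lambda>e. f e + r * g e) = (\<lambda>e. z k f e + r * z k g e)"
    and closed: "\<And>k f. k \<in> K \<Longrightarrow> f \<in> V \<Longrightarrow> z k f \<in> V"
    and commute: "\<And>k l f. k \<in> K \<Longrightarrow> l \<in> K \<Longrightarrow> f \<in> V \<Longrightarrow> z k (z l f) = z l (z k f)"
    and W: "W \<subseteq> V" "(\<lambda>_. 0) \<in> W" "\<And>f g r. f \<in> W \<Longrightarrow> g \<in> W \<Longrightarrow> (\<lambda>e. f e + r * g e) \<in> W"
    and zW: "\<And>k f. k \<in> K \<Longrightarrow> f \<in> W \<Longrightarrow> z k f \<in> W"
begin

lemma V_lin: "f \<in> V \<Longrightarrow> g \<in> V \<Longrightarrow> (\<lambda>e. f e + r * g e) \<in> V"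
  by (auto simp: V)

lemma V_0: "(\<lambda>_. 0) \<in> V" by (simp add: V)

lemma z_0: "k \<in> K \<Longrightarrow> z k (\<lambda>_. 0) = (\<lambda>_. 0)"
  using lin[of k "\<lambda>_. 0" "\<lambda>_. 0" "-1"] V_0 by simp

lemma pow_closed: "k \<in> K \<Longrightarrow> f \<in> V \<Longrightarrow> (z k ^^ m) f \<in> V"
  by (induction m) (auto intro: closed)

lemma pow_0: "k \<in> K \<Longrightarrow> (z k ^^ m) (\<lambda>_. 0) = (\<lambda>_. 0)"
  by (induction m) (auto simp: z_0)

lemma pow_lin:
  "k \<in> K \<Longrightarrow> f \<in> V \<Longrightarrow> g \<in> V \<Longrightarrow>
    (z k ^^ m) (\<lambda>e. f e + r * g e) = (\<lambda>e. (z k ^^ m) f e + r * (z k ^^ m) g e)"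
  by (induction m) (auto simp: lin pow_closed)

lemma pow_commute:
  assumes "k \<in> K" "l \<in> K" "f \<in> V"
  shows "(z k ^^ m) ((z l ^^ m') f) = (z l ^^ m') ((z k ^^ m) f)"
proof -
  have 1: "z l ((z k ^^ m) f) = (z k ^^ m) (z l f)" if "f \<in> V" for f
    using that by (induction m) (auto simp: commute assms pow_closed)
  show ?thesis using assms(3)
    by (induction m') (auto simp: 1[symmetric] pow_closed assms(2))
qed

definition nilp :: "'i \<Rightarrow> ('e \<Rightarrow> 'k) \<Rightarrow> bool" where
  "nilp k f \<longleftrightarrow> (\<exists>m. (z k ^^ m) f = (\<lambda>_. 0))"

lemma pow_0_mono:
  assumes "k \<in> K" "(z k ^^ m) f = (\<lambda>_. 0)" "m \<le> m'"
  shows "(z k ^^ m') f = (\<lambda>_. 0)"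
proof -
  have "(z k ^^ m') f = (z k ^^ (m' - m + m)) f" using assms(3) by simp
  also have "\<dots> = (z k ^^ (m' - m)) ((z k ^^ m) f)" by (simp only: funpow_add comp_apply)
  finally show ?thesis using assms(2) pow_0[OF assms(1)] by simp
qed

lemma nilp_lin:
  assumes "k \<in> K" "f \<in> V" "g \<in> V" "nilp k f" "nilp k g"
  shows "nilp k (\<lambda>e. f e + r * g e)"
proof -
  obtain m m' where m: "(z k ^^ m) f = (\<lambda>_. 0)" "(z k ^^ m') g = (\<lambda>_. 0)" using assms by (auto simp: nilp_def)
  have "(z k ^^ max m m') f = (\<lambda>_. 0)" "(z k ^^ max m m') g = (\<lambda>_. 0)"
    using m pow_0_mono[OF assms(1)] by (meson max.cobounded1 max.cobounded2)+
  then show ?thesis unfolding nilp_def using pow_lin[OF assms(1-3)] by (intro exI[of _ "max m m'"]) simp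
qed

lemma nilp_pow: "k \<in> K \<Longrightarrow> l \<in> K \<Longrightarrow> f \<in> V \<Longrightarrow> nilp k f \<Longrightarrow> nilp k ((z l ^^ m) f)"
  unfolding nilp_def by (metis pow_commute pow_0)

text \<open>The quantifier over \<open>W'\<close> says that f - g lies in the span of the positive
  powers \<open>(z k ^^ m) f\<close>. It is applied to W, to stay in the coset, and to the
  generalised kernels of the operators treated earlier.\<close>

lemma make_nilp:
  assumes k: "k \<in> K" and f: "f \<in> V"
  obtains g where "g \<in> V" "nilp k g"
    "\<And>W'. (\<lambda>_. 0) \<in> W' \<Longrightarrow> (\<forall>f\<in>W'. \<forall>g\<in>W'. \<forall>r. (\<lambda>e. f e + r * g e) \<in> W') \<Longrightarrow>
      (\<forall>m>0. (z k ^^ m) f \<in> W') \<Longrightarrow> (\<lambda>e. f e - g e) \<in> W'"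
proof -
  obtain c where c: "\<exists>j\<in>{..card E}. c j \<noteq> 0" "\<forall>e\<in>E. (\<Sum>j\<in>{..card E}. c j * (z k ^^ j) f e) = 0"
    using linear_dependence[OF finE, of "{..card E}" "\<lambda>j. (z k ^^ j) f"] by auto
  \<comment> \<open>The lowest power in a linear relation among \<open>card E + 1\<close> vectors.
    Solving for it shows that \<open>(z k ^^ m) f\<close> equals minus
    \<open>(z k ^^ m) (h l)\<close>, where h collects the higher powers.\<close>
  define m where "m = (LEAST j. c j \<noteq> 0)"
  have clt: "c j = 0" if "j < m" for j
    using that not_less_Least[of j "\<lambda>j. c j \<noteq> 0"] unfolding m_def by blast
  have cm: "c m \<noteq> 0" using c(1) LeastI_ex[of "\<lambda>j. c j \<noteq> 0"] unfolding m_def by blast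
  have mle: "m \<le> card E" using c(1) clt by (metis atMost_iff leI order.trans)
  define h where "h l = (\<lambda>e. \<Sum>j\<in>{m<..m + l}. c j / c m * (z k ^^ (j - m)) f e)" for l
  define l where "l = card E - m"
  have span: "h l \<in> W'" if W': "(\<lambda>_. 0) \<in> W'" "\<forall>f\<in>W'. \<forall>g\<in>W'. \<forall>r. (\<lambda>e. f e + r * g e) \<in> W'"
     "\<forall>m>0. (z k ^^ m) f \<in> W'" for W' l
  proof (induction l)
    case 0
    then show ?case using W' by (simp add: h_def)
  next
    case (Suc l)
    have "{m<..m + Suc l} = insert (m + Suc l) {m<..m + l}" by auto
    then have e: "h (Suc l) = (\<lambda>e. h l e + c (m + Suc l) / c m * (z k ^^ (Suc l)) f e)"
      by (simp add: h_def add.commute)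
    have "(z k ^^ Suc l) f \<in> W'" using W'(3) by blast
    from bspec[OF bspec[OF W'(2) Suc] this] show ?case unfolding e by blast
  qed
  have hV: "h l \<in> V" for l by (rule span) (auto simp: V_0 V_lin pow_closed k f)
  have hp: "(z k ^^ m) (h l) = (\<lambda>e. \<Sum>j\<in>{m<..m + l}. c j / c m * (z k ^^ j) f e)" for l
  proof (induction l)
    case 0
    then show ?case using pow_0[OF k] by (simp add: h_def)
  next
    case (Suc l)
    have i: "{m<..m + Suc l} = insert (m + Suc l) {m<..m + l}" by auto
    then have "h (Suc l) = (\<lambda>e. h l e + c (m + Suc l) / c m * (z k ^^ (Suc l)) f e)"
      by (simp add: h_def add.commute)
    then have "(z k ^^ m) (h (Suc l)) = (\<lambda>e. (z k ^^ m) (h l) e + c (m + Suc l) / c m * (z k ^^ m) ((z k ^^ Suc l) f) e)"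
      by (simp only: pow_lin[OF k hV pow_closed[OF k f]])
    also have "(z k ^^ m) ((z k ^^ Suc l) f) = (z k ^^ (m + Suc l)) f" by (simp only: funpow_add comp_apply)
    finally show ?case using Suc i by (simp add: add.commute)
  qed
  define g where "g = (\<lambda>e. f e + 1 * h l e)"
  have gV: "g \<in> V" unfolding g_def by (rule V_lin[OF f hV])
  have "(z k ^^ m) g = (\<lambda>e. (z k ^^ m) f e + (\<Sum>j\<in>{m<..card E}. c j / c m * (z k ^^ j) f e))"
    unfolding g_def pow_lin[OF k f hV] hp using mle by (simp add: l_def)
  also have "\<dots> = (\<lambda>_. 0)"
  proof
    fix e
    have "(\<Sum>j\<in>{..card E}. c j * (z k ^^ j) f e) = 0"
    proof (cases "e \<in> E")
      case False
      then have "(z k ^^ j) f e = 0" for j using pow_closed[OF k f] V by blast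
      then show ?thesis by simp
    qed (use c in blast)
    also have "(\<Sum>j\<in>{..card E}. c j * (z k ^^ j) f e) = (\<Sum>j\<in>insert m {m<..card E}. c j * (z k ^^ j) f e)"
    proof (rule sum.mono_neutral_right)
      show "\<forall>i\<in>{..card E} - insert m {m<..card E}. c i * (z k ^^ i) f e = 0"
      proof
        fix i assume "i \<in> {..card E} - insert m {m<..card E}"
        then have "i < m" by auto
        then show "c i * (z k ^^ i) f e = 0" using clt by simp
      qed
    qed (use mle in auto)
    also have "\<dots> = c m * (z k ^^ m) f e + (\<Sum>j\<in>{m<..card E}. c j * (z k ^^ j) f e)" by simp
    also have "\<dots> = c m * ((z k ^^ m) f e + (\<Sum>j\<in>{m<..card E}. c j / c m * (z k ^^ j) f e))"
      using cm by (simp add: distrib_left sum_distrib_left)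
    finally show "(z k ^^ m) f e + (\<Sum>j\<in>{m<..card E}. c j / c m * (z k ^^ j) f e) = 0" using cm by simp
  qed
  finally have ng: "nilp k g" unfolding nilp_def by blast
  have fgW: "(\<lambda>e. f e - g e) \<in> W'" if W': "(\<lambda>_. 0) \<in> W'" "\<forall>f\<in>W'. \<forall>g\<in>W'. \<forall>r. (\<lambda>e. f e + r * g e) \<in> W'"
     "\<forall>m>0. (z k ^^ m) f \<in> W'" for W'
  proof -
    have "(\<lambda>e. 0 + (-1) * h l e) \<in> W'"
      using spec[OF bspec[OF bspec[OF W'(2) W'(1)] span[OF W', of l]], of "-1"] .
    then show ?thesis by (simp add: g_def)
  qed
  show ?thesis by (rule that[OF gV ng]) (rule fgW)
qed

text \<open>The operators are treated one at a time. A correction for z k does no harm to the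
  earlier ones, since their generalised kernels are subspaces invariant under z k.\<close>

lemma common_nilp:
  assumes "finite L" "L \<subseteq> K" "u \<in> V" "\<And>k. k \<in> K \<Longrightarrow> z k u \<in> W"
  shows "\<exists>f\<in>V. (\<lambda>e. f e - u e) \<in> W \<and> (\<forall>k\<in>L. nilp k f)"
  using assms(1,2)
proof (induction L rule: finite_induct)
  case empty
  then show ?case using assms(3) W(2) by (intro bexI[of _ u]) auto
next
  case (insert k L)
  then obtain f where f: "f \<in> V" "(\<lambda>e. f e - u e) \<in> W" "\<forall>k\<in>L. nilp k f" by auto
  have k: "k \<in> K" using insert by auto
  obtain g where g: "g \<in> V" "nilp k g"
    "\<And>W'. (\<lambda>_. 0) \<in> W' \<Longrightarrow> (\<forall>f\<in>W'. \<forall>g\<in>W'. \<forall>r. (\<lambda>e. f e + r * g e) \<in> W') \<Longrightarrow>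
      (\<forall>m>0. (z k ^^ m) f \<in> W') \<Longrightarrow> (\<lambda>e. f e - g e) \<in> W'"
    by (rule make_nilp[OF k f(1)]) (rule that)
  have zf: "z k f \<in> W"
  proof -
    have "z k (\<lambda>e. u e + 1 * (f e - u e)) = (\<lambda>e. z k u e + 1 * z k (\<lambda>e. f e - u e) e)"
      using lin[OF k assms(3)] f(2) W(1) by blast
    moreover have "(\<lambda>e. z k u e + 1 * z k (\<lambda>e. f e - u e) e) \<in> W"
      using W(3) assms(4)[OF k] zW[OF k f(2)] by blast
    ultimately show ?thesis by simp
  qed
  have "(z k ^^ m) f \<in> W" if "m > 0" for m
    using that
  proof (induction m)
    case (Suc m)
    then show ?case using zf zW[OF k] by (cases m) auto
  qed simp
  then have fg: "(\<lambda>e. f e - g e) \<in> W" by (intro g(3)) (auto intro: W(2,3))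
  have "(\<lambda>e. (f e - u e) + (-1) * (f e - g e)) \<in> W" using W(3)[OF f(2) fg] .
  then have "(\<lambda>e. g e - u e) \<in> W" by (simp add: algebra_simps)
  moreover have "nilp l g" if l: "l \<in> L" for l
  proof -
    have lK: "l \<in> K" using l insert by auto
    let ?W' = "{h \<in> V. nilp l h}"
    have n0: "nilp l (\<lambda>_. 0)" unfolding nilp_def by (intro exI[of _ 0]) simp
    have "(\<lambda>e. f e - g e) \<in> ?W'"
      by (rule g(3)) (use n0 V_0 V_lin nilp_lin lK k f l nilp_pow pow_closed in auto)
    then have "nilp l (\<lambda>e. f e + (-1) * (f e - g e))"
      by (intro nilp_lin[OF lK f(1)]) (use f l in auto)
    then show ?thesis by simp
  qed
  ultimately show ?case using g by (intro bexI[of _ g]) auto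
qed

text \<open>The vector from \<open>common_nilp\<close> is nonzero because it lies in u + W and u
  does not lie in W. Passing to its last nonzero power under one operator after another reaches all
  the kernels.\<close>

lemma common_kernel:
  assumes "finite K" "u \<in> V" "u \<notin> W" "\<And>k. k \<in> K \<Longrightarrow> z k u \<in> W"
  shows "\<exists>v\<in>V. v \<noteq> (\<lambda>_. 0) \<and> (\<forall>k\<in>K. z k v = (\<lambda>_. 0))"
proof -
  obtain f where f: "f \<in> V" "(\<lambda>e. f e - u e) \<in> W" "\<forall>k\<in>K. nilp k f"
    using common_nilp[OF assms(1) order.refl assms(2,4)] by auto
  have f0: "f \<noteq> (\<lambda>_. 0)"
  proof
    assume "f = (\<lambda>_. 0)"
    then have "(\<lambda>e. 0 + (-1) * (f e - u e)) \<in> W" using W(3)[OF W(2) f(2), of "-1"] by simp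
    then show False using assms(3) \<open>f = (\<lambda>_. 0)\<close> by simp
  qed
  have "\<exists>v\<in>V. v \<noteq> (\<lambda>_. 0) \<and> (\<forall>k\<in>K. nilp k v) \<and> (\<forall>k\<in>L. z k v = (\<lambda>_. 0))" if "finite L" "L \<subseteq> K" for L
    using that
  proof (induction L rule: finite_induct)
    case empty
    then show ?case using f f0 by auto
  next
    case (insert k L)
    then obtain v where v: "v \<in> V" "v \<noteq> (\<lambda>_. 0)" "\<forall>k\<in>K. nilp k v" "\<forall>k\<in>L. z k v = (\<lambda>_. 0)" by auto
    have k: "k \<in> K" using insert by auto
    then obtain m0 where "(z k ^^ m0) v = (\<lambda>_. 0)" using v(3) by (auto simp: nilp_def)
    \<comment> \<open>The last nonzero power of z k on v. It is killed by z k, and by commutation it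
      stays in the kernels reached so far.\<close>
    then obtain m where m: "(z k ^^ m) v \<noteq> (\<lambda>_. 0)" "(z k ^^ Suc m) v = (\<lambda>_. 0)"
    proof (induction m0)
      case (Suc m0)
      then show ?case by blast
    qed (use v in auto)
    have "z l ((z k ^^ m) v) = (\<lambda>_. 0)" if "l \<in> L" for l
    proof -
      have "z l ((z k ^^ m) v) = (z k ^^ m) (z l v)"
        using pow_commute[of l k v 1 m] that insert.prems k v(1) by auto
      then show ?thesis using v(4) that pow_0[OF k] by simp
    qed
    with m v k show ?case by (intro bexI[of _ "(z k ^^ m) v"]) (auto simp: nilp_pow pow_closed)
  qed
  from this[OF assms(1) order.refl] show ?thesis by blast
qed

end

text \<open>The operators \<open>Z k = (T\<^sub>n\<^sub>-\<^sub>1 \<cdots> T\<^sub>k)\<inverse> Q T\<^sub>1 \<cdots> T\<^sub>k\<^sub>-\<^sub>1\<close> are Cherednik's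
  commuting elements of the affine Hecke algebra, up to inversion and scaling.\<close>

locale affine_braid =
  fixes n :: nat and T Ti :: "nat \<Rightarrow> 'v \<Rightarrow> 'v" and Q :: "'v \<Rightarrow> 'v"
  assumes n2: "2 \<le> n"
    and TiT: "\<And>i f. 1 \<le> i \<Longrightarrow> i < n \<Longrightarrow> Ti i (T i f) = f"
    and TTi: "\<And>i f. 1 \<le> i \<Longrightarrow> i < n \<Longrightarrow> T i (Ti i f) = f"
    and braid: "\<And>i f. 1 \<le> i \<Longrightarrow> Suc i < n \<Longrightarrow> T i (T (Suc i) (T i f)) = T (Suc i) (T i (T (Suc i) f))"
    and far: "\<And>i j f. 1 \<le> i \<Longrightarrow> Suc i < j \<Longrightarrow> j < n \<Longrightarrow> T i (T j f) = T j (T i f)"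
    and QT: "\<And>i f. 1 \<le> i \<Longrightarrow> Suc i < n \<Longrightarrow> Q (T (Suc i) f) = T i (Q f)"
    and QQT: "\<And>f. Q (Q (T 1 f)) = T (n - 1) (Q (Q f))"
begin

text \<open>As products of operators, \<open>up m\<close> is T_1 ... T_m, \<open>ups m\<close> is
  T_2 ... T_(m+1), and \<open>dw j\<close> is T_(n-1) ... T_(n-j).\<close>

primrec up :: "nat \<Rightarrow> 'v \<Rightarrow> 'v" where
  "up 0 f = f"
| "up (Suc m) f = up m (T (Suc m) f)"

primrec ups :: "nat \<Rightarrow> 'v \<Rightarrow> 'v" where
  "ups 0 f = f"
| "ups (Suc m) f = ups m (T (Suc (Suc m)) f)"

primrec dw :: "nat \<Rightarrow> 'v \<Rightarrow> 'v" where
  "dw 0 f = f"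
| "dw (Suc j) f = dw j (T (n - Suc j) f)"

text \<open>The recursion Z_k = T_k^-1 Z_(k+1) T_k^-1 downwards from Z_n = Q T_1 ... T_(n-1), with j
  = n - k. This form suits the inductive proofs of commutation.\<close>

primrec zr :: "nat \<Rightarrow> 'v \<Rightarrow> 'v" where
  "zr 0 f = Q (up (n - 1) f)"
| "zr (Suc j) f = Ti (n - Suc j) (zr j (Ti (n - Suc j) f))"

definition Z :: "nat \<Rightarrow> 'v \<Rightarrow> 'v" where "Z k = zr (n - k)"

definition com :: "('v \<Rightarrow> 'v) \<Rightarrow> ('v \<Rightarrow> 'v) \<Rightarrow> bool" where
  "com F G \<longleftrightarrow> (\<forall>f. F (G f) = G (F f))"

lemma Z_n: "Z n f = Q (up (n - 1) f)" by (simp add: Z_def)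

lemma Z_rec:
  assumes "1 \<le> k" "k < n"
  shows "Z k f = Ti k (Z (Suc k) (Ti k f))"
proof -
  have "n - k = Suc (n - Suc k)" "n - Suc (n - Suc k) = k" using assms by auto
  then show ?thesis by (simp add: Z_def)
qed

text \<open>For a fixed vector f of \<open>Z k\<close> this reads T_(n-1) ... T_k f = Q T_1 ...
  T_(k-1) f, which is the cyclic relation of the ASEP family at a single tuple.\<close>

lemma dw_Z:
  assumes "1 \<le> k" "k \<le> n"
  shows "dw (n - k) (Z k f) = Q (up (k - 1) f)"
  using assms
proof (induction "n - k" arbitrary: k f)
  case 0
  then have kn: "k = n" by simp
  show ?case unfolding kn by (simp add: Z_n)
next
  case (Suc j)
  then have k: "k < n" and e: "n - k = Suc j" "n - Suc j = k" "n - Suc k = j" by auto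
  have "dw (n - k) (Z k f) = dw (n - Suc k) (Z (Suc k) (Ti k f))"
    using Z_rec[of k] Suc.prems k by (simp add: e TTi)
  also have "\<dots> = Q (up k (Ti k f))" using Suc.hyps(1)[of "Suc k" "Ti k f"] Suc.prems k e by simp
  also have "up k (Ti k f) = up (k - 1) f" using Suc.prems k by (cases k) (auto simp: TTi)
  finally show ?case .
qed

lemma com_Ti: "1 \<le> i \<Longrightarrow> i < n \<Longrightarrow> com (T i) F \<Longrightarrow> com (Ti i) F"
  unfolding com_def by (metis TiT TTi)

lemma com_sym: "com F G \<longleftrightarrow> com G F" by (auto simp: com_def)

lemma com_T_far: "1 \<le> i \<Longrightarrow> i < n \<Longrightarrow> 1 \<le> j \<Longrightarrow> j < n \<Longrightarrow> Suc i < j \<or> Suc j < i \<Longrightarrow> com (T i) (T j)"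
  unfolding com_def by (metis far)

lemma com_up: "m + 2 \<le> j \<Longrightarrow> j < n \<Longrightarrow> T j (up m f) = up m (T j f)"
proof (induction m arbitrary: f)
  case (Suc m)
  have "T j (T (Suc m) f) = T (Suc m) (T j f)" using far[of "Suc m" j f] Suc.prems by simp
  then show ?case using Suc by simp
qed simp

lemma up_shift: "1 \<le> i \<Longrightarrow> Suc i \<le> m \<Longrightarrow> m < n \<Longrightarrow> T (Suc i) (up m f) = up m (T i f)"
proof (induction m arbitrary: f)
  case (Suc m)
  show ?case
  proof (cases "Suc i = Suc m")
    case True
    then obtain k where k: "m = Suc k" "i = Suc k" using Suc.prems by (cases m) auto
    have "T (Suc i) (up (Suc m) f) = T (Suc i) (up k (T i (T (Suc i) f)))" by (simp add: k)
    also have "\<dots> = up k (T (Suc i) (T i (T (Suc i) f)))" using com_up[of k "Suc i"] k Suc.prems by simp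
    also have "\<dots> = up k (T i (T (Suc i) (T i f)))" using braid[of i f] k Suc.prems by simp
    finally show ?thesis by (simp add: k)
  next
    case False
    then have "T i (T (Suc m) f) = T (Suc m) (T i f)" using far[of i "Suc m" f] Suc.prems by simp
    then show ?thesis using False Suc by simp
  qed
qed simp

text \<open>When T_i moves to the right, Q raises its index by one and T_1 ... T_(n-1) lowers it
  again (\<open>up_shift\<close>).\<close>

lemma com_T_Zn: "1 \<le> i \<Longrightarrow> Suc i < n \<Longrightarrow> com (T i) (Z n)"
  unfolding com_def Z_n by (subst QT[symmetric]) (auto simp: up_shift)

lemma com_T_Z_above:
  assumes "1 \<le> i" "i + 2 \<le> k" "k \<le> n"
  shows "com (T i) (Z k)"
  using assms
proof (induction "n - k" arbitrary: k)
  case 0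
  then show ?case using com_T_Zn[of i] by simp
next
  case (Suc j)
  then have IH: "com (T i) (Z (Suc k))" by simp
  have "com (T i) (Ti k)" using com_Ti[of k "T i"] com_T_far[of i k] Suc by (simp add: com_sym)
  then show ?case using IH Z_rec[of k] Suc unfolding com_def by simp
qed

lemma com_T_Z_below:
  assumes "1 \<le> k" "k < i" "i < n"
  shows "com (T i) (Z k)"
  using assms
proof (induction "n - k" arbitrary: k)
  case (Suc j)
  show ?case
  proof (cases "i = Suc k")
    case False
    then have IH: "com (T i) (Z (Suc k))" using Suc by simp
    have "com (T i) (Ti k)" using com_Ti[of k "T i"] com_T_far[of i k] Suc False by (simp add: com_sym)
    then show ?thesis using IH Z_rec[of k] Suc unfolding com_def by simp
  next
    case True
    have k: "1 \<le> k" "Suc k < n" using Suc True by auto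
    have Zk: "Z k f = Ti k (Ti i (Z (Suc i) (Ti i (Ti k f))))" for f
      using Z_rec[of k] Z_rec[of i] k True by simp
    have c: "T k (Z (Suc i) f) = Z (Suc i) (T k f)" for f
      using com_T_Z_above[of k "Suc i"] k True by (simp add: com_def)
    note inv = TiT[OF k(1)] TTi[OF k(1)] TiT[of i] TTi[of i]
    \<comment> \<open>In Z_k = T_k^-1 T_i^-1 Z_(i+1) T_i^-1 T_k^-1 the left factors turn T_i into
      T_k, which commutes with Z_(i+1), and the right factors turn it back into T_i.\<close>
    have b1: "T i (Ti k (Ti i f)) = Ti k (Ti i (T k f))" for f
    proof -
      define g where "g = Ti k (Ti i f)"
      then have "f = T i (T k g)" using inv k True by simp
      then have "T k f = T i (T k (T i g))" using braid[of k g] k True by simp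
      then show ?thesis unfolding g_def[symmetric] using inv k True by simp
    qed
    have b2: "T k (Ti i (Ti k f)) = Ti i (Ti k (T i f))" for f
    proof -
      define g where "g = Ti i (Ti k f)"
      then have "f = T k (T i g)" using inv k True by simp
      then have "T i f = T k (T i (T k g))" using braid[of k g] k True by simp
      then show ?thesis unfolding g_def[symmetric] using inv k True by simp
    qed
    show ?thesis unfolding com_def Zk by (simp add: b1 b2 c)
  qed
qed simp

lemma up_Q: "m \<le> n - 2 \<Longrightarrow> up m (Q f) = Q (ups m f)"
proof (induction m arbitrary: f)
  case (Suc m)
  moreover have "Suc (Suc m) < n" using Suc.prems n2 by linarith
  ultimately show ?case using QT[of "Suc m" f, symmetric] by simp
qed simp

lemma T1_ups: "T 1 (ups m f) = up (Suc m) f"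
  by (induction m arbitrary: f) auto

lemma ups_up: "m \<le> n - 2 \<Longrightarrow> ups m (up (n - 1) f) = up (n - 1) (up m f)"
proof (induction m arbitrary: f)
  case (Suc m)
  then show ?case using up_shift[of "Suc m" "n - 1" f] by simp
qed simp

text \<open>With \<tau> = Q T_1 ... T_(n-2) one has Z_n = \<tau> T_(n-1) and Z_(n-1) = T_(n-1)^-1
  \<tau>, so the claim means that \<tau>^2 commutes with T_(n-1). This is where \<open>QQT\<close>
  enters.\<close>

lemma com_Zn_Zn1: "com (Z n) (Z (n - 1))"
proof -
  define \<tau> where "\<tau> f = Q (up (n - 2) f)" for f
  have n1: "1 \<le> n - 1" "n - 1 < n" "Suc (n - 1) = n" "n - 1 = Suc (n - 2)" using n2 by auto
  have upn: "up (n - 1) f = up (n - 2) (T (n - 1) f)" for f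
    using up.simps(2)[of "n - 2" f] unfolding n1(4)[symmetric] .
  have Zn: "Z n f = \<tau> (T (n - 1) f)" for f
    unfolding Z_n \<tau>_def upn ..
  have Zn1: "Z (n - 1) f = Ti (n - 1) (\<tau> f)" for f
    using Z_rec[OF n1(1,2), of f] unfolding n1(3) Zn TTi[OF n1(1,2)] .
  have tt: "\<tau> (\<tau> f) = Q (Q (ups (n - 2) (up (n - 2) f)))" for f
    unfolding \<tau>_def by (simp add: up_Q)
  have "T (n - 1) (\<tau> (\<tau> f)) = \<tau> (\<tau> (T (n - 1) f))" for f
  proof -
    have "T (n - 1) (\<tau> (\<tau> f)) = Q (Q (up (n - 1) (up (n - 2) f)))"
      unfolding tt QQT[symmetric] T1_ups by (simp add: n1(4)[symmetric])
    also have "\<dots> = Q (Q (ups (n - 2) (up (n - 1) f)))" using ups_up[of "n - 2" f] by simp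
    also note upn
    finally show ?thesis by (simp add: tt)
  qed
  then show ?thesis unfolding com_def Zn Zn1 by (metis TTi TiT n1(1,2))
qed

lemma com_Zn_Z:
  assumes "1 \<le> k" "k < n"
  shows "com (Z n) (Z k)"
  using assms
proof (induction "n - k" arbitrary: k)
  case (Suc j)
  show ?case
  proof (cases "k = n - 1")
    case True
    then show ?thesis using com_Zn_Zn1 by simp
  next
    case False
    then have "com (Z n) (Z (Suc k))" using Suc by simp
    then have IH: "com (Z (Suc k)) (Z n)" by (subst com_sym)
    have "com (Ti k) (Z n)" using com_Ti[of k] com_T_Zn[of k] False Suc by simp
    then show ?thesis using IH Z_rec[of k] Suc unfolding com_def by simp
  qed
qed simp

lemma com_Z_less:
  assumes "1 \<le> j" "j < k" "k \<le> n"
  shows "com (Z k) (Z j)"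
  using assms
proof (induction "n - k" arbitrary: k)
  case 0
  then show ?case using com_Zn_Z[of j] by simp
next
  case (Suc l)
  then have IH: "com (Z (Suc k)) (Z j)" by simp
  have "com (Ti k) (Z j)" using com_Ti[of k] com_T_Z_below[of j k] Suc by simp
  then show ?case using IH Z_rec[of k] Suc unfolding com_def by simp
qed

lemma Z_commute: "k \<in> {1..n} \<Longrightarrow> j \<in> {1..n} \<Longrightarrow> Z k (Z j f) = Z j (Z k f)"
  using com_Z_less[of j k] com_Z_less[of k j] by (cases j k rule: linorder_cases) (auto simp: com_def)

end

section \<open>Existence of the ASEP polynomials\<close>

text \<open>A substitute for the number of inversions: undoing a descent lowers it, which is what
  the inductions over tuples need.\<close>

definition desc_wt :: "nat \<Rightarrow> (nat \<Rightarrow> nat) \<Rightarrow> nat" where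
  "desc_wt n \<mu> = (\<Sum>k\<in>{1..n}. (n - k) * \<mu> k)"

lemma desc_wt_less:
  assumes "i \<in> {1..<n}" "\<mu> (Suc i) < \<mu> i"
  shows "desc_wt n (\<mu> \<circ> swp i (Suc i)) < desc_wt n \<mu>"
proof -
  have ij: "i \<in> {1..n}" "Suc i \<in> {1..n}" "i \<noteq> Suc i" using assms by auto
  obtain r where r: "n - i = Suc r" "n - Suc i = r" using assms by (metis Suc_diff_Suc atLeastLessThan_iff)
  have "desc_wt n (\<mu>(i := p, Suc i := q)) = Suc r * p + r * q + (\<Sum>k\<in>{1..n} - {i, Suc i}. (n - k) * \<mu> k)" for p q
    unfolding desc_wt_def using sum_expset_upd2[OF ij, of "\<lambda>k x. (n - k) * x" \<mu> p q] r by simp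
  from this[of "\<mu> (Suc i)" "\<mu> i"] this[of "\<mu> i" "\<mu> (Suc i)"] assms(2) show ?thesis
    by (simp add: comp_transpose_upd)
qed

text \<open>The family generated from f by ascent exchanges. The leftmost descent of \<mu> is taken
  as the last exchange; \<open>fam_step\<close> shows that the choice does not matter.\<close>

function fam :: "nat \<Rightarrow> 'a \<Rightarrow> ((nat \<Rightarrow> nat) \<Rightarrow> 'a::comm_ring_1) \<Rightarrow> (nat \<Rightarrow> nat) \<Rightarrow> (nat \<Rightarrow> nat) \<Rightarrow> 'a" where
  "fam n t f \<mu> = (if \<exists>i. i \<in> {1..<n} \<and> \<mu> (Suc i) < \<mu> i
     then let i = (LEAST i. i \<in> {1..<n} \<and> \<mu> (Suc i) < \<mu> i)
          in heckeT i (Suc i) t (fam n t f (\<mu> \<circ> swp i (Suc i)))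
     else f)"
  by pat_completeness auto
termination
proof (relation "Wellfounded.measure (\<lambda>(n, t, f, \<mu>). desc_wt n \<mu>)", goal_cases)
  case (2 n t f \<mu> i)
  then have "i \<in> {1..<n} \<and> \<mu> (Suc i) < \<mu> i" by (metis (mono_tags, lifting) LeastI_ex)
  then show ?case using desc_wt_less[of i n \<mu>] by simp
qed auto

declare fam.simps [simp del]

lemma fam_no_descent: "(\<And>i. i \<in> {1..<n} \<Longrightarrow> \<mu> i \<le> \<mu> (Suc i)) \<Longrightarrow> fam n t f \<mu> = f"
  by (subst fam.simps) (auto simp: not_less[symmetric])

lemma fam_hpoly: "f \<in> hpoly n d \<Longrightarrow> fam n t f \<mu> \<in> hpoly n d"
proof (induction "desc_wt n \<mu>" arbitrary: \<mu> rule: less_induct)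
  case less
  show ?case
  proof (cases "\<exists>i. i \<in> {1..<n} \<and> \<mu> (Suc i) < \<mu> i")
    case True
    define l where "l = (LEAST i. i \<in> {1..<n} \<and> \<mu> (Suc i) < \<mu> i)"
    have l: "l \<in> {1..<n} \<and> \<mu> (Suc l) < \<mu> l" using True unfolding l_def by (rule LeastI_ex)
    have "fam n t f \<mu> = heckeT l (Suc l) t (fam n t f (\<mu> \<circ> swp l (Suc l)))"
      using True by (subst fam.simps) (simp add: l_def Let_def)
    moreover have "fam n t f (\<mu> \<circ> swp l (Suc l)) \<in> hpoly n d"
      using less desc_wt_less[of l n \<mu>] l by blast
    ultimately show ?thesis using l by (auto intro!: heckeT_hpoly)
  next
    case False
    have "fam n t f \<mu> = f" by (rule fam_no_descent) (use False in \<open>auto simp: not_less\<close>)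
    then show ?thesis using less.prems by simp
  qed
qed

text \<open>As in Matsumoto's theorem, two descents of \<mu> lead down to a common tuple: by
  commuting operators if they are far apart, by the braid relation if they are adjacent.\<close>

lemma fam_step:
  fixes f :: "(nat \<Rightarrow> nat) \<Rightarrow> ratt"
  assumes f: "f \<in> hpoly n d"
  shows "i \<in> {1..<n} \<Longrightarrow> \<mu> (Suc i) < \<mu> i \<Longrightarrow> fam n t f \<mu> = heckeT i (Suc i) t (fam n t f (\<mu> \<circ> swp i (Suc i)))"
proof (induction "desc_wt n \<mu>" arbitrary: \<mu> i rule: less_induct)
  case (less \<mu>)
  let ?F = "fam n t f" and ?s = "\<lambda>i. swp i (Suc i)" and ?T = "\<lambda>i. heckeT i (Suc i) t"
  have IH: "?F (\<mu> \<circ> ?s i) = ?T j (?F (\<mu> \<circ> ?s i \<circ> ?s j))"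
    if "i \<in> {1..<n}" "\<mu> (Suc i) < \<mu> i" "j \<in> {1..<n}" "(\<mu> \<circ> ?s i) (Suc j) < (\<mu> \<circ> ?s i) j" for i j
    using less.hyps[of "\<mu> \<circ> ?s i" j] desc_wt_less[OF that(1,2)] that(3,4) by blast
  have IH2: "?F (\<mu> \<circ> ?s i \<circ> ?s j) = ?T k (?F (\<mu> \<circ> ?s i \<circ> ?s j \<circ> ?s k))"
    if "i \<in> {1..<n}" "\<mu> (Suc i) < \<mu> i" "j \<in> {1..<n}" "(\<mu> \<circ> ?s i) (Suc j) < (\<mu> \<circ> ?s i) j"
      "k \<in> {1..<n}" "(\<mu> \<circ> ?s i \<circ> ?s j) (Suc k) < (\<mu> \<circ> ?s i \<circ> ?s j) k" for i j k
    using less.hyps[of "\<mu> \<circ> ?s i \<circ> ?s j" k] desc_wt_less[OF that(1,2)] desc_wt_less[OF that(3,4)] that(5,6)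
    by (meson less_trans)
  note fh = fam_hpoly[OF f]
  have diamond: "?T i (?F (\<mu> \<circ> ?s i)) = ?T j (?F (\<mu> \<circ> ?s j))"
    if i: "i \<in> {1..<n}" "\<mu> (Suc i) < \<mu> i" and j: "j \<in> {1..<n}" "\<mu> (Suc j) < \<mu> j" and "i < j" for i j
  proof (cases "j = Suc i")
    case False
    then have d: "distinct [i, Suc i, j, Suc j]" using that by auto
    have "?F (\<mu> \<circ> ?s i) = ?T j (?F (\<mu> \<circ> ?s i \<circ> ?s j))"
      by (rule IH[OF i j(1)]) (use d j in \<open>simp add: Transposition.transpose_def\<close>)
    moreover have "?F (\<mu> \<circ> ?s j) = ?T i (?F (\<mu> \<circ> ?s j \<circ> ?s i))"
      by (rule IH[OF j i(1)]) (use d i in \<open>simp add: Transposition.transpose_def\<close>)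
    moreover have "\<mu> \<circ> ?s i \<circ> ?s j = \<mu> \<circ> ?s j \<circ> ?s i"
      using d by (auto simp: fun_eq_iff Transposition.transpose_def)
    moreover have "?T i (?T j g) = ?T j (?T i g)" if "g \<in> hpoly n d" for g
      using heckeT_comm[OF that, of i "Suc i" j "Suc j"] d i j by auto
    ultimately show ?thesis using fh by simp
  next
    case True
    let ?a = "\<mu> \<circ> ?s i \<circ> ?s j \<circ> ?s i" and ?b = "\<mu> \<circ> ?s j \<circ> ?s i \<circ> ?s j"
    have ab: "?a = ?b" using True by (auto simp: fun_eq_iff Transposition.transpose_def)
    have m: "\<mu> (Suc (Suc i)) < \<mu> i" using i j True by simp
    have "?F (\<mu> \<circ> ?s i) = ?T j (?F (\<mu> \<circ> ?s i \<circ> ?s j))"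
      by (rule IH[OF i j(1)]) (use True m in \<open>simp add: Transposition.transpose_def\<close>)
    moreover have "?F (\<mu> \<circ> ?s i \<circ> ?s j) = ?T i (?F ?a)"
      by (rule IH2[OF i j(1) _ i(1)]) (use True m i j in \<open>simp_all add: Transposition.transpose_def\<close>)
    moreover have "?F (\<mu> \<circ> ?s j) = ?T i (?F (\<mu> \<circ> ?s j \<circ> ?s i))"
      by (rule IH[OF j i(1)]) (use True m in \<open>simp add: Transposition.transpose_def\<close>)
    moreover have "?F (\<mu> \<circ> ?s j \<circ> ?s i) = ?T j (?F ?b)"
      by (rule IH2[OF j i(1) _ j(1)]) (use True m i j in \<open>simp_all add: Transposition.transpose_def\<close>)
    moreover have "?T i (?T j (?T i (?F ?a))) = ?T j (?T i (?T j (?F ?a)))"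
      using heckeT_braid[OF fh[of _ ?a], where i = i and j = "Suc i" and k = "Suc (Suc i)"] i j True by auto
    ultimately show ?thesis unfolding ab by simp
  qed
  define l where "l = (LEAST i. i \<in> {1..<n} \<and> \<mu> (Suc i) < \<mu> i)"
  have ex: "\<exists>i. i \<in> {1..<n} \<and> \<mu> (Suc i) < \<mu> i" using less.prems by blast
  then have l: "l \<in> {1..<n} \<and> \<mu> (Suc l) < \<mu> l" unfolding l_def by (rule LeastI_ex)
  have Fl: "?F \<mu> = ?T l (?F (\<mu> \<circ> ?s l))"
    using ex by (subst fam.simps) (simp add: l_def Let_def)
  show ?case
  proof (cases l i rule: linorder_cases)
    case less
    then show ?thesis using diamond[of l i] l \<open>i \<in> {1..<n}\<close> \<open>\<mu> (Suc i) < \<mu> i\<close> Fl by simp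
  next
    case greater
    then show ?thesis using diamond[of i l] l \<open>i \<in> {1..<n}\<close> \<open>\<mu> (Suc i) < \<mu> i\<close> Fl by simp
  qed (use Fl in simp)
qed

lemma fam_asc:
  fixes f :: "(nat \<Rightarrow> nat) \<Rightarrow> ratt"
  assumes "f \<in> hpoly n d" "i \<in> {1..<n}" "\<mu> i < \<mu> (Suc i)"
  shows "fam n t f (\<mu> \<circ> swp i (Suc i)) = heckeT i (Suc i) t (fam n t f \<mu>)"
proof -
  have "\<mu> \<circ> swp i (Suc i) \<circ> swp i (Suc i) = \<mu>" by (simp add: o_assoc[symmetric])
  then show ?thesis using fam_step[OF assms(1,2), of "\<mu> \<circ> swp i (Suc i)" t] assms(3) by simp
qed

text \<open>\<open>tupA k 1\<close> is the identity tuple with the value \<open>k\<close> moved to the front, \<open>tupB k n\<close> the one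
  with \<open>k\<close> moved to the end.\<close>

definition tupA :: "nat \<Rightarrow> nat \<Rightarrow> nat \<Rightarrow> nat" where
  "tupA k m = (\<lambda>i. if i = m then k else if m < i \<and> i \<le> k then i - 1 else i)"

definition tupB :: "nat \<Rightarrow> nat \<Rightarrow> nat \<Rightarrow> nat" where
  "tupB k m = (\<lambda>i. if i = m then k else if k \<le> i \<and> i < m then Suc i else i)"

lemma tupA_Suc: "m < k \<Longrightarrow> tupA k m = tupA k (Suc m) \<circ> swp m (Suc m)"
  by (auto simp: fun_eq_iff tupA_def Transposition.transpose_def)

lemma tupB_Suc: "k \<le> m \<Longrightarrow> tupB k (Suc m) = tupB k m \<circ> swp m (Suc m)"
  by (auto simp: fun_eq_iff tupB_def Transposition.transpose_def)

lemma tup_self: "tupA k k = id" "tupB k k = id"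
  by (auto simp: fun_eq_iff tupA_def tupB_def)

lemma tupA_cyc: "2 \<le> n \<Longrightarrow> k \<in> {1..n} \<Longrightarrow> tupB k n \<circ> inv (cyc n) = tupA k 1"
proof -
  assume n: "2 \<le> n" and k: "k \<in> {1..n}"
  have "tupA k 1 \<circ> cyc n = tupB k n"
    using n k by (auto simp: fun_eq_iff tupA_def tupB_def cyc_def)
  then have "tupB k n \<circ> inv (cyc n) = tupA k 1 \<circ> (cyc n \<circ> inv (cyc n))" by (simp add: o_assoc)
  then show ?thesis using permutes_inv_o(1)[OF cyc_permutes[OF n]] by simp
qed

lemma sorted_list_eqI:
  fixes f g :: "nat \<Rightarrow> nat"
  assumes "\<And>i. i \<in> {1..<m} \<Longrightarrow> f i < f (Suc i)" "\<And>i. i \<in> {1..<m} \<Longrightarrow> g i < g (Suc i)"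
    and "f ` {1..m} = g ` {1..m}" "i \<in> {1..m}"
  shows "f i = g i"
proof -
  have srt: "sorted_wrt (<) (map h [1..<Suc m])" if "\<And>i. i \<in> {1..<m} \<Longrightarrow> h i < h (Suc i)" for h :: "nat \<Rightarrow> nat"
    unfolding sorted_wrt_iff_nth_Suc_transp[OF transp_on_less] using that by (auto simp del: upt_Suc)
  have "sorted_wrt (<) (map f [1..<Suc m])" "sorted_wrt (<) (map g [1..<Suc m])"
    by (rule srt, erule assms)+
  from strict_sorted_equal[OF this(2,1)] have "map f [1..<Suc m] = map g [1..<Suc m]"
    using assms(3)
    by (simp add: atLeastLessThanSuc_atLeastAtMost del: upt_Suc)
  then show ?thesis using assms(4) by (auto simp del: upt_Suc)
qed

text \<open>A tuple ascending on its first n - 1 places is determined by its last entry. These n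
  tuples are the base cases of the cyclic relation, one for each Z_k.\<close>

lemma permutes_no_descent:
  assumes "2 \<le> n" "\<mu> permutes {1..n}" "\<And>i. i \<in> {1..<n - 1} \<Longrightarrow> \<mu> i < \<mu> (Suc i)"
  shows "\<mu> = tupB (\<mu> n) n"
proof
  fix i
  have k: "\<mu> n \<in> {1..n}" using permutes_in_image[OF assms(2), of n] assms(1) by simp
  have im: "\<mu> ` {1..n - 1} = {1..n} - {\<mu> n}"
  proof -
    have e: "{1..n - 1} = {1..n} - {n}" by auto
    show ?thesis unfolding e using permutes_inj[OF assms(2)] permutes_image[OF assms(2)]
      by (simp add: image_set_diff)
  qed
  have im2: "tupB k n ` {1..n - 1} = {1..n} - {k}" if "k \<in> {1..n}" for k
  proof (intro equalityI subsetI)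
    fix x assume "x \<in> {1..n} - {k}"
    then have "x = tupB k n (if x < k then x else x - 1)" "(if x < k then x else x - 1) \<in> {1..n - 1}"
      using that by (auto simp: tupB_def)
    then show "x \<in> tupB k n ` {1..n - 1}" by (rule image_eqI)
  qed (use that in \<open>auto simp: tupB_def split: if_splits\<close>)
  consider "i \<in> {1..n - 1}" | "i = n" | "i \<notin> {1..n}" by fastforce
  then show "\<mu> i = tupB (\<mu> n) n i"
  proof cases
    case 1
    show ?thesis
    proof (rule sorted_list_eqI[OF _ _ _ 1])
      show "\<mu> ` {1..n - 1} = tupB (\<mu> n) n ` {1..n - 1}" using im im2[OF k] by simp
    qed (use assms(3) in \<open>auto simp: tupB_def\<close>)
  next
    case 3
    then show ?thesis using permutes_not_in[OF assms(2)] k by (auto simp: tupB_def)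
  qed (simp add: tupB_def)
qed

lemma permutes_ascending:
  assumes "\<mu> permutes {1..n}" "\<And>i. i \<in> {1..<n} \<Longrightarrow> \<mu> i < \<mu> (Suc i)"
  shows "\<mu> = id"
proof
  fix i show "\<mu> i = id i"
  proof (cases "i \<in> {1..n}")
    case True
    show ?thesis
    proof (rule sorted_list_eqI[OF _ _ _ True])
      show "\<mu> ` {1..n} = id ` {1..n}" using permutes_image[OF assms(1)] by simp
    qed (erule assms(2), simp)
  qed (use permutes_not_in[OF assms(1)] in auto)
qed

lemma permutes_comp_swp:
  "\<mu> permutes {1..n} \<Longrightarrow> i \<in> {1..n} \<Longrightarrow> j \<in> {1..n} \<Longrightarrow> \<mu> \<circ> swp i j permutes {1..n}"
  by (intro permutes_compose permutes_swap_id)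

lemma permutes_comp_inv_cyc:
  "2 \<le> n \<Longrightarrow> \<mu> permutes {1..n} \<Longrightarrow> \<mu> \<circ> inv (cyc n) permutes {1..n}"
  by (intro permutes_compose permutes_inv cyc_permutes)

text \<open>The relations of the ASEP family on coefficients, with t in an arbitrary commutative
  ring so that it can be specialised, and without the normalisation so that solutions can be scaled
  and subtracted.\<close>

definition asep_sol :: "nat \<Rightarrow> nat \<Rightarrow> 'a \<Rightarrow> ((nat \<Rightarrow> nat) \<Rightarrow> (nat \<Rightarrow> nat) \<Rightarrow> 'a::comm_ring_1) \<Rightarrow> bool" where
  "asep_sol n d t H \<longleftrightarrow> (\<forall>\<mu>. \<mu> permutes {1..n} \<longrightarrow> H \<mu> \<in> hpoly n d) \<and>
     (\<forall>\<mu>. \<mu> permutes {1..n} \<longrightarrow> (\<forall>i\<in>{1..n}. \<mu> i < \<mu> (nxt n i) \<longrightarrow>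
        H (\<mu> \<circ> swp i (nxt n i)) = heckeT i (nxt n i) t (H \<mu>))) \<and>
     (\<forall>\<mu>. \<mu> permutes {1..n} \<longrightarrow> rotc n (H (\<mu> \<circ> inv (cyc n))) = H \<mu>)"

text \<open>The exponent of the leading monomial of F_\<mu>, leading meaning of largest square sum.
  For \<mu> = id it is the staircase exponent at which the family is normalised.\<close>

definition expo :: "nat \<Rightarrow> (nat \<Rightarrow> nat) \<Rightarrow> nat \<Rightarrow> nat" where
  "expo n \<mu> = (\<lambda>i. if i \<in> {1..n} then n - \<mu> i else 0)"

definition asep_deg :: "nat \<Rightarrow> nat" where
  "asep_deg n = (\<Sum>i\<in>{1..n}. n - i)"

lemma expo_comp:
  assumes "\<sigma> permutes {1..n}"
  shows "expo n (\<mu> \<circ> \<sigma>) = expo n \<mu> \<circ> \<sigma>"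
  using permutes_in_image[OF assms] by (simp add: fun_eq_iff expo_def)

lemma expo_id_expset: "expo n id \<in> expset n (asep_deg n)"
  unfolding expset_def asep_deg_def by (auto simp: expo_def intro!: sum.cong)

lemma expo_expset: "\<mu> permutes {1..n} \<Longrightarrow> expo n \<mu> \<in> expset n (asep_deg n)"
  using expo_comp[of \<mu> n id] expset_comp_permutes[of \<mu> n "expo n id"] expo_id_expset by simp

lemma sqs_expo: "\<mu> permutes {1..n} \<Longrightarrow> sqs n (expo n \<mu>) = sqs n (expo n id)"
  using expo_comp[of \<mu> n id] sqs_comp[of \<mu> n "expo n id"] by simp

lemma expo_less_iff:
  assumes "\<mu> permutes {1..n}" "i \<in> {1..n}" "j \<in> {1..n}"
  shows "expo n \<mu> i < expo n \<mu> j \<longleftrightarrow> \<mu> j < \<mu> i"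
proof -
  have "\<mu> i \<le> n" "\<mu> j \<le> n" using permutes_in_image[OF assms(1)] assms(2,3) by auto
  then show ?thesis using assms(2,3) by (auto simp: expo_def)
qed

lemma heckeT_lin: "heckeT i j t (\<lambda>a. f a + r * g a) = (\<lambda>a. heckeT i j t f a + r * heckeT i j t g a)"
  using heckeT_add[of i j t f "\<lambda>a. r * g a"] heckeT_scale[of i j t r g] by simp

lemma hpoly_lin: "f \<in> hpoly n d \<Longrightarrow> g \<in> hpoly n d \<Longrightarrow> (\<lambda>a. f a + r * g a :: 'a::comm_ring_1) \<in> hpoly n d"
  by (auto simp: hpoly_def)

definition monc :: "(nat \<Rightarrow> nat) \<Rightarrow> (nat \<Rightarrow> nat) \<Rightarrow> 'a::zero_neq_one" where
  "monc b = (\<lambda>a. if a = b then 1 else 0)"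

lemma rotc_monc: "2 \<le> n \<Longrightarrow> rotc n (monc (b \<circ> inv (cyc n))) = monc b"
proof -
  assume n: "2 \<le> n"
  have "a \<circ> inv (cyc n) = b \<circ> inv (cyc n) \<longleftrightarrow> a = b" for a
  proof
    assume e: "a \<circ> inv (cyc n) = b \<circ> inv (cyc n)"
    have "a \<circ> inv (cyc n) \<circ> cyc n = b \<circ> inv (cyc n) \<circ> cyc n" by (simp only: e)
    then show "a = b" using permutes_inv_o(2)[OF cyc_permutes[OF n]] by (simp only: o_assoc[symmetric] o_id)
  qed simp
  then show ?thesis by (simp add: rotc_def monc_def)
qed

section \<open>Leading terms and a common fixed vector of Cherednik's elements\<close>

locale cherednik =
  fixes n :: nat and t :: ratt
  assumes n2: "2 \<le> n" and t0: "t \<noteq> 0"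
begin

abbreviation "U \<equiv> hpoly n (asep_deg n) :: ((nat \<Rightarrow> nat) \<Rightarrow> ratt) set"

text \<open>Extended by the identity outside \<open>U\<close>, so that the relations of
  \<open>affine_braid\<close> hold on the whole type.\<close>

definition TT :: "nat \<Rightarrow> ((nat \<Rightarrow> nat) \<Rightarrow> ratt) \<Rightarrow> (nat \<Rightarrow> nat) \<Rightarrow> ratt" where
  "TT i f = (if f \<in> U then heckeT i (Suc i) t f else f)"

definition TTi :: "nat \<Rightarrow> ((nat \<Rightarrow> nat) \<Rightarrow> ratt) \<Rightarrow> (nat \<Rightarrow> nat) \<Rightarrow> ratt" where
  "TTi i f = (if f \<in> U then (\<lambda>a. inverse t * (heckeT i (Suc i) t f a - (t - 1) * f a)) else f)"

definition QQ :: "((nat \<Rightarrow> nat) \<Rightarrow> ratt) \<Rightarrow> (nat \<Rightarrow> nat) \<Rightarrow> ratt" where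
  "QQ f = (if f \<in> U then rotc n f else f)"

text \<open>Among the polynomials of square sum at most that of the staircase, the quotient by W is
  spanned by the monomials with exponents \<open>expo n \<sigma>\<close>; the T_i act on it as in
  the regular representation.\<close>

definition W :: "((nat \<Rightarrow> nat) \<Rightarrow> ratt) set" where
  "W = {c \<in> U. sqle n (sqs n (expo n id)) c \<and> (\<forall>\<sigma>. \<sigma> permutes {1..n} \<longrightarrow> c (expo n \<sigma>) = 0)}"

definition good :: "(((nat \<Rightarrow> nat) \<Rightarrow> ratt) \<Rightarrow> (nat \<Rightarrow> nat) \<Rightarrow> ratt) \<Rightarrow> bool" where
  "good F \<longleftrightarrow> (\<forall>f\<in>U. F f \<in> U) \<and> (\<forall>f\<in>W. F f \<in> W) \<and>
     (\<forall>f\<in>U. \<forall>g\<in>U. \<forall>r. F (\<lambda>e. f e + r * g e) = (\<lambda>e. F f e + r * F g e))"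

lemma goodD:
  assumes "good F"
  shows "f \<in> U \<Longrightarrow> F f \<in> U" "f \<in> W \<Longrightarrow> F f \<in> W"
    "f \<in> U \<Longrightarrow> g \<in> U \<Longrightarrow> F (\<lambda>e. f e + r * g e) = (\<lambda>e. F f e + r * F g e)"
  using assms unfolding good_def by blast+

lemma good_comp: "good F \<Longrightarrow> good G \<Longrightarrow> good (\<lambda>f. F (G f))"
  unfolding good_def by simp

lemma W_U: "f \<in> W \<Longrightarrow> f \<in> U" by (simp add: W_def)

lemma W_lin:
  assumes "f \<in> W" "g \<in> W"
  shows "(\<lambda>a. f a + r * g a) \<in> W"
proof -
  have "sqle n (sqs n (expo n id)) (\<lambda>a. f a + r * g a)"
    unfolding sqle_def
  proof (intro allI impI)
    fix a assume "f a + r * g a \<noteq> 0"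
    then have "f a \<noteq> 0 \<or> g a \<noteq> 0" by auto
    then show "sqs n a \<le> sqs n (expo n id)" using assms unfolding W_def sqle_def by blast
  qed
  then show ?thesis using assms hpoly_lin[OF W_U[OF assms(1)] W_U[OF assms(2)], of r] by (simp add: W_def)
qed

lemma W_0: "(\<lambda>_. 0) \<in> W"
  by (simp add: W_def hpoly_0 sqle_def)

lemma heckeT_U: "i \<in> {1..<n} \<Longrightarrow> f \<in> U \<Longrightarrow> heckeT i (Suc i) t f \<in> U"
  by (rule heckeT_hpoly) auto

lemma heckeT_W:
  assumes i: "i \<in> {1..<n}" and f: "f \<in> W"
  shows "heckeT i (Suc i) t f \<in> W"
proof -
  have ij: "i \<in> {1..n}" "Suc i \<in> {1..n}" "i \<noteq> Suc i" using i by auto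
  have s: "sqle n (sqs n (expo n id)) f" using f by (simp add: W_def)
  have "heckeT i (Suc i) t f (expo n \<sigma>) = 0" if \<sigma>: "\<sigma> permutes {1..n}" for \<sigma>
  proof -
    have "expo n \<sigma> \<circ> swp i (Suc i) = expo n (\<sigma> \<circ> swp i (Suc i))"
      by (rule expo_comp[symmetric]) (use ij in \<open>auto intro: permutes_swap_id\<close>)
    moreover have "f (expo n (\<sigma> \<circ> swp i (Suc i))) = 0" "f (expo n \<sigma>) = 0"
      using f permutes_comp_swp[OF \<sigma> ij(1,2)] \<sigma> by (auto simp: W_def)
    ultimately show ?thesis using heckeT_top[OF s ij, of "expo n \<sigma>" t] sqs_expo[OF \<sigma>] by simp
  qed
  then show ?thesis using heckeT_U[OF i W_U[OF f]] heckeT_sqle[OF s ij, of t] by (simp add: W_def)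
qed

lemma good_TT: "i \<in> {1..<n} \<Longrightarrow> good (TT i)"
  unfolding good_def TT_def by (auto simp: heckeT_lin heckeT_U heckeT_W W_U hpoly_lin simp del: atLeastLessThan_iff)

lemma TTi_alt: "f \<in> U \<Longrightarrow> TTi i f = (\<lambda>a. 0 + inverse t * (heckeT i (Suc i) t f a + (1 - t) * f a))"
  by (simp add: TTi_def algebra_simps)

lemma good_TTi:
  assumes i: "i \<in> {1..<n}"
  shows "good (TTi i)"
  unfolding good_def
proof (intro conjI ballI allI)
  fix f assume f: "f \<in> U"
  show "TTi i f \<in> U" unfolding TTi_alt[OF f]
    by (rule hpoly_lin[OF hpoly_0 hpoly_lin[OF heckeT_U[OF i f] f]])
next
  fix f assume f: "f \<in> W"
  show "TTi i f \<in> W" unfolding TTi_alt[OF W_U[OF f]]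
    by (rule W_lin[OF W_0 W_lin[OF heckeT_W[OF i f] f]])
next
  fix f g r assume f: "f \<in> U" and g: "g \<in> U"
  show "TTi i (\<lambda>e. f e + r * g e) = (\<lambda>e. TTi i f e + r * TTi i g e)"
    unfolding TTi_alt[OF f] TTi_alt[OF g] TTi_alt[OF hpoly_lin[OF f g]] heckeT_lin
    by (simp add: algebra_simps)
qed

lemma good_QQ: "good QQ"
proof -
  have "rotc n f \<in> W" if f: "f \<in> W" for f
  proof -
    have "rotc n f (expo n \<sigma>) = 0" if \<sigma>: "\<sigma> permutes {1..n}" for \<sigma>
    proof -
      have "f (expo n (\<sigma> \<circ> inv (cyc n))) = 0" using f permutes_comp_inv_cyc[OF n2 \<sigma>] by (simp add: W_def)
      then show ?thesis using expo_comp[OF permutes_inv[OF cyc_permutes[OF n2]], of \<sigma>] by (simp add: rotc_def)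
    qed
    then show ?thesis using f rotc_hpoly[OF n2, of f] rotc_sqle[OF n2, of _ f] by (simp add: W_def)
  qed
  then show ?thesis unfolding good_def QQ_def
    using W_U rotc_hpoly[OF n2] by (auto simp: rotc_def hpoly_lin)
qed

sublocale affine_braid n TT TTi QQ
proof
  fix i :: nat and f assume "1 \<le> i" "i < n"
  then have i: "i \<in> {1..<n}" by auto
  then have ij: "i \<in> {1..n}" "Suc i \<in> {1..n}" "i \<noteq> Suc i" by auto
  show "TTi i (TT i f) = f"
  proof (cases "f \<in> U")
    case True
    show ?thesis using heckeT_quad[OF True ij, of t] True heckeT_U[OF i True] t0
      by (simp add: TT_def TTi_def field_simps)
  qed (simp add: TT_def TTi_def)
  show "TT i (TTi i f) = f"
  proof (cases "f \<in> U")
    case True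
    have "TTi i f \<in> U" using goodD(1)[OF good_TTi[OF i] True] .
    then have "TT i (TTi i f) = heckeT i (Suc i) t (TTi i f)" by (simp add: TT_def)
    also have "\<dots> = (\<lambda>a. inverse t * (heckeT i (Suc i) t (heckeT i (Suc i) t f) a - (t - 1) * heckeT i (Suc i) t f a))"
      using True by (simp add: TTi_def heckeT_scale heckeT_diff)
    finally show ?thesis using heckeT_quad[OF True ij, of t] t0 by (simp add: field_simps)
  qed (simp add: TT_def TTi_def)
next
  fix i :: nat and f assume i: "1 \<le> i" "Suc i < n"
  show "TT i (TT (Suc i) (TT i f)) = TT (Suc i) (TT i (TT (Suc i) f))"
  proof (cases "f \<in> U")
    case True
    have ij: "i \<in> {1..<n}" "Suc i \<in> {1..<n}" using i by auto
    note h = heckeT_U[OF ij(1)] heckeT_U[OF ij(2)]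
    show ?thesis using heckeT_braid[OF True, where i = i and j = "Suc i" and k = "Suc (Suc i)"] i
      by (simp add: TT_def True h)
  qed (simp add: TT_def)
  show "QQ (TT (Suc i) f) = TT i (QQ f)"
  proof (cases "f \<in> U")
    case True
    have ij: "i \<in> {1..<n}" "Suc i \<in> {1..<n}" "i \<in> {1..n}" using i by auto
    have "nxt n i = Suc i" "nxt n (Suc i) = Suc (Suc i)" using i by (auto simp: nxt_def)
    then show ?thesis using rotc_heckeT_nxt[OF n2 ij(3), of t f] heckeT_U[OF ij(2) True] rotc_hpoly[OF n2 True]
      by (simp add: TT_def QQ_def True)
  qed (simp add: TT_def QQ_def)
next
  fix i j :: nat and f assume i: "1 \<le> i" "Suc i < j" "j < n"
  show "TT i (TT j f) = TT j (TT i f)"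
  proof (cases "f \<in> U")
    case True
    have ij: "i \<in> {1..<n}" "j \<in> {1..<n}" using i by auto
    note h = heckeT_U[OF ij(1)] heckeT_U[OF ij(2)]
    show ?thesis using heckeT_comm[OF True, where i = i and j = "Suc i" and k = j and l = "Suc j"] i
      by (simp add: TT_def True h)
  qed (simp add: TT_def)
next
  fix f
  show "QQ (QQ (TT 1 f)) = TT (n - 1) (QQ (QQ f))"
  proof (cases "f \<in> U")
    case True
    have m: "n - 1 \<in> {1..n}" "n \<in> {1..n}" "1 \<in> {1..<n}" "n - 1 \<in> {1..<n}" "Suc (n - 1) = n" using n2 by auto
    have nx: "nxt n (n - 1) = n" "nxt n n = 1" "nxt n 1 = Suc 1" using n2 by (auto simp: nxt_def)
    have "rotc n (rotc n (heckeT 1 (Suc 1) t f)) = rotc n (heckeT n 1 t (rotc n f))"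
      using rotc_heckeT_nxt[OF n2 m(2), of t f] unfolding nx by simp
    also have "\<dots> = heckeT (n - 1) n t (rotc n (rotc n f))"
      using rotc_heckeT_nxt[OF n2 m(1), of t "rotc n f"] unfolding nx .
    moreover have "rotc n f \<in> U" "rotc n (rotc n f) \<in> U" "rotc n (heckeT 1 (Suc 1) t f) \<in> U"
      using True heckeT_U[OF m(3) True] by (simp_all add: rotc_hpoly[OF n2])
    ultimately show ?thesis
      using True heckeT_U[OF m(3) True] m(5) by (simp add: TT_def QQ_def)
  qed (simp add: TT_def QQ_def)
qed (rule n2)

lemma good_up: "m < n \<Longrightarrow> good (up m)"
proof (induction m)
  case (Suc m)
  then show ?case using good_comp[of "up m" "TT (Suc m)"] good_TT[of "Suc m"] by simp
qed (simp add: good_def)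

lemma good_zr: "j < n \<Longrightarrow> good (zr j)"
proof (induction j)
  case 0
  then show ?case using good_comp[OF good_QQ good_up[of "n - 1"]] by simp
next
  case (Suc j)
  then have "n - Suc j \<in> {1..<n}" by auto
  note g = good_TTi[OF this]
  from Suc have "good (zr j)" by simp
  from good_comp[OF g good_comp[OF this g]] show ?case by simp
qed

lemma good_Z: "k \<in> {1..n} \<Longrightarrow> good (Z k)"
  unfolding Z_def by (rule good_zr) auto

lemma good_dw: "j < n \<Longrightarrow> good (dw j)"
proof (induction j)
  case (Suc j)
  then show ?case using good_comp[of "dw j" "TT (n - Suc j)"] good_TT[of "n - Suc j"] by simp
qed (simp add: good_def)

lemma dw_in_W: "j < n \<Longrightarrow> g \<in> U \<Longrightarrow> dw j g \<in> W \<Longrightarrow> g \<in> W"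
proof (induction j arbitrary: g)
  case (Suc j)
  have i: "n - Suc j \<in> {1..<n}" using Suc.prems by auto
  have "TT (n - Suc j) g \<in> W"
    using Suc goodD(1)[OF good_TT[OF i]] by simp
  then have "TTi (n - Suc j) (TT (n - Suc j) g) \<in> W" using goodD(2)[OF good_TTi[OF i]] by simp
  then show ?case using TiT[of "n - Suc j" g] i by simp
qed simp

lemma fam_TT:
  assumes "f \<in> U" "i \<in> {1..<n}" "\<mu> i < \<mu> (Suc i)"
  shows "fam n t f (\<mu> \<circ> swp i (Suc i)) = TT i (fam n t f \<mu>)"
  using fam_asc[OF assms] fam_hpoly[OF assms(1)] by (simp add: TT_def)

lemma up_fam:
  assumes f: "f \<in> U" and k: "k \<in> {1..n}"
  shows "up (k - 1) f = fam n t f (tupA k 1)"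
proof -
  have *: "m < k \<Longrightarrow> up m (fam n t f (tupA k (Suc m))) = fam n t f (tupA k 1)" for m
  proof (induction m)
    case (Suc m)
    have "fam n t f (tupA k (Suc m)) = TT (Suc m) (fam n t f (tupA k (Suc (Suc m))))"
      unfolding tupA_Suc[OF Suc.prems] by (rule fam_TT[OF f]) (use Suc.prems k in \<open>auto simp: tupA_def\<close>)
    then show ?case using Suc by simp
  qed simp
  have "fam n t f (tupA k k) = f" unfolding tup_self by (rule fam_no_descent) auto
  then show ?thesis using *[of "k - 1"] k by simp
qed

lemma dw_fam:
  assumes f: "f \<in> U" and k: "k \<in> {1..n}"
  shows "dw (n - k) f = fam n t f (tupB k n)"
proof -
  have *: "j \<le> n - k \<Longrightarrow> dw j (fam n t f (tupB k (n - j))) = fam n t f (tupB k n)" for j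
  proof (induction j)
    case (Suc j)
    have e: "Suc (n - Suc j) = n - j" using Suc.prems by auto
    have "fam n t f (tupB k (n - j)) = TT (n - Suc j) (fam n t f (tupB k (n - Suc j)))"
      unfolding e[symmetric] by (subst tupB_Suc, use Suc.prems in simp, rule fam_TT[OF f])
        (use Suc.prems k in \<open>auto simp: tupB_def\<close>)
    then show ?case using Suc by simp
  qed simp
  have "fam n t f (tupB k k) = f" unfolding tup_self by (rule fam_no_descent) auto
  then show ?thesis using *[of "n - k"] k by simp
qed

text \<open>Once \<open>Z k f = f\<close>, the left side is the member of the family at
  \<open>tupB k n\<close>. The fixed vector equations of Z_1, ..., Z_n are therefore the cyclic
  relation at the n tuples of \<open>permutes_no_descent\<close>.\<close>

lemma Z_fixed_iff:
  assumes f: "f \<in> U" and k: "k \<in> {1..n}"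
  shows "dw (n - k) (Z k f) = rotc n (fam n t f (tupB k n \<circ> inv (cyc n)))"
  using dw_Z[of k f] k up_fam[OF f k] fam_hpoly[OF f] tupA_cyc[OF n2 k]
  by (simp add: QQ_def)

lemma monc_U: "\<mu> permutes {1..n} \<Longrightarrow> monc (expo n \<mu>) \<in> U"
  using expo_expset[of \<mu> n] by (auto simp: hpoly_def monc_def)

lemma monc_sqle: "\<mu> permutes {1..n} \<Longrightarrow> sqle n (sqs n (expo n id)) (monc (expo n \<mu>) :: (nat \<Rightarrow> nat) \<Rightarrow> ratt)"
  using sqs_expo[of \<mu> n] by (simp add: sqle_def monc_def)

lemma heckeT_monc:
  assumes \<mu>: "\<mu> permutes {1..n}" and i: "i \<in> {1..<n}" "\<mu> i < \<mu> (Suc i)"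
  shows "(\<lambda>a. heckeT i (Suc i) t (monc (expo n \<mu>)) a + (-1) * monc (expo n (\<mu> \<circ> swp i (Suc i))) a) \<in> W"
proof -
  let ?\<nu> = "expo n \<mu>" and ?s = "swp i (Suc i)"
  have ij: "i \<in> {1..n}" "Suc i \<in> {1..n}" "i \<noteq> Suc i" using i by auto
  note \<mu>s = permutes_comp_swp[OF \<mu> ij(1,2)]
  note sT = heckeT_sqle[OF monc_sqle[OF \<mu>] ij, of t]
  have U: "(\<lambda>a. heckeT i (Suc i) t (monc ?\<nu>) a + (-1) * monc (expo n (\<mu> \<circ> ?s)) a) \<in> U"
    by (rule hpoly_lin[OF heckeT_U[OF i(1) monc_U[OF \<mu>]] monc_U[OF \<mu>s]])
  have es: "expo n (\<mu> \<circ> ?s) = ?\<nu> \<circ> ?s" by (rule expo_comp) (use ij in \<open>auto intro: permutes_swap_id\<close>)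
  have lt: "?\<nu> (Suc i) < ?\<nu> i" using expo_less_iff[OF \<mu> ij(2,1)] i by simp
  have sw: "a \<circ> ?s = ?\<nu> \<longleftrightarrow> a = ?\<nu> \<circ> ?s" for a
  proof
    assume e: "a \<circ> ?s = ?\<nu>"
    have "a \<circ> ?s \<circ> ?s = ?\<nu> \<circ> ?s" by (simp only: e)
    then show "a = ?\<nu> \<circ> ?s" by (simp add: o_assoc[symmetric])
  qed (simp add: o_assoc[symmetric])
  have "heckeT i (Suc i) t (monc ?\<nu>) a = monc (?\<nu> \<circ> ?s) a" if "sqs n (expo n id) \<le> sqs n a" for a
  proof -
    have ne: "?\<nu> \<noteq> ?\<nu> \<circ> ?s" 
    proof
      assume "?\<nu> = ?\<nu> \<circ> ?s"
      then have "?\<nu> i = (?\<nu> \<circ> ?s) i" by (rule fun_cong)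
      moreover have "(?\<nu> \<circ> ?s) i = ?\<nu> (Suc i)" by simp
      ultimately show False using lt by simp
    qed
    have a: "a = ?\<nu> \<Longrightarrow> a (Suc i) < a i" "a = ?\<nu> \<circ> ?s \<Longrightarrow> a i < a (Suc i)" using lt by auto
    show ?thesis
      by (subst heckeT_top[OF monc_sqle[OF \<mu>] ij that]) (use a ne in \<open>auto simp: monc_def sw\<close>)
  qed
  then have z: "heckeT i (Suc i) t (monc ?\<nu>) a + (-1) * monc (expo n (\<mu> \<circ> ?s)) a = 0" if "sqs n (expo n id) \<le> sqs n a" for a
    using that unfolding es by simp
  have "sqle n (sqs n (expo n id)) (\<lambda>a. heckeT i (Suc i) t (monc ?\<nu>) a + (-1) * monc (expo n (\<mu> \<circ> ?s)) a)"
    unfolding sqle_def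
  proof (intro allI impI, rule ccontr)
    fix a assume "heckeT i (Suc i) t (monc ?\<nu>) a + (-1) * monc (expo n (\<mu> \<circ> ?s)) a \<noteq> 0"
      "\<not> sqs n a \<le> sqs n (expo n id)"
    moreover from this(2) have "sqs n (expo n id) \<le> sqs n a" by simp
    ultimately show False using z[of a] by blast
  qed
  moreover have "heckeT i (Suc i) t (monc ?\<nu>) (expo n \<sigma>) + (-1) * monc (expo n (\<mu> \<circ> ?s)) (expo n \<sigma>) = 0"
    if "\<sigma> permutes {1..n}" for \<sigma>
    by (rule z) (simp only: sqs_expo[OF that] order.refl)
  ultimately show ?thesis unfolding W_def using U by blast
qed

text \<open>At an ascent, T_i exchanges the two exponents of a leading monomial modulo W, with
  coefficient 1 and no power of t. So the family started at the staircase monomial consists of the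
  monomials \<open>expo n \<mu>\<close>.\<close>

lemma fam_monc:
  assumes "\<mu> permutes {1..n}"
  shows "(\<lambda>a. fam n t (monc (expo n id)) \<mu> a + (-1) * monc (expo n \<mu>) a) \<in> W"
  using assms
proof (induction "desc_wt n \<mu>" arbitrary: \<mu> rule: less_induct)
  case less
  let ?u = "monc (expo n id) :: (nat \<Rightarrow> nat) \<Rightarrow> ratt"
  have u: "?u \<in> U" by (rule monc_U) (rule permutes_id)
  show ?case
  proof (cases "\<exists>i\<in>{1..<n}. \<mu> (Suc i) < \<mu> i")
    case True
    then obtain i where i: "i \<in> {1..<n}" "\<mu> (Suc i) < \<mu> i" by auto
    let ?s = "swp i (Suc i)"
    let ?m = "\<mu> \<circ> ?s"
    have ij: "i \<in> {1..n}" "Suc i \<in> {1..n}" using i by auto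
    have m: "?m permutes {1..n}" by (rule permutes_comp_swp[OF less.prems ij])
    have mm: "?m \<circ> ?s = \<mu>" by (simp add: o_assoc[symmetric])
    have IH: "(\<lambda>a. fam n t ?u ?m a + (-1) * monc (expo n ?m) a) \<in> W"
      by (rule less.hyps[OF desc_wt_less[OF i] m])
    have F: "fam n t ?u \<mu> = heckeT i (Suc i) t (fam n t ?u ?m)" by (rule fam_step[OF u i])
    have 1: "(\<lambda>a. heckeT i (Suc i) t (fam n t ?u ?m) a + (-1) * heckeT i (Suc i) t (monc (expo n ?m)) a) \<in> W"
      using heckeT_W[OF i(1) IH] unfolding heckeT_lin .
    have 2: "(\<lambda>a. heckeT i (Suc i) t (monc (expo n ?m)) a + (-1) * monc (expo n \<mu>) a) \<in> W"
      using heckeT_monc[OF m i(1)] i(2) unfolding mm by simp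
    show ?thesis using W_lin[OF 1 2, of 1] unfolding F by simp
  next
    case False
    have "\<mu> i < \<mu> (Suc i)" if "i \<in> {1..<n}" for i
    proof -
      have "\<mu> i \<noteq> \<mu> (Suc i)" using permutes_inj[OF less.prems] by (metis injD n_not_Suc_n)
      then show ?thesis using False that by (meson linorder_neqE_nat)
    qed
    from permutes_ascending[OF less.prems this] have id: "\<mu> = id" by simp
    have "fam n t ?u \<mu> = ?u" unfolding id by (rule fam_no_descent) simp
    then show ?thesis using W_0 by (simp add: id)
  qed
qed

definition zz :: "nat \<Rightarrow> ((nat \<Rightarrow> nat) \<Rightarrow> ratt) \<Rightarrow> (nat \<Rightarrow> nat) \<Rightarrow> ratt" where
  "zz k f = (\<lambda>e. Z k f e + (-1) * f e)"

lemma good_zz: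
  assumes "k \<in> {1..n}"
  shows "good (zz k)"
proof -
  note g = goodD[OF good_Z[OF assms]]
  show ?thesis unfolding good_def zz_def
  proof (intro conjI ballI allI)
    fix f assume "f \<in> U"
    then show "(\<lambda>e. Z k f e + (-1) * f e) \<in> U" by (intro hpoly_lin g)
  next
    fix f assume "f \<in> W"
    then show "(\<lambda>e. Z k f e + (-1) * f e) \<in> W" by (intro W_lin g)
  qed (simp add: g(3) algebra_simps)
qed

text \<open>Leading monomials satisfy the cyclic relation exactly (\<open>rotc_monc\<close>), so
  after applying \<open>dw (n - k)\<close> both vectors have the leading monomial
  \<open>expo n (tupB k n)\<close>. The inverses of the T_i preserve W, so \<open>dw\<close> can be
  removed again.\<close>

lemma zz_monc:
  assumes k: "k \<in> {1..n}"
  shows "zz k (monc (expo n id)) \<in> W"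
proof -
  let ?u = "monc (expo n id) :: (nat \<Rightarrow> nat) \<Rightarrow> ratt"
  have u: "?u \<in> U" by (rule monc_U) (rule permutes_id)
  have Zu: "Z k ?u \<in> U" using goodD(1)[OF good_Z[OF k] u] .
  have nk: "n - k < n" using k n2 by auto
  let ?b = "tupB k n" and ?a = "tupB k n \<circ> inv (cyc n)"
  have b: "?b permutes {1..n}"
  proof (rule bij_imp_permutes)
    show "bij_betw ?b {1..n} {1..n}"
      by (rule bij_betw_byWitness[where f' = "\<lambda>x. if x = k then n else if x < k then x else x - 1"])
        (use k in \<open>auto simp: tupB_def split: if_splits\<close>)
  qed (use k in \<open>auto simp: tupB_def\<close>)
  have a: "?a permutes {1..n}" by (rule permutes_comp_inv_cyc[OF n2 b])
  have 1: "(\<lambda>e. rotc n (fam n t ?u ?a) e + (-1) * monc (expo n ?b) e) \<in> W"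
  proof -
    have "QQ (\<lambda>e. fam n t ?u ?a e + (-1) * monc (expo n ?a) e) \<in> W"
      by (rule goodD(2)[OF good_QQ fam_monc[OF a]])
    also have "QQ (\<lambda>e. fam n t ?u ?a e + (-1) * monc (expo n ?a) e) = (\<lambda>e. rotc n (fam n t ?u ?a) e + (-1) * rotc n (monc (expo n ?a)) e)"
      unfolding QQ_def using hpoly_lin[OF fam_hpoly[OF u] monc_U[OF a], of t ?a "-1"] by (simp add: rotc_def)
    also have "rotc n (monc (expo n ?a)) = (monc (expo n ?b) :: (nat \<Rightarrow> nat) \<Rightarrow> ratt)"
      unfolding expo_comp[OF permutes_inv[OF cyc_permutes[OF n2]]] by (rule rotc_monc[OF n2])
    finally show ?thesis .
  qed
  have 2: "(\<lambda>e. dw (n - k) (Z k ?u) e + (-1) * dw (n - k) ?u e) \<in> W"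
    unfolding Z_fixed_iff[OF u k] dw_fam[OF u k]
    using W_lin[OF 1 fam_monc[OF b], of "-1"] by (simp add: algebra_simps)
  have "dw (n - k) (\<lambda>e. Z k ?u e + (-1) * ?u e) \<in> W"
    unfolding goodD(3)[OF good_dw[OF nk] Zu u] by (rule 2)
  then show ?thesis unfolding zz_def by (rule dw_in_W[OF nk hpoly_lin[OF Zu u]])
qed

lemma exists_fixed: "\<exists>v\<in>U. v \<noteq> (\<lambda>_. 0) \<and> (\<forall>k\<in>{1..n}. Z k v = v)"
proof -
  interpret commuting_ops "expset n (asep_deg n)" zz U W "{1..n}"
  proof
    fix k l :: nat and f assume k: "k \<in> {1..n}" and l: "l \<in> {1..n}" and f: "f \<in> U"
    note gk = goodD[OF good_Z[OF k]] and gl = goodD[OF good_Z[OF l]]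
    show "zz k (zz l f) = zz l (zz k f)"
      unfolding zz_def gk(3)[OF gl(1)[OF f] f] gl(3)[OF gk(1)[OF f] f] Z_commute[OF k l]
      by (simp add: algebra_simps)
  qed (use W_U W_0 W_lin goodD[OF good_zz] in \<open>auto simp: hpoly_def\<close>)
  have u: "monc (expo n id) \<in> U" "monc (expo n id) \<notin> W"
  proof -
    show "monc (expo n id) \<notin> W"
    proof
      assume "monc (expo n id) \<in> W"
      then have "monc (expo n id) (expo n id) = (0 :: ratt)" using permutes_id unfolding W_def by blast
      then show False by (simp add: monc_def)
    qed
  qed (rule monc_U, rule permutes_id)
  obtain v where v: "v \<in> U" "v \<noteq> (\<lambda>_. 0)" "\<And>k. k \<in> {1..n} \<Longrightarrow> zz k v = (\<lambda>_. 0)"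
    using common_kernel[OF _ u zz_monc] by auto
  have "Z k v = v" if "k \<in> {1..n}" for k
    using fun_cong[OF v(3)[OF that]] by (simp add: zz_def fun_eq_iff)
  then show ?thesis using v by blast
qed

text \<open>A descent before place n - 1 is an operator that rotation carries to the next index,
  which gives the induction step. Without such descents the relation is the fixed vector equation of
  one Z_k.\<close>

lemma fam_cyclic:
  assumes v: "v \<in> U" "\<And>k. k \<in> {1..n} \<Longrightarrow> Z k v = v" and "\<mu> permutes {1..n}"
  shows "rotc n (fam n t v (\<mu> \<circ> inv (cyc n))) = fam n t v \<mu>"
  using assms(3)
proof (induction "desc_wt n \<mu>" arbitrary: \<mu> rule: less_induct)
  case less
  let ?ic = "inv (cyc n)"
  show ?case
  \<comment> \<open>The place n - 1 is left out: rotation would carry a descent there across the end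
    of the tuple.\<close>
  proof (cases "\<exists>i\<in>{1..<n - 1}. \<mu> (Suc i) < \<mu> i")
    case True
    then obtain i where i: "i \<in> {1..<n - 1}" "\<mu> (Suc i) < \<mu> i" by auto
    let ?s = "swp i (Suc i)" and ?s' = "swp (Suc i) (Suc (Suc i))"
    let ?m = "\<mu> \<circ> ?s"
    have i': "i \<in> {1..<n}" "i \<in> {1..n}" "Suc i \<in> {1..n}" "Suc i \<in> {1..<n}" "Suc i \<noteq> n" "i \<noteq> n" using i by auto
    have m: "?m permutes {1..n}" by (rule permutes_comp_swp[OF less.prems i'(2,3)])
    have ic: "?ic (Suc i) = i" "?ic (Suc (Suc i)) = Suc i"
      using inv_cyc_nxt[OF n2 i'(2)] inv_cyc_nxt[OF n2 i'(3)] i' by (auto simp: nxt_def)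
    have icj: "?ic x = ?ic y \<longleftrightarrow> x = y" for x y
      using permutes_inj[OF permutes_inv[OF cyc_permutes[OF n2]]] by (auto dest: injD)
    have ss: "?s \<circ> ?ic = ?ic \<circ> ?s'"
    proof
      fix x show "(?s \<circ> ?ic) x = (?ic \<circ> ?s') x"
        using ic icj[of x "Suc i"] icj[of x "Suc (Suc i)"] by (auto simp: Transposition.transpose_def)
    qed
    have e: "?m \<circ> ?ic \<circ> ?s' = \<mu> \<circ> ?ic"
    proof -
      have "?m \<circ> ?ic \<circ> ?s' = \<mu> \<circ> (?s \<circ> (?s \<circ> ?ic))" unfolding ss by (simp add: o_assoc)
      also have "?s \<circ> (?s \<circ> ?ic) = ?ic" by (simp add: o_assoc)
      finally show ?thesis .
    qed
    have lt: "(?m \<circ> ?ic) (Suc i) < (?m \<circ> ?ic) (Suc (Suc i))" using i(2) ic by simp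
    have "fam n t v (\<mu> \<circ> ?ic) = heckeT (Suc i) (Suc (Suc i)) t (fam n t v (?m \<circ> ?ic))"
      using fam_asc[OF v(1) i'(4) lt, of t] unfolding e .
    then have "rotc n (fam n t v (\<mu> \<circ> ?ic)) = heckeT i (Suc i) t (rotc n (fam n t v (?m \<circ> ?ic)))"
      unfolding rotc_heckeT[OF n2] by (simp add: rotc_heckeT[OF n2] ic)
    also have "\<dots> = heckeT i (Suc i) t (fam n t v ?m)"
      using less.hyps[OF desc_wt_less[OF i'(1) i(2)] m] by simp
    also have "\<dots> = fam n t v \<mu>" using fam_step[OF v(1) i'(1) i(2)] by simp
    finally show ?thesis .
  next
    case False
    have "\<mu> i < \<mu> (Suc i)" if "i \<in> {1..<n - 1}" for i
    proof -
      have "\<mu> i \<noteq> \<mu> (Suc i)" using permutes_inj[OF less.prems] by (metis injD n_not_Suc_n)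
      then show ?thesis using False that by (meson linorder_neqE_nat)
    qed
    from permutes_no_descent[OF n2 less.prems this] have B: "\<mu> = tupB (\<mu> n) n" .
    have k: "\<mu> n \<in> {1..n}" using permutes_in_image[OF less.prems, of n] n2 by simp
    show ?thesis using Z_fixed_iff[OF v(1) k] dw_fam[OF v(1) k] unfolding v(2)[OF k] B[symmetric] by simp
  qed
qed

theorem asep_sol_exists: "\<exists>H. asep_sol n (asep_deg n) t H \<and> H id \<noteq> (\<lambda>_. 0)"
proof -
  obtain v where v: "v \<in> U" "v \<noteq> (\<lambda>_. 0)" "\<And>k. k \<in> {1..n} \<Longrightarrow> Z k v = v" using exists_fixed by blast
  let ?H = "fam n t v" and ?ic = "inv (cyc n)"
  have cyc: "rotc n (?H (\<mu> \<circ> ?ic)) = ?H \<mu>" if "\<mu> permutes {1..n}" for \<mu>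
    by (rule fam_cyclic[OF v(1) _ that]) (rule v(3))
  have "?H (\<mu> \<circ> swp i (nxt n i)) = heckeT i (nxt n i) t (?H \<mu>)"
    if \<mu>: "\<mu> permutes {1..n}" and i: "i \<in> {1..n}" "\<mu> i < \<mu> (nxt n i)" for \<mu> i
  proof (cases "i = n")
    case False
    then show ?thesis using fam_asc[OF v(1), of i \<mu> t] i by (auto simp: nxt_def)
  next
    case True
    \<comment> \<open>The exchange across the places n and 1 is obtained by rotating the exchange at
      1 and 2.\<close>
    let ?m = "\<mu> \<circ> ?ic"
    have nx: "nxt n n = 1" "nxt n 1 = 2" using n2 by (auto simp: nxt_def)
    have ic: "?ic 1 = n" "?ic 2 = 1"
      using inv_cyc_nxt[OF n2, of n] inv_cyc_nxt[OF n2, of 1] n2 unfolding nx by auto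
    have icj: "?ic x = ?ic y \<longleftrightarrow> x = y" for x y
      using permutes_inj[OF permutes_inv[OF cyc_permutes[OF n2]]] by (auto dest: injD)
    have e: "?m \<circ> swp 1 2 = \<mu> \<circ> swp n 1 \<circ> ?ic"
    proof
      fix x show "(?m \<circ> swp 1 2) x = (\<mu> \<circ> swp n 1 \<circ> ?ic) x"
        using ic icj[of x 1] icj[of x 2] by (auto simp: Transposition.transpose_def)
    qed
    have s: "\<mu> \<circ> swp n 1 permutes {1..n}" using permutes_comp_swp[OF \<mu>, of n 1] n2 by simp
    have lt: "?m 1 < ?m (Suc 1)" using i(2) ic True nx by (simp add: numeral_2_eq_2)
    have 1: "?H (\<mu> \<circ> swp n 1 \<circ> ?ic) = heckeT 1 2 t (?H ?m)"
    proof -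
      have "?H (?m \<circ> swp 1 (Suc 1)) = heckeT 1 (Suc 1) t (?H ?m)"
        by (rule fam_asc[OF v(1) _ lt]) (use n2 in auto)
      then show ?thesis using e by (simp add: numeral_2_eq_2)
    qed
    have "?H (\<mu> \<circ> swp n 1) = rotc n (heckeT 1 2 t (?H ?m))" using cyc[OF s] 1 by simp
    also have "\<dots> = heckeT n 1 t (rotc n (?H ?m))" unfolding rotc_heckeT[OF n2] ic ..
    also have "rotc n (?H ?m) = ?H \<mu>" by (rule cyc[OF \<mu>])
    finally show ?thesis unfolding True nx .
  qed
  moreover have "?H id = v" by (rule fam_no_descent) simp
  ultimately show ?thesis unfolding asep_sol_def using fam_hpoly[OF v(1)] cyc v(2) by (intro exI[of _ ?H]) simp
qed

end

section \<open>Specialisation at t = 0\<close>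

locale ascent_list =
  fixes L :: "nat list \<Rightarrow> bool"
  assumes swap: "\<And>xs a b ys. L (xs @ [a, b] @ ys) \<Longrightarrow> a < b \<Longrightarrow> L (xs @ [b, a] @ ys)"
    and rotate1: "\<And>x xs. L (x # xs) \<Longrightarrow> L (xs @ [x])"
begin

lemma pass_one: "L (xs @ [b] @ cs @ ys) \<Longrightarrow> \<forall>c\<in>set cs. b < c \<Longrightarrow> L (xs @ cs @ [b] @ ys)"
proof (induction cs arbitrary: xs)
  case (Cons c cs)
  have "L (xs @ [c, b] @ (cs @ ys))" by (rule swap) (use Cons.prems in auto)
  then show ?case using Cons.IH[of "xs @ [c]"] Cons.prems by simp
qed simp

lemma pass_block: "L (xs @ bs @ cs @ ys) \<Longrightarrow> \<forall>b\<in>set bs. \<forall>c\<in>set cs. b < c \<Longrightarrow> L (xs @ cs @ bs @ ys)"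
proof (induction bs arbitrary: ys rule: rev_induct)
  case (snoc b bs)
  have "L ((xs @ bs) @ cs @ [b] @ ys)" by (rule pass_one) (use snoc.prems in auto)
  then show ?case using snoc.IH[of "[b] @ ys"] snoc.prems by simp
qed simp

lemma rotate: "L (xs @ ys) \<Longrightarrow> L (ys @ xs)"
proof (induction xs arbitrary: ys)
  case (Cons x xs)
  then have "L (xs @ (ys @ [x]))" using rotate1[of x "xs @ ys"] by simp
  from Cons.IH[OF this] show ?case by simp
qed simp

text \<open>Moving the block \<open>k, \<dots>, 1\<close> to the right past all the larger values and
  then rotating puts it in front of \<open>k + 1\<close>.\<close>

lemma decreasing_to_increasing:
  assumes "L (rev [1..<Suc n])"
  shows "L [1..<Suc n]"
proof -
  have "L (rev [1..<Suc (n - k)] @ [Suc (n - k)..<Suc n])" for k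
  proof (induction k)
    case (Suc k)
    show ?case
    proof (cases "k < n")
      case True
      define m where "m = n - Suc k"
      have m: "n - k = Suc m" "Suc m \<le> n" using True by (auto simp: m_def)
      have "L ([Suc m] @ rev [1..<Suc m] @ [Suc (Suc m)..<Suc n] @ [])" using Suc m by simp
      then have "L ([Suc m] @ [Suc (Suc m)..<Suc n] @ rev [1..<Suc m] @ [])" by (rule pass_block) auto
      then have "L (([Suc m] @ [Suc (Suc m)..<Suc n]) @ rev [1..<Suc m])" by simp
      from rotate[OF this] have "L (rev [1..<Suc m] @ [Suc m] @ [Suc (Suc m)..<Suc n])" .
      moreover have "[Suc m] @ [Suc (Suc m)..<Suc n] = [Suc m..<Suc n]" using m by (simp add: upt_conv_Cons)
      ultimately show ?thesis by (simp add: m_def)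
    qed (use Suc in simp)
  qed (use assms in simp)
  from this[of n] show ?thesis by simp
qed

end

lemma map_nat_eq_append:
  assumes "map f [1..<Suc n] = xs @ ys"
  shows "map f [1..<Suc (length xs)] = xs" "map f [Suc (length xs)..<Suc n] = ys" "n = length xs + length ys"
proof -
  have "length (map f [1..<Suc n]) = length xs + length ys" unfolding assms by simp
  then show n: "n = length xs + length ys" by (simp del: upt_Suc)
  have "[1..<Suc n] = [1..<Suc (length xs)] @ [Suc (length xs)..<Suc n]"
    using upt_add_eq_append[of 1 "Suc (length xs)" "length ys"] n by simp
  then have "map f [1..<Suc (length xs)] @ map f [Suc (length xs)..<Suc n] = xs @ ys"
    using assms by (simp only: map_append)
  then show "map f [1..<Suc (length xs)] = xs" "map f [Suc (length xs)..<Suc n] = ys"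
    by (simp_all add: append_eq_append_conv del: upt_Suc)
qed

text \<open>At t = 0 the T_i are not invertible, so a descent cannot be undone directly. The way
  from the longest permutation to the identity uses rotations
  (\<open>decreasing_to_increasing\<close>); from the identity, ascent exchanges reach
  everything.\<close>

lemma cyclic_ascents_generate:
  assumes n: "2 \<le> n" and w0: "wlong n \<in> R"
    and asc: "\<And>\<mu> i. \<mu> permutes {1..n} \<Longrightarrow> \<mu> \<in> R \<Longrightarrow> i \<in> {1..<n} \<Longrightarrow> \<mu> i < \<mu> (Suc i) \<Longrightarrow> \<mu> \<circ> swp i (Suc i) \<in> R"
    and rot: "\<And>\<mu>. \<mu> permutes {1..n} \<Longrightarrow> \<mu> \<circ> inv (cyc n) \<in> R \<Longrightarrow> \<mu> \<in> R"
    and "\<mu> permutes {1..n}"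
  shows "\<mu> \<in> R"
proof -
  define L where "L xs \<longleftrightarrow> (\<forall>\<mu>. \<mu> permutes {1..n} \<longrightarrow> map \<mu> [1..<Suc n] = xs \<longrightarrow> \<mu> \<in> R)" for xs
  have uniq: "\<mu> = \<nu>" if "\<mu> permutes {1..n}" "\<nu> permutes {1..n}" "map \<mu> [1..<Suc n] = map \<nu> [1..<Suc n]" for \<mu> \<nu>
  proof
    fix i show "\<mu> i = \<nu> i"
    proof (cases "i \<in> {1..n}")
      case True
      then show ?thesis using that(3) by (auto simp del: upt_Suc)
    next
      case False
      then show ?thesis using permutes_not_in[OF that(1) False] permutes_not_in[OF that(2) False] by simp
    qed
  qed
  interpret ascent_list L
  proof
    fix xs ys :: "nat list" and a b :: nat
    assume l: "L (xs @ [a, b] @ ys)" and ab: "a < b"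
    show "L (xs @ [b, a] @ ys)" unfolding L_def
    proof (intro allI impI)
      fix \<mu> assume p: "\<mu> permutes {1..n}" and m: "map \<mu> [1..<Suc n] = xs @ [b, a] @ ys"
      define i where "i = Suc (length xs)"
      note s = map_nat_eq_append[OF m]
      have i: "i \<in> {1..<n}" "i \<in> {1..n}" "Suc i \<in> {1..n}" using s(3) by (auto simp: i_def)
      have e: "[i..<Suc n] = i # Suc i # [Suc (Suc i)..<Suc n]" using i by (simp add: upt_conv_Cons)
      have ba: "\<mu> i = b" "\<mu> (Suc i) = a" "map \<mu> [Suc (Suc i)..<Suc n] = ys" using s(2) unfolding i_def[symmetric] e by auto
      let ?m = "\<mu> \<circ> swp i (Suc i)"
      have "map ?m [1..<Suc n] = xs @ [a, b] @ ys"
      proof -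
        have "[1..<Suc n] = [1..<i] @ [i..<Suc n]" using upt_add_eq_append[of 1 i "Suc n - i"] i by simp
        then have "map ?m [1..<Suc n] = map ?m [1..<i] @ map ?m [i..<Suc n]" by (simp only: map_append)
        moreover have "map ?m [1..<i] = xs"
        proof (rule trans)
          show "map ?m [1..<i] = map \<mu> [1..<i]" by (rule map_cong) (auto simp: Transposition.transpose_def)
          show "map \<mu> [1..<i] = xs" using s(1) unfolding i_def .
        qed
        moreover have "map ?m [Suc (Suc i)..<Suc n] = ys"
          unfolding ba(3)[symmetric] by (rule map_cong) (auto simp: Transposition.transpose_def)
        ultimately show ?thesis using ba(1,2) unfolding e by (simp del: upt_Suc)
      qed
      then have "?m \<in> R" by (rule l[unfolded L_def, rule_format, OF permutes_comp_swp[OF p i(2,3)]])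
      then have "?m \<circ> swp i (Suc i) \<in> R" using asc[OF permutes_comp_swp[OF p i(2,3)]] i(1) ba ab by simp
      then show "\<mu> \<in> R" by (simp add: o_assoc[symmetric])
    qed
  next
    fix x :: nat and xs assume l: "L (x # xs)"
    show "L (xs @ [x])" unfolding L_def
    proof (intro allI impI)
      fix \<mu> assume p: "\<mu> permutes {1..n}" and m: "map \<mu> [1..<Suc n] = xs @ [x]"
      note s = map_nat_eq_append[OF m]
      have ic: "inv (cyc n) (Suc j) = j" if "j \<in> {1..<n}" for j
        using inv_cyc_nxt[OF n, of j] that by (auto simp: nxt_def)
      have ic1: "inv (cyc n) 1 = n" using inv_cyc_nxt[OF n, of n] n by (auto simp: nxt_def)
      have n': "n = Suc (length xs)" using s(3) by simp
      have "\<mu> n = x" using s(2) n' by simp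
      have e: "[1..<Suc n] = 1 # map Suc [1..<n]" using n by (simp add: upt_conv_Cons map_Suc_upt)
      have "map (\<mu> \<circ> inv (cyc n)) (map Suc [1..<n]) = xs"
      proof (rule trans)
        show "map (\<mu> \<circ> inv (cyc n)) (map Suc [1..<n]) = map \<mu> [1..<n]" using ic by auto
        show "map \<mu> [1..<n] = xs" using s(1) unfolding n'[symmetric] .
      qed
      then have "map (\<mu> \<circ> inv (cyc n)) [1..<Suc n] = x # xs"
        unfolding e list.map(2)[of _ 1] using ic1 \<open>\<mu> n = x\<close> by (simp only: o_apply)
      then have "\<mu> \<circ> inv (cyc n) \<in> R"
        by (rule l[unfolded L_def, rule_format, OF permutes_comp_inv_cyc[OF n p]])
      then show "\<mu> \<in> R" by (rule rot[OF p])
    qed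
  qed
  have wp: "wlong n permutes {1..n}"
    by (rule bij_imp_permutes, rule bij_betw_byWitness[where f' = "wlong n"]) (auto simp: wlong_def)
  have "map (wlong n) [1..<Suc n] = rev [1..<Suc n]"
    by (rule nth_equalityI) (auto simp: wlong_def rev_nth simp del: upt_Suc)
  then have "\<mu> = wlong n" if "\<mu> permutes {1..n}" "map \<mu> [1..<Suc n] = rev [1..<Suc n]" for \<mu>
    using uniq[OF that(1) wp] that(2) by (simp only:)
  then have "L (rev [1..<Suc n])" using w0 unfolding L_def by blast
  from decreasing_to_increasing[OF this] have idR: "id \<in> R"
    unfolding L_def using permutes_id[of "{1..n}"] by simp
  show ?thesis using \<open>\<mu> permutes {1..n}\<close>
  proof (induction "desc_wt n \<mu>" arbitrary: \<mu> rule: less_induct)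
    case less
    show ?case
    proof (cases "\<exists>i\<in>{1..<n}. \<mu> (Suc i) < \<mu> i")
      case True
      then obtain i where i: "i \<in> {1..<n}" "\<mu> (Suc i) < \<mu> i" by auto
      have p: "\<mu> \<circ> swp i (Suc i) permutes {1..n}" using permutes_comp_swp[OF less.prems, of i "Suc i"] i by simp
      have "\<mu> \<circ> swp i (Suc i) \<circ> swp i (Suc i) \<in> R"
        by (rule asc[OF p less.hyps[OF desc_wt_less[OF i] p] i(1)]) (use i in simp)
      then show ?thesis by (simp add: o_assoc[symmetric])
    next
      case False
      have "\<mu> i < \<mu> (Suc i)" if "i \<in> {1..<n}" for i
      proof -
        have "\<mu> i \<noteq> \<mu> (Suc i)" using permutes_inj[OF less.prems] by (metis injD n_not_Suc_n)
        then show ?thesis using False that by (meson linorder_neqE_nat)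
      qed
      from permutes_ascending[OF less.prems this] show ?thesis using idR by simp
    qed
  qed
qed

section \<open>Solutions at t = 0\<close>

lemma wlong_permutes: "wlong n permutes {1..n}"
  by (rule bij_imp_permutes, rule bij_betw_byWitness[where f' = "wlong n"]) (auto simp: wlong_def)

text \<open>\<open>demR\<close> is x_j times \<partial>f, and \<partial>f is symmetric in x_i and
  x_j; the successors account for the factor x_j.\<close>

lemma demR_sym:
  assumes "i \<noteq> j"
  shows "demR i j c (a(i := p, j := Suc q)) = demR i j c (a(i := q, j := Suc p))"
proof -
  have "{m. m \<le> Suc (p + q) \<and> p < m \<and> Suc q \<le> m} = {m. m \<le> Suc (q + p) \<and> q < m \<and> Suc p \<le> m}" by auto
  then show ?thesis using assms unfolding demR_def by (simp add: add.commute)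
qed

lemma heckeT_at_0: "heckeT i j 0 c = demR i j c"
  by (simp add: heckeT_def fun_eq_iff)

context
  fixes n :: nat and H :: "(nat \<Rightarrow> nat) \<Rightarrow> (nat \<Rightarrow> nat) \<Rightarrow> 'a::comm_ring_1"
  assumes n2: "2 \<le> n" and sol: "asep_sol n (asep_deg n) 0 H"
begin

lemma sol_hpoly: "\<mu> permutes {1..n} \<Longrightarrow> H \<mu> \<in> hpoly n (asep_deg n)"
  and sol_asc: "\<mu> permutes {1..n} \<Longrightarrow> i \<in> {1..n} \<Longrightarrow> \<mu> i < \<mu> (nxt n i) \<Longrightarrow>
        H (\<mu> \<circ> swp i (nxt n i)) = heckeT i (nxt n i) 0 (H \<mu>)"
  and sol_rot: "\<mu> permutes {1..n} \<Longrightarrow> rotc n (H (\<mu> \<circ> inv (cyc n))) = H \<mu>"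
  using sol unfolding asep_sol_def by blast+

text \<open>The longest permutation has a descent at each i, so its component is x_(i+1) times a
  polynomial symmetric in x_i and x_(i+1), for all i < n at once.\<close>

lemma wlong_demR:
  assumes i: "i \<in> {1..<n}"
  shows "\<exists>c. H (wlong n) = demR i (Suc i) c"
proof -
  let ?m = "wlong n \<circ> swp i (Suc i)"
  have m: "?m permutes {1..n}" using permutes_comp_swp[OF wlong_permutes, of i n "Suc i"] i by simp
  have "H (?m \<circ> swp i (nxt n i)) = heckeT i (nxt n i) 0 (H ?m)"
    by (rule sol_asc[OF m]) (use i in \<open>auto simp: nxt_def wlong_def\<close>)
  moreover have "nxt n i = Suc i" using i by (simp add: nxt_def)
  ultimately show ?thesis by (intro exI[of _ "H ?m"]) (simp add: o_assoc[symmetric] heckeT_at_0)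
qed

text \<open>Divisibility by x_(i+1) gives the exponent q + 1 there. Symmetry of the quotient yields
  another exponent in the support with q at x_i, and the induction hypothesis bounds q.\<close>

lemma wlong_support_lower: "i \<in> {1..n} \<Longrightarrow> H (wlong n) a \<noteq> 0 \<Longrightarrow> i - 1 \<le> a i"
proof (induction i arbitrary: a)
  case (Suc i)
  show ?case
  proof (cases "i = 0")
    case False
    then have i: "i \<in> {1..<n}" using Suc.prems by auto
    obtain c where c: "H (wlong n) = demR i (Suc i) c" using wlong_demR[OF i] by blast
    obtain q where q: "a (Suc i) = Suc q" using Suc.prems(2) demR_0[of a "Suc i" i c] c by (metis not0_implies_Suc)
    have "a = a(i := a i, Suc i := Suc q)" using q by auto
    then have "demR i (Suc i) c a = demR i (Suc i) c (a(i := q, Suc i := Suc (a i)))"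
      using demR_sym[of i "Suc i" c a "a i" q] by simp
    then have "H (wlong n) (a(i := q, Suc i := Suc (a i))) \<noteq> 0" using c Suc.prems by simp
    from Suc.IH[OF _ this] i q show ?thesis by simp
  qed simp
qed simp

text \<open>The lower bounds on the exponents add up to the degree, so all of them are
  attained.\<close>

lemma wlong_support:
  assumes "H (wlong n) a \<noteq> 0"
  shows "a = expo n (wlong n)"
proof -
  have ex: "expo n (wlong n) i = (if i \<in> {1..n} then i - 1 else 0)" for i by (auto simp: expo_def wlong_def)
  have a: "a \<in> expset n (asep_deg n)" using sol_hpoly[OF wlong_permutes] assms by (auto simp: hpoly_def)
  have "(\<Sum>i\<in>{1..n}. a i - (i - 1)) = 0"
  proof -
    have "(\<Sum>i\<in>{1..n}. a i) = (\<Sum>i\<in>{1..n}. expo n (wlong n) i)"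
      using a expo_expset[OF wlong_permutes, of n] by (simp add: expset_def)
    also have "\<dots> = (\<Sum>i\<in>{1..n}. i - 1)" by (rule sum.cong) (auto simp: ex)
    finally show ?thesis
      by (subst sum_subtractf_nat) (use wlong_support_lower[OF _ assms] in auto)
  qed
  then have "a i = i - 1" if "i \<in> {1..n}" for i
  proof -
    have "a i - (i - 1) = 0" using \<open>(\<Sum>i\<in>{1..n}. a i - (i - 1)) = 0\<close> that by (simp only: sum_eq_0_iff finite_atLeastAtMost)
    then show ?thesis using wlong_support_lower[OF that assms] by linarith
  qed
  then show ?thesis using a by (auto simp: fun_eq_iff ex expset_def)
qed

text \<open>All three properties pass through ascent exchanges and rotations, so they spread from
  the monomial at the longest permutation with the same scalar \<kappa> throughout.\<close>

lemma top_coefficients: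
  assumes "\<mu> permutes {1..n}"
  defines "\<kappa> \<equiv> H (wlong n) (expo n (wlong n))"
  shows "sqle n (sqs n (expo n id)) (H \<mu>)"
    and "sqs n (expo n id) \<le> sqs n a \<Longrightarrow> H \<mu> a = (if a = expo n \<mu> then \<kappa> else 0)"
    and "\<kappa> = 0 \<Longrightarrow> H \<mu> = (\<lambda>_. 0)"
proof -
  let ?Q = "sqs n (expo n id)"
  define R where "R = {\<mu>. sqle n ?Q (H \<mu>) \<and> (\<forall>a. ?Q \<le> sqs n a \<longrightarrow> H \<mu> a = (if a = expo n \<mu> then \<kappa> else 0)) \<and>
      (\<kappa> = 0 \<longrightarrow> H \<mu> = (\<lambda>_. 0))}"
  have "\<mu> \<in> R"
  proof (rule cyclic_ascents_generate[OF n2 _ _ _ assms(1)])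
    show "wlong n \<in> R"
    proof -
      have "sqle n ?Q (H (wlong n))"
        unfolding sqle_def using wlong_support sqs_expo[OF wlong_permutes, of n] by fastforce
      moreover have "H (wlong n) a = (if a = expo n (wlong n) then \<kappa> else 0)" for a
        using wlong_support[of a] by (auto simp: \<kappa>_def)
      ultimately show ?thesis unfolding R_def by auto
    qed
  next
    fix \<mu> i assume \<mu>: "\<mu> permutes {1..n}" and R: "\<mu> \<in> R" and i: "i \<in> {1..<n}" and lt: "\<mu> i < \<mu> (Suc i)"
    let ?s = "swp i (Suc i)" and ?\<nu> = "expo n \<mu>"
    have ij: "i \<in> {1..n}" "Suc i \<in> {1..n}" "i \<noteq> Suc i" using i by auto
    have nx: "nxt n i = Suc i" using i by (simp add: nxt_def)
    have E: "H (\<mu> \<circ> ?s) = heckeT i (Suc i) 0 (H \<mu>)" using sol_asc[OF \<mu> ij(1)] lt nx by simp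
    have sq: "sqle n ?Q (H \<mu>)" using R by (simp add: R_def)
    have es: "expo n (\<mu> \<circ> ?s) = ?\<nu> \<circ> ?s" by (rule expo_comp) (use ij in \<open>auto intro: permutes_swap_id\<close>)
    have nlt: "?\<nu> (Suc i) < ?\<nu> i" using expo_less_iff[OF \<mu> ij(2,1)] lt by simp
    have sw: "a \<circ> ?s = ?\<nu> \<longleftrightarrow> a = ?\<nu> \<circ> ?s" for a
    proof
      assume e: "a \<circ> ?s = ?\<nu>"
      have "a \<circ> ?s \<circ> ?s = ?\<nu> \<circ> ?s" by (simp only: e)
      then show "a = ?\<nu> \<circ> ?s" by (simp add: o_assoc[symmetric])
    qed (simp add: o_assoc[symmetric])
    have "H (\<mu> \<circ> ?s) a = (if a = ?\<nu> \<circ> ?s then \<kappa> else 0)" if Q: "?Q \<le> sqs n a" for a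
    proof -
      have ne: "?\<nu> \<noteq> ?\<nu> \<circ> ?s"
      proof
        assume "?\<nu> = ?\<nu> \<circ> ?s"
        then have "?\<nu> i = (?\<nu> \<circ> ?s) i" by (rule fun_cong)
        moreover have "(?\<nu> \<circ> ?s) i = ?\<nu> (Suc i)" by simp
        ultimately show False using nlt by simp
      qed
      have a: "a = ?\<nu> \<Longrightarrow> a (Suc i) < a i" "a = ?\<nu> \<circ> ?s \<Longrightarrow> a i < a (Suc i)" using nlt by auto
      have "sqs n (a \<circ> ?s) = sqs n a" by (rule sqs_comp) (use ij in \<open>auto intro: permutes_swap_id\<close>)
      then have h: "H \<mu> a = (if a = ?\<nu> then \<kappa> else 0)" "H \<mu> (a \<circ> ?s) = (if a = ?\<nu> \<circ> ?s then \<kappa> else 0)"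
        using R Q unfolding R_def sw[symmetric] by auto
      show ?thesis unfolding E
        by (subst heckeT_top[OF sq ij Q], unfold h) (use a ne in \<open>auto simp del: o_apply\<close>)
    qed
    moreover have "\<kappa> = 0 \<Longrightarrow> H (\<mu> \<circ> ?s) = (\<lambda>_. 0)" unfolding E using R by (simp add: R_def heckeT_0)
    ultimately show "\<mu> \<circ> ?s \<in> R" using heckeT_sqle[OF sq ij, of 0] E es by (simp add: R_def)
  next
    fix \<mu> assume \<mu>: "\<mu> permutes {1..n}" and R: "\<mu> \<circ> inv (cyc n) \<in> R"
    let ?ic = "inv (cyc n)"
    note ip = permutes_inv[OF cyc_permutes[OF n2]]
    have sw: "a \<circ> ?ic = expo n \<mu> \<circ> ?ic \<longleftrightarrow> a = expo n \<mu>" for a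
    proof
      assume e: "a \<circ> ?ic = expo n \<mu> \<circ> ?ic"
      have "a \<circ> ?ic \<circ> cyc n = expo n \<mu> \<circ> ?ic \<circ> cyc n" by (simp only: e)
      then show "a = expo n \<mu>"
        using permutes_inv_o(2)[OF cyc_permutes[OF n2]] by (simp only: o_assoc[symmetric] o_id)
    qed simp
    have r: "sqle n ?Q (H (\<mu> \<circ> ?ic))" "\<And>a. ?Q \<le> sqs n a \<Longrightarrow> H (\<mu> \<circ> ?ic) a = (if a = expo n \<mu> \<circ> ?ic then \<kappa> else 0)"
      "\<kappa> = 0 \<Longrightarrow> H (\<mu> \<circ> ?ic) = (\<lambda>_. 0)"
      using R expo_comp[OF ip, of \<mu>] unfolding R_def by auto
    have "rotc n (H (\<mu> \<circ> ?ic)) a = (if a = expo n \<mu> then \<kappa> else 0)" if "?Q \<le> sqs n a" for a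
      using r(2)[of "a \<circ> ?ic"] that unfolding sqs_comp[OF ip] sw rotc_def by simp
    moreover have "sqle n ?Q (rotc n (H (\<mu> \<circ> ?ic)))" by (rule rotc_sqle[OF n2 r(1)])
    moreover have "\<kappa> = 0 \<Longrightarrow> rotc n (H (\<mu> \<circ> ?ic)) = (\<lambda>_. 0)" using r(3) by (simp add: rotc_def)
    ultimately show "\<mu> \<in> R" unfolding R_def sol_rot[OF \<mu>] by blast
  qed
  then show "sqle n ?Q (H \<mu>)" "?Q \<le> sqs n a \<Longrightarrow> H \<mu> a = (if a = expo n \<mu> then \<kappa> else 0)"
    "\<kappa> = 0 \<Longrightarrow> H \<mu> = (\<lambda>_. 0)" by (auto simp: R_def)
qed

lemma sol_zero: "H id (expo n id) = 0 \<Longrightarrow> \<mu> permutes {1..n} \<Longrightarrow> H \<mu> = (\<lambda>_. 0)"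
  using top_coefficients(2)[OF permutes_id, of "expo n id"] top_coefficients(3)[of \<mu>] by simp

lemma sol_wlong: "H (wlong n) = (\<lambda>a. if a = expo n (wlong n) then H id (expo n id) else 0)"
proof
  fix a show "H (wlong n) a = (if a = expo n (wlong n) then H id (expo n id) else 0)"
    using top_coefficients(2)[OF permutes_id, of "expo n id"] wlong_support[of a] by auto
qed

end

text \<open>The value of the component after the exchange is y_j times that of the symmetric
  \<partial>f, so exchanging the two coordinates scales it by r. For r = 1 - p the two formulas are
  the balance equations of a TASEP step at one edge.\<close>

lemma hev_exchange_0:
  fixes H :: "(nat \<Rightarrow> nat) \<Rightarrow> (nat \<Rightarrow> nat) \<Rightarrow> 'a::field"
  assumes n2: "2 \<le> n" and sol: "asep_sol n d 0 H" and \<mu>: "\<mu> permutes {1..n}"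
    and i: "i \<in> {1..n}" "\<mu> i < \<mu> (nxt n i)" and y: "y i \<noteq> y (nxt n i)" "y (nxt n i) \<noteq> 0"
    and r: "r = y i / y (nxt n i)"
  defines "s \<equiv> swp i (nxt n i)"
  shows "hev n d (H (\<mu> \<circ> s)) (y \<circ> s) = r * hev n d (H (\<mu> \<circ> s)) y"
    and "hev n d (H \<mu>) (y \<circ> s) = hev n d (H \<mu>) y + (1 - r) * hev n d (H (\<mu> \<circ> s)) y"
proof -
  let ?j = "nxt n i" and ?f = "hev n d (H \<mu>)" and ?g = "hev n d (H (\<mu> \<circ> s))"
  have ij: "i \<in> {1..n}" "?j \<in> {1..n}" "i \<noteq> ?j" using i nxt_in nxt_neq[OF n2] by auto
  have E: "H (\<mu> \<circ> s) = demR i ?j (H \<mu>)"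
    using sol \<mu> i unfolding asep_sol_def s_def heckeT_at_0[symmetric] by blast
  have ys: "(y \<circ> s) i = y ?j" "(y \<circ> s) ?j = y i" "y \<circ> s \<circ> s = y" by (auto simp: s_def o_assoc[symmetric])
  have g1: "?g y = y ?j * ((?f y - ?f (y \<circ> s)) / (y i - y ?j))"
    unfolding E by (rule hev_dem_field(2)[OF ij y(1) refl, folded s_def])
  have g2: "?g (y \<circ> s) = y i * ((?f (y \<circ> s) - ?f y) / (y ?j - y i))"
    using hev_dem_field(2)[OF ij _ refl, of "y \<circ> s" d "H \<mu>"] y(1) ys unfolding E s_def[symmetric] by simp
  have "y i - y ?j \<noteq> 0" "y ?j - y i \<noteq> 0" using y by auto
  then show "?g (y \<circ> s) = r * ?g y" unfolding g1 g2 r using y by (simp add: field_simps)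
  have "y i - y ?j \<noteq> 0" using y by auto
  then show "?f (y \<circ> s) = ?f y + (1 - r) * ?g y" unfolding g1 r using y by (simp add: field_simps)
qed

section \<open>Fractions without a pole at t = 0\<close>

definition loc0 :: "ratt \<Rightarrow> bool" where
  "loc0 r \<longleftrightarrow> (\<exists>a b. r = Fract a b \<and> poly b 0 \<noteq> 0)"

lemma at_t0_Fract:
  assumes "poly b 0 \<noteq> 0"
  shows "at_t0 (Fract a b) = poly a 0 / poly b 0"
  unfolding at_t0_def
proof (rule the_equality)
  fix v assume "\<exists>a' b'. Fract a b = Fract a' b' \<and> poly b' 0 \<noteq> 0 \<and> v = poly a' 0 / poly b' 0"
  then obtain a' b' where e: "Fract a b = Fract a' b'" "poly b' 0 \<noteq> 0" "v = poly a' 0 / poly b' 0" by blast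
  have "b \<noteq> 0" "b' \<noteq> 0" using assms e(2) by auto
  then have "a * b' = a' * b" using e(1) by (simp add: eq_fract)
  from arg_cong[OF this, of "\<lambda>q. poly q 0"] show "v = poly a 0 / poly b 0"
    unfolding e(3) using assms e(2) by (simp add: frac_eq_eq)
qed (use assms in blast)

lemma loc0_Fract: "poly b 0 \<noteq> 0 \<Longrightarrow> loc0 (Fract a b)"
  by (auto simp: loc0_def)

lemma loc0_add:
  assumes "loc0 r" "loc0 s"
  shows "loc0 (r + s)" "at_t0 (r + s) = at_t0 r + at_t0 s"
proof -
  obtain a b c d where r: "r = Fract a b" "poly b 0 \<noteq> 0" and s: "s = Fract c d" "poly d 0 \<noteq> 0"
    using assms unfolding loc0_def by blast
  have "b \<noteq> 0" "d \<noteq> 0" using r s by auto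
  then have e: "r + s = Fract (a * d + c * b) (b * d)" using r s by simp
  have bd: "poly (b * d) 0 \<noteq> 0" using r s by simp
  show "loc0 (r + s)" unfolding e by (rule loc0_Fract[OF bd])
  show "at_t0 (r + s) = at_t0 r + at_t0 s"
    unfolding e at_t0_Fract[OF bd] unfolding r(1) s(1) at_t0_Fract[OF r(2)] at_t0_Fract[OF s(2)]
    using r s by (simp add: field_simps)
qed

lemma loc0_mult:
  assumes "loc0 r" "loc0 s"
  shows "loc0 (r * s)" "at_t0 (r * s) = at_t0 r * at_t0 s"
proof -
  obtain a b c d where r: "r = Fract a b" "poly b 0 \<noteq> 0" and s: "s = Fract c d" "poly d 0 \<noteq> 0"
    using assms unfolding loc0_def by blast
  have e: "r * s = Fract (a * c) (b * d)" using r s by simp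
  have bd: "poly (b * d) 0 \<noteq> 0" using r s by simp
  show "loc0 (r * s)" unfolding e by (rule loc0_Fract[OF bd])
  show "at_t0 (r * s) = at_t0 r * at_t0 s"
    unfolding e at_t0_Fract[OF bd] unfolding r(1) s(1) at_t0_Fract[OF r(2)] at_t0_Fract[OF s(2)] by simp
qed

lemma loc0_const: "loc0 (cst z)" "at_t0 (cst z) = z"
  unfolding cst_def using loc0_Fract[of 1] at_t0_Fract[of 1] by auto

lemma cst_0_1: "cst 0 = 0" "cst 1 = 1" "cst (-1) = -1"
proof -
  show "cst 1 = 1" by (rule cst_hom(2))
  show "cst 0 = 0" by (simp add: cst_def Zero_fract_def)
  have "cst (-1) + cst 1 = cst 0" by (simp add: cst_def)
  then show "cst (-1) = -1" by (simp add: \<open>cst 1 = 1\<close> \<open>cst 0 = 0\<close> eq_neg_iff_add_eq_0)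
qed

lemma loc0_0: "loc0 0" "at_t0 0 = 0"
  using loc0_const[of 0] by (simp_all add: cst_0_1)

lemma loc0_1: "loc0 1" "at_t0 1 = 1"
  using loc0_const[of 1] by (simp_all add: cst_0_1)

lemma loc0_diff:
  assumes "loc0 r" "loc0 s"
  shows "loc0 (r - s)" "at_t0 (r - s) = at_t0 r - at_t0 s"
proof -
  have m: "loc0 (-1)" "at_t0 (-1) = -1" using loc0_const[of "-1"] by (simp_all add: cst_0_1)
  have e: "r - s = r + (-1) * s" by simp
  show "loc0 (r - s)" unfolding e by (intro loc0_add loc0_mult m assms)
  show "at_t0 (r - s) = at_t0 r - at_t0 s"
    unfolding e by (simp only: loc0_add(2)[OF assms(1) loc0_mult(1)[OF m(1) assms(2)]] loc0_mult(2)[OF m(1) assms(2)] m) simp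
qed

lemma loc0_tvar: "loc0 tvar" "at_t0 tvar = 0"
  unfolding tvar_def using loc0_Fract[of 1] at_t0_Fract[of 1] by auto

lemma loc0_sum:
  assumes "\<And>x. x \<in> A \<Longrightarrow> loc0 (f x)"
  shows "loc0 (sum f A) \<and> at_t0 (sum f A) = (\<Sum>x\<in>A. at_t0 (f x))"
  using assms by (induction A rule: infinite_finite_induct) (auto simp: loc0_0 loc0_add)

lemma heckeT_loc0:
  assumes c: "\<And>a. loc0 (c a)"
  shows "loc0 (heckeT i j tvar c a)" "at_t0 (heckeT i j tvar c a) = heckeT i j 0 (\<lambda>a. at_t0 (c a)) a"
proof -
  have L: "loc0 (demL i j c a)" and R: "loc0 (demR i j c a)" "at_t0 (demR i j c a) = demR i j (\<lambda>a. at_t0 (c a)) a"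
    unfolding demL_def demR_def using loc0_sum loc0_diff c by (simp_all add: loc0_sum loc0_diff)
  show "loc0 (heckeT i j tvar c a)" unfolding heckeT_def
    by (intro loc0_add loc0_diff loc0_mult loc0_tvar c L R)
  have 1: "loc0 (tvar * c a)" "loc0 (tvar * demL i j c a)" by (intro loc0_mult loc0_tvar c L)+
  show "at_t0 (heckeT i j tvar c a) = heckeT i j 0 (\<lambda>a. at_t0 (c a)) a"
    unfolding heckeT_at_0 heckeT_def loc0_add(2)[OF loc0_diff(1)[OF 1] R(1)] loc0_diff(2)[OF 1]
      loc0_mult(2)[OF loc0_tvar(1) c] loc0_mult(2)[OF loc0_tvar(1) L] R(2)
    by (simp add: loc0_tvar)
qed

text \<open>After clearing denominators one divides by the largest common power of \<open>t\<close>.\<close>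

lemma scale_loc0:
  assumes "finite S" "r0 \<in> S" "r0 \<noteq> (0 :: ratt)"
  shows "\<exists>s. (\<forall>r\<in>S. loc0 (s * r)) \<and> (\<exists>r\<in>S. at_t0 (s * r) \<noteq> 0)"
proof -
  have "\<forall>r::ratt. \<exists>a b. r = Fract a b \<and> b \<noteq> 0" by (metis Fract_cases)
  then obtain nu de where nd: "\<And>r::ratt. r = Fract (nu r) (de r)" "\<And>r. de r \<noteq> 0" by metis
  define D where "D = (\<Prod>r\<in>S. de r)"
  define q where "q r = nu r * (\<Prod>r'\<in>S - {r}. de r')" for r
  have D0: "D \<noteq> 0" using assms(1) nd(2) by (simp add: D_def)
  have Dr: "Fract D 1 * r = Fract (q r) 1" if "r \<in> S" for r
  proof -
    have e: "D = de r * (\<Prod>r'\<in>S - {r}. de r')" unfolding D_def using assms(1) that by (simp add: prod.remove)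
    have "Fract D 1 * r = Fract D 1 * Fract (nu r) (de r)" using nd(1)[of r] by simp
    also have "\<dots> = Fract (D * nu r) (de r)" by simp
    also have "\<dots> = Fract (q r) 1" using nd(2)[of r] by (simp add: eq_fract e q_def)
    finally show ?thesis .
  qed
  have q0: "q r \<noteq> 0 \<longleftrightarrow> r \<noteq> 0" if "r \<in> S" for r
  proof -
    have "Fract D 1 \<noteq> 0" using D0 by (simp add: Zero_fract_def eq_fract)
    then have "r \<noteq> 0 \<longleftrightarrow> Fract (q r) 1 \<noteq> 0" using Dr[OF that] by (metis mult_eq_0_iff)
    then show ?thesis by (simp add: Zero_fract_def eq_fract)
  qed
  define m where "m = Min (order 0 ` q ` {r \<in> S. r \<noteq> 0})"
  have fin: "finite (order 0 ` q ` {r \<in> S. r \<noteq> 0})" using assms(1) by simp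
  have ne: "order 0 ` q ` {r \<in> S. r \<noteq> 0} \<noteq> {}" using assms by auto
  obtain r1 where r1: "r1 \<in> S" "r1 \<noteq> 0" "m = order 0 (q r1)" using Min_in[OF fin ne] unfolding m_def by auto
  have dv: "[:0, 1:] ^ m dvd q r" if "r \<in> S" for r
  proof (cases "r = 0")
    case False
    then have "m \<le> order 0 (q r)" unfolding m_def using that fin by (intro Min_le) auto
    moreover have "[:0, 1:] ^ order 0 (q r) dvd q r" using order_1[of 0 "q r"] by simp
    ultimately show ?thesis using le_imp_power_dvd dvd_trans by blast
  qed (use q0[OF that] in simp)
  define h where "h r = q r div [:0, 1:] ^ m" for r
  have qh: "q r = [:0, 1:] ^ m * h r" if "r \<in> S" for r using dv[OF that] by (simp add: h_def)
  define s where "s = Fract D ([:0, 1:] ^ m)"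
  have sr: "s * r = Fract (h r) 1" if "r \<in> S" for r
  proof -
    have t: "[:0, 1:] ^ m \<noteq> (0 :: complex poly)" by simp
    have "s = Fract 1 ([:0, 1:] ^ m) * Fract D 1" by (simp add: s_def)
    then have "s * r = Fract 1 ([:0, 1:] ^ m) * Fract (q r) 1" using Dr[OF that] by (simp only: mult.assoc)
    also have "\<dots> = Fract (h r) 1" using t by (simp add: eq_fract qh[OF that] mult.commute)
    finally show ?thesis .
  qed
  have "poly (h r1) 0 \<noteq> 0"
  proof
    assume "poly (h r1) 0 = 0"
    then have "[:0, 1:] dvd h r1" using poly_eq_0_iff_dvd[of "h r1" 0] by simp
    then have "[:0, 1:] ^ m * [:0, 1:] dvd [:0, 1:] ^ m * h r1" by (intro mult_dvd_mono dvd_refl)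
    then have "[:0, 1:] ^ Suc m dvd q r1" unfolding qh[OF r1(1)] by (simp only: power_Suc2)
    moreover have "\<not> [:0, 1:] ^ Suc m dvd q r1"
      using order_2[of "q r1" 0] q0[OF r1(1)] r1(2,3) by simp
    ultimately show False by simp
  qed
  then have "at_t0 (s * r1) \<noteq> 0" unfolding sr[OF r1(1)] using at_t0_Fract[of 1] by simp
  moreover have "loc0 (s * r)" if "r \<in> S" for r unfolding sr[OF that] by (rule loc0_Fract) simp
  ultimately show ?thesis using r1(1) by blast
qed

section \<open>Solutions over C(t): reduction, uniqueness, absence of poles\<close>

lemma asep_sol_diff:
  assumes "asep_sol n d t H" "asep_sol n d t G"
  shows "asep_sol n d t (\<lambda>\<mu> a. H \<mu> a - G \<mu> a)"
  using assms unfolding asep_sol_def by (auto simp: hpoly_diff heckeT_diff rotc_def fun_eq_iff)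

lemma asep_sol_scale:
  assumes "asep_sol n d t H"
  shows "asep_sol n d t (\<lambda>\<mu> a. r * H \<mu> a)"
  using assms unfolding asep_sol_def by (auto simp: hpoly_scale heckeT_scale rotc_def fun_eq_iff)

lemma asep_sol_reduce:
  assumes sol: "asep_sol n d tvar H" and loc: "\<And>\<mu> a. \<mu> permutes {1..n} \<Longrightarrow> loc0 (H \<mu> a)"
    and n2: "2 \<le> n"
  shows "asep_sol n d 0 (\<lambda>\<mu> a. at_t0 (H \<mu> a))"
  unfolding asep_sol_def
proof (intro conjI allI impI ballI)
  fix \<mu> assume \<mu>: "\<mu> permutes {1..n}"
  show "(\<lambda>a. at_t0 (H \<mu> a)) \<in> hpoly n d"
    using sol \<mu> unfolding asep_sol_def hpoly_def by (auto simp: loc0_0)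
  show "rotc n (\<lambda>a. at_t0 (H (\<mu> \<circ> inv (cyc n)) a)) = (\<lambda>a. at_t0 (H \<mu> a))"
  proof
    fix a
    have "rotc n (H (\<mu> \<circ> inv (cyc n))) = H \<mu>" using sol \<mu> unfolding asep_sol_def by blast
    from fun_cong[OF this, of a] show "rotc n (\<lambda>a. at_t0 (H (\<mu> \<circ> inv (cyc n)) a)) a = at_t0 (H \<mu> a)"
      by (simp add: rotc_def)
  qed
  fix i assume i: "i \<in> {1..n}" "\<mu> i < \<mu> (nxt n i)"
  have "H (\<mu> \<circ> swp i (nxt n i)) = heckeT i (nxt n i) tvar (H \<mu>)" using sol \<mu> i unfolding asep_sol_def by blast
  then show "(\<lambda>a. at_t0 (H (\<mu> \<circ> swp i (nxt n i)) a)) = heckeT i (nxt n i) 0 (\<lambda>a. at_t0 (H \<mu> a))"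
    using heckeT_loc0(2)[of "H \<mu>", OF loc[OF \<mu>]] by (simp add: fun_eq_iff)
qed

text \<open>By \<open>scale_loc0\<close> the scaled solution has a nonzero reduction at t = 0, and
  \<open>sol_zero\<close> then forces a nonzero staircase coefficient in the reduction. So no
  coefficient has a larger pole than this one.\<close>

lemma asep_sol_scaled:
  assumes n2: "2 \<le> n" and sol: "asep_sol n (asep_deg n) tvar H"
    and nz: "\<nu> permutes {1..n}" "H \<nu> \<noteq> (\<lambda>_. 0)"
  shows "\<exists>s. (\<forall>\<mu> a. \<mu> permutes {1..n} \<longrightarrow> loc0 (s * H \<mu> a)) \<and> at_t0 (s * H id (expo n id)) \<noteq> 0"
proof -
  let ?P = "{\<mu>. \<mu> permutes {1..n}}"
  define S where "S = (\<lambda>(\<mu>, a). H \<mu> a) ` (?P \<times> expset n (asep_deg n))"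
  have fin: "finite S" unfolding S_def by (intro finite_imageI finite_cartesian_product finite_permutations) auto
  have h: "H \<mu> \<in> hpoly n (asep_deg n)" if "\<mu> permutes {1..n}" for \<mu> using sol that unfolding asep_sol_def by blast
  have inS: "H \<mu> a \<in> S" if "\<mu> permutes {1..n}" "a \<in> expset n (asep_deg n)" for \<mu> a
    unfolding S_def using that by force
  obtain a0 where "H \<nu> a0 \<noteq> 0" using nz(2) by auto
  moreover then have "a0 \<in> expset n (asep_deg n)" using hpolyD[OF h[OF nz(1)]] by blast
  ultimately obtain s where s: "\<forall>r\<in>S. loc0 (s * r)" "\<exists>r\<in>S. at_t0 (s * r) \<noteq> 0"
    using scale_loc0[OF fin inS[OF nz(1)]] by blast
  have loc: "loc0 (s * H \<mu> a)" if "\<mu> permutes {1..n}" for \<mu> a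
    using s(1) inS[OF that] hpolyD[OF h[OF that], of a] by (cases "a \<in> expset n (asep_deg n)") (auto simp: loc0_0)
  have red: "asep_sol n (asep_deg n) 0 (\<lambda>\<mu> a. at_t0 (s * H \<mu> a))"
    by (rule asep_sol_reduce[OF asep_sol_scale[OF sol] loc n2])
  obtain \<mu> a where \<mu>: "\<mu> permutes {1..n}" "at_t0 (s * H \<mu> a) \<noteq> 0" using s(2) unfolding S_def by auto
  have "at_t0 (s * H id (expo n id)) \<noteq> 0"
    using fun_cong[OF sol_zero[OF n2 red _ \<mu>(1)], of a] \<mu>(2) by auto
  with loc show ?thesis by blast
qed

text \<open>Used for uniqueness, on the difference of two normalised solutions, and to normalise the
  solution that Cherednik's elements provide.\<close>

lemma asep_sol_nonzero:
  assumes "2 \<le> n" "asep_sol n (asep_deg n) tvar H" "\<mu> permutes {1..n}" "H \<mu> \<noteq> (\<lambda>_. 0)"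
  shows "H id (expo n id) \<noteq> 0"
proof
  assume z: "H id (expo n id) = 0"
  from asep_sol_scaled[where H = H and \<nu> = \<mu>, OF assms] obtain s where "at_t0 (s * H id (expo n id)) \<noteq> 0" by (elim exE conjE)
  then show False using z by (simp add: loc0_0)
qed

lemma asep_sol_normalised:
  assumes n2: "2 \<le> n" and sol: "asep_sol n (asep_deg n) tvar H" and one: "H id (expo n id) = 1"
  shows "asep_sol n (asep_deg n) 0 (\<lambda>\<mu> a. at_t0 (H \<mu> a))" "at_t0 (H id (expo n id)) = 1"
proof -
  have "H id \<noteq> (\<lambda>_. 0)" using one by auto
  from asep_sol_scaled[where H = H and \<nu> = id, OF n2 sol permutes_id this]
  obtain s where s: "\<forall>\<mu> a. \<mu> permutes {1..n} \<longrightarrow> loc0 (s * H \<mu> a)" "at_t0 (s * H id (expo n id)) \<noteq> 0"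
    by (elim exE conjE)
  \<comment> \<open>The normalised coefficient is 1, so the scale s itself is a unit at t = 0 and
    can be divided out.\<close>
  have "loc0 s" "at_t0 s \<noteq> 0"
    using s(1)[rule_format, OF permutes_id, of "expo n id"] s(2) one by auto
  then obtain a b where ab: "s = Fract a b" "poly b 0 \<noteq> 0" "poly a 0 \<noteq> 0"
    unfolding loc0_def using at_t0_Fract by fastforce
  then have a0: "a \<noteq> 0" "b \<noteq> 0" by auto
  then have inv: "Fract b a * s = 1" unfolding ab by (simp add: One_fract_def eq_fract)
  have "loc0 (H \<mu> c)" if "\<mu> permutes {1..n}" for \<mu> c
  proof -
    have "loc0 (Fract b a * (s * H \<mu> c))" by (rule loc0_mult(1)[OF loc0_Fract[OF ab(3)] s(1)[rule_format, OF that]])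
    then show ?thesis using inv by (simp add: mult.assoc[symmetric])
  qed
  then show "asep_sol n (asep_deg n) 0 (\<lambda>\<mu> a. at_t0 (H \<mu> a))" by (rule asep_sol_reduce[OF sol _ n2])
  show "at_t0 (H id (expo n id)) = 1" using one by (simp add: loc0_1)
qed

lemma rearr_stair: "rearr n stair = {\<sigma>. \<sigma> permutes {1..n}}"
  by (auto simp: rearr_def stair_def comp_def)

lemma pact_sbar: "pact (sbar n i) x = x \<circ> swp i (nxt n i)"
proof -
  have "sbar n i = swp i (nxt n i)" by (auto simp: sbar_def fun_eq_iff Transposition.transpose_def)
  then show ?thesis by (simp add: pact_def)
qed

lemma is_hpoly_hpoly:
  assumes "is_hpoly n c" "c a \<noteq> 0" "a \<in> expset n d"
  shows "c \<in> hpoly n d"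
proof -
  from assms(1) obtain e where o: "\<forall>b. c b \<noteq> 0 \<longrightarrow> (\<forall>i. i \<notin> {1..n} \<longrightarrow> b i = 0)"
    and e: "\<forall>b. c b \<noteq> 0 \<longrightarrow> (\<Sum>i\<in>{1..n}. b i) = e"
    unfolding is_hpoly_def by (elim conjE exE)
  have "e = d" using e assms(2,3) by (simp add: expset_def)
  show ?thesis unfolding hpoly_def
  proof (intro CollectI allI impI, rule ccontr)
    fix b assume b: "b \<notin> expset n d" "c b \<noteq> 0"
    have "b \<in> expset n d" unfolding expset_def
      using o[rule_format, OF b(2)] e[rule_format, OF b(2)] \<open>e = d\<close> by simp
    then show False using b(1) by simp
  qed
qed

lemma stair_exponent: "(\<lambda>i. if i \<in> {1..n} then stair n - stair i else 0) = expo n id"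
  by (auto simp: expo_def stair_def fun_eq_iff)

text \<open>The definition does not fix the degree. For the identity tuple the normalised
  coefficient shows it to be \<open>asep_deg n\<close>, and the exchange relations carry it to the
  other tuples, by induction over descents.\<close>

lemma asep_family_sol:
  assumes n2: "2 \<le> n" and F: "asep_family n stair F"
  shows "asep_sol n (asep_deg n) tvar F" "F id (expo n id) = 1"
    "\<not> \<mu> permutes {1..n} \<Longrightarrow> F \<mu> = (\<lambda>_. 0)"
proof -
  note F' = F[unfolded asep_family_def rearr_stair stair_exponent mem_Collect_eq]
  note F1 = F'[THEN conjunct1] and F2 = F'[THEN conjunct2, THEN conjunct1]
    and F3 = F'[THEN conjunct2, THEN conjunct2, THEN conjunct1]
    and F4 = F'[THEN conjunct2, THEN conjunct2, THEN conjunct2, THEN conjunct1]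
    and F6 = F'[THEN conjunct2, THEN conjunct2, THEN conjunct2, THEN conjunct2, THEN conjunct2]
  show "\<not> \<mu> permutes {1..n} \<Longrightarrow> F \<mu> = (\<lambda>_. 0)" by (rule F1[rule_format])
  have "stair = id" by (simp add: stair_def id_def)
  then show one: "F id (expo n id) = 1" using F3 by (simp only:)
  have mm: "\<mu> \<in> {\<sigma>. \<sigma> permutes {1..n}}" if "\<mu> permutes {1..n}" for \<mu> using that by simp
  have hp: "is_hpoly n (F \<mu>)" if "\<mu> permutes {1..n}" for \<mu> by (rule F2[rule_format, OF mm[OF that]])
  have ex: "peval n (F (\<mu> \<circ> swp i (nxt n i))) x = tvar * peval n (F \<mu>) x
             - (tvar * x i - x (nxt n i)) / (x i - x (nxt n i))
               * (peval n (F \<mu>) x - peval n (F \<mu>) (x \<circ> swp i (nxt n i)))"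
    if "\<mu> permutes {1..n}" "i \<in> {1..n}" "\<mu> i < \<mu> (nxt n i)" "x i \<noteq> x (nxt n i)" for \<mu> i x
    by (rule F4[unfolded pact_sbar, rule_format, OF mm[OF that(1)] that(2-4)])
  have cy: "peval n (F (\<mu> \<circ> inv (cyc n))) (x \<circ> inv (cyc n)) = peval n (F \<mu>) x"
    if "\<mu> permutes {1..n}" for \<mu> x
    by (rule F6[unfolded pact_def, rule_format, OF mm[OF that]])
  have step: "F (\<mu> \<circ> swp i (nxt n i)) = heckeT i (nxt n i) tvar (F \<mu>)"
    if \<mu>: "\<mu> permutes {1..n}" and i: "i \<in> {1..n}" "\<mu> i < \<mu> (nxt n i)" and h: "F \<mu> \<in> hpoly n (asep_deg n)" for \<mu> i
  proof (rule is_hpoly_eqI)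
    have ij: "i \<in> {1..n}" "nxt n i \<in> {1..n}" "i \<noteq> nxt n i" using i nxt_in nxt_neq[OF n2] by auto
    have hT: "heckeT i (nxt n i) tvar (F \<mu>) \<in> hpoly n (asep_deg n)" by (rule heckeT_hpoly[OF h ij])
    then show "is_hpoly n (heckeT i (nxt n i) tvar (F \<mu>))" by (rule hpoly_is_hpoly)
    show "is_hpoly n (F (\<mu> \<circ> swp i (nxt n i)))" by (rule hp[OF permutes_comp_swp[OF \<mu> ij(1,2)]])
    fix x :: "nat \<Rightarrow> ratt" assume "inj x"
    then have "x i \<noteq> x (nxt n i)" using ij by (auto dest: injD)
    from ex[OF \<mu> i this] show "peval n (F (\<mu> \<circ> swp i (nxt n i))) x = peval n (heckeT i (nxt n i) tvar (F \<mu>)) x"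
      unfolding peval_eq_hev[OF hT] hev_heckeT[of i n "nxt n i" x, OF ij \<open>x i \<noteq> x (nxt n i)\<close>] peval_eq_hev[OF h] .
  qed
  have h: "F \<mu> \<in> hpoly n (asep_deg n)" if "\<mu> permutes {1..n}" for \<mu>
    using that
  proof (induction "desc_wt n \<mu>" arbitrary: \<mu> rule: less_induct)
    case less
    show ?case
    proof (cases "\<exists>i\<in>{1..<n}. \<mu> (Suc i) < \<mu> i")
      case True
      then obtain i where i: "i \<in> {1..<n}" "\<mu> (Suc i) < \<mu> i" by auto
      let ?m = "\<mu> \<circ> swp i (Suc i)"
      have nx: "nxt n i = Suc i" using i by (simp add: nxt_def)
      have ij: "i \<in> {1..n}" "Suc i \<in> {1..n}" "i \<noteq> Suc i" using i by auto
      have m: "?m permutes {1..n}" by (rule permutes_comp_swp[OF less.prems ij(1,2)])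
      have hm: "F ?m \<in> hpoly n (asep_deg n)" by (rule less.hyps[OF desc_wt_less[OF i] m])
      have "F (?m \<circ> swp i (nxt n i)) = heckeT i (nxt n i) tvar (F ?m)"
        by (rule step[OF m ij(1) _ hm]) (use i nx in simp)
      then have "F \<mu> = heckeT i (Suc i) tvar (F ?m)" unfolding nx by (simp add: o_assoc[symmetric])
      then show ?thesis using heckeT_hpoly[OF hm ij] by simp
    next
      case False
      have "\<mu> i < \<mu> (Suc i)" if "i \<in> {1..<n}" for i
      proof -
        have "\<mu> i \<noteq> \<mu> (Suc i)" using permutes_inj[OF less.prems] by (metis injD n_not_Suc_n)
        then show ?thesis using False that by (meson linorder_neqE_nat)
      qed
      from permutes_ascending[OF less.prems this] have "\<mu> = id" by simp
      then show ?thesis using is_hpoly_hpoly[OF hp[OF permutes_id], of "expo n id"] one expo_id_expset by simp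
    qed
  qed
  have "rotc n (F (\<mu> \<circ> inv (cyc n))) = F \<mu>" if \<mu>: "\<mu> permutes {1..n}" for \<mu>
  proof (rule hpoly_eqI)
    note h' = h[OF permutes_comp_inv_cyc[OF n2 \<mu>]]
    show "F \<mu> \<in> hpoly n (asep_deg n)" by (rule h[OF \<mu>])
    show "rotc n (F (\<mu> \<circ> inv (cyc n))) \<in> hpoly n (asep_deg n)" by (rule rotc_hpoly[OF n2 h'])
    show "hev n (asep_deg n) (rotc n (F (\<mu> \<circ> inv (cyc n)))) x = hev n (asep_deg n) (F \<mu>) x" for x
      unfolding hev_rotc[OF n2] using cy[OF \<mu>, of x] unfolding peval_eq_hev[OF h'] peval_eq_hev[OF h[OF \<mu>]] .
  qed
  then show "asep_sol n (asep_deg n) tvar F" unfolding asep_sol_def using h step by blast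
qed

lemma asep_family_exists:
  assumes n2: "2 \<le> n"
  shows "\<exists>F. asep_family n stair F"
proof -
  have "tvar \<noteq> 0" by (simp add: tvar_def Zero_fract_def eq_fract)
  then interpret cherednik n tvar using n2 by unfold_locales
  obtain H0 where H0: "asep_sol n (asep_deg n) tvar H0" "H0 id \<noteq> (\<lambda>_. 0)" using asep_sol_exists by blast
  have c: "H0 id (expo n id) \<noteq> 0" by (rule asep_sol_nonzero[where H = H0 and \<mu> = id, OF n2 H0(1) permutes_id H0(2)])
  define H where "H = (\<lambda>\<mu> a. inverse (H0 id (expo n id)) * H0 \<mu> a)"
  have H: "asep_sol n (asep_deg n) tvar H" unfolding H_def by (rule asep_sol_scale[OF H0(1)])
  have one: "H id (expo n id) = 1" using c by (simp add: H_def)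
  define F where "F \<mu> = (if \<mu> permutes {1..n} then H \<mu> else (\<lambda>_. 0))" for \<mu>
  have FH: "F \<mu> = H \<mu>" if "\<mu> permutes {1..n}" for \<mu> using that by (simp add: F_def)
  have h: "H \<mu> \<in> hpoly n (asep_deg n)" if "\<mu> permutes {1..n}" for \<mu> using H that unfolding asep_sol_def by blast
  have "stair = id" by (simp add: stair_def id_def)
  have "asep_family n stair F"
    unfolding asep_family_def rearr_stair stair_exponent mem_Collect_eq
  proof (intro conjI allI impI ballI)
    fix \<mu> assume "\<not> \<mu> permutes {1..n}"
    then show "F \<mu> = (\<lambda>_. 0)" by (simp add: F_def)
  next
    show "F stair (expo n id) = 1" using one FH[OF permutes_id] by (simp add: \<open>stair = id\<close>)
  next
    fix \<mu> assume "\<mu> \<in> {\<sigma>. \<sigma> permutes {1..n}}"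
    then have \<mu>: "\<mu> permutes {1..n}" by simp
    show "is_hpoly n (F \<mu>)" unfolding FH[OF \<mu>] by (rule hpoly_is_hpoly[OF h[OF \<mu>]])
    {
      fix i and x :: "nat \<Rightarrow> ratt"
      assume i: "i \<in> {1..n}" "\<mu> i < \<mu> (nxt n i)" and x: "x i \<noteq> x (nxt n i)"
      have ij: "i \<in> {1..n}" "nxt n i \<in> {1..n}" "i \<noteq> nxt n i" using i nxt_in nxt_neq[OF n2] by auto
      note s = permutes_comp_swp[OF \<mu> ij(1,2)]
      have E: "H (\<mu> \<circ> swp i (nxt n i)) = heckeT i (nxt n i) tvar (H \<mu>)" using H \<mu> i unfolding asep_sol_def by blast
      show "peval n (F (pact (sbar n i) \<mu>)) x = tvar * peval n (F \<mu>) x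
          - (tvar * x i - x (nxt n i)) / (x i - x (nxt n i)) * (peval n (F \<mu>) x - peval n (F \<mu>) (pact (sbar n i) x))"
        unfolding pact_sbar FH[OF \<mu>] FH[OF s] peval_eq_hev[OF h[OF \<mu>]] peval_eq_hev[OF h[OF s]] unfolding E
        by (rule hev_heckeT[OF ij x])
    next
      fix i and x :: "nat \<Rightarrow> ratt" assume i: "i \<in> {1..n}" "\<mu> i = \<mu> (nxt n i)"
      then have "i = nxt n i" using permutes_inj[OF \<mu>] by (auto dest: injD)
      then show "peval n (F \<mu>) (pact (sbar n i) x) = peval n (F \<mu>) x" using nxt_neq[OF n2 i(1)] by simp
    next
      fix x :: "nat \<Rightarrow> ratt"
      note s = permutes_comp_inv_cyc[OF n2 \<mu>]
      have E: "rotc n (H (\<mu> \<circ> inv (cyc n))) = H \<mu>" using H \<mu> unfolding asep_sol_def by blast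
      show "peval n (F (pact (cyc n) \<mu>)) (pact (cyc n) x) = peval n (F \<mu>) x"
        unfolding pact_def FH[OF \<mu>] FH[OF s] peval_eq_hev[OF h[OF \<mu>]] peval_eq_hev[OF h[OF s]]
          hev_rotc[OF n2, symmetric] unfolding E ..
    }
  qed
  then show ?thesis by blast
qed

lemma asep_family_unique:
  assumes n2: "2 \<le> n" and F: "asep_family n stair F" and G: "asep_family n stair G"
  shows "F = G"
proof
  fix \<mu>
  note f = asep_family_sol[OF n2 F] and g = asep_family_sol[OF n2 G]
  show "F \<mu> = G \<mu>"
  proof (cases "\<mu> permutes {1..n}")
    case True
    have "(\<lambda>a. F \<mu> a - G \<mu> a) = (\<lambda>_. 0)"
    proof (rule ccontr)
      assume "(\<lambda>a. F \<mu> a - G \<mu> a) \<noteq> (\<lambda>_. 0)"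
      from asep_sol_nonzero[where H = "\<lambda>\<mu> a. F \<mu> a - G \<mu> a" and \<mu> = \<mu>, OF n2 asep_sol_diff[OF f(1) g(1)] True this]
      show False using f(2) g(2) by simp
    qed
    then show ?thesis by (simp add: fun_eq_iff)
  qed (use f(3) g(3) in simp)
qed

lemma asep_F_family: "2 \<le> n \<Longrightarrow> asep_family n stair (asep_F n stair)"
  unfolding asep_F_def using asep_family_exists asep_family_unique by (metis theI)

definition asepG :: "nat \<Rightarrow> (nat \<Rightarrow> nat) \<Rightarrow> (nat \<Rightarrow> nat) \<Rightarrow> complex" where
  "asepG n \<mu> a = at_t0 (asep_F n stair \<mu> a)"

lemma asepG_sol:
  assumes n2: "2 \<le> n"
  shows "asep_sol n (asep_deg n) 0 (asepG n)" "asepG n id (expo n id) = 1"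
  unfolding asepG_def[abs_def]
  by (rule asep_sol_normalised[OF n2 asep_family_sol(1,2)[OF n2 asep_F_family[OF n2]]])+

lemma asep_F0_hev:
  assumes n2: "2 \<le> n" and \<mu>: "\<mu> permutes {1..n}"
  shows "asep_F0 n stair \<mu> y = hev n (asep_deg n) (asepG n \<mu>) y"
proof -
  have h: "asep_F n stair \<mu> \<in> hpoly n (asep_deg n)"
    using asep_family_sol(1)[OF n2 asep_F_family[OF n2]] \<mu> unfolding asep_sol_def by blast
  show ?thesis unfolding asep_F0_def hev_def monval_def asepG_def
    by (rule sum.mono_neutral_left) (use hpolyD[OF h] in \<open>auto simp: loc0_0\<close>)
qed

lemma asep_P0_hev:
  "2 \<le> n \<Longrightarrow> asep_P0 n stair y = (\<Sum>\<mu> | \<mu> permutes {1..n}. hev n (asep_deg n) (asepG n \<mu>) y)"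
  unfolding asep_P0_def rearr_stair by (intro sum.cong) (auto simp: asep_F0_hev)

lemma asepG_wlong:
  assumes n2: "2 \<le> n"
  shows "hev n (asep_deg n) (asepG n (wlong n)) y = (\<Prod>i\<in>{1..n}. y i ^ (i - 1))"
proof -
  have "hev n (asep_deg n) (asepG n (wlong n)) y = (\<Sum>a\<in>{expo n (wlong n)}. asepG n (wlong n) a * monval n y a)"
    unfolding hev_def sol_wlong[OF n2 asepG_sol(1)[OF n2]]
    by (rule sum.mono_neutral_right) (use expo_expset[OF wlong_permutes] in auto)
  also have "\<dots> = monval n y (expo n (wlong n))"
    unfolding sol_wlong[OF n2 asepG_sol(1)[OF n2]] by (simp add: asepG_sol(2)[OF n2])
  also have "\<dots> = (\<Prod>i\<in>{1..n}. y i ^ (i - 1))"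
    unfolding monval_def by (rule prod.cong) (auto simp: expo_def wlong_def)
  finally show ?thesis .
qed

section \<open>Chains driven by coins\<close>

text \<open>The expectation of g after the steps \<open>is\<close>, conditioned on one coin after
  another. It keeps measure theory out of the analysis; \<open>coins_nn_integral\<close> connects it
  with the product measure.\<close>

primrec evl :: "real \<Rightarrow> ('i \<Rightarrow> bool \<Rightarrow> 's \<Rightarrow> 's) \<Rightarrow> ('s \<Rightarrow> real) \<Rightarrow> 'i list \<Rightarrow> 's \<Rightarrow> real" where
  "evl p st g [] x = g x"
| "evl p st g (i # is) x = p * evl p st g is (st i True x) + (1 - p) * evl p st g is (st i False x)"

lemma evl_append: "evl p st g (xs @ ys) x = evl p st (evl p st g ys) xs x"
  by (induction xs arbitrary: x) auto

lemma evl_add: "evl p st (\<lambda>x. g x + h x) xs x = evl p st g xs x + evl p st h xs x"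
  by (induction xs arbitrary: x) (auto simp: algebra_simps)

lemma evl_cmult: "evl p st (\<lambda>x. c * g x) xs x = c * evl p st g xs x"
  by (induction xs arbitrary: x) (auto simp: algebra_simps)

lemma evl_const: "evl p st (\<lambda>x. c) xs x = c"
  by (induction xs arbitrary: x) (auto simp: algebra_simps)

lemma evl_sum: "evl p st (\<lambda>x. \<Sum>a\<in>A. g a x) xs x = (\<Sum>a\<in>A. evl p st (g a) xs x)"
  by (induction A rule: infinite_finite_induct) (auto simp: evl_const evl_add)

lemma evl_minus: "evl p st (\<lambda>x. - g x) xs x = - evl p st g xs x"
  using evl_cmult[of p st "-1" g xs x] by simp

lemma evl_diff: "evl p st (\<lambda>x. g x - h x) xs x = evl p st g xs x - evl p st h xs x"
  using evl_add[of p st g "\<lambda>x. - h x" xs x] by (simp add: evl_minus)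

locale coin_chain =
  fixes p :: real and st :: "'i \<Rightarrow> bool \<Rightarrow> 's \<Rightarrow> 's" and I :: "'i set" and Inv :: "'s set"
  assumes p01: "0 < p" "p < 1"
    and Inv: "\<And>i b x. i \<in> I \<Longrightarrow> x \<in> Inv \<Longrightarrow> st i b x \<in> Inv"
begin

lemma evl_mono:
  assumes "\<And>y. y \<in> Inv \<Longrightarrow> g y \<le> h y" "set xs \<subseteq> I" "x \<in> Inv"
  shows "evl p st g xs x \<le> evl p st h xs x"
  using assms(2,3)
proof (induction xs arbitrary: x)
  case (Cons i xs)
  then show ?case using Inv p01 by (auto intro!: add_mono mult_left_mono)
qed (use assms(1) in auto)

lemma evl_commute:
  assumes "\<And>i b y. i \<in> I \<Longrightarrow> y \<in> Inv \<Longrightarrow> st i b (F y) = F (st i b y)" "set xs \<subseteq> I" "x \<in> Inv"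
  shows "evl p st g xs (F x) = evl p st (\<lambda>y. g (F y)) xs x"
  using assms(2,3)
proof (induction xs arbitrary: x)
  case (Cons i xs)
  then show ?case using Inv assms(1) by simp
qed simp

text \<open>A prescribed pattern of l coins has probability at least \<open>pm ^ l\<close>.\<close>

definition pm :: real where "pm = min p (1 - p)"

lemma pm: "0 < pm" "pm < 1" "pm \<le> p" "pm \<le> 1 - p"
  using p01 by (auto simp: pm_def)

lemma pm_pow: "0 < pm ^ k" "pm ^ k \<le> 1"
  using pm by (auto intro: power_le_one)

text \<open>The coin pattern prescribed by f has probability at least \<open>pm ^ length xs\<close>,
  and on all other patterns g is bounded by M.\<close>

lemma evl_le_run:
  assumes M: "\<And>y. y \<in> Inv \<Longrightarrow> g y \<le> M" and xs: "set xs \<subseteq> I" and x: "x \<in> Inv"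
  shows "evl p st g xs x \<le> (1 - pm ^ length xs) * M + pm ^ length xs * g (foldl (\<lambda>x i. st i (f i) x) x xs)"
  using xs x
proof (induction xs arbitrary: x)
  case (Cons i xs)
  let ?e = "pm ^ length xs" and ?z = "foldl (\<lambda>x i. st i (f i) x) (st i (f i) x) xs"
  have in1: "st i b x \<in> Inv" for b using Inv Cons.prems by auto
  have zI: "?z \<in> Inv"
  proof -
    have "set ys \<subseteq> I \<Longrightarrow> y \<in> Inv \<Longrightarrow> foldl (\<lambda>x i. st i (f i) x) y ys \<in> Inv" for y ys
      by (induction ys arbitrary: y) (auto intro: Inv)
    then show ?thesis using Cons.prems in1 by auto
  qed
  have le: "evl p st g xs y \<le> M" if "y \<in> Inv" for y
    using evl_mono[of g "\<lambda>_. M" xs y] M Cons.prems(1) that by (simp add: evl_const)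
  define A where "A = evl p st g xs (st i (f i) x)"
  define B where "B = evl p st g xs (st i (\<not> f i) x)"
  define r where "r = (if f i then p else 1 - p)"
  have r: "pm \<le> r" "0 \<le> 1 - r" using pm p01 by (auto simp: r_def)
  have "evl p st g (i # xs) x = r * A + (1 - r) * B"
    by (cases "f i") (auto simp: A_def B_def r_def)
  also have "\<dots> \<le> r * A + (1 - r) * M"
    using le[OF in1, of "\<not> f i"] r by (auto simp: B_def intro: mult_left_mono)
  also have "\<dots> = M - r * (M - A)" by (simp add: algebra_simps)
  also have "\<dots> \<le> M - pm * (M - A)"
    using r le[OF in1, of "f i"] by (auto simp: A_def intro: mult_right_mono)
  also have "\<dots> \<le> M - pm * (M - ((1 - ?e) * M + ?e * g ?z))"
  proof -
    have "A \<le> (1 - ?e) * M + ?e * g ?z" unfolding A_def using Cons in1 by auto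
    then show ?thesis using pm by (intro diff_left_mono mult_left_mono) auto
  qed
  also have "\<dots> = (1 - pm ^ length (i # xs)) * M + pm ^ length (i # xs) * g ?z"
    by (simp add: algebra_simps)
  finally show ?case by simp
qed simp

lemma evl_ge_run:
  assumes M: "\<And>y. y \<in> Inv \<Longrightarrow> M \<le> g y" and xs: "set xs \<subseteq> I" and x: "x \<in> Inv"
  shows "evl p st g xs x \<ge> (1 - pm ^ length xs) * M + pm ^ length xs * g (foldl (\<lambda>x i. st i (f i) x) x xs)"
  using evl_le_run[of "\<lambda>x. - g x" "- M" xs x f] assms by (simp add: evl_minus algebra_simps)

end

section \<open>Bubble sort in a window\<close>

abbreviation iswp :: "int \<Rightarrow> int \<Rightarrow> int \<Rightarrow> int" where "iswp \<equiv> Transposition.transpose"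

text \<open>Each index exchanges one ascent inside the window [x0, x1] or does nothing, and
  \<open>idx e\<close> is the index responsible for the edge e, e + 1. The locale is used for the
  labels of an affine permutation and for the ring process cut open at one edge.\<close>

locale sorting =
  fixes t :: "nat \<Rightarrow> 's \<Rightarrow> 's" and Inv :: "'s set" and val :: "'s \<Rightarrow> int \<Rightarrow> 'v::linorder"
    and x0 x1 :: int and idx :: "int \<Rightarrow> nat" and sw :: "nat list"
  assumes Inv: "\<And>s i. s \<in> Inv \<Longrightarrow> i \<in> set sw \<Longrightarrow> t i s \<in> Inv"
    and step: "\<And>s i. s \<in> Inv \<Longrightarrow> i \<in> set sw \<Longrightarrow>
      (\<exists>e\<in>{x0..<x1}. val s e < val s (e + 1) \<and> (\<forall>x\<in>{x0..x1}. val (t i s) x = val s (iswp e (e + 1) x))) \<or>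
      (\<forall>x\<in>{x0..x1}. val (t i s) x = val s x) \<and> (\<forall>e\<in>{x0..<x1}. idx e = i \<longrightarrow> \<not> val s e < val s (e + 1))"
    and idx: "\<And>e. e \<in> {x0..<x1} \<Longrightarrow> idx e \<in> set sw"
begin

definition ascs :: "'s \<Rightarrow> (int \<times> int) set" where
  "ascs s = {(x, y). x \<in> {x0..x1} \<and> y \<in> {x0..x1} \<and> x < y \<and> val s x < val s y}"

lemma fin_ascs: "finite (ascs s)" "card (ascs s) \<le> card ({x0..x1} \<times> {x0..x1})"
proof -
  have "ascs s \<subseteq> {x0..x1} \<times> {x0..x1}" by (auto simp: ascs_def)
  moreover have f: "finite ({x0..x1} \<times> {x0..x1})" by simp
  ultimately show "finite (ascs s)" "card (ascs s) \<le> card ({x0..x1} \<times> {x0..x1})"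
    using finite_subset card_mono[OF f] by blast+
qed

lemma ascs_swap:
  assumes e: "e \<in> {x0..<x1}" and lt: "val s e < val s (e + 1)"
    and eq: "\<forall>x\<in>{x0..x1}. val s' x = val s (iswp e (e + 1) x)"
  shows "card (ascs s') < card (ascs s)"
proof -
  let ?\<tau> = "iswp e (e + 1)"
  let ?f = "\<lambda>(x, y). (?\<tau> x, ?\<tau> y)"
  have "?f z \<in> ascs s - {(e, e + 1)}" if z: "z \<in> ascs s'" for z
  proof -
    obtain x y where xy: "z = (x, y)" "x \<in> {x0..x1}" "y \<in> {x0..x1}" "x < y" "val s' x < val s' y"
      using z by (auto simp: ascs_def)
    have v: "val s (?\<tau> x) < val s (?\<tau> y)" using xy eq by auto
    have ne: "\<not> (x = e \<and> y = e + 1)" using v lt by auto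
    then have "?\<tau> x < ?\<tau> y" "?\<tau> x \<in> {x0..x1}" "?\<tau> y \<in> {x0..x1}"
      using xy e by (auto simp: Transposition.transpose_def)
    moreover have "\<not> (?\<tau> x = e \<and> ?\<tau> y = e + 1)"
      using xy(4) by (auto simp: Transposition.transpose_def split: if_splits)
    ultimately show ?thesis using v xy(1) by (auto simp: ascs_def)
  qed
  then have "?f ` ascs s' \<subseteq> ascs s - {(e, e + 1)}" by (rule image_subsetI)
  then have "card (?f ` ascs s') \<le> card (ascs s - {(e, e + 1)})" using fin_ascs by (intro card_mono) auto
  moreover have "inj_on ?f (ascs s')"
  proof -
    have "?\<tau> a = ?\<tau> b \<longleftrightarrow> a = b" for a b
      by (metis transpose_involutory)
    then show ?thesis by (auto simp: inj_on_def)
  qed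
  ultimately have "card (ascs s') \<le> card (ascs s - {(e, e + 1)})" by (simp only: card_image)
  also have "\<dots> < card (ascs s)"
    using e lt fin_ascs by (intro card_Diff1_less) (auto simp: ascs_def)
  finally show ?thesis .
qed

lemma image_swap:
  assumes "e \<in> {x0..<x1}" "\<forall>x\<in>{x0..x1}. val s' x = val s (iswp e (e + 1) x)"
  shows "val s' ` {x0..x1} = val s ` {x0..x1}"
proof -
  have "iswp e (e + 1) ` {x0..x1} = {x0..x1}"
    by (rule permutes_image[OF permutes_swap_id]) (use assms(1) in auto)
  then have "val s ` {x0..x1} = (\<lambda>x. val s (iswp e (e + 1) x)) ` {x0..x1}"
    using image_image[of "val s" "iswp e (e + 1)" "{x0..x1}"] by simp
  also have "\<dots> = val s' ` {x0..x1}" using assms(2) by (intro image_cong) auto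
  finally show ?thesis ..
qed

definition sorted_on :: "'s \<Rightarrow> bool" where
  "sorted_on s \<longleftrightarrow> (\<forall>e\<in>{x0..<x1}. \<not> val s e < val s (e + 1))"

abbreviation run :: "'s \<Rightarrow> nat list \<Rightarrow> 's" where "run \<equiv> foldl (\<lambda>s i. t i s)"

lemma run_Inv: "s \<in> Inv \<Longrightarrow> set is \<subseteq> set sw \<Longrightarrow> run s is \<in> Inv"
  by (induction "is" arbitrary: s) (auto intro: Inv)

lemma run_image: "s \<in> Inv \<Longrightarrow> set is \<subseteq> set sw \<Longrightarrow> val (run s is) ` {x0..x1} = val s ` {x0..x1}"
proof (induction "is" arbitrary: s)
  case (Cons i "is")
  have "val (t i s) ` {x0..x1} = val s ` {x0..x1}"
  proof -
    have i: "i \<in> set sw" using Cons.prems by simp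
    from step[OF Cons.prems(1) i] show ?thesis
    proof
      assume "\<exists>e\<in>{x0..<x1}. val s e < val s (e + 1) \<and> (\<forall>x\<in>{x0..x1}. val (t i s) x = val s (iswp e (e + 1) x))"
      then obtain e where "e \<in> {x0..<x1}" "\<forall>x\<in>{x0..x1}. val (t i s) x = val s (iswp e (e + 1) x)" by blast
      then show ?thesis by (rule image_swap)
    next
      assume "(\<forall>x\<in>{x0..x1}. val (t i s) x = val s x) \<and> (\<forall>e\<in>{x0..<x1}. idx e = i \<longrightarrow> \<not> val s e < val s (e + 1))"
      then show ?thesis by (intro image_cong) auto
    qed
  qed
  then show ?case using Cons Inv by simp
qed simp

lemma ascs_same: "\<forall>x\<in>{x0..x1}. val s' x = val s x \<Longrightarrow> ascs s' = ascs s"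
  by (auto simp: ascs_def)

lemma run_ascs:
  "s \<in> Inv \<Longrightarrow> set is \<subseteq> set sw \<Longrightarrow> card (ascs (run s is)) < card (ascs s) \<or>
    (\<forall>x\<in>{x0..x1}. val (run s is) x = val s x) \<and> (\<forall>e\<in>{x0..<x1}. idx e \<in> set is \<longrightarrow> \<not> val s e < val s (e + 1))"
proof (induction "is" arbitrary: s)
  case (Cons i "is")
  let ?s = "t i s"
  have i: "i \<in> set sw" "?s \<in> Inv" "set is \<subseteq> set sw" using Cons.prems Inv by auto
  note IH = Cons.IH[OF i(2,3)]
  from step[OF Cons.prems(1) i(1)] show ?case
  proof
    assume "\<exists>e\<in>{x0..<x1}. val s e < val s (e + 1) \<and> (\<forall>x\<in>{x0..x1}. val ?s x = val s (iswp e (e + 1) x))"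
    then have "card (ascs ?s) < card (ascs s)" using ascs_swap by blast
    moreover have "card (ascs (run ?s is)) \<le> card (ascs ?s)"
      using IH ascs_same[of "run ?s is" ?s] by auto
    ultimately show ?thesis by simp
  next
    assume same: "(\<forall>x\<in>{x0..x1}. val ?s x = val s x) \<and> (\<forall>e\<in>{x0..<x1}. idx e = i \<longrightarrow> \<not> val s e < val s (e + 1))"
    then have "ascs ?s = ascs s" using ascs_same[of ?s s] by blast
    then show ?thesis using IH same by auto
  qed
qed simp

lemma sorted_on_le:
  assumes "sorted_on s" "x \<in> {x0..x1}" "y \<in> {x0..x1}" "x \<le> y"
  shows "val s y \<le> val s x"
proof -
  have le: "val s (x + int k) \<le> val s x" if "x + int k \<in> {x0..x1}" for k
    using that
  proof (induction k)
    case (Suc k)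
    then have a: "val s (x + int k + 1) \<le> val s (x + int k)"
      using assms(1,2) by (auto simp: sorted_on_def not_less)
    have b: "val s (x + int k) \<le> val s x" using Suc assms(2) by auto
    have e: "x + int (Suc k) = x + int k + 1" by simp
    show ?case unfolding e by (rule order.trans[OF a b])
  qed simp
  show ?thesis using le[of "nat (y - x)"] assms(2-4) by simp
qed

text \<open>A sweep that exchanges nothing has tested every edge, so the window is sorted; every
  other sweep uses up at least one of the finitely many ascending pairs.\<close>

lemma run_replicate:
  assumes "s \<in> Inv"
  shows "card (ascs (run s (concat (replicate T sw)))) + T \<le> card (ascs s) \<or> sorted_on (run s (concat (replicate T sw)))"
proof (induction T)
  case (Suc T)
  have e: "concat (replicate (Suc T) sw) = concat (replicate T sw) @ sw"
    by (induction T) auto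
  let ?s = "run s (concat (replicate T sw))"
  have sI: "?s \<in> Inv" by (rule run_Inv[OF assms]) auto
  have *: "card (ascs (run ?s sw)) < card (ascs ?s) \<or> (\<forall>x\<in>{x0..x1}. val (run ?s sw) x = val ?s x) \<and> sorted_on ?s"
    using run_ascs[OF sI order.refl] idx unfolding sorted_on_def by blast
  have same: "sorted_on (run ?s sw)" if "\<forall>x\<in>{x0..x1}. val (run ?s sw) x = val ?s x" "sorted_on ?s"
    using that by (auto simp: sorted_on_def)
  have "ascs ?s = {}" if "sorted_on ?s"
    using sorted_on_le[OF that] by (fastforce simp: ascs_def not_less[symmetric])
  then have "sorted_on ?s \<Longrightarrow> sorted_on (run ?s sw)" using * same by auto
  moreover have "card (ascs (run ?s sw)) + Suc T \<le> card (ascs s)" if "card (ascs ?s) + T \<le> card (ascs s)" "\<not> sorted_on ?s"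
    using * that by auto
  ultimately show ?case using Suc unfolding e by auto
qed simp

lemma run_sorts:
  assumes "s \<in> Inv" "card ({x0..x1} \<times> {x0..x1}) < T"
  shows "sorted_on (run s (concat (replicate T sw)))"
  using run_replicate[OF assms(1), of T] fin_ascs(2)[of s] assms(2) by linarith

end

section \<open>Affine permutations\<close>

definition aswap :: "nat \<Rightarrow> int \<Rightarrow> int \<Rightarrow> int" where
  "aswap n i x = (if int n dvd x - i then x + 1 else if int n dvd x - i - 1 then x - 1 else x)"

definition aper :: "nat \<Rightarrow> (int \<Rightarrow> int) \<Rightarrow> bool" where
  "aper n X \<longleftrightarrow> bij X \<and> (\<forall>x. X (x + int n) = X x + int n)"

text \<open>An affine permutation is encoded by its position function \<open>X\<close>, with \<open>inv X\<close> giving the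
  label at a site. Left multiplication acts on sites and right multiplication on labels; \<open>stpL\<close>
  and \<open>stpB\<close> are the corresponding length increasing (0-Hecke) steps.\<close>

definition stpL :: "nat \<Rightarrow> int \<Rightarrow> bool \<Rightarrow> (int \<Rightarrow> int) \<Rightarrow> int \<Rightarrow> int" where
  "stpL n i b X = (if b \<and> inv X i < inv X (i + 1) then aswap n i \<circ> X else X)"

definition stpB :: "nat \<Rightarrow> int \<Rightarrow> bool \<Rightarrow> (int \<Rightarrow> int) \<Rightarrow> int \<Rightarrow> int" where
  "stpB n j b X = (if b \<and> X j < X (j + 1) then X \<circ> aswap n j else X)"

text \<open>Its absolute value counts the inversions between the translates of a and those of b, as
  in Shi's formula for the length.\<close>

definition wind :: "nat \<Rightarrow> int \<Rightarrow> int \<Rightarrow> (int \<Rightarrow> int) \<Rightarrow> int" where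
  "wind n a b X = (X b - X a) div int n"

text \<open>The bound is 2 because \<open>wind\<close> is a floor: the value -1 still allows a small
  negative gap. With 2 all gaps exceed n (\<open>deep_gap\<close>), so a shift of one value by n
  does not change the order.\<close>

definition deep :: "nat \<Rightarrow> (int \<Rightarrow> int) \<Rightarrow> bool" where
  "deep n X \<longleftrightarrow> (\<forall>a\<in>{1..int n}. \<forall>b\<in>{1..int n}. a < b \<longrightarrow> 2 \<le> \<bar>wind n a b X\<bar>)"

lemma dvd_small: "int n dvd z \<Longrightarrow> \<bar>z\<bar> < int n \<Longrightarrow> z = 0"
  using dvd_imp_le_int[of z "int n"] by linarith

locale affine =
  fixes n :: nat
  assumes n2: "2 \<le> n"
begin

lemma not_dvd_Suc: "int n dvd a \<Longrightarrow> \<not> int n dvd a + 1" "int n dvd a \<Longrightarrow> \<not> int n dvd a - 1"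
proof -
  have "\<not> int n dvd 1" using n2 by simp
  then show "int n dvd a \<Longrightarrow> \<not> int n dvd a + 1" "int n dvd a \<Longrightarrow> \<not> int n dvd a - 1"
    by (simp_all add: dvd_add_right_iff dvd_diff_right_iff)
qed

lemma aswap_cases:
  obtains "int n dvd x - i" "aswap n i x = x + 1" "\<not> int n dvd x - i - 1"
  | "int n dvd x - i - 1" "aswap n i x = x - 1" "\<not> int n dvd x - i"
  | "\<not> int n dvd x - i" "\<not> int n dvd x - i - 1" "aswap n i x = x"
  using not_dvd_Suc[of "x - i"] by (auto simp: aswap_def)

lemma aswap_aswap [simp]: "aswap n i (aswap n i x) = x"
proof (cases rule: aswap_cases[of x i])
  case 1
  then show ?thesis using not_dvd_Suc[of "x - i"] by (auto simp: aswap_def algebra_simps)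
next
  case 2
  then have e: "x - 1 - i = x - i - 1" by simp
  show ?thesis using 2 by (simp add: aswap_def e)
qed simp

lemma aswap_comp: "aswap n i \<circ> aswap n i = id" by (simp add: fun_eq_iff)

lemma bij_aswap: "bij (aswap n i)" by (rule o_bij[OF aswap_comp aswap_comp])

lemma inv_aswap: "inv (aswap n i) = aswap n i"
  by (rule inv_unique_comp[OF aswap_comp aswap_comp])

lemma dvd_shift: "int n dvd x + int n - i \<longleftrightarrow> int n dvd x - i" "int n dvd x + int n - i - 1 \<longleftrightarrow> int n dvd x - i - 1"
proof -
  have "x + int n - i = (x - i) + int n" "x + int n - i - 1 = (x - i - 1) + int n" by simp_all
  then show "int n dvd x + int n - i \<longleftrightarrow> int n dvd x - i" "int n dvd x + int n - i - 1 \<longleftrightarrow> int n dvd x - i - 1"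
    by (simp_all only: dvd_add_triv_right_iff)
qed

lemma aper_aswap: "aper n (aswap n i)"
  unfolding aper_def using bij_aswap by (auto simp: aswap_def dvd_shift)

lemma aper_id: "aper n id" by (simp add: aper_def)

lemma aper_comp: "aper n X \<Longrightarrow> aper n Y \<Longrightarrow> aper n (X \<circ> Y)"
  unfolding aper_def by (auto intro: bij_comp)

lemma aper_bij: "aper n X \<Longrightarrow> bij X" by (simp add: aper_def)

lemma aper_inv_apply:
  assumes "aper n X"
  shows "inv X (X x) = x" "X (inv X x) = x"
  by (rule inv_f_f[OF bij_is_inj[OF aper_bij[OF assms]]], rule surj_f_inv_f[OF bij_is_surj[OF aper_bij[OF assms]]])

lemma aper_eq_iff: "aper n X \<Longrightarrow> X x = X y \<longleftrightarrow> x = y"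
  using aper_bij bij_is_inj inj_eq by metis

lemma aper_mult:
  assumes "aper n X"
  shows "X (x + int n * m) = X x + int n * m"
proof (induction m rule: int_induct[of _ 0])
  case (step1 i)
  have e: "x + int n * (i + 1) = (x + int n * i) + int n" by (simp add: algebra_simps)
  have "X (x + int n * (i + 1)) = X (x + int n * i) + int n"
    unfolding e using assms unfolding aper_def by blast
  then show ?case using step1 by (simp add: algebra_simps)
next
  case (step2 i)
  have e: "x + int n * i = (x + int n * (i - 1)) + int n" by (simp add: algebra_simps)
  have "X (x + int n * i) = X (x + int n * (i - 1)) + int n"
    unfolding e using assms unfolding aper_def by blast
  then show ?case using step2 by (simp add: algebra_simps)
qed simp

lemma aper_inv:
  assumes "aper n X"
  shows "aper n (inv X)"
  unfolding aper_def
proof (intro conjI allI)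
  show "bij (inv X)" using assms aper_bij bij_imp_bij_inv by blast
  fix x
  have "X (inv X x + int n) = x + int n" using assms aper_inv_apply(2)[OF assms] unfolding aper_def by simp
  then have "inv X (X (inv X x + int n)) = inv X (x + int n)" by simp
  then show "inv X (x + int n) = inv X x + int n" using aper_inv_apply(1)[OF assms] by simp
qed

lemma aper_stpL: "aper n X \<Longrightarrow> aper n (stpL n i b X)"
  and aper_stpB: "aper n X \<Longrightarrow> aper n (stpB n i b X)"
  by (simp_all add: stpL_def stpB_def aper_comp aper_aswap)

lemma aswap_mono:
  assumes "c < d" "\<not> (int n dvd c - j \<and> d = c + 1)"
  shows "aswap n j c < aswap n j d"
proof -
  have d1: "d = c + 1 \<Longrightarrow> d - j - 1 = c - j" "d = c + 2 \<Longrightarrow> d - j - 1 = c - j + 1" by simp_all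
  consider "d = c + 1" | "d = c + 2" | "c + 2 < d" using assms(1) by linarith
  then show ?thesis
  proof cases
    case 1
    then show ?thesis using assms(2) d1(1)
      by (cases rule: aswap_cases[of c j]; cases rule: aswap_cases[of d j]) auto
  next
    case 2
    have "int n dvd c - j \<Longrightarrow> \<not> int n dvd d - j - 1" unfolding d1(2)[OF 2] by (rule not_dvd_Suc(1))
    then show ?thesis using 2
      by (cases rule: aswap_cases[of c j]; cases rule: aswap_cases[of d j]) (blast | linarith)+
  next
    case 3
    then show ?thesis
      by (cases rule: aswap_cases[of c j]; cases rule: aswap_cases[of d j]) auto
  qed
qed

lemma aswap_less_iff:
  assumes "c \<noteq> d" "\<not> (int n dvd c - j \<and> d = c + 1)" "\<not> (int n dvd d - j \<and> c = d + 1)"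
  shows "aswap n j c < aswap n j d \<longleftrightarrow> c < d"
  using aswap_mono[of c d j] aswap_mono[of d c j] assms by (meson linorder_neqE less_asym)

lemma aswap_same: "int n dvd e - j \<Longrightarrow> aswap n j e = e + 1" "int n dvd e - j \<Longrightarrow> aswap n j (e + 1) = e"
  using not_dvd_Suc(1)[of "e - j"] by (auto simp: aswap_def algebra_simps)

text \<open>If the labels at the sites \<open>i, i + 1\<close> form a translate of \<open>j, j + 1\<close>, both steps are the
  same; otherwise neither step affects the condition of the other.\<close>

lemma stpL_stpB:
  assumes X: "aper n X"
  shows "stpL n i b (stpB n j b' X) = stpB n j b' (stpL n i b X)"
proof (cases "b \<and> b'")
  case False
  then show ?thesis by (auto simp: stpL_def stpB_def)
next
  case True
  let ?c = "inv X i" and ?d = "inv X (i + 1)"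
  have inv1: "inv (X \<circ> aswap n j) = aswap n j \<circ> inv X"
    using o_inv_distrib[OF aper_bij[OF X] bij_aswap] by (simp add: inv_aswap)
  note ai = aper_inv_apply[OF X]
  have cd: "X ?c = i" "X ?d = i + 1" "?c \<noteq> ?d"
    using ai aper_eq_iff[OF aper_inv[OF X], of i "i + 1"] by auto
  have tr: "\<exists>m. f - i = int n * m" if "int n dvd f - i" for f i using that by (auto simp: dvd_def)
  consider (up) "int n dvd ?c - j" "?d = ?c + 1" | (down) "int n dvd ?d - j" "?c = ?d + 1"
    | (none) "\<not> (int n dvd ?c - j \<and> ?d = ?c + 1)" "\<not> (int n dvd ?d - j \<and> ?c = ?d + 1)" by blast
  then show ?thesis
  proof cases
    case up
    then obtain m where m: "?c = j + int n * m" by (metis tr add_diff_cancel_left' diff_add_cancel add.commute)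
    have Xj: "X j = i - int n * m" "X (j + 1) = i + 1 - int n * m"
    proof -
      have "X (j + int n * m) = i" "X (j + 1 + int n * m) = i + 1"
        using cd up m by (auto simp: algebra_simps)
      then show "X j = i - int n * m" "X (j + 1) = i + 1 - int n * m"
        using aper_mult[OF X, of j m] aper_mult[OF X, of "j + 1" m] by auto
    qed
    have L: "X \<circ> aswap n j = aswap n i \<circ> X"
    proof
      fix x
      have k: "X (j + int n * k) = i + int n * (k - m)" "X (j + 1 + int n * k) = i + int n * (k - m) + 1" for k
        using aper_mult[OF X, of j k] aper_mult[OF X, of "j + 1" k] Xj by (auto simp: algebra_simps)
      show "(X \<circ> aswap n j) x = (aswap n i \<circ> X) x"
      proof (cases rule: aswap_cases[of x j])
        case 1
        then obtain k where k': "x - j = int n * k" using tr by blast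
        have x: "x = j + int n * k" "x + 1 = j + 1 + int n * k" using k' by auto
        have "aswap n i (X x) = X x + 1" unfolding x(1) k by (rule aswap_same(1)) simp
        moreover have "X (x + 1) = i + int n * (k - m) + 1" unfolding x(2) by (rule k(2))
        moreover have "X x = i + int n * (k - m)" unfolding x(1) by (rule k(1))
        ultimately show ?thesis using 1(2) by simp
      next
        case 2
        then obtain k where k': "x - (j + 1) = int n * k" using tr[of x "j + 1"] by (auto simp: algebra_simps)
        have x: "x = j + 1 + int n * k" "x - 1 = j + int n * k" using k' by auto
        have "aswap n i (X x) = X x - 1"
          unfolding x(1) k using aswap_same(2)[of "i + int n * (k - m)" i] by simp
        moreover have "X (x - 1) = i + int n * (k - m)" unfolding x(2) by (rule k(1))
        moreover have "X x = i + int n * (k - m) + 1" unfolding x(1) by (rule k(2))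
        ultimately show ?thesis using 2(2) by simp
      next
        case 3
        have "\<not> int n dvd X x - i"
        proof
          assume "int n dvd X x - i"
          then obtain k where "X x - i = int n * k" using tr by blast
          then have "X x = X (j + int n * (k + m))" using k(1)[of "k + m"] by simp
          then have "x = j + int n * (k + m)" using aper_eq_iff[OF X] by simp
          then show False using 3(1) by simp
        qed
        moreover have "\<not> int n dvd X x - i - 1"
        proof
          assume "int n dvd X x - i - 1"
          then obtain k where "X x - (i + 1) = int n * k" using tr[of "X x" "i + 1"] by (auto simp: algebra_simps)
          then have "X x = X (j + 1 + int n * (k + m))" using k(2)[of "k + m"] by simp
          then have "x = j + 1 + int n * (k + m)" using aper_eq_iff[OF X] by simp
          then show False using 3(2) by simp
        qed
        ultimately show ?thesis using 3(3) by (simp add: aswap_def)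
      qed
    qed
    have 1: "stpB n j True X = X \<circ> aswap n j" "stpL n i True X = aswap n i \<circ> X"
      using Xj up by (auto simp: stpL_def stpB_def)
    have 2: "stpL n i True (X \<circ> aswap n j) = X \<circ> aswap n j"
      unfolding stpL_def inv1 using up aswap_same[OF up(1)] by simp
    have 3: "stpB n j True (aswap n i \<circ> X) = aswap n i \<circ> X"
    proof -
      have "int n dvd X j - i" unfolding Xj by simp
      moreover have "X (j + 1) = X j + 1" using Xj by simp
      ultimately show ?thesis using aswap_same[of "X j" i] by (simp add: stpB_def)
    qed
    show ?thesis using True 1 2 3 L by simp
  next
    case down
    then obtain m where m: "?d = j + int n * m" by (metis tr add_diff_cancel_left' diff_add_cancel add.commute)
    have Xj: "X j = i + 1 - int n * m" "X (j + 1) = i - int n * m"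
    proof -
      have "X (j + int n * m) = i + 1" "X (j + 1 + int n * m) = i"
        using cd down m by (auto simp: algebra_simps)
      then show "X j = i + 1 - int n * m" "X (j + 1) = i - int n * m"
        using aper_mult[OF X, of j m] aper_mult[OF X, of "j + 1" m] by auto
    qed
    have "stpB n j b' X = X" "stpL n i b X = X" using Xj down by (auto simp: stpL_def stpB_def)
    then show ?thesis by simp
  next
    case none
    have L: "aswap n j ?c < aswap n j ?d \<longleftrightarrow> ?c < ?d" using aswap_less_iff[OF cd(3) none] .
    have B: "aswap n i (X j) < aswap n i (X (j + 1)) \<longleftrightarrow> X j < X (j + 1)"
    proof (rule aswap_less_iff)
      show "X j \<noteq> X (j + 1)" using aper_eq_iff[OF X] by simp
      show "\<not> (int n dvd X j - i \<and> X (j + 1) = X j + 1)"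
      proof
        assume h: "int n dvd X j - i \<and> X (j + 1) = X j + 1"
        then obtain m where m: "X j - i = int n * m" using tr by blast
        have "X (j + int n * (-m)) = i" "X (j + 1 + int n * (-m)) = i + 1"
          using h m aper_mult[OF X, of j "-m"] aper_mult[OF X, of "j + 1" "-m"] by auto
        then have "?c = j + int n * (-m)" "?d = j + 1 + int n * (-m)" using ai(1) by metis+
        then show False using none(1) by simp
      qed
      show "\<not> (int n dvd X (j + 1) - i \<and> X j = X (j + 1) + 1)"
      proof
        assume h: "int n dvd X (j + 1) - i \<and> X j = X (j + 1) + 1"
        then obtain m where m: "X (j + 1) - i = int n * m" using tr by blast
        have "X (j + int n * (-m)) = i + 1" "X (j + 1 + int n * (-m)) = i"
          using h m aper_mult[OF X, of j "-m"] aper_mult[OF X, of "j + 1" "-m"] by auto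
        then have "?d = j + int n * (-m)" "?c = j + 1 + int n * (-m)" using ai(1) by metis+
        then show False using none(2) by simp
      qed
    qed
    show ?thesis using True L B unfolding stpL_def stpB_def by (auto simp: inv1 o_assoc)
  qed
qed

text \<open>A step exchanges neighbouring labels only when they are increasing, so it never touches
  a pair that is inverted already.\<close>

lemma stpL_inverted:
  assumes X: "aper n X" and "c < d" "X d < X c"
  shows "stpL n i b X d < stpL n i b X c"
proof (cases "b \<and> inv X i < inv X (i + 1)")
  case True
  have "\<not> (int n dvd X d - i \<and> X c = X d + 1)"
  proof
    assume h: "int n dvd X d - i \<and> X c = X d + 1"
    then obtain m where m: "X d - i = int n * m" by (auto simp: dvd_def)
    have "X (d + int n * (-m)) = i" "X (c + int n * (-m)) = i + 1"
      using h m aper_mult[OF X, of d "-m"] aper_mult[OF X, of c "-m"] by auto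
    then have "inv X i = d + int n * (-m)" "inv X (i + 1) = c + int n * (-m)"
      using aper_inv_apply(1)[OF X] by metis+
    then show False using True assms(2) by simp
  qed
  then show ?thesis using aswap_mono[OF assms(3)] True by (simp add: stpL_def)
qed (use assms in \<open>auto simp: stpL_def\<close>)

lemma X_noncong:
  assumes X: "aper n X" and ab: "a < b" "b < a + int n"
  shows "\<not> int n dvd X b - X a"
proof
  assume "int n dvd X b - X a"
  then obtain m where "X b - X a = int n * m" by (auto simp: dvd_def)
  then have "X b = X (a + int n * m)" using aper_mult[OF X, of a m] by simp
  then have "b = a + int n * m" using aper_eq_iff[OF X] by simp
  then show False using ab dvd_small[of n "b - a"] by simp
qed

text \<open>A bound on \<open>wind\<close> is an order relation between X at a and X at a translate
  of b. It is strict because these values are never congruent mod n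
  (\<open>X_noncong\<close>).\<close>

lemma wind_ge: "aper n X \<Longrightarrow> a < b \<Longrightarrow> b < a + int n \<Longrightarrow> q \<le> wind n a b X \<longleftrightarrow> X a < X (b + int n * (-q))"
  and wind_less: "aper n X \<Longrightarrow> a < b \<Longrightarrow> b < a + int n \<Longrightarrow> wind n a b X < q \<longleftrightarrow> X (b + int n * (-q)) < X a"
proof -
  assume X: "aper n X" and ab: "a < b" "b < a + int n"
  have np: "0 < int n" using n2 by simp
  have a: "X (b + int n * (-q)) = X b - int n * q" using aper_mult[OF X, of b "-q"] by simp
  have ne: "X b - X a \<noteq> int n * q" using X_noncong[OF X ab] by auto
  have "q \<le> wind n a b X \<longleftrightarrow> int n * q \<le> X b - X a"
  proof -
    define z where "z = X b - X a"
    have z: "z = int n * (z div int n) + z mod int n" "0 \<le> z mod int n" "z mod int n < int n" using np by simp_all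
    show ?thesis unfolding wind_def z_def[symmetric]
    proof
      assume "q \<le> z div int n"
      then have "int n * q \<le> int n * (z div int n)" using np by (intro mult_left_mono) auto
      then show "int n * q \<le> z" using z by linarith
    next
      assume le: "int n * q \<le> z"
      show "q \<le> z div int n"
      proof (rule ccontr)
        assume "\<not> q \<le> z div int n"
        then have "int n * (z div int n + 1) \<le> int n * q" using np by (intro mult_left_mono) auto
        then show False using le z unfolding distrib_left mult_1_right by linarith
      qed
    qed
  qed
  then show g: "q \<le> wind n a b X \<longleftrightarrow> X a < X (b + int n * (-q))" using ne unfolding a by linarith
  show "wind n a b X < q \<longleftrightarrow> X (b + int n * (-q)) < X a"
    using g ne unfolding a by linarith
qed

lemma wind_mono:
  assumes X: "aper n X" and ab: "a < b" "b < a + int n"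
  shows "\<bar>wind n a b X\<bar> \<le> \<bar>wind n a b (stpL n i c X)\<bar>"
proof -
  let ?Y = "stpL n i c X" and ?q = "wind n a b X"
  have Y: "aper n ?Y" by (rule aper_stpL[OF X])
  have np: "0 < int n" using n2 by simp
  consider "?q = 0" | "1 \<le> ?q" | "?q \<le> -1" by linarith
  then show ?thesis
  proof cases
    case 2
    have "int n * 1 \<le> int n * ?q" using 2 np by (intro mult_left_mono) auto
    then have "b + int n * (- ?q) < a" using ab unfolding mult_minus_right mult_1_right by linarith
    moreover have "X a < X (b + int n * (- ?q))" using wind_ge[OF X ab, of ?q] by simp
    ultimately have "?Y a < ?Y (b + int n * (- ?q))" by (rule stpL_inverted[OF X])
    then have "?q \<le> wind n a b ?Y" using wind_ge[OF Y ab, of ?q] by simp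
    then show ?thesis using 2 by linarith
  next
    case 3
    have "int n * (?q + 1) \<le> int n * 0" using 3 np by (intro mult_left_mono) auto
    then have "a < b + int n * (- (?q + 1))" using ab unfolding mult_minus_right mult_zero_right by linarith
    moreover have "X (b + int n * (- (?q + 1))) < X a" using wind_less[OF X ab, of "?q + 1"] by simp
    ultimately have "?Y (b + int n * (- (?q + 1))) < ?Y a" by (rule stpL_inverted[OF X])
    then have "wind n a b ?Y < ?q + 1" using wind_less[OF Y ab, of "?q + 1"] by simp
    then show ?thesis using 3 by linarith
  qed simp
qed

text \<open>The pair (c, d) consists of a and the nearest translate of b still to be inverted with
  it. Its positions are less than n apart, which keeps the necessary exchanges inside a window
  without wrap-around.\<close>

lemma wind_pair:
  assumes X: "aper n X" and ab: "a < b" "b < a + int n"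
  obtains c d where "c < d" "X c < X d" "X d < X c + int n"
    "\<And>Y. aper n Y \<Longrightarrow> Y d < Y c \<Longrightarrow> \<bar>wind n a b X\<bar> < \<bar>wind n a b Y\<bar>"
proof -
  let ?q = "wind n a b X"
  have np: "0 < int n" using n2 by simp
  have s: "X (b + int n * (-k)) = X b - int n * k" for k using aper_mult[OF X, of b "-k"] by simp
  show ?thesis
  proof (cases "0 \<le> ?q")
    case True
    let ?c = "b + int n * (- (?q + 1))"
    have "int n * 1 \<le> int n * (?q + 1)" using True np by (intro mult_left_mono) auto
    then have 1: "?c < a" using ab unfolding mult_minus_right mult_1_right by linarith
    have 2: "X ?c < X a" using wind_less[OF X ab, of "?q + 1"] by simp
    have 3: "X a < X ?c + int n"
      using wind_ge[OF X ab, of ?q] s[of ?q] s[of "?q + 1"] by (simp add: algebra_simps)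
    show ?thesis
    proof (rule that[OF 1 2 3])
      fix Y assume Y: "aper n Y" "Y a < Y ?c"
      then have "?q + 1 \<le> wind n a b Y" using wind_ge[OF Y(1) ab, of "?q + 1"] by simp
      then show "\<bar>?q\<bar> < \<bar>wind n a b Y\<bar>" using True by linarith
    qed
  next
    case False
    let ?d = "b + int n * (- ?q)"
    have "int n * 0 \<le> int n * (- ?q)" using False np by (intro mult_left_mono) auto
    then have 1: "a < ?d" using ab unfolding mult_zero_right by linarith
    have 2: "X a < X ?d" using wind_ge[OF X ab, of ?q] by simp
    have 3: "X ?d < X a + int n"
      using wind_less[OF X ab, of "?q + 1"] s[of ?q] s[of "?q + 1"] by (simp add: algebra_simps)
    show ?thesis
    proof (rule that[OF 1 2 3])
      fix Y assume Y: "aper n Y" "Y ?d < Y a"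
      then have "wind n a b Y < ?q" using wind_less[OF Y(1) ab, of ?q] by simp
      then show "\<bar>?q\<bar> < \<bar>wind n a b Y\<bar>" using False by linarith
    qed
  qed
qed

text \<open>Sorting the labels at the sites X c, ..., X d into decreasing order puts d before c. The
  window holds fewer than n edges, so each index acts on at most one of them, and there are at most
  n * n pairs to sort.\<close>

lemma inversion_run:
  assumes X: "aper n X" and cd: "c < d" "X c < X d" "X d < X c + int n"
    and sw: "set sw = {0..<n}" and T: "n * n < T"
  obtains f where "foldl (\<lambda>X i. stpL n (int i) (f i) X) X (concat (replicate T sw)) d
     < foldl (\<lambda>X i. stpL n (int i) (f i) X) X (concat (replicate T sw)) c"
proof -
  define x0 x1 where "x0 = X c" and "x1 = X d"
  have x01: "x0 < x1" "x1 < x0 + int n" using cd by (auto simp: x0_def x1_def)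
  \<comment> \<open>The coin shows True exactly at the edges inside the window. The edges at its
    boundary stay closed, so no label enters or leaves.\<close>
  define f where "f i = (\<exists>e\<in>{x0..<x1}. int n dvd e - int i)" for i :: nat
  let ?t = "\<lambda>i X. stpL n (int i) (f i) X"
  interpret sorting ?t "{X. aper n X}" inv x0 x1 "\<lambda>e. nat (e mod int n)" sw
  proof
    fix Y i assume "Y \<in> {X. aper n X}"
    then show "?t i Y \<in> {X. aper n X}" by (simp add: aper_stpL)
  next
    fix e assume "e \<in> {x0..<x1}"
    then show "nat (e mod int n) \<in> set sw" using n2 unfolding sw by (auto simp: nat_less_iff)
  next
    fix Y i assume "Y \<in> {X. aper n X}" and i: "i \<in> set sw"
    then have Y: "aper n Y" by simp
    have shift: "inv Y (i' + int n * m) = inv Y i' + int n * m" for i' m by (rule aper_mult[OF aper_inv[OF Y]])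
    show "(\<exists>e\<in>{x0..<x1}. inv Y e < inv Y (e + 1) \<and> (\<forall>x\<in>{x0..x1}. inv (?t i Y) x = inv Y (iswp e (e + 1) x))) \<or>
      (\<forall>x\<in>{x0..x1}. inv (?t i Y) x = inv Y x) \<and> (\<forall>e\<in>{x0..<x1}. nat (e mod int n) = i \<longrightarrow> \<not> inv Y e < inv Y (e + 1))"
    proof (cases "f i \<and> inv Y (int i) < inv Y (int i + 1)")
      case True
      then obtain e where e: "e \<in> {x0..<x1}" "int n dvd e - int i" unfolding f_def by blast
      then obtain m where "e - int i = int n * m" by (auto simp: dvd_def)
      then have em: "e = int i + int n * m" "e + 1 = int i + 1 + int n * m" by auto
      have "inv Y e = inv Y (int i) + int n * m" "inv Y (e + 1) = inv Y (int i + 1) + int n * m"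
        by (simp only: em(1) shift, simp only: em(2) shift)
      then have lt: "inv Y e < inv Y (e + 1)" using True by simp
      have "inv (?t i Y) x = inv Y (iswp e (e + 1) x)" if x: "x \<in> {x0..x1}" for x
      proof -
        have "inv (?t i Y) = inv Y \<circ> aswap n (int i)"
          using True o_inv_distrib[OF bij_aswap aper_bij[OF Y]] by (simp add: stpL_def inv_aswap)
        moreover have "aswap n (int i) x = iswp e (e + 1) x"
        proof (cases "x = e \<or> x = e + 1")
          case True
          then show ?thesis using aswap_same[OF e(2)] by auto
        next
          case False
          have "x - int i = (x - e) + (e - int i)" "x - int i - 1 = (x - (e + 1)) + (e - int i)" by simp_all
          then have "int n dvd x - int i \<longleftrightarrow> int n dvd x - e" "int n dvd x - int i - 1 \<longleftrightarrow> int n dvd x - (e + 1)"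
            using e(2) by (simp_all only: dvd_add_left_iff)
          moreover have "\<bar>x - e\<bar> < int n" "\<bar>x - (e + 1)\<bar> < int n" using x e(1) x01 by auto
          ultimately have "\<not> int n dvd x - int i" "\<not> int n dvd x - int i - 1"
            using dvd_small[of n "x - e"] dvd_small[of n "x - (e + 1)"] False by auto
          then show ?thesis using False by (simp add: aswap_def)
        qed
        ultimately show ?thesis by simp
      qed
      then show ?thesis using e(1) lt by blast
    next
      case False
      then have same: "?t i Y = Y" by (auto simp: stpL_def)
      have "\<not> inv Y e < inv Y (e + 1)" if e: "e \<in> {x0..<x1}" "nat (e mod int n) = i" for e
      proof -
        have "e mod int n = int i" using e(2) n2 by auto
        then have d: "e - int i = int n * (e div int n)" by (metis minus_mod_eq_mult_div)
        then have "f i" unfolding f_def using e(1) by force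
        then have "\<not> inv Y (int i) < inv Y (int i + 1)" using False by simp
        moreover have "e = int i + int n * (e div int n)" "e + 1 = int i + 1 + int n * (e div int n)" using d by auto
        ultimately show ?thesis using shift by (metis add_less_cancel_right)
      qed
      then show ?thesis using same by simp
    qed
  qed
  let ?Y = "run X (concat (replicate T sw))"
  have XI: "X \<in> {X. aper n X}" using X by simp
  have "?Y \<in> {X. aper n X}" by (rule run_Inv[OF XI]) auto
  then have YI: "aper n ?Y" by simp
  have "card ({x0..x1} \<times> {x0..x1}) \<le> n * n"
    using x01 by (simp add: card_cartesian_product) (intro mult_le_mono; linarith)
  then have srt: "sorted_on ?Y" using run_sorts[OF XI] T by simp
  have im: "inv ?Y ` {x0..x1} = inv X ` {x0..x1}" by (rule run_image[OF XI]) auto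
  have pos: "?Y l \<in> {x0..x1}" if "X l \<in> {x0..x1}" for l
  proof -
    have "inv X (X l) \<in> inv ?Y ` {x0..x1}" unfolding im using that by (rule imageI)
    then show ?thesis using aper_inv_apply[OF X] aper_inv_apply[OF YI] by auto
  qed
  have "?Y c \<in> {x0..x1}" "?Y d \<in> {x0..x1}" using pos[of c] pos[of d] x01 by (auto simp: x0_def x1_def)
  then have "\<not> ?Y c \<le> ?Y d" using sorted_on_le[OF srt, of "?Y c" "?Y d"] aper_inv_apply(1)[OF YI] cd(1) by auto
  then show ?thesis by (intro that[of f]) simp
qed

end

section \<open>The limiting order and the ring process\<close>

abbreviation sweeps :: "'i list \<Rightarrow> nat \<Rightarrow> 'i list" where
  "sweeps sw m \<equiv> concat (replicate m sw)"

lemma sweeps_add: "sweeps sw (m + k) = sweeps sw m @ sweeps sw k"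
  by (simp add: replicate_add)

lemma set_sweeps: "set (sweeps sw m) \<subseteq> set sw"
  by (auto split: if_splits)

locale affine_chain = affine +
  fixes p :: real and sw :: "nat list"
  assumes p: "0 < p" "p < 1" and sw: "set sw = {0..<n}"
begin

abbreviation stA :: "nat \<Rightarrow> bool \<Rightarrow> (int \<Rightarrow> int) \<Rightarrow> int \<Rightarrow> int" where
  "stA i b X \<equiv> stpL n (int i) b X"

sublocale A: coin_chain p stA "{0..<n}" "{X. aper n X}"
  by unfold_locales (use p aper_stpL in auto)

text \<open>A potential that never increases along the walk and is at least halved within
  \<open>wT\<close> sweeps with a probability bounded from below.\<close>

definition wexp :: "int \<Rightarrow> int \<Rightarrow> (int \<Rightarrow> int) \<Rightarrow> real" where
  "wexp a b X = (1 / 2) ^ nat \<bar>wind n a b X\<bar>"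

lemma wexp_pos: "0 < wexp a b X" by (simp add: wexp_def)

lemma wexp_mono: "\<bar>wind n a b X\<bar> \<le> \<bar>wind n a b Y\<bar> \<Longrightarrow> wexp a b Y \<le> wexp a b X"
  unfolding wexp_def by (intro power_decreasing) auto

lemma wexp_half:
  assumes "\<bar>wind n a b X\<bar> < \<bar>wind n a b Y\<bar>"
  shows "wexp a b Y \<le> wexp a b X / 2"
proof -
  have "wexp a b Y \<le> (1 / 2) ^ Suc (nat \<bar>wind n a b X\<bar>)"
    unfolding wexp_def using assms by (intro power_decreasing) auto
  then show ?thesis by (simp add: wexp_def)
qed

context
  fixes a b :: int
  assumes ab: "a < b" "b < a + int n"
begin

lemma wexp_chain: "coin_chain p stA {0..<n} {Y. aper n Y \<and> \<bar>wind n a b X\<bar> \<le> \<bar>wind n a b Y\<bar>}"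
proof
  fix i :: nat and c Y assume "Y \<in> {Y. aper n Y \<and> \<bar>wind n a b X\<bar> \<le> \<bar>wind n a b Y\<bar>}"
  then show "stA i c Y \<in> {Y. aper n Y \<and> \<bar>wind n a b X\<bar> \<le> \<bar>wind n a b Y\<bar>}"
    using wind_mono[of Y, OF _ ab, of "int i" c] aper_stpL by (auto intro: order.trans)
qed (use p in auto)

lemma wexp_evl_le:
  assumes X: "aper n X" and xs: "set xs \<subseteq> {0..<n}"
  shows "evl p stA (wexp a b) xs X \<le> wexp a b X"
proof -
  interpret coin_chain p stA "{0..<n}" "{Y. aper n Y \<and> \<bar>wind n a b X\<bar> \<le> \<bar>wind n a b Y\<bar>}" by (rule wexp_chain)
  have "evl p stA (wexp a b) xs X \<le> evl p stA (\<lambda>_. wexp a b X) xs X"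
    by (rule evl_mono[OF _ xs]) (use X wexp_mono in auto)
  then show ?thesis by (simp add: evl_const)
qed

definition wT :: nat where "wT = Suc (n * n)"

text \<open>With e = \<open>pm ^ length (sweeps sw wT)\<close> as a lower bound for the probability
  of halving, the expected factor is at most (1 - e) + e / 2.\<close>

definition wr :: real where "wr = 1 - A.pm ^ length (sweeps sw wT) / 2"

lemma wr: "0 \<le> wr" "wr < 1"
  using A.pm_pow[of "length (sweeps sw wT)"] by (auto simp: wr_def)

lemma wexp_contract:
  assumes X: "aper n X"
  shows "evl p stA (wexp a b) (sweeps sw wT) X \<le> wr * wexp a b X"
proof -
  interpret coin_chain p stA "{0..<n}" "{Y. aper n Y \<and> \<bar>wind n a b X\<bar> \<le> \<bar>wind n a b Y\<bar>}" by (rule wexp_chain)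
  obtain c d where cd: "c < d" "X c < X d" "X d < X c + int n"
    "\<And>Y. aper n Y \<Longrightarrow> Y d < Y c \<Longrightarrow> \<bar>wind n a b X\<bar> < \<bar>wind n a b Y\<bar>"
    by (rule wind_pair[OF X ab]) (rule that)
  obtain f where f: "foldl (\<lambda>X i. stA i (f i) X) X (sweeps sw wT) d < foldl (\<lambda>X i. stA i (f i) X) X (sweeps sw wT) c"
    by (rule inversion_run[OF X cd(1-3) sw, where T = wT]) (simp add: wT_def, rule that)
  let ?Y = "foldl (\<lambda>X i. stA i (f i) X) X (sweeps sw wT)" and ?e = "pm ^ length (sweeps sw wT)"
  have "aper n (foldl (\<lambda>X i. stA i (f i) X) X ys)" for ys
    using X by (induction ys arbitrary: X) (auto simp: aper_stpL)
  then have half: "wexp a b ?Y \<le> wexp a b X / 2" by (intro wexp_half cd(4) f)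
  have "evl p stA (wexp a b) (sweeps sw wT) X \<le> (1 - ?e) * wexp a b X + ?e * wexp a b ?Y"
    by (rule evl_le_run) (use X wexp_mono set_sweeps[of wT sw] sw in auto)
  also have "\<dots> \<le> (1 - ?e) * wexp a b X + ?e * (wexp a b X / 2)"
    using half pm_pow by (intro add_left_mono mult_left_mono) (auto intro: less_imp_le)
  also have "\<dots> = wr * wexp a b X" by (simp add: wr_def algebra_simps)
  finally show ?thesis .
qed

text \<open>The expectations decrease with the number of sweeps, so they have a limit l; contraction
  over \<open>wT\<close> sweeps gives l \<le> wr l, hence l = 0.\<close>

lemma wexp_tendsto_0:
  assumes X: "aper n X"
  shows "(\<lambda>m. evl p stA (wexp a b) (sweeps sw m) X) \<longlonglongrightarrow> 0"
proof -
  define r where "r m = evl p stA (wexp a b) (sweeps sw m) X" for m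
  have swI: "set (sweeps sw m) \<subseteq> {0..<n}" for m using set_sweeps[of m sw] sw by simp
  have XI: "X \<in> {X. aper n X}" using X by simp
  have nn: "0 \<le> r m" for m
    using A.evl_mono[of "\<lambda>_. 0" "wexp a b" "sweeps sw m" X, OF _ swI XI] wexp_pos
    by (simp add: evl_const r_def less_imp_le)
  have dec: "r (m + k) \<le> r m" for m k
    unfolding r_def sweeps_add evl_append by (rule A.evl_mono[OF _ swI XI]) (use wexp_evl_le[OF _ swI] in auto)
  have "decseq r"
    unfolding decseq_def
  proof (intro allI impI)
    fix m k :: nat assume "m \<le> k"
    then show "r k \<le> r m" using dec[of m "k - m"] by simp
  qed
  then obtain l where l: "r \<longlonglongrightarrow> l" by (rule decseq_convergent[of r 0]) (use nn in auto)
  have ctr: "r (m + wT) \<le> wr * r m" for m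
    unfolding r_def sweeps_add evl_append evl_cmult[symmetric]
    by (rule A.evl_mono[OF _ swI XI]) (use wexp_contract in auto)
  have "l \<le> wr * l"
    by (rule LIMSEQ_le[OF LIMSEQ_ignore_initial_segment[OF l] tendsto_mult[OF tendsto_const l]]) (use ctr in auto)
  moreover have "0 \<le> l" by (rule LIMSEQ_le_const[OF l]) (use nn in auto)
  moreover have "(1 - wr) * l \<le> 0" using \<open>l \<le> wr * l\<close> by (simp add: algebra_simps)
  ultimately have "l = 0" using wr by (auto simp: mult_le_0_iff)
  then show ?thesis using l unfolding r_def[abs_def] by simp
qed

end

definition shallow :: "(int \<Rightarrow> int) \<Rightarrow> real" where
  "shallow X = (if deep n X then 0 else 1)"

lemma shallow_le: "shallow X \<le> (\<Sum>(a, b)\<in>{(a, b). a \<in> {1..int n} \<and> b \<in> {1..int n} \<and> a < b}. 2 * wexp a b X)"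
proof (cases "deep n X")
  case True
  then show ?thesis by (simp add: shallow_def sum_nonneg wexp_pos less_imp_le case_prod_unfold)
next
  case False
  let ?P = "{(a, b). a \<in> {1..int n} \<and> b \<in> {1..int n} \<and> a < b}"
  have fin: "finite ?P" by (rule finite_subset[of _ "{1..int n} \<times> {1..int n}"]) auto
  obtain a b where ab: "a \<in> {1..int n}" "b \<in> {1..int n}" "a < b" "\<bar>wind n a b X\<bar> < 2"
    using False unfolding deep_def by force
  \<comment> \<open>A pair that violates \<open>deep\<close> has |wind| \<le> 1, so its potential is
    at least 1/2. This is the source of the factor 2 in the bound.\<close>
  have "(1/2::real) ^ 1 \<le> wexp a b X" unfolding wexp_def using ab(4) by (intro power_decreasing) auto
  then have "shallow X \<le> (\<lambda>(a, b). 2 * wexp a b X) (a, b)" using False by (simp add: shallow_def)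
  also have "\<dots> \<le> (\<Sum>(a, b)\<in>?P. 2 * wexp a b X)"
    by (rule member_le_sum[of "(a, b)"]) (use ab fin wexp_pos in \<open>auto intro: less_imp_le\<close>)
  finally show ?thesis .
qed

lemma shallow_tendsto_0:
  assumes X: "aper n X"
  shows "(\<lambda>m. evl p stA shallow (sweeps sw m) X) \<longlonglongrightarrow> 0"
proof (rule tendsto_sandwich[of "\<lambda>_. 0"])
  let ?P = "{(a, b). a \<in> {1..int n} \<and> b \<in> {1..int n} \<and> a < b}"
  let ?g = "\<lambda>X. (\<Sum>(a, b)\<in>?P. 2 * wexp a b X)"
  have swI: "set (sweeps sw m) \<subseteq> {0..<n}" for m using set_sweeps[of m sw] sw by simp
  have XI: "X \<in> {X. aper n X}" using X by simp
  show "\<forall>\<^sub>F m in sequentially. evl p stA shallow (sweeps sw m) X \<le> evl p stA ?g (sweeps sw m) X"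
    by (intro always_eventually allI A.evl_mono[OF _ swI XI] shallow_le)
  have "evl p stA (\<lambda>_. 0) (sweeps sw m) X \<le> evl p stA shallow (sweeps sw m) X" for m
    by (rule A.evl_mono[OF _ swI XI]) (simp add: shallow_def)
  then show "\<forall>\<^sub>F m in sequentially. 0 \<le> evl p stA shallow (sweeps sw m) X" by (simp add: evl_const)
  have e: "evl p stA ?g (sweeps sw m) X = (\<Sum>(a, b)\<in>?P. 2 * evl p stA (wexp a b) (sweeps sw m) X)" for m
    unfolding case_prod_unfold by (simp add: evl_sum evl_cmult)
  have "(\<lambda>m. \<Sum>(a, b)\<in>?P. 2 * evl p stA (wexp a b) (sweeps sw m) X) \<longlonglongrightarrow> (\<Sum>(a, b)\<in>?P. 2 * 0)"
    unfolding case_prod_unfold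
    by (intro tendsto_sum tendsto_mult tendsto_const wexp_tendsto_0 X) auto
  then show "(\<lambda>m. evl p stA ?g (sweeps sw m) X) \<longlonglongrightarrow> 0" unfolding e by (simp add: case_prod_unfold)
qed simp

lemma shallow_prefix_tendsto_0:
  assumes "set xs \<subseteq> {0..<n}" "aper n X"
  shows "(\<lambda>m. evl p stA shallow (xs @ sweeps sw m) X) \<longlonglongrightarrow> 0"
  using assms
proof (induction xs arbitrary: X)
  case (Cons i xs)
  have "(\<lambda>m. p * evl p stA shallow (xs @ sweeps sw m) (stA i True X) +
      (1 - p) * evl p stA shallow (xs @ sweeps sw m) (stA i False X)) \<longlonglongrightarrow> p * 0 + (1 - p) * 0"
    by (intro tendsto_intros Cons.IH) (use Cons.prems aper_stpL in auto)
  then show ?case by simp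
qed (use shallow_tendsto_0 in simp)

end

definition pat :: "nat \<Rightarrow> (int \<Rightarrow> int) \<Rightarrow> nat \<Rightarrow> nat" where
  "pat n X k = (if k \<in> {1..n} then card {l \<in> {1..n}. X (int l) \<le> X (int k)} else k)"

definition edge :: "nat \<Rightarrow> nat \<Rightarrow> nat" where
  "edge n i = (if i = 0 then n else i)"

text \<open>Multispecies TASEP on a ring; index \<open>0\<close> is the edge joining \<open>n\<close> and \<open>1\<close>.\<close>

definition stpR :: "nat \<Rightarrow> nat \<Rightarrow> bool \<Rightarrow> (nat \<Rightarrow> nat) \<Rightarrow> nat \<Rightarrow> nat" where
  "stpR n i b w = (let e = edge n i in if b \<and> w e < w (nxt n e) then w \<circ> swp e (nxt n e) else w)"

context affine
begin

lemma pat_le_iff: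
  assumes X: "aper n X" and k: "k \<in> {1..n}" and l: "l \<in> {1..n}"
  shows "pat n X k \<le> pat n X l \<longleftrightarrow> X (int k) \<le> X (int l)" "pat n X k < pat n X l \<longleftrightarrow> X (int k) < X (int l)"
proof -
  have mono: "pat n X k \<le> pat n X l" if "X (int k) \<le> X (int l)" "k \<in> {1..n}" "l \<in> {1..n}" for k l
    unfolding pat_def using that by (auto intro!: card_mono)
  have strict: "pat n X k < pat n X l" if "X (int k) < X (int l)" "k \<in> {1..n}" "l \<in> {1..n}" for k l
  proof -
    let ?A = "\<lambda>k. {l \<in> {1..n}. X (int l) \<le> X (int k)}"
    have "?A k \<subseteq> ?A l" "l \<in> ?A l" "l \<notin> ?A k" using that by auto
    then have "card (?A k) < card (?A l)" by (intro psubset_card_mono) auto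
    then show ?thesis using that by (simp add: pat_def)
  qed
  show "pat n X k \<le> pat n X l \<longleftrightarrow> X (int k) \<le> X (int l)" "pat n X k < pat n X l \<longleftrightarrow> X (int k) < X (int l)"
    using mono[of k l] mono[of l k] strict[of k l] strict[of l k] k l by linarith+
qed

lemma pat_permutes:
  assumes X: "aper n X"
  shows "pat n X permutes {1..n}"
proof (rule bij_imp_permutes)
  have inj: "inj_on (pat n X) {1..n}"
  proof (rule inj_onI)
    fix k l assume kl: "k \<in> {1..n}" "l \<in> {1..n}" and "pat n X k = pat n X l"
    then have "X (int k) = X (int l)"
      using pat_le_iff(1)[OF X kl] pat_le_iff(1)[OF X kl(2,1)] by simp
    then show "k = l" using aper_eq_iff[OF X] by simp
  qed
  have "pat n X k \<in> {1..n}" if k: "k \<in> {1..n}" for k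
  proof -
    let ?S = "{l \<in> {1..n}. X (int l) \<le> X (int k)}"
    have "card ?S \<le> card {1..n}" by (rule card_mono) auto
    moreover have "card {k} \<le> card ?S" by (rule card_mono) (use k in auto)
    ultimately show ?thesis using k by (simp add: pat_def)
  qed
  then have "pat n X ` {1..n} \<subseteq> {1..n}" by (rule image_subsetI)
  then have "pat n X ` {1..n} = {1..n}" using inj by (intro endo_inj_surj) auto
  with inj show "bij_betw (pat n X) {1..n} {1..n}" by (simp add: bij_betw_def)
qed (auto simp: pat_def)

lemma pat_reorder:
  assumes \<sigma>: "\<sigma> permutes {1..n}"
    and eq: "\<And>k l. k \<in> {1..n} \<Longrightarrow> l \<in> {1..n} \<Longrightarrow> Y (int l) \<le> Y (int k) \<longleftrightarrow> X (int (\<sigma> l)) \<le> X (int (\<sigma> k))"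
  shows "pat n Y = pat n X \<circ> \<sigma>"
proof
  fix k
  show "pat n Y k = (pat n X \<circ> \<sigma>) k"
  proof (cases "k \<in> {1..n}")
    case True
    let ?A = "{l \<in> {1..n}. Y (int l) \<le> Y (int k)}" and ?B = "{l \<in> {1..n}. X (int l) \<le> X (int (\<sigma> k))}"
    have im: "\<sigma> ` ?A = ?B"
    proof (intro equalityI subsetI)
      fix x assume "x \<in> \<sigma> ` ?A"
      then show "x \<in> ?B" using eq[OF True] permutes_in_image[OF \<sigma>] by auto
    next
      fix x assume x: "x \<in> ?B"
      have "inv \<sigma> x \<in> {1..n}" "\<sigma> (inv \<sigma> x) = x"
        using x permutes_in_image[OF permutes_inv[OF \<sigma>], of x] permutes_inverses[OF \<sigma>] by auto
      then show "x \<in> \<sigma> ` ?A" using eq[OF True, of "inv \<sigma> x"] x by (intro image_eqI[of _ _ "inv \<sigma> x"]) auto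
    qed
    have ij: "inj_on \<sigma> ?A" by (rule inj_on_subset[OF permutes_inj[OF \<sigma>]]) simp
    have "card ?A = card ?B" unfolding im[symmetric] by (simp only: card_image[OF ij])
    moreover have "\<sigma> k \<in> {1..n}" using permutes_in_image[OF \<sigma>] True by blast
    ultimately show ?thesis using True by (simp add: pat_def)
  next
    case False
    then show ?thesis using permutes_not_in[OF \<sigma> False] by (auto simp: pat_def)
  qed
qed

lemma deep_gap:
  assumes X: "aper n X" and deep: "deep n X" and ab: "a \<in> {1..int n}" "b \<in> {1..int n}" "a \<noteq> b"
  shows "int n < \<bar>X a - X b\<bar>"
proof -
  have gap: "int n < \<bar>X b - X a\<bar>" if ab: "a \<in> {1..int n}" "b \<in> {1..int n}" "a < b" for a b
  proof -
    have b: "b < a + int n" using ab by auto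
    have w: "2 \<le> \<bar>wind n a b X\<bar>" using deep ab unfolding deep_def by blast
    have s: "X (b + int n * (-k)) = X b - int n * k" for k using aper_mult[OF X, of b "-k"] by simp
    show ?thesis
    proof (cases "2 \<le> wind n a b X")
      case True
      then have "X a < X b - int n * 2" using wind_ge[OF X ab(3) b, of 2] s[of 2] by simp
      then show ?thesis using n2 by linarith
    next
      case False
      then have "wind n a b X < -1" using w by linarith
      then have "X b - int n * (-1) < X a" using wind_less[OF X ab(3) b, of "-1"] s[of "-1"] by simp
      then show ?thesis using n2 by linarith
    qed
  qed
  show ?thesis using gap[of a b] gap[of b a] ab by (cases a b rule: linorder_cases) (auto simp: abs_minus_commute)
qed

text \<open>At an inner edge this is an exchange of two neighbours. At edge 0 the step replaces X 1
  by X n - n and X n by X 1 + n, and these shifts by n are invisible to the order because all gaps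
  exceed n.\<close>

lemma pat_stpB:
  assumes X: "aper n X" and deep: "deep n X" and i: "i < n"
  shows "pat n (stpB n (int i) b X) = stpR n i b (pat n X)"
proof (cases "i = 0")
  case False
  let ?s = "swp i (Suc i)"
  have ij: "i \<in> {1..n}" "Suc i \<in> {1..n}" using False i by auto
  have e: "edge n i = i" "nxt n i = Suc i" using False i by (auto simp: edge_def nxt_def)
  have sI: "?s permutes {1..n}" by (rule permutes_swap_id[OF ij])
  have lt: "X (int i) < X (int i + 1) \<longleftrightarrow> pat n X i < pat n X (Suc i)"
    using pat_le_iff(2)[OF X ij] by (simp add: add.commute)
  have as: "aswap n (int i) (int k) = int (?s k)" if k: "k \<in> {1..n}" for k
  proof -
    consider "k = i" | "k = Suc i" | "k \<noteq> i" "k \<noteq> Suc i" by blast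
    then show ?thesis
    proof cases
      case 3
      have "\<bar>int k - int i\<bar> < int n" "\<bar>int k - int i - 1\<bar> < int n" using k ij by auto
      then have "\<not> int n dvd int k - int i" "\<not> int n dvd int k - int i - 1"
        using dvd_small[of n "int k - int i"] dvd_small[of n "int k - int i - 1"] 3 by auto
      then show ?thesis using 3 by (simp add: aswap_def)
    qed (use aswap_same[of "int i" "int i"] in \<open>auto simp: add.commute\<close>)
  qed
  have "pat n (X \<circ> aswap n (int i)) = pat n X \<circ> ?s"
    by (rule pat_reorder[OF sI]) (simp add: as)
  then show ?thesis unfolding stpB_def stpR_def Let_def e using lt by auto
next
  case True
  let ?s = "swp n 1"
  have ij: "n \<in> {1..n}" "1 \<in> {1..n}" "n \<noteq> 1" using n2 by auto
  have e: "edge n 0 = n" "nxt n n = 1" by (auto simp: edge_def nxt_def)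
  have sI: "?s permutes {1..n}" by (rule permutes_swap_id[OF ij(1,2)])
  have gap: "int n < \<bar>X (int k) - X (int l)\<bar>" if "k \<in> {1..n}" "l \<in> {1..n}" "k \<noteq> l" for k l
    by (rule deep_gap[OF X deep]) (use that in auto)
  have X0: "X 0 = X (int n) - int n" "X (int n + 1) = X 1 + int n"
    using X[unfolded aper_def, THEN conjunct2, rule_format, of 0] X[unfolded aper_def, THEN conjunct2, rule_format, of 1]
    by (simp_all add: add.commute)
  have lt: "X 0 < X 1 \<longleftrightarrow> pat n X n < pat n X 1"
    using pat_le_iff(2)[OF X ij(1,2)] gap[OF ij] X0 by auto
  show ?thesis
  proof (cases "X 0 < X 1")
    case False
    then show ?thesis unfolding True stpB_def stpR_def Let_def e using lt by auto
  next
    case lt01: True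
    have ltn: "X (int n) < X 1" using lt01 gap[OF ij] X0 by auto
    let ?Y = "X \<circ> aswap n 0"
    have a: "aswap n 0 1 = 0" "aswap n 0 (int n) = int n + 1"
      using aswap_same[of 0 0] aswap_same(1)[of "int n" 0] by auto
    have Y: "?Y 1 = X (int n) - int n" "?Y (int n) = X 1 + int n" using a X0 by simp_all
    have Yo: "?Y (int k) = X (int k)" if "k \<in> {1..n}" "k \<noteq> 1" "k \<noteq> n" for k
    proof -
      have "\<not> int n dvd int k" "\<not> int n dvd int k - 1"
        using dvd_small[of n "int k"] dvd_small[of n "int k - 1"] that by auto
      then show ?thesis by (simp add: aswap_def)
    qed
    have "pat n ?Y = pat n X \<circ> ?s"
    proof (rule pat_reorder[OF sI])
      fix k l assume k: "k \<in> {1..n}" and l: "l \<in> {1..n}"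
      have c: "x = 1 \<or> x = n \<or> (x \<noteq> 1 \<and> x \<noteq> n)" for x :: nat by blast
      have Y': "?Y (int 1) = X (int n) - int n" using Y by simp
      show "?Y (int l) \<le> ?Y (int k) \<longleftrightarrow> X (int (?s l)) \<le> X (int (?s k))"
        using c[of k] c[of l]
      proof (elim disjE)
        assume "k \<noteq> 1 \<and> k \<noteq> n" "l \<noteq> 1 \<and> l \<noteq> n"
        then show ?thesis using Yo[OF k] Yo[OF l] by simp
      next
        assume kl: "k = 1" "l \<noteq> 1 \<and> l \<noteq> n"
        then show ?thesis using Yo[OF l] Y' gap[OF ij(1) l] by auto
      next
        assume kl: "k = n" "l \<noteq> 1 \<and> l \<noteq> n"
        then show ?thesis using Yo[OF l] Y gap[OF ij(2) l] ij(3) by auto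
      next
        assume kl: "l = 1" "k \<noteq> 1 \<and> k \<noteq> n"
        then show ?thesis using Yo[OF k] Y' gap[OF ij(1) k] by auto
      next
        assume kl: "l = n" "k \<noteq> 1 \<and> k \<noteq> n"
        then show ?thesis using Yo[OF k] Y gap[OF ij(2) k] ij(3) by auto
      next
        assume kl: "k = 1" "l = n"
        then show ?thesis using Y Y' ltn by auto
      next
        assume kl: "k = n" "l = 1"
        then show ?thesis using Y Y' ltn by auto
      qed (use Y Y' in auto)
    qed
    then show ?thesis unfolding True stpB_def stpR_def Let_def e using lt lt01 by auto
  qed
qed

end

lemma wlong_wlong: "wlong n (wlong n k) = k"
  by (auto simp: wlong_def)

lemma wlong_comp_wlong: "wlong n \<circ> wlong n = id"
  by (simp add: fun_eq_iff wlong_wlong)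

lemma wlong_less_iff: "k \<in> {1..n} \<Longrightarrow> l \<in> {1..n} \<Longrightarrow> wlong n k < wlong n l \<longleftrightarrow> l < k"
  by (auto simp: wlong_def)

lemma edge_in: "i < n \<Longrightarrow> edge n i \<in> {1..n}"
  by (auto simp: edge_def)

lemma nxt_edge: "i < n \<Longrightarrow> nxt n (edge n i) = Suc i"
  by (auto simp: edge_def nxt_def)

lemma stpR_permutes: "2 \<le> n \<Longrightarrow> w permutes {1..n} \<Longrightarrow> i < n \<Longrightarrow> stpR n i b w permutes {1..n}"
  using permutes_comp_swp[of w n "edge n i" "nxt n (edge n i)"] nxt_in[of "edge n i" n] edge_in[of i n]
  by (simp add: stpR_def Let_def)

text \<open>With the coin at edge 0 always False the ring is cut open and the process is bubble sort
  on a line. The same coin pattern thus leads from every start to \<open>wlong n\<close>.\<close>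

lemma ring_sort:
  assumes n2: "2 \<le> n" and w: "w permutes {1..n}" and sw: "set sw = {0..<n}" and T: "n * n < T"
  shows "foldl (\<lambda>w i. stpR n i (i \<noteq> 0) w) w (sweeps sw T) = wlong n"
proof -
  let ?t = "\<lambda>i w. stpR n i (i \<noteq> 0) w"
  interpret sorting ?t "{w. w permutes {1..n}}" "\<lambda>w x. w (nat x)" 1 "int n" nat sw
  proof
    fix v i assume "v \<in> {w. w permutes {1..n}}" "i \<in> set sw"
    then show "?t i v \<in> {w. w permutes {1..n}}" using stpR_permutes[OF n2] sw by simp
  next
    fix e assume "e \<in> {1..<int n}"
    then show "nat e \<in> set sw" unfolding sw by auto
  next
    fix v i assume "v \<in> {w. w permutes {1..n}}" and i: "i \<in> set sw"
    show "(\<exists>e\<in>{1..<int n}. v (nat e) < v (nat (e + 1)) \<and> (\<forall>x\<in>{1..int n}. ?t i v (nat x) = v (nat (iswp e (e + 1) x)))) \<or>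
      (\<forall>x\<in>{1..int n}. ?t i v (nat x) = v (nat x)) \<and> (\<forall>e\<in>{1..<int n}. nat e = i \<longrightarrow> \<not> v (nat e) < v (nat (e + 1)))"
    proof (cases "i \<noteq> 0 \<and> v i < v (Suc i)")
      case True
      have ii: "edge n i = i" "nxt n (edge n i) = Suc i" using True i sw nxt_edge[of i n] by (auto simp: edge_def)
      have e: "int i \<in> {1..<int n}" "nat (int i + 1) = Suc i" using True i sw by auto
      have "?t i v (nat x) = v (nat (iswp (int i) (int i + 1) x))" if x: "x \<in> {1..int n}" for x
      proof -
        have "?t i v (nat x) = v (swp i (Suc i) (nat x))" using True ii by (simp add: stpR_def Let_def)
        also have "swp i (Suc i) (nat x) = nat (iswp (int i) (int i + 1) x)"
          using x by (auto simp: Transposition.transpose_def)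
        finally show ?thesis .
      qed
      then show ?thesis using e True by (intro disjI1 bexI[of _ "int i"]) auto
    next
      case False
      have same: "?t i v = v"
      proof (cases "i = 0")
        case f: False
        have ii: "edge n i = i" "nxt n (edge n i) = Suc i" using f i sw nxt_edge[of i n] by (auto simp: edge_def)
        then show ?thesis using False f by (simp add: stpR_def Let_def)
      qed (simp add: stpR_def Let_def)
      have "\<not> v (nat e) < v (nat (e + 1))" if "e \<in> {1..<int n}" "nat e = i" for e
      proof -
        have "nat (e + 1) = Suc i" "i \<noteq> 0" using that by auto
        then show ?thesis using False that(2) by simp
      qed
      then show ?thesis using same by simp
    qed
  qed
  let ?v = "run w (sweeps sw T)"
  have wI: "w \<in> {w. w permutes {1..n}}" using w by simp
  have "?v \<in> {w. w permutes {1..n}}" by (rule run_Inv[OF wI set_sweeps])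
  then have v: "?v permutes {1..n}" by simp
  have srt: "sorted_on ?v" by (rule run_sorts[OF wI]) (use T in \<open>simp add: card_cartesian_product\<close>)
  have "wlong n \<circ> ?v = id"
  proof (rule permutes_ascending)
    show "wlong n \<circ> ?v permutes {1..n}" by (rule permutes_compose[OF v wlong_permutes])
    fix i assume i: "i \<in> {1..<n}"
    have ii: "int i \<in> {1..<int n}" "nat (int i + 1) = Suc i" using i by auto
    have "\<not> ?v i < ?v (Suc i)" using bspec[OF srt[unfolded sorted_on_def] ii(1)] unfolding ii(2) nat_int .
    moreover have "?v i \<noteq> ?v (Suc i)" using inj_eq[OF permutes_inj[OF v]] by simp
    ultimately have "?v (Suc i) < ?v i" by linarith
    moreover have "?v i \<in> {1..n}" "?v (Suc i) \<in> {1..n}" using permutes_in_image[OF v] i by auto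
    ultimately show "(wlong n \<circ> ?v) i < (wlong n \<circ> ?v) (Suc i)" using wlong_less_iff by simp
  qed
  from fun_cong[OF this] have k: "wlong n (?v k) = k" for k by simp
  show ?thesis
  proof
    fix k show "?v k = wlong n k"
      using arg_cong[OF k[of k], of "wlong n"] unfolding wlong_wlong .
  qed
qed

lemma tendsto_chain:
  fixes a b c :: "nat \<Rightarrow> real"
  assumes "(\<lambda>m. a m - b m) \<longlonglongrightarrow> 0" "(\<lambda>m. b m - c m) \<longlonglongrightarrow> 0"
  shows "(\<lambda>m. a m - c m) \<longlonglongrightarrow> 0"
  using tendsto_add[OF assms] by simp

lemma tendsto_diff_0:
  fixes a b :: "nat \<Rightarrow> real"
  assumes "a \<longlonglongrightarrow> L" "(\<lambda>m. a m - b m) \<longlonglongrightarrow> 0"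
  shows "b \<longlonglongrightarrow> L"
  using tendsto_diff[OF assms] by simp

lemma rev_sweeps: "rev (sweeps sw m) = sweeps (rev sw) m"
  by (simp add: rev_concat)

context affine_chain
begin

sublocale R: coin_chain p "stpR n" "{0..<n}" "{w. w permutes {1..n}}"
  by unfold_locales (use p stpR_permutes[OF n2] in auto)

definition ringT :: nat where "ringT = Suc (n * n)"

definition ringc :: real where "ringc = 1 - R.pm ^ length (sweeps (rev sw) ringT)"

lemma ringc: "0 \<le> ringc" "ringc < 1"
  using R.pm_pow[of "length (sweeps (rev sw) ringT)"] by (auto simp: ringc_def)

text \<open>Doeblin's argument: all starts meet at \<open>wlong n\<close> along a common coin
  pattern, so each block of \<open>ringT\<close> sweeps shrinks the range of the expectation by the
  factor \<open>ringc\<close>.\<close>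

lemma ring_oscillation:
  assumes G: "\<And>w. \<bar>G w\<bar> \<le> C"
  shows "\<exists>lo hi. (\<forall>w. w permutes {1..n} \<longrightarrow> lo \<le> evl p (stpR n) G (rev (sweeps sw (r * ringT))) w \<and>
      evl p (stpR n) G (rev (sweeps sw (r * ringT))) w \<le> hi) \<and> hi - lo \<le> ringc ^ r * (2 * C)"
proof (induction r)
  case 0
  have "- C \<le> G w \<and> G w \<le> C" for w using G[of w] by (auto simp: abs_le_iff)
  then show ?case by (intro exI[of _ "- C"] exI[of _ C]) auto
next
  case (Suc r)
  let ?K = "evl p (stpR n) G (rev (sweeps sw (r * ringT)))"
  let ?xs = "sweeps (rev sw) ringT"
  let ?e = "R.pm ^ length ?xs"
  obtain lo hi where lh: "\<And>w. w permutes {1..n} \<Longrightarrow> lo \<le> ?K w" "\<And>w. w permutes {1..n} \<Longrightarrow> ?K w \<le> hi"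
    "hi - lo \<le> ringc ^ r * (2 * C)" using Suc by blast
  have K: "evl p (stpR n) G (rev (sweeps sw (Suc r * ringT))) = evl p (stpR n) ?K ?xs"
  proof
    fix w
    have "Suc r * ringT = r * ringT + ringT" by simp
    then show "evl p (stpR n) G (rev (sweeps sw (Suc r * ringT))) w = evl p (stpR n) ?K ?xs w"
      by (simp only: sweeps_add rev_append evl_append rev_sweeps)
  qed
  have xs: "set ?xs \<subseteq> {0..<n}" using set_sweeps[of ringT "rev sw"] sw by simp
  let ?g = "?K (wlong n)"
  have run: "foldl (\<lambda>w i. stpR n i (i \<noteq> 0) w) w ?xs = wlong n" if "w permutes {1..n}" for w
    by (rule ring_sort[OF n2 that]) (use sw in \<open>auto simp: ringT_def\<close>)
  have "evl p (stpR n) ?K ?xs w \<le> (1 - ?e) * hi + ?e * ?g" if w: "w permutes {1..n}" for w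
    using R.evl_le_run[of ?K hi ?xs w "\<lambda>i. i \<noteq> 0"] lh(2) xs w run[OF w] by simp
  moreover have "(1 - ?e) * lo + ?e * ?g \<le> evl p (stpR n) ?K ?xs w" if w: "w permutes {1..n}" for w
    using R.evl_ge_run[of lo ?K ?xs w "\<lambda>i. i \<noteq> 0"] lh(1) xs w run[OF w] by simp
  moreover have "((1 - ?e) * hi + ?e * ?g) - ((1 - ?e) * lo + ?e * ?g) \<le> ringc ^ Suc r * (2 * C)"
  proof -
    have "((1 - ?e) * hi + ?e * ?g) - ((1 - ?e) * lo + ?e * ?g) = ringc * (hi - lo)"
      by (simp add: ringc_def algebra_simps)
    also have "\<dots> \<le> ringc * (ringc ^ r * (2 * C))" using lh(3) ringc by (intro mult_left_mono) auto
    finally show ?thesis by (simp add: mult.assoc)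
  qed
  ultimately show ?case unfolding K by blast
qed

text \<open>The first step of the walk can be moved to the end as a right multiplication, which
  away from the walls acts on the pattern as a step of the ring process.\<close>

lemma evl_front:
  assumes i: "i < n" and xs: "set xs \<subseteq> {0..<n}"
  shows "evl p stA F (i # xs) id = evl p stA (\<lambda>X. p * F (stpB n (int i) True X) + (1 - p) * F (stpB n (int i) False X)) xs id"
proof -
  have "stA i b id = stpB n (int i) b id" for b
    by (simp add: stpL_def stpB_def)
  moreover have "evl p stA F xs (stpB n (int i) b id) = evl p stA (\<lambda>X. F (stpB n (int i) b X)) xs id" for b
    by (rule A.evl_commute[OF _ xs]) (simp add: stpL_stpB, rule CollectI, rule aper_id)
  ultimately show ?thesis by (simp add: evl_add evl_cmult)
qed

text \<open>Iterates \<open>evl_front\<close>. Replacing one right multiplication by a ring step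
  costs an error of at most 2 C, and only where X is not deep, which has vanishing probability.
  Steps taken off the front are applied last, so the ring runs through them in reverse.\<close>

lemma front_tendsto:
  assumes "set is \<subseteq> {0..<n}" "\<And>w. \<bar>G w\<bar> \<le> C"
  shows "(\<lambda>m. evl p stA (\<lambda>X. G (pat n X)) (is @ sweeps sw m) id -
     evl p stA (\<lambda>X. evl p (stpR n) G (rev is) (pat n X)) (sweeps sw m) id) \<longlonglongrightarrow> 0"
  using assms
proof (induction "is" arbitrary: G)
  case (Cons i "is")
  let ?G = "\<lambda>w. p * G (stpR n i True w) + (1 - p) * G (stpR n i False w)"
  let ?H = "\<lambda>X. p * G (pat n (stpB n (int i) True X)) + (1 - p) * G (pat n (stpB n (int i) False X))"
  have i: "i < n" and "is": "set is \<subseteq> {0..<n}" using Cons.prems(1) by auto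
  have C0: "0 \<le> C" using Cons.prems(2)[of undefined] by linarith
  have conv: "\<bar>p * x + (1 - p) * y\<bar> \<le> C" if "\<bar>x\<bar> \<le> C" "\<bar>y\<bar> \<le> C" for x y
  proof -
    have "\<bar>p * x + (1 - p) * y\<bar> \<le> p * \<bar>x\<bar> + (1 - p) * \<bar>y\<bar>"
      using p by (intro order.trans[OF abs_triangle_ineq]) (simp add: abs_mult)
    also have "\<dots> \<le> p * C + (1 - p) * C" using that p by (intro add_mono mult_left_mono) auto
    finally show ?thesis by (simp add: algebra_simps)
  qed
  have GC: "\<bar>?G w\<bar> \<le> C" for w by (rule conv) (rule Cons.prems(2))+
  let ?xs = "\<lambda>m. is @ sweeps sw m"
  have xsI: "set (?xs m) \<subseteq> {0..<n}" for m using "is" set_sweeps[of m sw] sw by auto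
  have idI: "id \<in> {X. aper n X}" using aper_id by simp
  have near: "\<bar>?H X - ?G (pat n X)\<bar> \<le> 2 * C * shallow X" if X: "aper n X" for X
  proof (cases "deep n X")
    case True
    then show ?thesis using pat_stpB[OF X True i] by (simp add: shallow_def)
  next
    case False
    have "\<bar>?H X - ?G (pat n X)\<bar> \<le> \<bar>?H X\<bar> + \<bar>?G (pat n X)\<bar>" by (rule abs_triangle_ineq4)
    also have "\<dots> \<le> C + C" by (intro add_mono conv Cons.prems(2) GC)
    finally show ?thesis using False by (simp add: shallow_def)
  qed
  have d: "\<bar>evl p stA ?H (?xs m) id - evl p stA (\<lambda>X. ?G (pat n X)) (?xs m) id\<bar> \<le> 2 * C * evl p stA shallow (?xs m) id" for m
  proof -
    have 1: "evl p stA (\<lambda>X. ?H X - ?G (pat n X)) (?xs m) id \<le> evl p stA (\<lambda>X. 2 * C * shallow X) (?xs m) id"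
      by (rule A.evl_mono[OF _ xsI idI]) (use near in \<open>auto simp: abs_le_iff\<close>)
    have 2: "evl p stA (\<lambda>X. ?G (pat n X) - ?H X) (?xs m) id \<le> evl p stA (\<lambda>X. 2 * C * shallow X) (?xs m) id"
      by (rule A.evl_mono[OF _ xsI idI]) (use near in \<open>auto simp: abs_le_iff\<close>)
    show ?thesis using 1 2 unfolding evl_diff evl_cmult by (simp add: abs_le_iff)
  qed
  have l0: "(\<lambda>m. 2 * C * evl p stA shallow (?xs m) id) \<longlonglongrightarrow> 0"
    using tendsto_mult_left[OF shallow_prefix_tendsto_0[OF "is" aper_id], of "2 * C"] by simp
  have l1: "(\<lambda>m. evl p stA ?H (?xs m) id - evl p stA (\<lambda>X. ?G (pat n X)) (?xs m) id) \<longlonglongrightarrow> 0"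
    by (rule Lim_null_comparison[OF _ l0]) (use d in auto)
  have l2: "(\<lambda>m. evl p stA (\<lambda>X. ?G (pat n X)) (?xs m) id -
     evl p stA (\<lambda>X. evl p (stpR n) ?G (rev is) (pat n X)) (sweeps sw m) id) \<longlonglongrightarrow> 0"
    by (rule Cons.IH[OF "is" GC])
  have g: "evl p (stpR n) G (rev (i # is)) w = evl p (stpR n) ?G (rev is) w" for w
  proof -
    have "evl p (stpR n) G [i] = ?G" by (simp add: fun_eq_iff)
    then show ?thesis by (simp add: evl_append)
  qed
  have f: "evl p stA (\<lambda>X. G (pat n X)) ((i # is) @ sweeps sw m) id = evl p stA ?H (?xs m) id" for m
    using evl_front[OF i xsI[of m], of "\<lambda>X. G (pat n X)"] by simp
  show ?case unfolding f g by (rule tendsto_chain[OF l1 l2])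
qed simp

text \<open>Turning r blocks of sweeps at the front into ring steps replaces G by an almost constant
  function, whose value is close to L. The weights \<psi> do not see the replacement, so their sum
  against G is L times their total in the limit of large r.\<close>

lemma stationary_limit:
  fixes \<psi> :: "(nat \<Rightarrow> nat) \<Rightarrow> complex"
  assumes st: "\<And>G. (\<Sum>w | w permutes {1..n}. \<psi> w * of_real (evl p (stpR n) G (rev sw) w)) = (\<Sum>w | w permutes {1..n}. \<psi> w * of_real (G w))"
    and G: "\<And>w. \<bar>G w\<bar> \<le> C"
    and L: "(\<lambda>m. evl p stA (\<lambda>X. G (pat n X)) (sweeps sw m) id) \<longlonglongrightarrow> L"
  shows "(\<Sum>w | w permutes {1..n}. \<psi> w * of_real (G w)) = of_real L * (\<Sum>w | w permutes {1..n}. \<psi> w)"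
proof -
  let ?P = "{w. w permutes {1..n}}"
  have iter: "(\<Sum>w\<in>?P. \<psi> w * of_real (evl p (stpR n) G (rev (sweeps sw k)) w)) = (\<Sum>w\<in>?P. \<psi> w * of_real (G w))" for k G
  proof (induction k arbitrary: G)
    case (Suc k)
    have "evl p (stpR n) G (rev (sweeps sw (Suc k))) w = evl p (stpR n) (evl p (stpR n) G (rev sw)) (rev (sweeps sw k)) w" for w
      by (simp add: evl_append)
    then show ?case using Suc[of "evl p (stpR n) G (rev sw)"] st[of G] by simp
  qed simp
  define D where "D = (\<Sum>w\<in>?P. \<psi> w * of_real (G w)) - of_real L * (\<Sum>w\<in>?P. \<psi> w)"
  define N where "N = (\<Sum>w\<in>?P. norm (\<psi> w))"
  have "norm D \<le> ringc ^ r * (2 * C * N)" for r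
  proof -
    let ?K = "evl p (stpR n) G (rev (sweeps sw (r * ringT)))"
    obtain lo hi where lh: "\<And>w. w permutes {1..n} \<Longrightarrow> lo \<le> ?K w" "\<And>w. w permutes {1..n} \<Longrightarrow> ?K w \<le> hi"
      "hi - lo \<le> ringc ^ r * (2 * C)" using ring_oscillation[of G C r] G by blast
    have swI: "set (sweeps sw m) \<subseteq> {0..<n}" for m using set_sweeps[of m sw] sw by simp
    have idI: "id \<in> {X. aper n X}" using aper_id by simp
    let ?h = "\<lambda>m. evl p stA (\<lambda>X. ?K (pat n X)) (sweeps sw m) id"
    have "(\<lambda>m. evl p stA (\<lambda>X. G (pat n X)) (sweeps sw (r * ringT) @ sweeps sw m) id) \<longlonglongrightarrow> L"
      using LIMSEQ_ignore_initial_segment[OF L, of "r * ringT"] by (simp only: sweeps_add[symmetric] add.commute)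
    from tendsto_diff_0[OF this front_tendsto[where G = G and C = C, OF swI G]] have hL: "?h \<longlonglongrightarrow> L" .
    have h: "lo \<le> ?h m" "?h m \<le> hi" for m
      using A.evl_mono[of "\<lambda>_. lo" "\<lambda>X. ?K (pat n X)" "sweeps sw m" id, OF _ swI idI]
        A.evl_mono[of "\<lambda>X. ?K (pat n X)" "\<lambda>_. hi" "sweeps sw m" id, OF _ swI idI] lh(1,2) pat_permutes
      by (auto simp: evl_const)
    have Llh: "lo \<le> L" "L \<le> hi"
      using LIMSEQ_le_const[OF hL] LIMSEQ_le_const2[OF hL] h by blast+
    have "D = (\<Sum>w\<in>?P. \<psi> w * of_real (?K w)) - of_real L * (\<Sum>w\<in>?P. \<psi> w)"
      unfolding D_def iter ..
    also have "\<dots> = (\<Sum>w\<in>?P. \<psi> w * of_real (?K w - L))"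
      by (simp add: sum_distrib_left sum_subtractf algebra_simps)
    finally have "norm D \<le> (\<Sum>w\<in>?P. norm (\<psi> w * of_real (?K w - L)))" by (simp add: norm_sum)
    also have "\<dots> \<le> (\<Sum>w\<in>?P. norm (\<psi> w) * (ringc ^ r * (2 * C)))"
    proof (rule sum_mono)
      fix w assume "w \<in> ?P"
      then have "\<bar>?K w - L\<bar> \<le> ringc ^ r * (2 * C)" using lh(1,2)[of w] lh(3) Llh by (auto simp: abs_le_iff)
      then show "norm (\<psi> w * of_real (?K w - L)) \<le> norm (\<psi> w) * (ringc ^ r * (2 * C))"
        by (simp add: norm_mult mult_left_mono del: of_real_diff)
    qed
    also have "\<dots> = ringc ^ r * (2 * C * N)" by (simp add: N_def sum_distrib_right[symmetric])
    finally show ?thesis .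
  qed
  moreover have "(\<lambda>r. ringc ^ r * (2 * C * N)) \<longlonglongrightarrow> 0"
    using tendsto_mult_right[OF LIMSEQ_realpow_zero[OF ringc], of "2 * C * N"] by simp
  ultimately have "norm D \<le> 0" by (intro LIMSEQ_le_const) auto
  then show ?thesis by (simp add: D_def)
qed

end

text \<open>The inverse of w^-1 w0 is w0 w, so this is F at w^-1 w0 in the indexing of the theorem
  (\<open>psi_Fw0\<close>). The factor w0 also turns the descents of w, where the TASEP gains mass,
  into the ascents that the exchange relation starts from.\<close>

definition psi :: "nat \<Rightarrow> (nat \<Rightarrow> complex) \<Rightarrow> (nat \<Rightarrow> nat) \<Rightarrow> complex" where
  "psi n y w = hev n (asep_deg n) (asepG n (wlong n \<circ> w)) y"

text \<open>A TASEP step leaves the fraction 1 - p of the mass at an ascent in place and moves p of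
  it to the descent. By \<open>hev_exchange_0\<close> exactly this happens to the values of the
  polynomials when the two coordinates at the edge are exchanged.\<close>

lemma psi_step:
  fixes p :: real
  assumes n2: "2 \<le> n" and i: "i < n"
    and y: "y (edge n i) \<noteq> y (Suc i)" "y (Suc i) \<noteq> 0" "of_real (1 - p) = y (edge n i) / y (Suc i)"
  shows "(\<Sum>w | w permutes {1..n}. psi n y w * of_real (p * G (stpR n i True w) + (1 - p) * G (stpR n i False w)))
    = (\<Sum>w | w permutes {1..n}. psi n (y \<circ> swp (edge n i) (Suc i)) w * of_real (G w))"
proof -
  define e j s where "e = edge n i" and "j = Suc i" and "s = swp e j"
  have ej: "e \<in> {1..n}" "j \<in> {1..n}" "e \<noteq> j" "nxt n e = j"
    using edge_in[OF i] nxt_edge[OF i] i nxt_neq[OF n2 edge_in[OF i]] by (auto simp: e_def j_def)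
  let ?P = "{w. w permutes {1..n}}" and ?A = "{w. w permutes {1..n} \<and> w e < w j}" and ?B = "{w. w permutes {1..n} \<and> w j < w e}"
  let ?g = "\<lambda>w. complex_of_real (G w)" and ?y = "y \<circ> s" and ?p = "complex_of_real p"
  note sol = asepG_sol(1)[OF n2]
  have fin: "finite ?A" "finite ?B"
    using finite_permutations[of "{1..n}"] by (auto intro: finite_subset[of _ ?P])
  have P: "?P = ?A \<union> ?B" "?A \<inter> ?B = {}"
  proof -
    have "w e \<noteq> w j" if "w permutes {1..n}" for w using inj_eq[OF permutes_inj[OF that]] ej by simp
    then show "?P = ?A \<union> ?B" by (auto simp: neq_iff)
  qed auto
  have ss: "w \<circ> s \<circ> s = w" for w :: "nat \<Rightarrow> nat" by (simp add: s_def o_assoc[symmetric])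
  have ws: "w \<circ> s permutes {1..n}" if "w permutes {1..n}" for w
    unfolding s_def by (rule permutes_comp_swp[OF that ej(1,2)])
  have s_ej: "s e = j" "s j = e" by (simp_all add: s_def)
  have sw: "(w \<circ> s) e = w j" "(w \<circ> s) j = w e" for w :: "nat \<Rightarrow> nat" by (simp_all add: s_def)
  have B: "psi n ?y (w \<circ> s) = (1 - ?p) * psi n y (w \<circ> s)" "psi n ?y w = psi n y w + ?p * psi n y (w \<circ> s)" if w: "w \<in> ?B" for w
  proof -
    let ?\<mu> = "wlong n \<circ> w"
    have wp: "w permutes {1..n}" using w by simp
    have \<mu>: "?\<mu> permutes {1..n}" by (rule permutes_compose[OF wp wlong_permutes])
    have wi: "w e \<in> {1..n}" "w j \<in> {1..n}" using permutes_in_image[OF wp] ej by blast+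
    have lt: "?\<mu> e < ?\<mu> (nxt n e)" using wlong_less_iff[OF wi] w ej(4) by simp
    have y': "y e \<noteq> y (nxt n e)" "y (nxt n e) \<noteq> 0" "of_real (1 - p) = y e / y (nxt n e)" using y ej(4) by (simp_all add: e_def j_def)
    have o: "wlong n \<circ> (w \<circ> s) = ?\<mu> \<circ> s" by (simp add: o_assoc)
    have "psi n ?y (w \<circ> s) = of_real (1 - p) * psi n y (w \<circ> s)"
      unfolding psi_def o unfolding s_def ej(4)[symmetric] by (rule hev_exchange_0(1)[OF n2 sol \<mu> ej(1) lt y'])
    then show "psi n ?y (w \<circ> s) = (1 - ?p) * psi n y (w \<circ> s)" by simp
    have "psi n ?y w = psi n y w + (1 - of_real (1 - p)) * psi n y (w \<circ> s)"
      unfolding psi_def o unfolding s_def ej(4)[symmetric] by (rule hev_exchange_0(2)[OF n2 sol \<mu> ej(1) lt y'])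
    then show "psi n ?y w = psi n y w + ?p * psi n y (w \<circ> s)" by simp
  qed
  have A: "psi n ?y w = (1 - ?p) * psi n y w" if w: "w \<in> ?A" for w
  proof -
    have "w \<circ> s \<in> ?B" using w ws sw[of w] by simp
    from B(1)[OF this] show ?thesis unfolding ss .
  qed
  have bij: "(\<Sum>w\<in>?A. psi n y w * (?p * ?g (w \<circ> s))) = (\<Sum>w\<in>?B. psi n y (w \<circ> s) * (?p * ?g w))"
    by (rule sum.reindex_bij_witness[where i = "\<lambda>w. w \<circ> s" and j = "\<lambda>w. w \<circ> s"]) (use ss ws s_ej in auto)
  have "(\<Sum>w\<in>?P. psi n y w * of_real (p * G (stpR n i True w) + (1 - p) * G (stpR n i False w)))
    = (\<Sum>w\<in>?A. psi n y w * (?p * ?g (w \<circ> s) + (1 - ?p) * ?g w)) + (\<Sum>w\<in>?B. psi n y w * ?g w)"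
  proof -
    have stR: "stpR n i False w = w" "stpR n i True w = (if w e < w j then w \<circ> s else w)" for w
      by (simp_all add: stpR_def Let_def e_def[symmetric] ej(4) s_def)
    show ?thesis unfolding P(1) sum.union_disjoint[OF fin P(2)] stR
      by (intro arg_cong2[where f = "(+)"] sum.cong) (auto simp: algebra_simps)
  qed
  also have "\<dots> = (\<Sum>w\<in>?A. psi n ?y w * ?g w) + (\<Sum>w\<in>?B. psi n ?y w * ?g w)"
  proof -
    have "(\<Sum>w\<in>?A. psi n y w * (?p * ?g (w \<circ> s) + (1 - ?p) * ?g w))
      = (\<Sum>w\<in>?A. psi n y w * (?p * ?g (w \<circ> s))) + (\<Sum>w\<in>?A. psi n ?y w * ?g w)"
      unfolding sum.distrib[symmetric] by (rule sum.cong[OF refl]) (simp only: A, simp add: algebra_simps)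
    moreover have "(\<Sum>w\<in>?B. psi n ?y w * ?g w) = (\<Sum>w\<in>?B. psi n y w * ?g w) + (\<Sum>w\<in>?B. psi n y (w \<circ> s) * (?p * ?g w))"
      unfolding sum.distrib[symmetric] by (rule sum.cong[OF refl]) (simp only: B(2), simp add: algebra_simps)
    ultimately show ?thesis using bij by simp
  qed
  also have "\<dots> = (\<Sum>w\<in>?P. psi n ?y w * ?g w)" unfolding P(1) sum.union_disjoint[OF fin P(2)] ..
  finally show ?thesis unfolding e_def[symmetric] j_def[symmetric] s_def[symmetric] .
qed

text \<open>Through \<open>edge\<close> the site 0 is read as n, so the point returns to itself
  after a full sweep.\<close>

definition spot :: "nat \<Rightarrow> complex \<Rightarrow> nat \<Rightarrow> nat \<Rightarrow> complex" where
  "spot n q r = (\<lambda>k. if k = edge n r then q else 1)"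

lemma spot_swap:
  assumes "i < n" "2 \<le> n"
  shows "spot n q (Suc i) \<circ> swp (edge n i) (Suc i) = spot n q i"
    "spot n q i \<circ> swp (edge n i) (Suc i) = spot n q (Suc i)"
    "edge n (Suc i) = Suc i" "edge n i \<noteq> Suc i"
proof -
  show e: "edge n (Suc i) = Suc i" by (simp add: edge_def)
  show ne: "edge n i \<noteq> Suc i" using assms by (auto simp: edge_def)
  show "spot n q (Suc i) \<circ> swp (edge n i) (Suc i) = spot n q i"
    "spot n q i \<circ> swp (edge n i) (Suc i) = spot n q (Suc i)"
    using e ne by (auto simp: fun_eq_iff spot_def Transposition.transpose_def)
qed

lemma spot_ends: "spot n q n = spot n q 0" "spot n q 0 = lastpt n q"
  by (simp_all add: spot_def edge_def lastpt_def)

text \<open>The reversed sweep runs through the edges n - 1, ..., 0 and carries q from site n down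
  to site 0, which is n again. At each edge q stands at the right end, so 1 / q = 1 - p.\<close>

lemma psi_stationary_up:
  fixes p :: real
  assumes n2: "2 \<le> n" and p: "0 < p" "p < 1"
  shows "(\<Sum>w | w permutes {1..n}. psi n (lastpt n (of_real (inverse (1 - p)))) w * of_real (evl p (stpR n) G (rev [0..<n]) w))
    = (\<Sum>w | w permutes {1..n}. psi n (lastpt n (of_real (inverse (1 - p)))) w * of_real (G w))"
proof -
  let ?q = "complex_of_real (inverse (1 - p))"
  have q: "?q \<noteq> 0" "?q \<noteq> 1" "of_real (1 - p) = 1 / ?q" using p by (auto simp: inverse_eq_divide)
  have "r \<le> n \<Longrightarrow> (\<Sum>w | w permutes {1..n}. psi n (spot n ?q r) w * of_real (evl p (stpR n) G (rev [0..<r]) w))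
    = (\<Sum>w | w permutes {1..n}. psi n (spot n ?q 0) w * of_real (G w))" for r
  proof (induction r)
    case (Suc r)
    then have r: "r < n" by simp
    note sp = spot_swap[OF r n2]
    have y: "spot n ?q (Suc r) (edge n r) = 1" "spot n ?q (Suc r) (Suc r) = ?q" using sp(3,4) by (simp_all add: spot_def)
    have "(\<Sum>w | w permutes {1..n}. psi n (spot n ?q (Suc r)) w * of_real (evl p (stpR n) G (rev [0..<Suc r]) w))
      = (\<Sum>w | w permutes {1..n}. psi n (spot n ?q r) w * of_real (evl p (stpR n) G (rev [0..<r]) w))"
      using psi_step[OF n2 r, where y = "spot n ?q (Suc r)" and p = p and G = "evl p (stpR n) G (rev [0..<r])"] q
      unfolding y sp(1) by simp
    then show ?case using Suc r by simp
  qed simp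
  from this[of n] show ?thesis unfolding spot_ends by simp
qed

text \<open>Here the edges 0, ..., n - 1 carry q upwards. It stands at the left end of each edge, so
  q / 1 = 1 - p.\<close>

lemma psi_stationary_down:
  fixes p :: real
  assumes n2: "2 \<le> n" and p: "0 < p" "p < 1"
  shows "(\<Sum>w | w permutes {1..n}. psi n (lastpt n (of_real (1 - p))) w * of_real (evl p (stpR n) G (rev (rev [0..<n])) w))
    = (\<Sum>w | w permutes {1..n}. psi n (lastpt n (of_real (1 - p))) w * of_real (G w))"
proof -
  let ?q = "complex_of_real (1 - p)"
  have q: "?q \<noteq> 1" "of_real (1 - p) = ?q / 1" using p by auto
  have "k \<le> n \<Longrightarrow> (\<Sum>w | w permutes {1..n}. psi n (spot n ?q (n - k)) w * of_real (evl p (stpR n) G [n - k..<n] w))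
    = (\<Sum>w | w permutes {1..n}. psi n (spot n ?q n) w * of_real (G w))" for k
  proof (induction k)
    case (Suc k)
    define r where "r = n - Suc k"
    have r: "r < n" "n - k = Suc r" using Suc.prems by (auto simp: r_def)
    note sp = spot_swap[OF r(1) n2]
    have y: "spot n ?q r (edge n r) = ?q" "spot n ?q r (Suc r) = 1" using sp(3,4) by (simp_all add: spot_def)
    have "[r..<n] = r # [Suc r..<n]" using r by (simp add: upt_conv_Cons)
    then have "(\<Sum>w | w permutes {1..n}. psi n (spot n ?q r) w * of_real (evl p (stpR n) G [r..<n] w))
      = (\<Sum>w | w permutes {1..n}. psi n (spot n ?q (Suc r)) w * of_real (evl p (stpR n) G [Suc r..<n] w))"
      using psi_step[OF n2 r(1), where y = "spot n ?q r" and p = p and G = "evl p (stpR n) G [Suc r..<n]"] q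
      unfolding y sp(2) by simp
    then show ?case using Suc r unfolding r_def[symmetric] by simp
  qed simp
  from this[of n] show ?thesis by (simp add: spot_ends)
qed

lemma psi_Fw0:
  assumes n2: "2 \<le> n" and w: "w permutes {1..n}"
  shows "Fw0 n (inv w \<circ> wlong n) y = psi n y w"
proof -
  have "inv (inv w \<circ> wlong n) = wlong n \<circ> w"
    by (rule inv_unique_comp)
      (use permutes_inv_o[OF w] wlong_comp_wlong[of n] in \<open>simp_all add: fun_eq_iff wlong_wlong\<close>)
  then show ?thesis
    unfolding Fw0_def psi_def using asep_F0_hev[OF n2 permutes_compose[OF w wlong_permutes]] by simp
qed

lemma psi_sum:
  assumes n2: "2 \<le> n"
  shows "(\<Sum>w | w permutes {1..n}. psi n y w) = asep_P0 n stair y"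
  unfolding asep_P0_hev[OF n2] psi_def
  by (rule sum.reindex_bij_witness[where i = "\<lambda>w. wlong n \<circ> w" and j = "\<lambda>w. wlong n \<circ> w"])
    (auto simp: o_assoc wlong_comp_wlong simp del: One_nat_def intro: permutes_compose wlong_permutes)

lemma psi_id:
  assumes "2 \<le> n" "q \<noteq> 0"
  shows "psi n (lastpt n q) id \<noteq> 0"
  using asepG_wlong[OF assms(1), of "lastpt n q"] assms(2) by (auto simp: psi_def lastpt_def)

context affine_chain
begin

theorem pattern_limit:
  fixes q :: complex
  assumes dir: "sw = [0..<n] \<and> q = of_real (inverse (1 - p)) \<or> sw = rev [0..<n] \<and> q = of_real (1 - p)"
    and L: "\<And>w. w permutes {1..n} \<Longrightarrow>
      (\<lambda>m. evl p stA (\<lambda>X. if pat n X = w then 1 else 0) (sweeps sw m) id) \<longlonglongrightarrow> L w"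
    and w: "w permutes {1..n}"
  shows "of_real (L w) = Fw0 n (inv w \<circ> wlong n) (lastpt n q) / asep_P0 n stair (lastpt n q)"
proof -
  let ?\<psi> = "psi n (lastpt n q)" and ?S = "asep_P0 n stair (lastpt n q)"
  have q0: "q \<noteq> 0" using dir p by auto
  have st: "(\<Sum>w | w permutes {1..n}. ?\<psi> w * of_real (evl p (stpR n) G (rev sw) w))
    = (\<Sum>w | w permutes {1..n}. ?\<psi> w * of_real (G w))" for G
    using dir
  proof (elim disjE conjE)
    assume "sw = [0..<n]" "q = of_real (inverse (1 - p))"
    then show ?thesis using psi_stationary_up[OF n2 p, of G] by (simp only:)
  next
    assume "sw = rev [0..<n]" "q = of_real (1 - p)"
    then show ?thesis using psi_stationary_down[OF n2 p, of G] by (simp only:)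
  qed
  have key: "?\<psi> v = of_real (L v) * ?S" if v: "v permutes {1..n}" for v
  proof -
    let ?G = "\<lambda>x. if x = v then 1 else (0::real)"
    have "(\<Sum>w | w permutes {1..n}. ?\<psi> w * of_real (?G w)) = of_real (L v) * (\<Sum>w | w permutes {1..n}. ?\<psi> w)"
      by (rule stationary_limit[OF st, of ?G 1]) (use L[OF v] in auto)
    moreover have "(\<Sum>w | w permutes {1..n}. ?\<psi> w * of_real (?G w)) = (\<Sum>w\<in>{v}. ?\<psi> w)"
      by (rule sum.mono_neutral_cong_right) (use v finite_permutations[of "{1..n}"] in auto)
    ultimately show ?thesis unfolding psi_sum[OF n2] by simp
  qed
  \<comment> \<open>If the total were zero, \<open>key\<close> would make every component vanish,
    but the component at the identity is a monomial with the value q^(n-1).\<close>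
  have "?S \<noteq> 0" using key[OF permutes_id] psi_id[OF n2 q0] by auto
  then show ?thesis using key[OF w] unfolding psi_Fw0[OF n2 w] by simp
qed

end

section \<open>Alcoves and chambers\<close>

text \<open>A vector \<open>\<gamma>\<close> is extended to all integers by \<open>\<gamma>\<^sub>x\<^sub>+\<^sub>n = \<gamma>\<^sub>x - 1\<close>; the reflections then all act
  by precomposition.\<close>

definition lift :: "nat \<Rightarrow> vec \<Rightarrow> int \<Rightarrow> real" where
  "lift n \<gamma> x = \<gamma> (nat ((x - 1) mod int n + 1)) - real_of_int ((x - 1) div int n)"

text \<open>On lifted vectors u is precomposition with X (\<open>acts_lift\<close>). The clause on
  sums ensures that \<open>Vsp\<close> is preserved.\<close>

definition acts :: "nat \<Rightarrow> (vec \<Rightarrow> vec) \<Rightarrow> (int \<Rightarrow> int) \<Rightarrow> bool" where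
  "acts n u X \<longleftrightarrow> aper n X \<and>
     (\<forall>\<gamma> k. u \<gamma> k = (if k \<in> {1..n} then lift n \<gamma> (X (int k)) else \<gamma> k)) \<and>
     (\<forall>\<gamma>. (\<Sum>k\<in>{1..n}. u \<gamma> k) = (\<Sum>k\<in>{1..n}. \<gamma> k))"

context affine
begin

lemma lift_pos: "k \<in> {1..n} \<Longrightarrow> lift n \<gamma> (int k) = \<gamma> k"
  by (auto simp: lift_def)

lemma lift_shift: "lift n \<gamma> (x + int n) = lift n \<gamma> x - 1"
proof -
  have e: "x + int n - 1 = (x - 1) + int n" by simp
  have "(x + int n - 1) mod int n = (x - 1) mod int n" unfolding e by simp
  moreover have "(x + int n - 1) div int n = (x - 1) div int n + 1" unfolding e using n2 by simp
  ultimately show ?thesis by (simp add: lift_def)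
qed

lemma shift_mult:
  fixes f :: "int \<Rightarrow> real"
  assumes "\<And>x. f (x + int n) = f x - 1"
  shows "f (x + int n * m) = f x - real_of_int m"
proof (induction m rule: int_induct[of _ 0])
  case (step1 i)
  have e: "x + int n * (i + 1) = (x + int n * i) + int n" by (simp add: algebra_simps)
  show ?case unfolding e assms using step1 by simp
next
  case (step2 i)
  have e: "x + int n * i = (x + int n * (i - 1)) + int n" by (simp add: algebra_simps)
  show ?case using step2(2) unfolding e assms by simp
qed simp

lemma lift_mult: "lift n \<gamma> (x + int n * m) = lift n \<gamma> x - real_of_int m"
  by (rule shift_mult[where f = "lift n \<gamma>"]) (rule lift_shift)

lemma int_decomp:
  obtains k m where "k \<in> {1..n}" "x = int k + int n * m"
proof -
  have np: "0 < int n" using n2 by simp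
  define k where "k = nat ((x - 1) mod int n + 1)"
  have r: "0 \<le> (x - 1) mod int n" "(x - 1) mod int n < int n" using np by auto
  then have k: "int k = (x - 1) mod int n + 1" by (simp add: k_def)
  have "x - 1 = int n * ((x - 1) div int n) + (x - 1) mod int n" by simp
  then have "x = int k + int n * ((x - 1) div int n)" unfolding k by linarith
  moreover have "k \<in> {1..n}" using r k by auto
  ultimately show ?thesis by (rule that[rotated])
qed

lemma lift_eqI:
  assumes "\<And>x. f (x + int n) = f x - 1" "\<And>k. k \<in> {1..n} \<Longrightarrow> f (int k) = \<gamma> k"
  shows "lift n \<gamma> = f"
proof
  fix x
  obtain k m where x: "k \<in> {1..n}" "x = int k + int n * m" by (rule int_decomp)
  have "f x = f (int k) - real_of_int m" unfolding x(2) by (rule shift_mult[where f = f]) (rule assms(1))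
  then show "lift n \<gamma> x = f x"
    using lift_mult[of \<gamma> "int k" m] lift_pos[OF x(1), of \<gamma>] assms(2)[OF x(1)] x(2) by simp
qed

lemma lift_comp_shift: "aper n X \<Longrightarrow> lift n \<gamma> (X (x + int n)) = lift n \<gamma> (X x) - 1"
  using lift_shift[of \<gamma> "X x"] by (simp add: aper_def)

lemma aswap_pos:
  assumes i: "i \<in> {1..<n}" and k: "k \<in> {1..n}"
  shows "aswap n (int i) (int k) = int (swp i (Suc i) k)"
proof -
  consider "k = i" | "k = Suc i" | "k \<noteq> i" "k \<noteq> Suc i" by blast
  then show ?thesis
  proof cases
    case 3
    have "\<bar>int k - int i\<bar> < int n" "\<bar>int k - int i - 1\<bar> < int n" using k i by auto
    then have "\<not> int n dvd int k - int i" "\<not> int n dvd int k - int i - 1"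
      using dvd_small[of n "int k - int i"] dvd_small[of n "int k - int i - 1"] 3 by auto
    then show ?thesis using 3 by (simp add: aswap_def)
  qed (use aswap_same[of "int i" "int i"] in \<open>auto simp: add.commute\<close>)
qed

lemma aswap_0: "aswap n 0 1 = 0" "aswap n 0 (int n) = int n + 1"
  "k \<in> {1..n} \<Longrightarrow> k \<noteq> 1 \<Longrightarrow> k \<noteq> n \<Longrightarrow> aswap n 0 (int k) = int k"
proof -
  show "aswap n 0 1 = 0" "aswap n 0 (int n) = int n + 1"
    using aswap_same[of 0 0] aswap_same(1)[of "int n" 0] by auto
  assume "k \<in> {1..n}" "k \<noteq> 1" "k \<noteq> n"
  then have "\<not> int n dvd int k" "\<not> int n dvd int k - 1"
    using dvd_small[of n "int k"] dvd_small[of n "int k - 1"] by auto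
  then show "aswap n 0 (int k) = int k" by (simp add: aswap_def)
qed

lemma lift_srefl:
  assumes i: "i < n"
  shows "lift n (srefl n i \<gamma>) = lift n \<gamma> \<circ> aswap n (int i)"
proof (rule lift_eqI)
  show "(lift n \<gamma> \<circ> aswap n (int i)) (x + int n) = (lift n \<gamma> \<circ> aswap n (int i)) x - 1" for x
    using lift_comp_shift[OF aper_aswap] by simp
  fix k assume k: "k \<in> {1..n}"
  show "(lift n \<gamma> \<circ> aswap n (int i)) (int k) = srefl n i \<gamma> k"
  proof (cases "i = 0")
    case False
    then have i': "i \<in> {1..<n}" using i by auto
    have "swp i (Suc i) k \<in> {1..n}" using i' k by (auto simp: Transposition.transpose_def)
    then have "(lift n \<gamma> \<circ> aswap n (int i)) (int k) = \<gamma> (swp i (Suc i) k)"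
      using aswap_pos[OF i' k] lift_pos by simp
    then show ?thesis using False i by (auto simp: srefl_def Transposition.transpose_def)
  next
    case True
    have l: "lift n \<gamma> 0 = \<gamma> n + 1" "lift n \<gamma> (int n + 1) = \<gamma> 1 - 1"
      using lift_shift[of \<gamma> 0] lift_shift[of \<gamma> 1] lift_pos[of n \<gamma>] lift_pos[of 1 \<gamma>] n2 by (auto simp: add.commute)
    consider "k = 1" | "k = n" | "k \<noteq> 1" "k \<noteq> n" by blast
    then show ?thesis
    proof cases
      case 3
      then show ?thesis using aswap_0(3)[OF k] lift_pos[OF k] True by (simp add: srefl_def)
    qed (use True aswap_0(1,2) l n2 in \<open>auto simp: srefl_def\<close>)
  qed
qed

lemma srefl_outside: "i < n \<Longrightarrow> k \<notin> {1..n} \<Longrightarrow> srefl n i \<gamma> k = \<gamma> k"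
  using n2 by (auto simp: srefl_def)

lemma srefl_sum:
  assumes "i < n"
  shows "(\<Sum>k\<in>{1..n}. srefl n i \<gamma> k) = (\<Sum>k\<in>{1..n}. \<gamma> k)"
proof -
  have u: "(\<Sum>k\<in>{1..n}. (\<gamma>(a := p, b := q)) k) = (\<Sum>k\<in>{1..n}. \<gamma> k)"
    if "a \<in> {1..n}" "b \<in> {1..n}" "a \<noteq> b" "p + q = \<gamma> a + \<gamma> b" for a b p q
  proof -
    have e: "{1..n} = insert a (insert b ({1..n} - {a, b}))" using that by auto
    have "(\<Sum>k\<in>{1..n} - {a, b}. (\<gamma>(a := p, b := q)) k) = (\<Sum>k\<in>{1..n} - {a, b}. \<gamma> k)"
      by (rule sum.cong) auto
    moreover have "(\<Sum>k\<in>insert a (insert b ({1..n} - {a, b})). f k) = f a + (f b + (\<Sum>k\<in>{1..n} - {a, b}. f k))" for f :: "nat \<Rightarrow> real"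
      using that(3) by simp
    ultimately show ?thesis using that by (subst (1 2) e) simp
  qed
  show ?thesis
    using assms n2 u[of 1 n "\<gamma> n + 1" "\<gamma> 1 - 1"] u[of i "Suc i" "\<gamma> (Suc i)" "\<gamma> i"]
    by (cases "i = 0") (auto simp: srefl_def)
qed

lemma acts_id: "acts n id id"
  unfolding acts_def using aper_id lift_pos by (auto simp: fun_eq_iff)

lemma acts_sgen:
  assumes u: "acts n u X" and i: "i < n"
  shows "acts n (sgen n i u) (aswap n (int i) \<circ> X)"
proof -
  have X: "aper n X" and f: "\<And>\<gamma> k. u \<gamma> k = (if k \<in> {1..n} then lift n \<gamma> (X (int k)) else \<gamma> k)"
    and s: "\<And>\<gamma>. (\<Sum>k\<in>{1..n}. u \<gamma> k) = (\<Sum>k\<in>{1..n}. \<gamma> k)"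
    using u unfolding acts_def by blast+
  show ?thesis unfolding acts_def
  proof (intro conjI allI)
    show "aper n (aswap n (int i) \<circ> X)" by (rule aper_comp[OF aper_aswap X])
    fix \<gamma> k
    show "sgen n i u \<gamma> k = (if k \<in> {1..n} then lift n \<gamma> ((aswap n (int i) \<circ> X) (int k)) else \<gamma> k)"
      using f[of "srefl n i \<gamma>" k] lift_srefl[OF i, of \<gamma>] srefl_outside[OF i, of k \<gamma>] by (simp add: sgen_def)
    show "(\<Sum>k\<in>{1..n}. sgen n i u \<gamma> k) = (\<Sum>k\<in>{1..n}. \<gamma> k)"
      unfolding sgen_def o_apply s by (rule srefl_sum[OF i])
  qed
qed

lemma acts_lift:
  assumes "acts n u X"
  shows "lift n (u \<gamma>) = lift n \<gamma> \<circ> X"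
proof (rule lift_eqI)
  have "aper n X" using assms by (simp add: acts_def)
  then show "(lift n \<gamma> \<circ> X) (x + int n) = (lift n \<gamma> \<circ> X) x - 1" for x using lift_comp_shift by simp
  show "k \<in> {1..n} \<Longrightarrow> (lift n \<gamma> \<circ> X) (int k) = u \<gamma> k" for k using assms by (simp add: acts_def)
qed

lemma acts_Vsp: "acts n u X \<Longrightarrow> \<gamma> \<in> Vsp n \<Longrightarrow> u \<gamma> \<in> Vsp n"
  by (auto simp: acts_def Vsp_def)

text \<open>Stated for a translation invariant relation to cover the closed and the open alcove at
  once. The step from n to n + 1 produces the wall of s_0.\<close>

lemma chamber_step_iff:
  "(\<forall>x. P (lift n \<gamma> (x + 1)) (lift n \<gamma> x)) \<longleftrightarrow> (\<forall>i\<in>{1..<n}. P (\<gamma> (Suc i)) (\<gamma> i)) \<and> P (\<gamma> 1 - 1) (\<gamma> n)"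
  if P: "\<And>a b c. P (a - c) (b - c) \<longleftrightarrow> P a b" for P :: "real \<Rightarrow> real \<Rightarrow> bool"
proof
  have e: "int i + 1 = int (Suc i)" for i by simp
  have n1: "n \<in> {1..n}" "1 \<in> {1..n}" using n2 by auto
  have last: "lift n \<gamma> (int n + 1) = \<gamma> 1 - 1"
    using lift_shift[of \<gamma> 1] lift_pos[OF n1(2), of \<gamma>] by (simp add: add.commute)
  {
    assume h: "\<forall>x. P (lift n \<gamma> (x + 1)) (lift n \<gamma> x)"
    have "P (\<gamma> (Suc i)) (\<gamma> i)" if "i \<in> {1..<n}" for i
      using h[rule_format, of "int i"] lift_pos[of i \<gamma>] lift_pos[of "Suc i" \<gamma>] that unfolding e by auto
    then show "(\<forall>i\<in>{1..<n}. P (\<gamma> (Suc i)) (\<gamma> i)) \<and> P (\<gamma> 1 - 1) (\<gamma> n)"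
      using h[rule_format, of "int n"] last lift_pos[OF n1(1), of \<gamma>] by simp
  }
  assume h: "(\<forall>i\<in>{1..<n}. P (\<gamma> (Suc i)) (\<gamma> i)) \<and> P (\<gamma> 1 - 1) (\<gamma> n)"
  show "\<forall>x. P (lift n \<gamma> (x + 1)) (lift n \<gamma> x)"
  proof
    fix x
    obtain k m where x: "k \<in> {1..n}" "x = int k + int n * m" by (rule int_decomp)
    have x1: "x + 1 = (int k + 1) + int n * m" unfolding x(2) by simp
    have "P (lift n \<gamma> (int k + 1)) (lift n \<gamma> (int k))"
    proof (cases "k = n")
      case True
      then show ?thesis using h last lift_pos[OF n1(1), of \<gamma>] by simp
    next
      case False
      then have "k \<in> {1..<n}" "Suc k \<in> {1..n}" using x(1) by auto
      then show ?thesis using h lift_pos[OF x(1), of \<gamma>] lift_pos[of "Suc k" \<gamma>] unfolding e by simp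
    qed
    then show "P (lift n \<gamma> (x + 1)) (lift n \<gamma> x)"
      unfolding x1 unfolding x(2) lift_mult P .
  qed
qed

text \<open>In terms of lifts the alcove consists of the antitone functions, all n walls being steps
  from x to x + 1.\<close>

lemma alcoveA_iff: "\<gamma> \<in> alcoveA n \<longleftrightarrow> \<gamma> \<in> Vsp n \<and> (\<forall>x. lift n \<gamma> (x + 1) \<le> lift n \<gamma> x)"
  using chamber_step_iff[of "(\<le>)" \<gamma>] by (auto simp: alcoveA_def chamberC_def)

lemma alcoveA_int_iff: "\<gamma> \<in> alcoveA_int n \<longleftrightarrow> \<gamma> \<in> Vsp n \<and> (\<forall>x. lift n \<gamma> (x + 1) < lift n \<gamma> x)"
  using chamber_step_iff[of "(<)" \<gamma>] by (auto simp: alcoveA_int_def)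

lemma antitone_steps:
  fixes f :: "int \<Rightarrow> real"
  shows "(\<And>x. f (x + 1) \<le> f x) \<Longrightarrow> x \<le> y \<Longrightarrow> f y \<le> f x"
    and "(\<And>x. f (x + 1) < f x) \<Longrightarrow> x < y \<Longrightarrow> f y < f x"
proof -
  have 1: "f (x + int k) \<le> f x" if "\<And>x. f (x + 1) \<le> f x" for k x
  proof (induction k)
    case (Suc k)
    have e: "x + int (Suc k) = (x + int k) + 1" by simp
    show ?case unfolding e using that[of "x + int k"] Suc by linarith
  qed simp
  show w: "(\<And>x. f (x + 1) \<le> f x) \<Longrightarrow> x \<le> y \<Longrightarrow> f y \<le> f x" for x y
    using 1[of x "nat (y - x)"] by simp
  assume s: "\<And>x. f (x + 1) < f x" and "x < y"
  have "f y \<le> f (x + 1)" by (rule w) (use s \<open>x < y\<close> in \<open>auto intro: less_imp_le\<close>)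
  then show "f y < f x" using s[of x] by linarith
qed

text \<open>The vector \<rho>/n. Its lift is affine with slope -1/n, so it compares any two distinct
  integers strictly.\<close>

definition centre :: vec where
  "centre k = (if k \<in> {1..n} then (real n + 1) / (2 * real n) - real k / real n else 0)"

lemma lift_centre: "lift n centre = (\<lambda>x. (real n + 1) / (2 * real n) - real_of_int x / real n)"
  by (rule lift_eqI) (use n2 in \<open>auto simp: centre_def field_simps\<close>)

lemma centre_Vsp: "centre \<in> Vsp n"
proof -
  have s: "(\<Sum>k\<in>{1..m}. real k) = real m * (real m + 1) / 2" for m
    by (induction m) (auto simp: field_simps)
  have "(\<Sum>k\<in>{1..n}. centre k) = (\<Sum>k\<in>{1..n}. (real n + 1) / (2 * real n) - real k / real n)"
    by (intro sum.cong) (auto simp: centre_def)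
  also have "\<dots> = real n * ((real n + 1) / (2 * real n)) - (\<Sum>k\<in>{1..n}. real k) / real n"
    by (simp add: sum_subtractf sum_divide_distrib)
  also have "\<dots> = 0" unfolding s using n2 by (simp add: field_simps)
  finally have "(\<Sum>k\<in>{1..n}. centre k) = 0" .
  then show ?thesis by (auto simp: Vsp_def centre_def)
qed

lemma lift_centre_less: "lift n centre x < lift n centre y \<longleftrightarrow> y < x"
  unfolding lift_centre using n2 by (simp add: divide_strict_right_mono divide_less_cancel)

lemma centre_alcove: "centre \<in> alcoveA n"
  unfolding alcoveA_iff using centre_Vsp lift_centre_less by (auto intro: less_imp_le)

text \<open>The foot of the perpendicular from \<open>centre\<close> to the wall of s_i. No other
  hyperplane of the arrangement passes through this point, as the proof of
  \<open>not_back_iff\<close> shows.\<close>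

definition facet :: "nat \<Rightarrow> vec" where
  "facet i k = (centre k + srefl n i centre k) / 2"

lemma lift_facet:
  assumes "i < n"
  shows "lift n (facet i) = (\<lambda>x. (lift n centre x + lift n centre (aswap n (int i) x)) / 2)"
proof (rule lift_eqI)
  fix x
  show "(lift n centre (x + int n) + lift n centre (aswap n (int i) (x + int n))) / 2
    = (lift n centre x + lift n centre (aswap n (int i) x)) / 2 - 1"
    using lift_shift[of centre x] lift_comp_shift[OF aper_aswap[of "int i"], of centre x] by simp
next
  fix k assume k: "k \<in> {1..n}"
  have "lift n centre (aswap n (int i) (int k)) = srefl n i centre k"
    using fun_cong[OF lift_srefl[OF assms, of centre], of "int k"] lift_pos[OF k] by simp
  then show "(lift n centre (int k) + lift n centre (aswap n (int i) (int k))) / 2 = facet i k"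
    using lift_pos[OF k] by (simp add: facet_def)
qed

lemma facet_alcove:
  assumes i: "i < n"
  shows "facet i \<in> alcoveA n" "srefl n i (facet i) = facet i"
proof -
  have V: "facet i \<in> Vsp n"
    using centre_Vsp srefl_sum[OF i, of centre] srefl_outside[OF i, of _ centre]
    by (auto simp: Vsp_def facet_def sum.distrib sum_divide_distrib[symmetric])
  have "lift n (facet i) (x + 1) \<le> lift n (facet i) x" for x
  proof -
    have "x + aswap n (int i) x \<le> (x + 1) + aswap n (int i) (x + 1)"
      by (cases rule: aswap_cases[of x "int i"]; cases rule: aswap_cases[of "x + 1" "int i"]) auto
    then have "real_of_int (x + aswap n (int i) x) / real n \<le> real_of_int ((x + 1) + aswap n (int i) (x + 1)) / real n"
      by (intro divide_right_mono) auto
    then have "lift n centre (x + 1) + lift n centre (aswap n (int i) (x + 1))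
        \<le> lift n centre x + lift n centre (aswap n (int i) x)"
      unfolding lift_centre by (simp add: add_divide_distrib)
    then show ?thesis by (simp add: lift_facet[OF i])
  qed
  then show "facet i \<in> alcoveA n" using V by (simp add: alcoveA_iff)
  show "srefl n i (facet i) = facet i"
  proof
    fix k show "srefl n i (facet i) k = facet i k"
    proof (cases "k \<in> {1..n}")
      case True
      have "srefl n i (facet i) k = lift n (facet i) (aswap n (int i) (int k))"
        using lift_pos[OF True, of "srefl n i (facet i)"] lift_srefl[OF i, of "facet i"] by simp
      also have "\<dots> = lift n (facet i) (int k)" by (simp add: lift_facet[OF i] add.commute)
      finally show ?thesis using lift_pos[OF True] by simp
    next
      case False
      then show ?thesis by (rule srefl_outside[OF i])
    qed
  qed
qed

text \<open>The hyperplane for a, b and k = m1 - m2 is the set where the lifts at c and d agree, so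
  hyperplanes become pairs of integers up to simultaneous translation by n.\<close>

lemma separates_iff:
  assumes a: "a \<in> {1..n}" and b: "b \<in> {1..n}"
    and c: "c = int a + int n * m1" and d: "d = int b + int n * m2"
  shows "y a - y b \<le> of_int (m1 - m2) \<longleftrightarrow> lift n y c \<le> lift n y d"
    "of_int (m1 - m2) \<le> y a - y b \<longleftrightarrow> lift n y d \<le> lift n y c"
  unfolding c d lift_mult lift_pos[OF a] lift_pos[OF b] by auto

text \<open>The only hyperplane between A u and A s_i u is the one where the lifts at
  \<open>?c\<close> and \<open>?d\<close> agree. On A u the lift at \<open>?c\<close> is the larger
  one; on A lifts are antitone, so there the order of \<open>?c\<close> and \<open>?d\<close>
  decides the side.\<close>

lemma not_back_iff:
  assumes u: "acts n u X" and i: "i < n"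
  shows "not_back n u i \<longleftrightarrow> inv X (int i) < inv X (int i + 1)"
proof -
  let ?c = "inv X (int i)" and ?d = "inv X (int i + 1)" and ?S = "aswap n (int i)"
  have X: "aper n X" using u by (simp add: acts_def)
  note ai = aper_inv_apply[OF X]
  note v = acts_sgen[OF u i]
  have S: "?S (int i) = int i + 1" "?S (int i + 1) = int i" using aswap_same[of "int i" "int i"] by auto
  have cd: "?c \<noteq> ?d" using aper_eq_iff[OF aper_inv[OF X]] by simp
  have U: "lift n y ?d \<le> lift n y ?c" if "y \<in> alc n u" for y
    using that alcoveA_iff acts_lift[OF u] ai unfolding alc_def by auto
  have SU: "lift n y ?c \<le> lift n y ?d" if "y \<in> alc n (sgen n i u)" for y
    using that alcoveA_iff acts_lift[OF v] ai S unfolding alc_def by auto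
  have ctr: "u centre \<in> alc n u" using centre_alcove unfolding alc_def by blast
  have Uc: "lift n (u centre) ?d < lift n (u centre) ?c"
    unfolding acts_lift[OF u] o_apply lift_centre_less ai by simp
  show ?thesis
  proof
    assume nb: "not_back n u i"
    show "?c < ?d"
    proof (rule ccontr)
      assume "\<not> ?c < ?d"
      then have dc: "?d < ?c" using cd by simp
      obtain a m1 where a: "a \<in> {1..n}" "?c = int a + int n * m1" by (rule int_decomp)
      obtain b m2 where b: "b \<in> {1..n}" "?d = int b + int n * m2" by (rule int_decomp)
      note sep = separates_iff[OF a(1) b(1) a(2) b(2)]
      have "a \<noteq> b"
      proof
        assume "a = b"
        then have "?c = ?d + int n * (m1 - m2)" using a(2) b(2) by (simp add: algebra_simps)
        then have "X ?c = X ?d + int n * (m1 - m2)" using aper_mult[OF X] by metis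
        then have "int n * (m1 - m2) = -1" using ai by simp
        then have "int n dvd 1" by (metis dvd_minus_iff dvd_triv_left)
        then show False using n2 by simp
      qed
      moreover have "separates a b (m1 - m2) (alc n u) (alc n (sgen n i u))"
        unfolding separates_def sep using U SU by blast
      moreover have "separates a b (m1 - m2) (alc n u) (alcoveA n)"
        unfolding separates_def sep using U alcoveA_iff antitone_steps(1)[of "lift n _" ?d ?c] dc by auto
      ultimately show False using nb a(1) b(1) unfolding not_back_def by blast
    qed
  next
    assume lt: "?c < ?d"
    have False if a: "a \<in> {1..n}" and b: "b \<in> {1..n}" and ab: "a \<noteq> b"
      and s1: "separates a b k (alc n u) (alc n (sgen n i u))" and s2: "separates a b k (alc n u) (alcoveA n)" for a b k
    proof -
      \<comment> \<open>This point lies in both alcoves A u and A s_i u, so every hyperplane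
        separating them contains it.\<close>
      let ?f = "u (facet i)"
      have "?f \<in> alc n u" "?f \<in> alc n (sgen n i u)"
        using facet_alcove[OF i] unfolding alc_def sgen_def by (auto simp: image_iff intro!: bexI[of _ "facet i"])
      then have "?f a - ?f b = of_int k" using s1 unfolding separates_def by force
      moreover have "?f a = lift n (facet i) (X (int a))" "?f b = lift n (facet i) (X (int b))"
        using u a b unfolding acts_def by auto
      ultimately have k: "lift n (facet i) (X (int a)) = lift n (facet i) (X (int b)) + of_int k" by simp
      let ?e = "X (int a + int n * k)" and ?g = "X (int b)"
      have "lift n (facet i) ?e = lift n (facet i) ?g"
        using k lift_mult[of "facet i" "X (int a)" k] aper_mult[OF X, of "int a" k] by simp
      moreover have lf: "lift n (facet i) x = (real n + 1) / (2 * real n) - real_of_int (x + ?S x) / (2 * real n)" for x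
        unfolding lift_facet[OF i] lift_centre by (simp add: diff_divide_distrib add_divide_distrib)
      ultimately have "real_of_int (?e + ?S ?e) / (2 * real n) = real_of_int (?g + ?S ?g) / (2 * real n)"
        using lf[of ?e] lf[of ?g] by argo
      then have "real_of_int (?e + ?S ?e) = real_of_int (?g + ?S ?g)" using n2 by simp
      then have eg: "?e + ?S ?e = ?g + ?S ?g" by linarith
      have neg: "?e \<noteq> ?g"
      proof
        assume "?e = ?g"
        then have e: "int b - int a = int n * k" using aper_eq_iff[OF X] by auto
        have "\<bar>int b - int a\<bar> < int n" using a b by auto
        then have "int b - int a = 0" using dvd_small[of n "int b - int a"] e by simp
        then show False using ab by simp
      qed
      \<comment> \<open>Equal lifts at the facet point mean equal sums x + s_i x. As s_i moves
        integers by at most 1, only translates of the pair i, i + 1 satisfy this.\<close>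
      have "(int n dvd ?e - int i \<and> ?g = ?e + 1) \<or> (int n dvd ?g - int i \<and> ?e = ?g + 1)"
        using eg neg by (cases rule: aswap_cases[of ?e "int i"]; cases rule: aswap_cases[of ?g "int i"])
          (auto simp: algebra_simps)
      then have "\<exists>m. (int a + int n * k = ?c + int n * m \<and> int b = ?d + int n * m) \<or>
          (int b = ?c + int n * m \<and> int a + int n * k = ?d + int n * m)"
      proof (elim disjE conjE)
        assume h: "int n dvd ?e - int i" "?g = ?e + 1"
        then obtain m where m: "?e - int i = int n * m" by (auto simp: dvd_def)
        have "X (?c + int n * m) = ?e" "X (?d + int n * m) = ?g"
          using aper_mult[OF X, of ?c m] aper_mult[OF X, of ?d m] ai(2)[of "int i"] ai(2)[of "int i + 1"] m h(2)
          by linarith+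
        then show ?thesis using aper_eq_iff[OF X] by metis
      next
        assume h: "int n dvd ?g - int i" "?e = ?g + 1"
        then obtain m where m: "?g - int i = int n * m" by (auto simp: dvd_def)
        have "X (?c + int n * m) = ?g" "X (?d + int n * m) = ?e"
          using aper_mult[OF X, of ?c m] aper_mult[OF X, of ?d m] ai(2)[of "int i"] ai(2)[of "int i + 1"] m h(2)
          by linarith+
        then show ?thesis using aper_eq_iff[OF X] by metis
      qed
      then obtain m where "(int a + int n * k = ?c + int n * m \<and> int b = ?d + int n * m) \<or>
          (int b = ?c + int n * m \<and> int a + int n * k = ?d + int n * m)" by blast
      then have m: "(?c = int a + int n * (k - m) \<and> ?d = int b + int n * (- m)) \<or>
          (?d = int a + int n * (k - m) \<and> ?c = int b + int n * (- m))"
        by (elim disjE conjE; simp add: algebra_simps)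
      have k': "k - m - (- m) = k" by simp
      \<comment> \<open>\<open>centre\<close> and \<open>u centre\<close> lie strictly on the same
        side of the hyperplane, so it cannot separate A u from A.\<close>
      have Ac: "lift n centre ?d < lift n centre ?c" unfolding lift_centre_less by (rule lt)
      from m show False
      proof
        assume h: "?c = int a + int n * (k - m) \<and> ?d = int b + int n * (- m)"
        note sep = separates_iff[OF a b conjunct1[OF h] conjunct2[OF h], unfolded k']
        from s2 show False unfolding separates_def sep using ctr Uc centre_alcove Ac by fastforce
      next
        assume h: "?d = int a + int n * (k - m) \<and> ?c = int b + int n * (- m)"
        note sep = separates_iff[OF a b conjunct1[OF h] conjunct2[OF h], unfolded k']
        from s2 show False unfolding separates_def sep using ctr Uc centre_alcove Ac by fastforce
      qed
    qed
    then show "not_back n u i" unfolding not_back_def by blast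
  qed
qed

text \<open>One generic point of the alcove, the image of \<open>centre\<close>, already determines
  the chamber. Conversely, antitone lifts order the coordinates of every point of A u as X
  prescribes.\<close>

lemma alc_chamber_iff:
  assumes u: "acts n u X" and w: "w permutes {1..n}"
  shows "alc n u \<subseteq> chamber n w \<longleftrightarrow> pat n X = w"
proof
  have X: "aper n X" and f: "\<And>\<gamma> k. k \<in> {1..n} \<Longrightarrow> u \<gamma> k = lift n \<gamma> (X (int k))"
    using u unfolding acts_def by auto
  note pp = pat_permutes[OF X]
  {
    assume "alc n u \<subseteq> chamber n w"
    moreover have "u centre \<in> alc n u" using centre_alcove unfolding alc_def by blast
    ultimately obtain \<gamma> where \<gamma>: "\<gamma> \<in> chamberC n" "u centre = \<gamma> \<circ> w" unfolding chamber_def by auto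
    have "pat n X \<circ> inv w = id"
    proof (rule permutes_ascending)
      show "pat n X \<circ> inv w permutes {1..n}" by (rule permutes_compose[OF permutes_inv[OF w] pp])
      fix i assume i: "i \<in> {1..<n}"
      let ?k = "inv w i" and ?l = "inv w (Suc i)"
      have kl: "?k \<in> {1..n}" "?l \<in> {1..n}" using permutes_in_image[OF permutes_inv[OF w]] i by auto
      have "\<gamma> (Suc i) \<le> \<gamma> i" using \<gamma>(1) i by (simp add: chamberC_def)
      then have "u centre ?l \<le> u centre ?k" unfolding \<gamma>(2) using permutes_inverses(1)[OF w] by simp
      then have "\<not> X (int ?l) < X (int ?k)"
        unfolding f[OF kl(1)] f[OF kl(2)] using lift_centre_less by (meson not_less)
      moreover have "?k \<noteq> ?l" using inj_eq[OF permutes_inj[OF permutes_inv[OF w]]] by simp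
      then have "X (int ?k) \<noteq> X (int ?l)" using aper_eq_iff[OF X] by simp
      ultimately show "(pat n X \<circ> inv w) i < (pat n X \<circ> inv w) (Suc i)"
        using pat_le_iff(2)[OF X kl] by simp
    qed
    then have "pat n X \<circ> inv w \<circ> w = w" by simp
    then show "pat n X = w" using permutes_inv_o(2)[OF w] by (simp add: o_assoc[symmetric])
  }
  assume p: "pat n X = w"
  show "alc n u \<subseteq> chamber n w"
  proof
    fix y assume "y \<in> alc n u"
    then obtain \<gamma> where \<gamma>: "\<gamma> \<in> alcoveA n" "y = u \<gamma>" unfolding alc_def by auto
    have y: "y \<in> Vsp n" using acts_Vsp[OF u] \<gamma> alcoveA_iff by simp
    note iw = permutes_inv[OF w]
    have "(\<Sum>k\<in>{1..n}. (y \<circ> inv w) k) = (\<Sum>k\<in>{1..n}. y k)" using sum.permute[OF iw, of y] by simp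
    then have "y \<circ> inv w \<in> Vsp n"
      using y permutes_not_in[OF iw] unfolding Vsp_def by auto
    moreover have "(y \<circ> inv w) (Suc i) \<le> (y \<circ> inv w) i" if i: "i \<in> {1..<n}" for i
    proof -
      let ?k = "inv w i" and ?l = "inv w (Suc i)"
      have kl: "?k \<in> {1..n}" "?l \<in> {1..n}" using permutes_in_image[OF iw] i by auto
      have "pat n X ?k < pat n X ?l" unfolding p using permutes_inverses(1)[OF w] by simp
      then have "X (int ?k) \<le> X (int ?l)" using pat_le_iff(2)[OF X kl] by simp
      then show ?thesis
        unfolding \<gamma>(2) o_apply f[OF kl(1)] f[OF kl(2)] using \<gamma>(1) antitone_steps(1)[of "lift n \<gamma>"] unfolding alcoveA_iff by blast
    qed
    ultimately have "y \<circ> inv w \<in> chamberC n" by (simp add: chamberC_def)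
    moreover have "y = (y \<circ> inv w) \<circ> w" using permutes_inv_o(2)[OF w] by (simp add: o_assoc[symmetric])
    ultimately show "y \<in> chamber n w" unfolding chamber_def by blast
  qed
qed

lemma mem_alc_iff:
  assumes u: "acts n u X" and y: "y \<in> Vsp n"
  shows "y \<in> alc n u \<longleftrightarrow> (\<forall>x. lift n y (inv X (x + 1)) \<le> lift n y (inv X x))"
proof
  have X: "aper n X" and f: "\<And>\<gamma> k. u \<gamma> k = (if k \<in> {1..n} then lift n \<gamma> (X (int k)) else \<gamma> k)"
    and s: "\<And>\<gamma>. (\<Sum>k\<in>{1..n}. u \<gamma> k) = (\<Sum>k\<in>{1..n}. \<gamma> k)"
    using u unfolding acts_def by blast+
  note ai = aper_inv_apply[OF X]
  {
    assume "y \<in> alc n u"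
    then obtain \<gamma> where "\<gamma> \<in> alcoveA n" "y = u \<gamma>" unfolding alc_def by auto
    then show "\<forall>x. lift n y (inv X (x + 1)) \<le> lift n y (inv X x)"
      using acts_lift[OF u] alcoveA_iff ai by simp
  }
  assume h: "\<forall>x. lift n y (inv X (x + 1)) \<le> lift n y (inv X x)"
  define \<gamma> where "\<gamma> k = (if k \<in> {1..n} then lift n y (inv X (int k)) else 0)" for k
  have l: "lift n \<gamma> = (\<lambda>x. lift n y (inv X x))"
    by (rule lift_eqI) (auto simp: lift_comp_shift[OF aper_inv[OF X]] \<gamma>_def)
  have y0: "k \<notin> {1..n} \<Longrightarrow> y k = 0" for k using y by (auto simp: Vsp_def)
  have uy: "u \<gamma> = y"
  proof
    fix k show "u \<gamma> k = y k"
      using f[of \<gamma> k] ai(1) lift_pos[of k y] y0[of k] by (simp add: l) (simp add: \<gamma>_def)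
  qed
  have "\<gamma> \<in> Vsp n"
    using s[of \<gamma>] y unfolding uy by (auto simp: Vsp_def \<gamma>_def)
  then have "\<gamma> \<in> alcoveA n" using h by (simp add: alcoveA_iff l)
  then show "y \<in> alc n u" using uy unfolding alc_def by blast
qed

end

section \<open>Rays\<close>

text \<open>The inverse of the affine permutation of u_j: a point y of V lies in A u_j iff
  \<open>lift n y\<close> is antitone along \<open>rayL n i j\<close>
  (\<open>mem_ray_alc\<close>).\<close>

primrec rayL :: "nat \<Rightarrow> (nat \<Rightarrow> int) \<Rightarrow> nat \<Rightarrow> int \<Rightarrow> int" where
  "rayL n i 0 = id"
| "rayL n i (Suc j) = rayL n i j \<circ> aswap n (i j)"

text \<open>If f is the lift of z0, this is the lift of z0 + s \<delta>
  (\<open>lift_delta\<close>).\<close>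

definition tilt :: "nat \<Rightarrow> (int \<Rightarrow> real) \<Rightarrow> real \<Rightarrow> int \<Rightarrow> real" where
  "tilt n f s x = f x + s * (1 - (if int n dvd x then real n else 0))"

context affine
begin

lemma aper_rayL: "aper n (rayL n i j)"
proof (induction j)
  case (Suc j)
  show ?case unfolding rayL.simps(2) by (rule aper_comp[OF Suc aper_aswap])
qed (use aper_id in \<open>simp only: rayL.simps(1)\<close>)

lemma acts_ray_u:
  assumes "\<And>j. i j < n"
  shows "acts n (ray_u n i j) (inv (rayL n (\<lambda>j. int (i j)) j))"
proof (induction j)
  case 0
  show ?case using acts_id by (simp add: inv_id[unfolded id_def] id_def)
next
  case (Suc j)
  have "inv (rayL n (\<lambda>j. int (i j)) (Suc j)) = aswap n (int (i j)) \<circ> inv (rayL n (\<lambda>j. int (i j)) j)"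
    using o_inv_distrib[OF aper_bij[OF aper_rayL] bij_aswap] by (simp only: inv_aswap rayL.simps(2))
  then show ?case using acts_sgen[OF Suc assms[of j]] by (simp only: ray_u.simps(2))
qed

lemma mem_ray_alc:
  assumes "\<And>j. i j < n" "y \<in> Vsp n"
  shows "y \<in> alc n (ray_u n i j) \<longleftrightarrow>
    (\<forall>x. lift n y (rayL n (\<lambda>j. int (i j)) j (x + 1)) \<le> lift n y (rayL n (\<lambda>j. int (i j)) j x))"
  using mem_alc_iff[OF acts_ray_u[OF assms(1)] assms(2)] inv_inv_eq[OF aper_bij[OF aper_rayL]] by simp

lemma aswap_cong:
  assumes "int n dvd i - k"
  shows "aswap n i = aswap n k"
proof -
  have e: "x - i + (i - k) = x - k" "x - i - 1 + (i - k) = x - k - 1" for x by simp_all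
  have "int n dvd x - k \<longleftrightarrow> int n dvd x - i" "int n dvd x - k - 1 \<longleftrightarrow> int n dvd x - i - 1" for x
    using dvd_add_left_iff[OF assms, of "x - i"] dvd_add_left_iff[OF assms, of "x - i - 1"] unfolding e by simp_all
  then show ?thesis by (simp add: aswap_def fun_eq_iff)
qed

lemma rayL_cong: "(\<And>j. int n dvd i j - k j) \<Longrightarrow> rayL n i j = rayL n k j"
proof (induction j)
  case (Suc j)
  then show ?case using aswap_cong[of "i j" "k j"] by (simp only: rayL.simps(2))
qed simp

text \<open>Negation of the integers reverses the ray: it maps the edge i, i + 1 to -i - 1, -i. The
  direction -\<delta> is reduced to \<delta> in this way.\<close>

lemma aswap_neg: "aswap n (- i - 1) (- x) = - aswap n i x"
proof -
  have e: "- x - (- i - 1) = - (x - i - 1)" "- x - (- i - 1) - 1 = - (x - i)" by simp_all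
  show ?thesis
    by (cases rule: aswap_cases[of x i]) (simp_all add: aswap_def e del: minus_diff_eq diff_minus_eq_add)
qed

lemma rayL_neg: "rayL n (\<lambda>j. - i j - 1) j (- x) = - rayL n i j x"
  by (induction j arbitrary: x) (simp_all add: aswap_neg)

text \<open>The ray direction moves the values at multiples of \<open>n\<close>; \<open>rayL n int j\<close> lists the integers in
  the order in which the ray sees them after \<open>j\<close> crossings.\<close>

lemma rayL_int:
  "rayL n int j (int j) = 0"
  "x < y \<Longrightarrow> \<not> int n dvd x - int j \<Longrightarrow> \<not> int n dvd y - int j \<Longrightarrow> rayL n int j x < rayL n int j y"
proof (induction j arbitrary: x y)
  case (Suc j)
  case 1
  show ?case using Suc(1) aswap_same(2)[of "int j" "int j"] by (simp add: add.commute)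
next
  case (Suc j)
  case 2
  have e: "z - int (Suc j) = z - int j - 1" for z by simp
  note nd = 2(2,3)[unfolded e]
  have nS: "\<not> int n dvd aswap n (int j) z - int j" if "\<not> int n dvd z - int j - 1" for z
    using that not_dvd_Suc(1)[of "z - int j"]
    by (cases rule: aswap_cases[of z "int j"]) (auto simp: algebra_simps)
  have "\<not> (int n dvd x - int j \<and> y = x + 1)" using nd(2) by (auto simp: algebra_simps)
  then have "aswap n (int j) x < aswap n (int j) y" by (rule aswap_mono[OF 2(1)])
  then show ?case using Suc(2)[OF _ nS[OF nd(1)] nS[OF nd(2)]] by simp
qed auto

lemma rayL_dvd: "int n dvd rayL n int j x \<longleftrightarrow> int n dvd x - int j"
proof
  note m = aper_mult[OF aper_rayL, of int j "int j", unfolded rayL_int(1)]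
  assume "int n dvd x - int j"
  then obtain k where "x - int j = int n * k" by (auto simp: dvd_def)
  then have "x = int j + int n * k" by simp
  then show "int n dvd rayL n int j x" using m by simp
next
  note m = aper_mult[OF aper_rayL, of int j "int j", unfolded rayL_int(1)]
  assume "int n dvd rayL n int j x"
  then obtain k where "rayL n int j x = int n * k" by (auto simp: dvd_def)
  then have "rayL n int j x = rayL n int j (int j + int n * k)" using m by simp
  then have "x = int j + int n * k" using aper_eq_iff[OF aper_rayL] by blast
  then show "int n dvd x - int j" by simp
qed

text \<open>The integer that follows 0 in the order after j crossings, hence the one that 0 passes
  at the next crossing.\<close>

definition hit :: "nat \<Rightarrow> int" where
  "hit j = rayL n int j (int j + 1)"

lemma hit_Suc: "rayL n int (Suc j) (int j) = hit j" "hit j < hit (Suc j)"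
proof -
  show e: "rayL n int (Suc j) (int j) = hit j"
    using aswap_same(1)[of "int j" "int j"] by (simp add: hit_def)
  have "\<not> int n dvd int j - int (Suc j)" "\<not> int n dvd int (Suc j) + 1 - int (Suc j)" using n2 by auto
  then show "hit j < hit (Suc j)"
    unfolding e[symmetric] unfolding hit_def by (rule rayL_int(2)[rotated]) simp
qed

lemma hit_ge: "int j + 1 \<le> hit j"
proof (induction j)
  case (Suc j)
  then show ?case using hit_Suc(2)[of j] by simp
qed (simp add: hit_def)

text \<open>The time \<open>rtime f (Suc k)\<close> is the solution s of
  \<open>tilt n f s 0 = tilt n f s (hit k)\<close>.\<close>

definition rtime :: "(int \<Rightarrow> real) \<Rightarrow> nat \<Rightarrow> real" where
  "rtime f j = (case j of 0 \<Rightarrow> 0 | Suc k \<Rightarrow> (f 0 - f (hit k)) / real n)"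

context
  fixes f :: "int \<Rightarrow> real"
  assumes dec: "\<And>x. f (x + 1) < f x" and per: "\<And>x. f (x + int n) = f x - 1"
begin

lemma f_less: "x < y \<Longrightarrow> f y < f x"
  using antitone_steps(2)[of f] dec by blast

lemma rtime_mono: "strict_mono (rtime f)"
  unfolding strict_mono_Suc_iff
proof
  fix j show "rtime f j < rtime f (Suc j)"
    using f_less[OF hit_Suc(2)] f_less[of 0 "hit 0"] hit_ge[of 0] n2
    by (cases j) (auto simp: rtime_def divide_strict_right_mono)
qed

lemma rtime_unbounded: "\<exists>j. x < rtime f j"
proof -
  obtain m :: nat where m: "x * real n < real m" using reals_Archimedean2 by blast
  have "f (0 + int n * int m) = f 0 - real_of_int (int m)" by (rule shift_mult[where f = f]) (rule per)
  moreover have "int n * int m < hit (n * m)" using hit_ge[of "n * m"] by simp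
  ultimately have "real m < f 0 - f (hit (n * m))" using f_less by fastforce
  then have "x * real n < f 0 - f (hit (n * m))" using m by linarith
  then have "x < rtime f (Suc (n * m))" using n2 by (simp add: rtime_def pos_less_divide_eq)
  then show ?thesis by blast
qed

lemma tilt_shift: "tilt n f s (x + int n) = tilt n f s x - 1"
  by (simp add: tilt_def per)

text \<open>Along \<open>rayL n int j\<close> the only gaps that vary with \<open>s\<close> are those next to a multiple of \<open>n\<close>;
  they vanish at the two ends of the time interval.\<close>

lemma gap:
  shows "int n dvd x - int j \<Longrightarrow> tilt n f s (rayL n int j x) - tilt n f s (rayL n int j (x + 1)) = real n * (rtime f (Suc j) - s)"
    and "int n dvd x + 1 - int j \<Longrightarrow> rtime f j \<le> s \<Longrightarrow> (j = 0 \<longrightarrow> 0 \<le> s) \<Longrightarrow>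
       real n * (s - rtime f j) \<le> tilt n f s (rayL n int j x) - tilt n f s (rayL n int j (x + 1))"
    and "\<not> int n dvd x - int j \<Longrightarrow> \<not> int n dvd x + 1 - int j \<Longrightarrow>
       tilt n f s (rayL n int j (x + 1)) < tilt n f s (rayL n int j x)"
proof -
  let ?L = "rayL n int j"
  have np: "real n \<noteq> 0" using n2 by simp
  have red: "tilt n f s (?L (x + int n * m)) - tilt n f s (?L (x + int n * m + 1)) = tilt n f s (?L x) - tilt n f s (?L (x + 1))" for x m
  proof -
    have e: "x + int n * m + 1 = (x + 1) + int n * m" by simp
    have "tilt n f s (y + int n * m) = tilt n f s y - real_of_int m" for y
      by (rule shift_mult[where f = "tilt n f s"]) (rule tilt_shift)
    then show ?thesis unfolding e aper_mult[OF aper_rayL] by simp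
  qed
  have n1: "\<not> int n dvd 1" "\<not> int n dvd -1" using n2 by auto
  {
    assume "int n dvd x - int j"
    then obtain m where "x - int j = int n * m" by (auto simp: dvd_def)
    then have x: "x = int j + int n * m" by simp
    have "\<not> int n dvd ?L (int j + 1)" unfolding rayL_dvd using n1 by simp
    then have "tilt n f s (?L (int j)) - tilt n f s (?L (int j + 1)) = f 0 + s * (1 - real n) - (f (hit j) + s)"
      unfolding rayL_int(1) by (simp add: tilt_def hit_def)
    also have "\<dots> = real n * (rtime f (Suc j) - s)" using np by (simp add: rtime_def field_simps)
    finally show "tilt n f s (?L x) - tilt n f s (?L (x + 1)) = real n * (rtime f (Suc j) - s)"
      unfolding x red .
  }
  {
    assume "int n dvd x + 1 - int j" and s: "rtime f j \<le> s" "j = 0 \<longrightarrow> 0 \<le> s"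
    then obtain m where "x + 1 - int j = int n * m" by (auto simp: dvd_def)
    then have x: "x = (int j - 1) + int n * m" by simp
    have nd: "\<not> int n dvd ?L (int j - 1)" unfolding rayL_dvd using n1 by simp
    have g: "tilt n f s (?L (int j - 1)) - tilt n f s (?L (int j - 1 + 1)) = f (?L (int j - 1)) + s - (f 0 + s * (1 - real n))"
      using nd rayL_int(1)[of j] by (simp add: tilt_def)
    have "real n * (s - rtime f j) \<le> f (?L (int j - 1)) + s - (f 0 + s * (1 - real n))"
    proof (cases j)
      case 0
      then show ?thesis using f_less[of "-1" 0] by (simp add: rtime_def algebra_simps)
    next
      case (Suc k)
      have "?L (int j - 1) = hit k" unfolding Suc using hit_Suc(1)[of k] by simp
      then show ?thesis unfolding Suc using np by (simp add: rtime_def field_simps)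
    qed
    then show "real n * (s - rtime f j) \<le> tilt n f s (?L x) - tilt n f s (?L (x + 1))"
      unfolding x red g .
  }
  assume nd: "\<not> int n dvd x - int j" "\<not> int n dvd x + 1 - int j"
  have "?L x < ?L (x + 1)" by (rule rayL_int(2)) (use nd in auto)
  then show "tilt n f s (?L (x + 1)) < tilt n f s (?L x)"
    using f_less nd rayL_dvd by (simp add: tilt_def)
qed

lemma tilt_stay:
  assumes s: "rtime f j \<le> s" "s \<le> rtime f (Suc j)"
  shows "tilt n f s (rayL n int j (x + 1)) \<le> tilt n f s (rayL n int j x)"
proof -
  have "j = 0 \<longrightarrow> 0 \<le> s" using s by (auto simp: rtime_def)
  moreover have "0 \<le> real n * (rtime f (Suc j) - s)" "0 \<le> real n * (s - rtime f j)" using s by auto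
  ultimately show ?thesis
    using gap(1)[of x j s] gap(2)[of x j s] gap(3)[of x j s] s by argo
qed

lemma tilt_touch:
  assumes s: "rtime f j < s" "s \<le> rtime f (Suc j)"
    and le: "tilt n f s (rayL n int j x) \<le> tilt n f s (rayL n int j (x + 1))"
  shows "s = rtime f (Suc j)" "int n dvd x - int j"
proof -
  have n0: "0 < real n" using n2 by simp
  have "j = 0 \<longrightarrow> 0 \<le> s" using s by (auto simp: rtime_def)
  moreover have "0 < real n * (s - rtime f j)" using s n0 by simp
  ultimately have d: "int n dvd x - int j"
    using gap(2)[of x j s] gap(3)[of x j s] s le by (cases "int n dvd x + 1 - int j") auto
  then show "int n dvd x - int j" .
  have "real n * (rtime f (Suc j) - s) \<le> 0" using gap(1)[OF d, of s] le by linarith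
  then show "s = rtime f (Suc j)" using n0 s(2) by (simp add: mult_le_0_iff)
qed

lemma tilt_leave:
  assumes "rtime f (Suc j) < s"
  shows "tilt n f s (rayL n int j (int j)) < tilt n f s (rayL n int j (int j + 1))"
proof -
  have "real n * (rtime f (Suc j) - s) < 0" using assms n2 by (simp add: mult_pos_neg)
  then show ?thesis using gap(1)[of "int j" j s] by simp
qed

end

text \<open>A second walk through the alcoves agrees with the first by induction: it cannot stay in
  an alcove longer than the ray does (\<open>leave\<close>), and the wall it crosses must be touched
  by the ray at that time (\<open>touch\<close>), which fixes both time and index. The abstract h
  and L serve both directions.\<close>

lemma ray_index_eqI:
  assumes idx: "\<And>j. idx j < n" and V: "\<And>s. (\<lambda>k. z0 k + s * \<eta> k) \<in> Vsp n"
    and H: "\<And>s. lift n (\<lambda>k. z0 k + s * \<eta> k) = h s"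
    and L: "\<And>j. rayL n (\<lambda>j. int (idx j)) j = L j"
    and \<tau>: "\<tau> 0 = 0" "strict_mono \<tau>" "\<And>x. \<exists>j. x < \<tau> j"
    and stay: "\<And>j s x. \<tau> j \<le> s \<Longrightarrow> s \<le> \<tau> (Suc j) \<Longrightarrow> h s (L j (x + 1)) \<le> h s (L j x)"
    and touch: "\<And>j s x. \<tau> j < s \<Longrightarrow> s \<le> \<tau> (Suc j) \<Longrightarrow> h s (L j x) \<le> h s (L j (x + 1)) \<Longrightarrow>
       s = \<tau> (Suc j) \<and> int n dvd x - int (idx j)"
    and leave: "\<And>j s. \<tau> (Suc j) < s \<Longrightarrow> \<exists>x. h s (L j x) < h s (L j (x + 1))"
  shows "ray_index n z0 \<eta> = idx"
proof -
  have mem: "(\<lambda>k. z0 k + s * \<eta> k) \<in> alc n (ray_u n i j) \<longleftrightarrow>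
      (\<forall>x. h s (rayL n (\<lambda>j. int (i j)) j (x + 1)) \<le> h s (rayL n (\<lambda>j. int (i j)) j x))"
    if "\<And>j. i j < n" for i s j
    using mem_ray_alc[OF that V] unfolding H .
  have "ray_walk n z0 \<eta> idx"
    unfolding ray_walk_def using \<tau> idx stay by (auto simp: mem[OF idx] L intro!: exI[of _ \<tau>])
  moreover have "i = idx" if "ray_walk n z0 \<eta> i" for i
  proof -
    from that obtain \<tau>' where i: "\<And>j. i j < n" and t0: "\<tau>' 0 = 0" and tm: "strict_mono \<tau>'"
      and a: "\<And>j s. s \<in> {\<tau>' j..\<tau>' (Suc j)} \<Longrightarrow> (\<lambda>k. z0 k + s * \<eta> k) \<in> alc n (ray_u n i j)"
      unfolding ray_walk_def by blast
    let ?R = "rayL n (\<lambda>j. int (i j))"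
    have b: "h s (?R j (x + 1)) \<le> h s (?R j x)" if "\<tau>' j \<le> s" "s \<le> \<tau>' (Suc j)" for j s x
      using a[of s j] that mem[OF i] by simp
    have "?R j = L j \<and> \<tau>' j = \<tau> j \<and> (\<forall>k<j. i k = idx k)" for j
    proof (induction j)
      case 0
      show ?case using t0 \<tau>(1) L[of 0] by simp
    next
      case (Suc j)
      then have R: "?R j = L j" and t: "\<tau>' j = \<tau> j" by simp_all
      let ?s = "\<tau>' (Suc j)"
      have lt: "\<tau>' j < ?s" "?s \<le> \<tau>' (Suc (Suc j))" using tm by (simp_all add: strict_mono_less strict_mono_less_eq)
      have le: "?s \<le> \<tau> (Suc j)"
        using leave[of j ?s] b[of j ?s] lt unfolding R by (metis not_less less_imp_le)
      have S: "?R (Suc j) = L j \<circ> aswap n (int (i j))" using R by simp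
      have sw: "aswap n (int (i j)) (int (i j)) = int (i j) + 1" "aswap n (int (i j)) (int (i j) + 1) = int (i j)"
        using aswap_same[of "int (i j)" "int (i j)"] by simp_all
      have "h ?s (L j (int (i j))) \<le> h ?s (L j (int (i j) + 1))"
        using b[of "Suc j" ?s "int (i j)"] lt(2) unfolding S o_apply sw by simp
      from touch[OF _ le this] have q: "?s = \<tau> (Suc j)" "int n dvd int (i j) - int (idx j)"
        using lt(1) t by auto
      have "\<bar>int (i j) - int (idx j)\<bar> < int n" using i[of j] idx[of j] by linarith
      then have ij: "i j = idx j" using dvd_small[OF q(2)] by simp
      have "?R (Suc j) = L (Suc j)" unfolding S using L[of "Suc j"] L[of j] ij by simp
      then show ?case using q(1) ij Suc less_Suc_eq by auto
    qed
    then have "i j = idx j" for j using lessI[of j] by blast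
    then show "i = idx" by (intro ext)
  qed
  ultimately show ?thesis unfolding ray_index_def by (rule the_equality)
qed

lemma delta_Vsp:
  assumes "z0 \<in> Vsp n"
  shows "(\<lambda>k. z0 k + s * delta n k) \<in> Vsp n"
proof -
  have "(\<Sum>k\<in>{1..n}. delta n k) = (\<Sum>k\<in>{1..n}. 1 - (if k = n then real n else 0))"
    by (intro sum.cong) (auto simp: delta_def)
  also have "\<dots> = 0" using n2 by (simp add: sum_subtractf)
  finally have "(\<Sum>k\<in>{1..n}. z0 k + s * delta n k) = 0"
    using assms by (simp add: Vsp_def sum.distrib sum_distrib_left[symmetric])
  moreover have "k \<notin> {1..n} \<Longrightarrow> delta n k = 0" for k using n2 by (auto simp: delta_def)
  ultimately show ?thesis using assms by (auto simp: Vsp_def)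
qed

lemma lift_delta: "lift n (\<lambda>k. z0 k + s * delta n k) = tilt n (lift n z0) s"
proof (rule lift_eqI)
  show "tilt n (lift n z0) s (x + int n) = tilt n (lift n z0) s x - 1" for x
    by (simp add: tilt_def lift_shift)
  fix k assume k: "k \<in> {1..n}"
  have "int n dvd int k \<longleftrightarrow> k = n"
    using k by (auto dest: dvd_imp_le)
  then show "tilt n (lift n z0) s (int k) = z0 k + s * delta n k"
    using lift_pos[OF k, of z0] k by (auto simp: tilt_def delta_def)
qed

theorem ray_index_delta:
  assumes z: "z0 \<in> alcoveA_int n"
  shows "ray_index n z0 (\<lambda>k. of_int 1 * delta n k) = (\<lambda>j. j mod n)"
    and "ray_index n z0 (\<lambda>k. of_int (-1) * delta n k) = (\<lambda>j. n - 1 - j mod n)"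
proof -
  let ?f = "lift n z0"
  have V: "z0 \<in> Vsp n" and dec: "\<And>x. ?f (x + 1) < ?f x" using z unfolding alcoveA_int_iff by auto
  note d = dec lift_shift
  have m: "j mod n < n" for j using n2 by simp
  have md: "int n dvd int (j mod n) - int j" for j
    by (simp add: zmod_int mod_eq_dvd_iff[symmetric])
  show "ray_index n z0 (\<lambda>k. of_int 1 * delta n k) = (\<lambda>j. j mod n)"
  proof (rule ray_index_eqI[where h = "tilt n ?f" and L = "rayL n int" and \<tau> = "rtime ?f"])
    show "(\<lambda>k. z0 k + s * (of_int 1 * delta n k)) \<in> Vsp n" for s using delta_Vsp[OF V] by simp
    show "lift n (\<lambda>k. z0 k + s * (of_int 1 * delta n k)) = tilt n ?f s" for s using lift_delta by simp
    show "rayL n (\<lambda>j. int (j mod n)) j = rayL n int j" for j by (rule rayL_cong) (rule md)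
    show "strict_mono (rtime ?f)" by (rule rtime_mono[OF d])
    show "\<exists>j. x < rtime ?f j" for x by (rule rtime_unbounded[OF d])
    show "tilt n ?f s (rayL n int j (x + 1)) \<le> tilt n ?f s (rayL n int j x)"
      if "rtime ?f j \<le> s" "s \<le> rtime ?f (Suc j)" for j s x by (rule tilt_stay[OF d that])
    fix j s
    show "s = rtime ?f (Suc j) \<and> int n dvd x - int (j mod n)"
      if t: "rtime ?f j < s" "s \<le> rtime ?f (Suc j)" "tilt n ?f s (rayL n int j x) \<le> tilt n ?f s (rayL n int j (x + 1))" for x
    proof -
      have "int n dvd (x - int j) - (int (j mod n) - int j)"
        by (rule dvd_diff[OF tilt_touch(2)[OF d t] md])
      then show ?thesis using tilt_touch(1)[OF d t] by simp
    qed
    show "\<exists>x. tilt n ?f s (rayL n int j x) < tilt n ?f s (rayL n int j (x + 1))" if "rtime ?f (Suc j) < s"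
      using tilt_leave[OF d that] by blast
  qed (auto simp: m rtime_def)
  \<comment> \<open>Negating arguments and values again gives a decreasing function that drops by 1
    over n steps, so the results for \<delta> apply to it.\<close>
  let ?g = "\<lambda>x. - ?f (- x)"
  have g1: "?g (x + 1) < ?g x" for x using dec[of "- x - 1"] by simp
  have g2: "?g (x + int n) = ?g x - 1" for x using lift_shift[of z0 "- x - int n"] by simp
  note d = g1 g2
  have md: "int n dvd int (n - 1 - j mod n) - (- int j - 1)" for j
  proof -
    have "int (n - 1 - j mod n) - (- int j - 1) = int n - (int (j mod n) - int j)" using m[of j] by (simp add: of_nat_diff)
    then show ?thesis using md[of j] by (simp only: dvd_diff dvd_refl)
  qed
  have h: "tilt n ?f (- s) x = - tilt n ?g s (- x)" for s x by (simp add: tilt_def)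
  let ?L = "\<lambda>j x. - rayL n int j (- x)"
  show "ray_index n z0 (\<lambda>k. of_int (-1) * delta n k) = (\<lambda>j. n - 1 - j mod n)"
  proof (rule ray_index_eqI[where h = "\<lambda>s. tilt n ?f (- s)" and L = ?L and \<tau> = "rtime ?g"])
    show "(\<lambda>k. z0 k + s * (of_int (-1) * delta n k)) \<in> Vsp n" for s using delta_Vsp[OF V, of "- s"] by simp
    show "lift n (\<lambda>k. z0 k + s * (of_int (-1) * delta n k)) = tilt n ?f (- s)" for s using lift_delta[of z0 "- s"] by simp
    show "rayL n (\<lambda>j. int (n - 1 - j mod n)) j = ?L j" for j
    proof
      fix x
      have "rayL n (\<lambda>j. int (n - 1 - j mod n)) j = rayL n (\<lambda>j. - int j - 1) j" by (rule rayL_cong) (rule md)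
      then show "rayL n (\<lambda>j. int (n - 1 - j mod n)) j x = ?L j x" using rayL_neg[of int j "- x"] by simp
    qed
    show "strict_mono (rtime ?g)" by (rule rtime_mono[OF d])
    show "\<exists>j. x < rtime ?g j" for x by (rule rtime_unbounded[OF d])
    fix j and s :: real and x :: int
    show "tilt n ?f (- s) (?L j (x + 1)) \<le> tilt n ?f (- s) (?L j x)"
      if "rtime ?g j \<le> s" "s \<le> rtime ?g (Suc j)"
      using tilt_stay[OF d that, of "- x - 1"] unfolding h by simp
    show "s = rtime ?g (Suc j) \<and> int n dvd x - int (n - 1 - j mod n)"
      if t: "rtime ?g j < s" "s \<le> rtime ?g (Suc j)" "tilt n ?f (- s) (?L j x) \<le> tilt n ?f (- s) (?L j (x + 1))"
    proof -
      have t3: "tilt n ?g s (rayL n int j (- x - 1)) \<le> tilt n ?g s (rayL n int j (- x - 1 + 1))"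
        using t(3) unfolding h by simp
      have "int n dvd - (- x - 1 - int j) - (int (n - 1 - j mod n) - (- int j - 1))"
        using tilt_touch(2)[OF d t(1,2) t3] md[of j] by (simp only: dvd_diff dvd_minus_iff)
      moreover have "- (- x - 1 - int j) - (int (n - 1 - j mod n) - (- int j - 1)) = x - int (n - 1 - j mod n)" by simp
      ultimately show ?thesis using tilt_touch(1)[OF d t(1,2) t3] by simp
    qed
  next
    fix j s assume "rtime ?g (Suc j) < s"
    from tilt_leave[OF d this] show "\<exists>x. tilt n ?f (- s) (?L j x) < tilt n ?f (- s) (?L j (x + 1))"
      unfolding h by (intro exI[of _ "- int j - 1"]) (simp add: add.commute)
  qed (use m n2 in \<open>auto simp: rtime_def\<close>)
qed

end

section \<open>The reduced random walk\<close>

primrec coins :: "('i \<Rightarrow> bool \<Rightarrow> 's \<Rightarrow> 's) \<Rightarrow> 'i list \<Rightarrow> (nat \<Rightarrow> bool) \<Rightarrow> 's \<Rightarrow> 's" where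
  "coins st [] \<omega> x = x"
| "coins st (i # is) \<omega> x = coins st is (\<lambda>k. \<omega> (Suc k)) (st i (\<omega> 0) x)"

lemma coins_snoc: "coins st (is @ [i]) \<omega> x = st i (\<omega> (length is)) (coins st is \<omega> x)"
  by (induction "is" arbitrary: \<omega> x) auto

locale coin_space = fixes p :: real assumes p01: "0 < p" "p < 1"
begin

abbreviation B :: "bool measure" where "B \<equiv> measure_pmf (bernoulli_pmf p)"

abbreviation CS :: "(nat \<Rightarrow> bool) measure" where "CS \<equiv> \<Pi>\<^sub>M j\<in>(UNIV::nat set). B"

sublocale SS: sequence_space B
  by unfold_locales

lemma space_CS: "space CS = UNIV"
  by (simp add: space_PiM)

lemma coins_measurable: "(\<lambda>\<omega>. coins st is \<omega> x) \<in> measurable CS (count_space UNIV)"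
proof (induction "is" arbitrary: x)
  case (Cons i "is")
  have shift: "(\<lambda>\<omega> k. \<omega> (Suc k)) \<in> measurable CS CS"
    by (rule measurable_PiM_single') (auto simp: space_PiM intro!: measurable_component_singleton)
  have m: "(\<lambda>\<omega>. coins st is (\<lambda>k. \<omega> (Suc k)) y) \<in> measurable CS (count_space UNIV)" for y
    by (rule measurable_compose[OF shift Cons])
  have b: "{\<omega> \<in> space CS. \<omega> 0} \<in> sets CS"
  proof -
    have "(\<lambda>\<omega>. \<omega> 0) \<in> measurable CS B" by (rule measurable_component_singleton) simp
    from measurable_sets[OF this, of "{True}"] show ?thesis by (simp add: vimage_def Int_def conj_commute)
  qed
  have e: "(\<lambda>\<omega>. coins st (i # is) \<omega> x) = (\<lambda>\<omega>. if \<omega> 0 then coins st is (\<lambda>k. \<omega> (Suc k)) (st i True x)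
      else coins st is (\<lambda>k. \<omega> (Suc k)) (st i False x))"
    by auto
  show ?case unfolding e by (rule measurable_If[OF m m b])
qed simp

lemma coins_set: "{\<omega> \<in> space CS. Q (coins st is \<omega> x)} \<in> sets CS"
  using measurable_sets[OF coins_measurable, of "{y. Q y}" st "is" x] by (simp add: vimage_def Int_def conj_commute)

lemma evl_nonneg:
  assumes "\<And>y. 0 \<le> g y"
  shows "0 \<le> evl p st g is x"
  using assms p01 by (induction "is" arbitrary: x) (auto intro!: add_nonneg_nonneg)

text \<open>Splitting off the first coin of the sequence space (\<open>SS.PiM_iter\<close>)
  reproduces the recursion of \<open>evl\<close>.\<close>

lemma coins_nn_integral:
  assumes g: "\<And>y. 0 \<le> g y"
  shows "(\<integral>\<^sup>+\<omega>. ennreal (g (coins st is \<omega> x)) \<partial>CS) = ennreal (evl p st g is x)"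
proof (induction "is" arbitrary: x)
  case Nil
  show ?case using SS.P.emeasure_space_1 by simp
next
  case (Cons i "is")
  interpret P: pair_sigma_finite B CS ..
  have m: "(\<lambda>\<omega>. ennreal (g (coins st (i # is) \<omega> x))) \<in> borel_measurable CS"
    by (rule measurable_compose[OF coins_measurable]) simp
  have cn: "(\<lambda>(s, \<omega>). case_nat s \<omega>) \<in> measurable (B \<Otimes>\<^sub>M CS) CS"
    by measurable
  have "(\<integral>\<^sup>+\<omega>. ennreal (g (coins st (i # is) \<omega> x)) \<partial>CS)
      = (\<integral>\<^sup>+\<omega>. ennreal (g (coins st (i # is) \<omega> x)) \<partial>distr (B \<Otimes>\<^sub>M CS) CS (\<lambda>(s, \<omega>). case_nat s \<omega>))"
    by (simp only: SS.PiM_iter)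
  also have "\<dots> = (\<integral>\<^sup>+z. ennreal (g (coins st (i # is) ((\<lambda>(s, \<omega>). case_nat s \<omega>) z) x)) \<partial>(B \<Otimes>\<^sub>M CS))"
    by (rule nn_integral_distr[OF cn]) (simp only: measurable_distr_eq1 m)
  also have "\<dots> = (\<integral>\<^sup>+b. \<integral>\<^sup>+\<omega>. ennreal (g (coins st (i # is) (case_nat b \<omega>) x)) \<partial>CS \<partial>B)"
    using SS.P.nn_integral_fst[OF measurable_compose[OF cn m]] by simp
  also have "\<dots> = (\<integral>\<^sup>+b. ennreal (evl p st g is (st i b x)) \<partial>B)"
    using Cons by simp
  also have "\<dots> = ennreal (evl p st g (i # is) x)"
    using p01 evl_nonneg[of g st "is", OF g] by (simp add: ennreal_mult' ennreal_plus mult.commute)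
  finally show ?case .
qed

lemma coins_measure:
  "measure CS {\<omega> \<in> space CS. Q (coins st is \<omega> x)} = evl p st (\<lambda>y. if Q y then 1 else 0) is x"
proof -
  let ?A = "{\<omega> \<in> space CS. Q (coins st is \<omega> x)}"
  have "emeasure CS ?A = (\<integral>\<^sup>+\<omega>. indicator ?A \<omega> \<partial>CS)"
    by (rule nn_integral_indicator[symmetric]) (rule coins_set[where Q = Q])
  also have "\<dots> = (\<integral>\<^sup>+\<omega>. ennreal (if Q (coins st is \<omega> x) then 1 else 0) \<partial>CS)"
    by (intro nn_integral_cong) (auto simp: indicator_def)
  also have "\<dots> = ennreal (evl p st (\<lambda>y. if Q y then 1 else 0) is x)"
    by (rule coins_nn_integral) simp
  finally show ?thesis
    using evl_nonneg[of "\<lambda>y. if Q y then 1 else 0" st "is" x] by (simp add: measure_def)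
qed

end

lemma concat_replicate_mod:
  assumes "0 < (n::nat)"
  shows "map (\<lambda>j. f (j mod n)) [0..<n * m] = concat (replicate m (map f [0..<n]))"
proof (induction m)
  case (Suc m)
  have "[0..<n * Suc m] = [0..<n * m] @ [n * m..<n * m + n]"
    using upt_add_eq_append[of 0 "n * m" n] by (simp add: add.commute)
  moreover have "map (\<lambda>j. f (j mod n)) [n * m..<n * m + n] = map f [0..<n]"
    by (rule nth_equalityI) auto
  ultimately show ?case using Suc by (simp flip: replicate_append_same)
qed simp

context affine
begin

lemma chain_path_coins:
  "chain_path n z0 \<eta> \<omega> M = coins (\<lambda>k. chain_step n z0 \<eta> (k mod n)) [0..<M] \<omega> id"
  by (induction M) (simp_all add: coins_snoc id_def)

definition apath :: "(nat \<Rightarrow> nat) \<Rightarrow> (nat \<Rightarrow> bool) \<Rightarrow> nat \<Rightarrow> int \<Rightarrow> int" where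
  "apath idx \<omega> M = coins (\<lambda>i. stpL n (int i)) (map idx [0..<M]) \<omega> id"

lemma apath_Suc: "apath idx \<omega> (Suc M) = stpL n (int (idx M)) (\<omega> M) (apath idx \<omega> M)"
  by (simp add: apath_def coins_snoc)

lemma apath_0: "apath idx \<omega> 0 = id"
  by (simp add: apath_def id_def)

lemma aper_apath: "aper n (apath idx \<omega> M)"
proof (induction M)
  case 0
  show ?case unfolding apath_0 by (rule aper_id)
qed (simp only: apath_Suc aper_stpL)

lemma acts_chain_path:
  assumes "\<And>j. ray_index n z0 \<eta> (j mod n) = idx j" "\<And>j. idx j < n"
  shows "acts n (chain_path n z0 \<eta> \<omega> M) (apath idx \<omega> M)"
proof (induction M)
  case 0
  show ?case unfolding apath_0 chain_path.simps by (rule acts_id)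
next
  case (Suc M)
  show ?case
    unfolding apath_Suc chain_path.simps chain_step_def stpL_def assms(1) Let_def
      not_back_iff[OF Suc assms(2)]
    using acts_sgen[OF Suc assms(2)[of M]] Suc by (auto simp only: conj_commute split: if_splits)
qed

text \<open>This holds for every coin sequence: each of the finitely many pairs is inverted from
  some time on or never.\<close>

lemma pat_apath_eventually:
  "\<exists>w. w permutes {1..n} \<and> (\<forall>\<^sub>F M in sequentially. pat n (apath idx \<omega> M) = w)"
proof -
  let ?X = "apath idx \<omega>"
  have stay: "?X (M + k) d < ?X (M + k) c" if "c < d" "?X M d < ?X M c" for c d M k
  proof (induction k)
    case (Suc k)
    show ?case unfolding add_Suc_right apath_Suc by (rule stpL_inverted[OF aper_apath that(1) Suc])
  qed (use that in simp)
  have "\<forall>\<^sub>F M in sequentially. (?X M l < ?X M k) = (\<exists>M. ?X M l < ?X M k)" if "k < l" for k l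
  proof (cases "\<exists>M. ?X M l < ?X M k")
    case True
    then obtain M where M: "?X M l < ?X M k" by blast
    have "?X N l < ?X N k" if "M \<le> N" for N
      using stay[OF \<open>k < l\<close> M, of "N - M"] that by simp
    then show ?thesis using True unfolding eventually_sequentially by blast
  next
    case False
    then show ?thesis by (intro always_eventually) blast
  qed
  then have "\<forall>kl\<in>{kl \<in> {1..n} \<times> {1..n}. fst kl < snd kl}.
      \<forall>\<^sub>F M in sequentially. (?X M (int (snd kl)) < ?X M (int (fst kl))) = (\<exists>M. ?X M (int (snd kl)) < ?X M (int (fst kl)))"
    by simp
  moreover have "finite {kl \<in> {1..n} \<times> {1..n}. fst kl < snd kl}" by simp
  ultimately have "\<forall>\<^sub>F M in sequentially. \<forall>kl\<in>{kl \<in> {1..n} \<times> {1..n}. fst kl < snd kl}.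
      (?X M (int (snd kl)) < ?X M (int (fst kl))) = (\<exists>M. ?X M (int (snd kl)) < ?X M (int (fst kl)))"
    by (rule eventually_ball_finite[rotated])
  then obtain N where N0: "\<forall>M\<ge>N. \<forall>kl\<in>{kl \<in> {1..n} \<times> {1..n}. fst kl < snd kl}.
      (?X M (int (snd kl)) < ?X M (int (fst kl))) = (\<exists>M. ?X M (int (snd kl)) < ?X M (int (fst kl)))"
    unfolding eventually_sequentially by blast
  have N: "(?X M (int l) < ?X M (int k)) = (\<exists>M. ?X M (int l) < ?X M (int k))"
    if "N \<le> M" "k \<in> {1..n}" "l \<in> {1..n}" "k < l" for M k l
    using bspec[OF mp[OF spec[OF N0] that(1)], of "(k, l)"] that by simp
  have "pat n (?X M) = pat n (?X N)" if M: "N \<le> M" for M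
  proof -
    have "pat n (?X M) = pat n (?X N) \<circ> id"
    proof (rule pat_reorder[OF permutes_id])
      fix k l assume kl: "k \<in> {1..n}" "l \<in> {1..n}"
      have lt: "(?X M (int l) < ?X M (int k)) = (?X N (int l) < ?X N (int k))"
        if "k \<in> {1..n}" "l \<in> {1..n}" "k < l" for k l
        using N[OF M that] N[OF order_refl that] by simp
      have ne: "?X M' (int k) = ?X M' (int l) \<longleftrightarrow> k = l" for M' using aper_eq_iff[OF aper_apath] by simp
      show "?X M (int l) \<le> ?X M (int k) \<longleftrightarrow> ?X N (int (id l)) \<le> ?X N (int (id k))"
        unfolding id_apply using lt[OF kl] lt[OF kl(2,1)] ne[of M] ne[of N]
        by (meson linorder_neqE_nat not_less order_less_le)
    qed
    then show ?thesis by simp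
  qed
  then have "\<forall>\<^sub>F M in sequentially. pat n (?X M) = pat n (?X N)" unfolding eventually_sequentially by blast
  then show ?thesis using pat_permutes[OF aper_apath] by blast
qed

end

context affine_chain
begin

sublocale coin_space p by unfold_locales (rule p)+

text \<open>By \<open>pat_apath_eventually\<close> the indicators of the event after m sweeps
  converge pointwise to that of the limiting event, and dominated convergence applies.\<close>

lemma pattern_limit_measure:
  assumes m: "\<And>m. map idx [0..<n * m] = sweeps sw m"
  shows "(\<lambda>m. evl p stA (\<lambda>X. if pat n X = w then 1 else 0) (sweeps sw m) id)
    \<longlonglongrightarrow> measure CS {\<omega> \<in> space CS. \<forall>\<^sub>F M in sequentially. pat n (apath idx \<omega> M) = w}"
proof -
  let ?E = "{\<omega> \<in> space CS. \<forall>\<^sub>F M in sequentially. pat n (apath idx \<omega> M) = w}"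
  let ?A = "\<lambda>m. {\<omega> \<in> space CS. pat n (apath idx \<omega> (n * m)) = w}"
  have P: "{\<omega> \<in> space CS. pat n (apath idx \<omega> M) = w} \<in> sets CS" for M
    unfolding apath_def by (rule coins_set[where Q = "\<lambda>X. pat n X = w"])
  then have A: "?A m \<in> sets CS" for m .
  have E: "?E \<in> sets CS" by (rule sets_Collect_eventually_sequentially) (rule P)
  have "(\<lambda>m. \<integral>\<omega>. indicator (?A m) \<omega> \<partial>CS) \<longlonglongrightarrow> (\<integral>\<omega>. indicator ?E \<omega> \<partial>CS :: real)"
  proof (rule integral_dominated_convergence[where w = "\<lambda>_. 1"])
    show "AE \<omega> in CS. (\<lambda>m. indicator (?A m) \<omega> :: real) \<longlonglongrightarrow> indicator ?E \<omega>"
    proof (rule AE_I2)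
      fix \<omega> assume \<omega>: "\<omega> \<in> space CS"
      obtain v where v: "\<forall>\<^sub>F M in sequentially. pat n (apath idx \<omega> M) = v"
        using pat_apath_eventually by blast
      have "(\<forall>\<^sub>F M in sequentially. pat n (apath idx \<omega> M) = w) \<longleftrightarrow> v = w"
      proof
        assume "\<forall>\<^sub>F M in sequentially. pat n (apath idx \<omega> M) = w"
        with v have "\<forall>\<^sub>F M in sequentially. v = w" by eventually_elim simp
        then show "v = w" by simp
      qed (use v in simp)
      moreover have "\<forall>\<^sub>F m in sequentially. pat n (apath idx \<omega> (n * m)) = v"
      proof -
        obtain N where N: "\<And>M. N \<le> M \<Longrightarrow> pat n (apath idx \<omega> M) = v"
          using v unfolding eventually_sequentially by blast
        have "N \<le> n * m" if "N \<le> m" for m using that n2 mult_le_mono[of 1 n N m] by simp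
        then show ?thesis using N unfolding eventually_sequentially by blast
      qed
      then have "\<forall>\<^sub>F m in sequentially. indicator (?A m) \<omega> = (if v = w then 1 else 0 :: real)"
        by eventually_elim (use \<omega> in \<open>simp add: indicator_def\<close>)
      ultimately show "(\<lambda>m. indicator (?A m) \<omega> :: real) \<longlonglongrightarrow> indicator ?E \<omega>"
        using \<omega> by (auto simp: indicator_def intro: tendsto_eventually)
    qed
  qed (use A E in \<open>auto simp: indicator_def\<close>)
  moreover have "(\<integral>\<omega>. indicator (?A m) \<omega> \<partial>CS) = evl p stA (\<lambda>X. if pat n X = w then 1 else 0) (sweeps sw m) id" for m
    using coins_measure[of "\<lambda>X. pat n X = w" "\<lambda>i. stpL n (int i)" "map idx [0..<n * m]" id] A[of m] m
    by (simp add: apath_def)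
  ultimately show ?thesis using E by simp
qed

end

text \<open>The random sign is a probability measure on all integers, so the event is cut into
  countably many slices to see that it is measurable.\<close>

lemma (in coin_space) choice_measure:
  fixes D :: "int \<Rightarrow> (nat \<Rightarrow> bool) set"
  assumes D: "\<And>e. D e \<in> sets CS"
  shows "measure (measure_pmf (pmf_of_set {1::int, -1}) \<Otimes>\<^sub>M CS) {(e, \<omega>). \<omega> \<in> D e} = 1/2 * (measure CS (D 1) + measure CS (D (-1)))"
proof -
  let ?U = "measure_pmf (pmf_of_set {1::int, -1})" and ?D = "{(e, \<omega>). \<omega> \<in> D e}"
  have "?D = (\<Union>e. {e} \<times> D e)" by auto
  moreover have "(\<Union>e. {e} \<times> D e) \<in> sets (?U \<Otimes>\<^sub>M CS)"
  proof (rule sets.countable_UN')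
    show "(\<lambda>e. {e} \<times> D e) ` UNIV \<subseteq> sets (?U \<Otimes>\<^sub>M CS)"
      by (intro image_subsetI pair_measureI D) simp
  qed auto
  ultimately have "emeasure (?U \<Otimes>\<^sub>M CS) ?D = (\<integral>\<^sup>+e. emeasure CS (Pair e -` ?D) \<partial>?U)"
    by (simp add: SS.P.emeasure_pair_measure_alt)
  also have "\<dots> = (\<integral>\<^sup>+e. emeasure CS (D e) \<partial>?U)" by (simp add: vimage_def)
  also have "\<dots> = (emeasure CS (D 1) + emeasure CS (D (-1))) / 2"
    by (simp add: nn_integral_pmf_of_set)
  also have "\<dots> = ennreal (1/2 * (measure CS (D 1) + measure CS (D (-1))))"
    by (simp add: SS.P.emeasure_eq_measure ennreal_plus[symmetric] ennreal_divide_numeral del: ennreal_plus)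
  finally show ?thesis by (simp add: measure_def[of "?U \<Otimes>\<^sub>M CS"])
qed

theorem theorem1p6:
  fixes n :: nat and p :: real and z0 :: vec
  assumes "2 \<le> n" and "0 < p" and "p < 1" and "z0 \<in> alcoveA_int n"
  defines "\<Omega> \<equiv> measure_pmf (pmf_of_set {1::int, -1}) \<Otimes>\<^sub>M
                 (\<Pi>\<^sub>M j\<in>(UNIV::nat set). measure_pmf (bernoulli_pmf p))"
  defines "U \<equiv> (\<lambda>(\<epsilon>::int, \<omega>::nat \<Rightarrow> bool) (M::nat).
                 chain_path n z0 (\<lambda>k. of_int \<epsilon> * delta n k) \<omega> M)"
  shows "(AE x in \<Omega>. \<exists>w. w permutes {1..n} \<and>
                        (\<forall>\<^sub>F M in sequentially. alc n (U x M) \<subseteq> chamber n w))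
       \<and> (\<forall>w. w permutes {1..n} \<longrightarrow>
            complex_of_real
              (measure \<Omega> {x \<in> space \<Omega>. \<forall>\<^sub>F M in sequentially. alc n (U x M) \<subseteq> chamber n w})
            = 1/2 * (Fw0 n (inv w \<circ> wlong n) (lastpt n (complex_of_real (1 - p)))
                       / asep_P0 n stair (lastpt n (complex_of_real (1 - p)))
                     + Fw0 n (inv w \<circ> wlong n) (lastpt n (complex_of_real (inverse (1 - p))))
                       / asep_P0 n stair (lastpt n (complex_of_real (inverse (1 - p))))))"
proof -
  interpret affine n by unfold_locales (rule assms(1))
  interpret coin_space p by unfold_locales (rule assms(2,3))+
  define idx :: "int \<Rightarrow> nat \<Rightarrow> nat" where "idx e j = (if e = 1 then j mod n else n - 1 - j mod n)" for e j
  have idx: "ray_index n z0 (\<lambda>k. of_int e * delta n k) (j mod n) = idx e j" if "e \<in> {1, -1}" for e j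
    using ray_index_delta[OF assms(4)] that by (auto simp: idx_def)
  have idx_less: "idx e j < n" for e j using n2 by (simp add: idx_def)
  have iff: "alc n (U (e, \<omega>) M) \<subseteq> chamber n w \<longleftrightarrow> pat n (apath (idx e) \<omega> M) = w"
    if "e \<in> {1, -1}" "w permutes {1..n}" for e \<omega> M w
    unfolding U_def prod.case
    by (rule alc_chamber_iff[OF acts_chain_path[OF idx[OF that(1)] idx_less] that(2)])
  have space: "space \<Omega> = UNIV" unfolding \<Omega>_def space_pair_measure space_CS by simp
  interpret PP: pair_prob_space "measure_pmf (pmf_of_set {1::int, -1})" CS ..
  \<comment> \<open>The space of signs is the set of all integers; only 1 and -1 carry mass, and
    only for them is the ray known.\<close>
  have "AE x in \<Omega>. fst x \<in> {1, -1}"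
    unfolding \<Omega>_def
  proof (rule PP.AE_pair_measure)
    have "{x \<in> space (measure_pmf (pmf_of_set {1, - 1}) \<Otimes>\<^sub>M CS). fst x \<in> {1, - 1 :: int}} = {1, -1} \<times> space CS"
      by (auto simp: space_pair_measure)
    moreover have "{1, -1} \<times> space CS \<in> sets (measure_pmf (pmf_of_set {1::int, - 1}) \<Otimes>\<^sub>M CS)"
      by (rule pair_measureI) auto
    ultimately show "{x \<in> space (measure_pmf (pmf_of_set {1, - 1}) \<Otimes>\<^sub>M CS). fst x \<in> {1, - 1 :: int}}
        \<in> sets (measure_pmf (pmf_of_set {1, - 1}) \<Otimes>\<^sub>M CS)" by simp
  qed (auto simp: AE_measure_pmf_iff)
  then have ae: "AE x in \<Omega>. \<exists>w. w permutes {1..n} \<and> (\<forall>\<^sub>F M in sequentially. alc n (U x M) \<subseteq> chamber n w)"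
  proof (rule AE_mp, intro AE_I2 impI)
    fix x :: "int \<times> (nat \<Rightarrow> bool)" assume "fst x \<in> {1, -1}"
    moreover obtain w where "w permutes {1..n}" "\<forall>\<^sub>F M in sequentially. pat n (apath (idx (fst x)) (snd x) M) = w"
      using pat_apath_eventually by blast
    ultimately show "\<exists>w. w permutes {1..n} \<and> (\<forall>\<^sub>F M in sequentially. alc n (U x M) \<subseteq> chamber n w)"
      using iff[of "fst x" w "snd x"] by auto
  qed
  have prob: "complex_of_real (measure \<Omega> {x \<in> space \<Omega>. \<forall>\<^sub>F M in sequentially. alc n (U x M) \<subseteq> chamber n w})
      = 1/2 * (Fw0 n (inv w \<circ> wlong n) (lastpt n (complex_of_real (1 - p)))
                / asep_P0 n stair (lastpt n (complex_of_real (1 - p)))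
              + Fw0 n (inv w \<circ> wlong n) (lastpt n (complex_of_real (inverse (1 - p))))
                / asep_P0 n stair (lastpt n (complex_of_real (inverse (1 - p)))))"
    if w: "w permutes {1..n}" for w
  proof -
    define D where "D e = {\<omega> \<in> space CS. \<forall>\<^sub>F M in sequentially. alc n (U (e, \<omega>) M) \<subseteq> chamber n w}" for e
    define L where "L e w = measure CS {\<omega> \<in> space CS. \<forall>\<^sub>F M in sequentially. pat n (apath (idx e) \<omega> M) = w}" for e w
    have D: "D e \<in> sets CS" for e
      unfolding D_def U_def prod.case chain_path_coins
      by (rule sets_Collect_eventually_sequentially) (rule coins_set[where Q = "\<lambda>u. alc n u \<subseteq> chamber n w"])
    have DL: "measure CS (D e) = L e w" if "e \<in> {1, -1}" for e
      unfolding D_def L_def iff[OF that w] ..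
    have "{x \<in> space \<Omega>. \<forall>\<^sub>F M in sequentially. alc n (U x M) \<subseteq> chamber n w} = {(e, \<omega>). \<omega> \<in> D e}"
      unfolding space D_def space_CS by auto
    then have m: "measure \<Omega> {x \<in> space \<Omega>. \<forall>\<^sub>F M in sequentially. alc n (U x M) \<subseteq> chamber n w} = 1/2 * (L 1 w + L (-1) w)"
      using choice_measure[of D, OF D] DL by (simp add: \<Omega>_def)
    have n0: "0 < n" using n2 by simp
    \<comment> \<open>The direction \<delta> sweeps the indices upwards and yields q = 1 / (1 - p);
      the direction -\<delta> sweeps them downwards and yields q = 1 - p.\<close>
    interpret fwd: affine_chain n p "[0..<n]" by unfold_locales (use assms(2,3) in auto)
    interpret bwd: affine_chain n p "rev [0..<n]" by unfold_locales (use assms(2,3) in auto)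
    have f: "map (idx 1) [0..<n * m] = sweeps [0..<n] m" for m
      using concat_replicate_mod[OF n0, of "\<lambda>j. j" m] by (simp add: idx_def[abs_def])
    have rv: "map (\<lambda>j. n - 1 - j) [0..<n] = rev [0..<n]"
      by (rule nth_equalityI) (auto simp: rev_nth)
    have b: "map (idx (-1)) [0..<n * m] = sweeps (rev [0..<n]) m" for m
      using concat_replicate_mod[OF n0, of "\<lambda>j. n - 1 - j" m] unfolding rv by (simp add: idx_def[abs_def])
    have "complex_of_real (L 1 w) = Fw0 n (inv w \<circ> wlong n) (lastpt n (of_real (inverse (1 - p))))
        / asep_P0 n stair (lastpt n (of_real (inverse (1 - p))))"
      unfolding L_def
      by (rule fwd.pattern_limit[OF disjI1[OF conjI[OF refl refl]] fwd.pattern_limit_measure[OF f] w])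
    moreover have "complex_of_real (L (-1) w) = Fw0 n (inv w \<circ> wlong n) (lastpt n (of_real (1 - p)))
        / asep_P0 n stair (lastpt n (of_real (1 - p)))"
      unfolding L_def
      by (rule bwd.pattern_limit[OF disjI2[OF conjI[OF refl refl]] bwd.pattern_limit_measure[OF b] w])
    ultimately show ?thesis unfolding m by simp
  qed
  show ?thesis using ae prob by blast
qed

end
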